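(* Let $g\colon U\to V$ be a morphism of Lie algebras over a field of characteristic $0$. There is an $L_\infty$-algebra structure $(\Delta=l_1,l_2,l_3,\ldots)$ on the S-cohomology complex $\Lambda^{*+1}(U,V)$, $*\ge1$ (where $\Lambda^{n+1}(U,V)$ is placed in degree $n$), capturing deformations of the Lie algebra morphism $g$, i.e. such that deformations of $g$ (the $\mathsf F(E)$-algebra structures on $T=U\oplus V$) correspond to the degree $1$ elements $\kappa\in\Lambda^2(U,V)$ satisfying the Quantum Master Equation $$0=\Delta(\kappa)+\frac1{2!}l_2(\kappa,\kappa)-\frac1{3!}l_3(\kappa,\kappa,\kappa)-\frac1{4!}l_4(\kappa,\kappa,\kappa,\kappa)+\cdots .$$
   Context: $\mathbf k$ is a field of characteristic $0$; $U,V$ are Lie algebras over $\mathbf k$, $g\colon U\to V$ a Lie algebra morphism. **S-cohomology complex.** $\Lambda^n(U,V)=\mathrm{Hom}(U^{\wedge n},U)\oplus\mathrm{Hom}(V^{\wedge n},V)\oplus\mathrm{Hom}(U^{\wedge n-1},V)$ with differential $\Delta^n(x_U,x_V,x_g)=\big(bx_U,\ bx_V,\ (-1)^{n-1}gx_U-(-1)^{n-1}x_Vg^{\otimes n}+bx_g\big)$, where $b$ is the Chevalley–Eilenberg differential with the sign convention $$(b\varphi)(x_1,\ldots,x_{n+1})=\sum_{s}(-1)^s\,x_s\cdot\varphi(x_1,\ldots,\widehat{x_s},\ldots,x_{n+1})+\sum_{s<t}(-1)^{s+t-1}\varphi([x_s,x_t],x_1,\ldots,\widehat{x_s},\ldots,\widehat{x_t},\ldots,x_{n+1})$$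 ($U$, $V$ are adjoint modules over themselves and $V$ is a $U$-module via $g$). **The resolution $\mathsf F(E)$.** $T=U\oplus V$ is two-colored ($T_B=U$, $T_W=V$). $(\mathsf F(E),\partial)$ is the minimal model of the 2-colored operad $\mathbf{Lie}_{B\to W}$ whose algebras are morphisms of Lie algebras: the free 2-colored PROP on skew-symmetric generators $\mu_n\colon B^{\otimes n}\to B$ of degree $n-2$ ($n\ge2$), $\nu_n\colon W^{\otimes n}\to W$ of degree $n-2$ ($n\ge2$), $f_n\colon B^{\otimes n}\to W$ of degree $n-1$ ($n\ge1$), with $$\partial(\mu_n)=\sum_{\substack{i+j=n+1\\ i,j\ge2}}(-1)^{j(i-1)}\sum_{\sigma\in S_{j,i-1}}\mathrm{sgn}(\sigma)\,\mu_i\circ(\mu_j\otimes\mathrm{Id}^{\otimes i-1})\circ\sigma,$$ $\partial(\nu_n)$ given by the same formula with $\nu$ in place of $\mu$, and $$\begin{aligned}\partial(f_n)={}&\sum_{l=2}^n\sum_{\substack{r_1+\cdots+r_l=n\\ r_1\le\cdots\le r_l}}(-1)^{\frac{l(l-1)}2+\sum_{i=1}^{l-1}r_i(l-i)}\sum_{\sigma\in S^<_{r_1,\ldots,r_l}}\mathrm{sgn}(\sigma)\,\nu_l(f_{r_1}\otimes\cdots\otimes f_{r_l})\circ\sigma\\&-\sum_{\substack{i+j=n+1\\ i\ge1,j\ge2}}(-1)^{j(i-1)}\sum_{\sigma\in S_{j,i-1}}\mathrm{sgn}(\sigma)\,f_i\circ(\mu_j\otimes\mathrm{Id}^{\otimes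 i-1})\circ\sigma,\end{aligned}$$ where $S_{j,i-1}$ is the set of $(j,i-1)$-unshuffles and $S^<_{r_1,\ldots,r_l}$ the set of $(r_1,\ldots,r_l)$-unshuffles with $\sigma(r_1+\cdots+r_{i-1}+1)<\sigma(r_1+\cdots+r_i+1)$ whenever $r_i=r_{i+1}$. An $\mathsf F(E)$-algebra structure on $T$ is a morphism of differential graded 2-colored PROPs $\mathsf F(E)\to\mathrm{End}_T$, where $\mathrm{End}_T$ (multilinear maps between tensor products of $U$'s and $V$'s) has zero differential. **$L_\infty$-structure.** On a $\mathbb Z$-graded module $L$, it is a sequence of operations $l_n\colon L^{\otimes n}\to L$, $n\ge1$, of degree $2-n$, each anti-symmetric, $l_n(x_{\sigma(1)},\ldots,x_{\sigma(n)})=\chi(\sigma)l_n(x_1,\ldots,x_n)$, with $$\sum_{i+j=n+1}\sum_\sigma\chi(\sigma)(-1)^{i(j-1)}l_j\big(l_i(x_{\sigma(1)},\ldots,x_{\sigma(i)}),x_{\sigma(i+1)},\ldots,x_{\sigma(n)}\big)=0$$ for all $n\ge1$, where $i\ge1$, $\sigma$ runs over $(i,n-i)$-unshuffles and $\chi(\sigma)=\mathrm{sgn}(\sigma)\varepsilon(\sigma;x_1,\ldots,x_n)$ with $\varepsilon$ the Koszul sign: $x_1\wedge\cdots\wedge x_n=\varepsilon\, x_{\sigma(1)}\wedge\cdots\wedge x_{\sigma(n)}$. In the Quantum Master Equation the coefficient of $l_k(\kappa,\ldots,\kappa)$ is $-(-1)^{k(k+1)/2}/k!$ (signs $+,+,-,-,+,+,\ldots$).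 *)

theory Defs
  imports
    Complex_Main
    "HOL-Combinatorics.Permutations"
    "HOL-Library.Function_Algebras"
    "HOL-Library.Product_Plus"
begin

section \<open>Lie algebras\<close>

locale lie_algebra = vector_space scale
  for scale :: "'k::field \<Rightarrow> 'a::ab_group_add \<Rightarrow> 'a" +
  fixes bracket :: "'a \<Rightarrow> 'a \<Rightarrow> 'a"
  assumes bracket_add_left: "bracket (x + y) z = bracket x z + bracket y z"
    and bracket_add_right: "bracket z (x + y) = bracket z x + bracket z y"
    and bracket_scale_left: "bracket (scale c x) y = scale c (bracket x y)"
    and bracket_scale_right: "bracket x (scale c y) = scale c (bracket x y)"
    and bracket_self: "bracket x x = 0"
    and jacobi: "bracket (bracket x y) z + bracket (bracket y z) x + bracket (bracket z x) y = 0"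

locale lie_algebra_hom =
  dom: lie_algebra sU brU + cod: lie_algebra sV brV + Vector_Spaces.linear sU sV g
  for sU :: "'k::field \<Rightarrow> 'u::ab_group_add \<Rightarrow> 'u" and brU
    and sV :: "'k \<Rightarrow> 'v::ab_group_add \<Rightarrow> 'v" and brV
    and g :: "'u \<Rightarrow> 'v" +
  assumes map_bracket: "g (brU x y) = brV (g x) (g y)"


section \<open>Multilinear maps, tensor products, unshuffles\<close>

text \<open>
  Multilinear maps \<open>A\<^sub>1 \<times> \<dots> \<times> A\<^sub>n \<rightarrow> W\<close>, the \<open>A\<^sub>i\<close> being subspaces of one ambient space.
  Arguments are passed as a list; the map is required to vanish on lists outside the product,
  so that equality of multilinear maps is equality of functions.
\<close>

definition multilinear_maps ::
  "('k::field \<Rightarrow> 'a::ab_group_add \<Rightarrow> 'a) \<Rightarrow> ('k \<Rightarrow> 'w::ab_group_add \<Rightarrow> 'w) \<Rightarrow>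
   'a set list \<Rightarrow> ('a list \<Rightarrow> 'w) set"
where
  "multilinear_maps s sW As =
     {f. (\<forall>xs. xs \<notin> listset As \<longrightarrow> f xs = 0) \<and>
         (\<forall>xs\<in>listset As. \<forall>i<length As. \<forall>x\<in>As ! i. \<forall>y\<in>As ! i.
            f (xs[i := x + y]) = f (xs[i := x]) + f (xs[i := y])) \<and>
         (\<forall>xs\<in>listset As. \<forall>i<length As. \<forall>x\<in>As ! i. \<forall>c.
            f (xs[i := s c x]) = sW c (f (xs[i := x])))}"

text \<open>
  The tensor product of subspaces \<open>A\<^sub>1, \<dots>, A\<^sub>n\<close> over a field: multilinear forms separate its
  elements, so it is realised as the span of the evaluations \<open>\<omega> \<mapsto> \<omega> (x\<^sub>1, \<dots>, x\<^sub>n)\<close> on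
  multilinear forms; such an evaluation is the decomposable tensor of \<open>x\<^sub>1, \<dots>, x\<^sub>n\<close>. For
  \<open>n = 0\<close> this is the ground field.
\<close>

type_synonym ('k, 'a) tensor = "('a list \<Rightarrow> 'k) \<Rightarrow> 'k"

abbreviation multilinear_forms ::
  "('k::field \<Rightarrow> 'a::ab_group_add \<Rightarrow> 'a) \<Rightarrow> 'a set list \<Rightarrow> ('a list \<Rightarrow> 'k) set"
where
  "multilinear_forms s As \<equiv> multilinear_maps s (*) As"

definition pure_tensor ::
  "('k::field \<Rightarrow> 'a::ab_group_add \<Rightarrow> 'a) \<Rightarrow> 'a set list \<Rightarrow> 'a list \<Rightarrow> ('k, 'a) tensor"
where
  "pure_tensor s As xs = (\<lambda>\<omega>. if \<omega> \<in> multilinear_forms s As then \<omega> xs else 0)"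

definition tensor_scale :: "'k::field \<Rightarrow> ('k, 'a) tensor \<Rightarrow> ('k, 'a) tensor" where
  "tensor_scale c t = (\<lambda>\<omega>. c * t \<omega>)"

definition tensor_space ::
  "('k::field \<Rightarrow> 'a::ab_group_add \<Rightarrow> 'a) \<Rightarrow> 'a set list \<Rightarrow> ('k, 'a) tensor set"
where
  "tensor_space s As = module.span tensor_scale (pure_tensor s As ` listset As)"

text \<open>The isomorphism \<open>(A\<^sub>1 \<otimes> \<dots> \<otimes> A\<^sub>m) \<otimes> (B\<^sub>1 \<otimes> \<dots> \<otimes> B\<^sub>n) \<cong> A\<^sub>1 \<otimes> \<dots> \<otimes> B\<^sub>n\<close>; it sends the pair of the
  decomposable tensors of \<open>xs\<close> and \<open>ys\<close> to that of \<open>xs @ ys\<close>.\<close>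

definition tensor_append ::
  "('k::field \<Rightarrow> 'a::ab_group_add \<Rightarrow> 'a) \<Rightarrow> 'a set list \<Rightarrow> 'a set list \<Rightarrow>
   ('k, 'a) tensor \<Rightarrow> ('k, 'a) tensor \<Rightarrow> ('k, 'a) tensor"
where
  "tensor_append s As Bs t u =
     (\<lambda>\<omega>. if \<omega> \<in> multilinear_forms s (As @ Bs) then t (\<lambda>xs. u (\<lambda>ys. \<omega> (xs @ ys))) else 0)"

text \<open>The linear extension to a tensor product of a tensor-valued multilinear map \<open>F\<close>; it
  sends the decomposable tensor of \<open>xs\<close> to \<open>F xs\<close>.\<close>

definition tensor_lift :: "('a list \<Rightarrow> ('k, 'b) tensor) \<Rightarrow> ('k, 'a) tensor \<Rightarrow> ('k, 'b) tensor" where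
  "tensor_lift F t = (\<lambda>\<omega>. t (\<lambda>xs. F xs \<omega>))"

text \<open>
  Permutations act on \<open>{..<n}\<close>, so positions are counted from \<open>0\<close>. The list
  \<open>permute_list \<sigma> [x\<^sub>0, x\<^sub>1, \<dots>]\<close> is \<open>[x\<^bsub>\<sigma> 0\<^esub>, x\<^bsub>\<sigma> 1\<^esub>, \<dots>]\<close>.
\<close>

definition unshuffles :: "nat list \<Rightarrow> (nat \<Rightarrow> nat) set" where
  "unshuffles rs =
     {\<sigma>. \<sigma> permutes {..<sum_list rs} \<and>
         (\<forall>b<length rs. strict_mono_on {sum_list (take b rs)..<sum_list (take (Suc b) rs)} \<sigma>)}"

definition ordered_unshuffles :: "nat list \<Rightarrow> (nat \<Rightarrow> nat) set" where
  "ordered_unshuffles rs =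
     {\<sigma>\<in>unshuffles rs. \<forall>b. Suc b < length rs \<and> rs ! b = rs ! Suc b \<longrightarrow>
         \<sigma> (sum_list (take b rs)) < \<sigma> (sum_list (take (Suc b) rs))}"

definition sign_pow :: "int \<Rightarrow> 'r::ring_1" where
  "sign_pow n = (if even n then 1 else - 1)"


section \<open>\<open>L\<^sub>\<infinity>\<close>-structures\<close>

text \<open>The sign \<open>\<epsilon>\<close> in \<open>x\<^sub>1 \<and> \<dots> \<and> x\<^sub>n = \<epsilon> x\<^bsub>\<sigma>(1)\<^esub> \<and> \<dots> \<and> x\<^bsub>\<sigma>(n)\<^esub>\<close> for \<open>x\<^sub>i\<close> of degree \<open>ds\<^sub>i\<close>: every
  pair whose order is reversed contributes the product of its degrees.\<close>

definition koszul_sign :: "(nat \<Rightarrow> nat) \<Rightarrow> int list \<Rightarrow> 'r::comm_ring_1" where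
  "koszul_sign \<sigma> ds =
     (\<Prod>(i, j)\<in>{(i, j). i < j \<and> j < length ds \<and> \<sigma> j < \<sigma> i}. sign_pow (ds ! \<sigma> i * ds ! \<sigma> j))"

definition antisym_koszul_sign :: "(nat \<Rightarrow> nat) \<Rightarrow> int list \<Rightarrow> 'r::comm_ring_1" where
  "antisym_koszul_sign \<sigma> ds = of_int (sign \<sigma>) * koszul_sign \<sigma> ds"

text \<open>
  A graded module is a family \<open>L\<close> of subspaces of an ambient space; only homogeneous elements
  occur. The operation \<open>l\<^sub>n\<close> is given by its components: for a list \<open>ds\<close> of \<open>n\<close> degrees, \<open>l ds\<close> is
  the restriction of \<open>l\<^sub>n\<close> to the tensor product of the \<open>L\<close> in these degrees.
\<close>

definition L_infinity_structure ::
  "('k::field \<Rightarrow> 'a::ab_group_add \<Rightarrow> 'a) \<Rightarrow> (int \<Rightarrow> 'a set) \<Rightarrow> (int list \<Rightarrow> 'a list \<Rightarrow> 'a) \<Rightarrow> bool"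
where
  "L_infinity_structure s L l \<longleftrightarrow>
     vector_space s \<and> (\<forall>p. module.subspace s (L p)) \<and>
     (\<forall>ds. ds \<noteq> [] \<longrightarrow>
        l ds \<in> multilinear_maps s s (map L ds) \<and>
        (\<forall>xs\<in>listset (map L ds).
           l ds xs \<in> L (sum_list ds + 2 - int (length ds)) \<and>
           (\<forall>\<sigma>. \<sigma> permutes {..<length ds} \<longrightarrow>
              l (permute_list \<sigma> ds) (permute_list \<sigma> xs) = s (antisym_koszul_sign \<sigma> ds) (l ds xs)) \<and>
           (\<Sum>(i, j)\<in>{(i, j). 1 \<le> i \<and> 1 \<le> j \<and> i + j = length ds + 1}.
              \<Sum>\<sigma>\<in>unshuffles [i, length ds - i].
                let ds' = permute_list \<sigma> ds; xs' = permute_list \<sigma> xs in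
                s (antisym_koszul_sign \<sigma> ds * (- 1) ^ (i * (j - 1)))
                  (l ((sum_list (take i ds') + 2 - int i) # drop i ds')
                     (l (take i ds') (take i xs') # drop i xs'))) = 0))"

definition master_term ::
  "('k::field_char_0 \<Rightarrow> 'a::ab_group_add \<Rightarrow> 'a) \<Rightarrow> (int list \<Rightarrow> 'a list \<Rightarrow> 'a) \<Rightarrow> 'a \<Rightarrow> nat \<Rightarrow> 'a"
where
  "master_term s l \<kappa> k =
     s (- ((- 1) ^ (k * (k + 1) div 2)) / fact k) (l (replicate k 1) (replicate k \<kappa>))"

text \<open>This is the sum over all \<open>k \<ge> 1\<close> whenever only finitely many terms are nonzero.\<close>

definition quantum_master_equation ::
  "('k::field_char_0 \<Rightarrow> 'a::ab_group_add \<Rightarrow> 'a) \<Rightarrow> (int list \<Rightarrow> 'a list \<Rightarrow> 'a) \<Rightarrow> 'a \<Rightarrow> bool"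
where
  "quantum_master_equation s l \<kappa> \<longleftrightarrow>
     0 = (\<Sum>k\<in>{k. 1 \<le> k \<and> master_term s l \<kappa> k \<noteq> 0}. master_term s l \<kappa> k)"


section \<open>The S-cohomology complex\<close>

definition alternating_maps ::
  "('k::field \<Rightarrow> 'a::ab_group_add \<Rightarrow> 'a) \<Rightarrow> ('k \<Rightarrow> 'w::ab_group_add \<Rightarrow> 'w) \<Rightarrow> nat \<Rightarrow>
   ('a list \<Rightarrow> 'w) set"
where
  "alternating_maps s sW n =
     {f\<in>multilinear_maps s sW (replicate n UNIV). \<forall>xs. \<not> distinct xs \<longrightarrow> f xs = 0}"

text \<open>The differential of an \<open>n\<close>-cochain \<open>\<phi>\<close> with values in a module with action \<open>act\<close>; as in the
  formula for it, the indices \<open>s\<close> and \<open>t\<close> count from \<open>1\<close>.\<close>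

definition ce_differential ::
  "('k::field \<Rightarrow> 'w::ab_group_add \<Rightarrow> 'w) \<Rightarrow> ('a \<Rightarrow> 'a \<Rightarrow> 'a) \<Rightarrow> ('a \<Rightarrow> 'w \<Rightarrow> 'w) \<Rightarrow> nat \<Rightarrow>
   ('a list \<Rightarrow> 'w) \<Rightarrow> 'a list \<Rightarrow> 'w"
where
  "ce_differential sW br act n \<phi> xs =
     (if length xs = n + 1 then
        (\<Sum>s\<in>{1..n + 1}. sW ((- 1) ^ s) (act (xs ! (s - 1)) (\<phi> (nths xs (- {s - 1}))))) +
        (\<Sum>(s, t)\<in>{(s, t). 1 \<le> s \<and> s < t \<and> t \<le> n + 1}.
           sW ((- 1) ^ (s + t - 1))
             (\<phi> (br (xs ! (s - 1)) (xs ! (t - 1)) # nths xs (- {s - 1, t - 1}))))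
      else 0)"

type_synonym ('u, 'v) cochain = "('u list \<Rightarrow> 'u) \<times> ('v list \<Rightarrow> 'v) \<times> ('u list \<Rightarrow> 'v)"

definition cochain_scale ::
  "('k \<Rightarrow> 'u \<Rightarrow> 'u) \<Rightarrow> ('k \<Rightarrow> 'v \<Rightarrow> 'v) \<Rightarrow> 'k \<Rightarrow> ('u, 'v) cochain \<Rightarrow> ('u, 'v) cochain"
where
  "cochain_scale sU sV c = (\<lambda>(xU, xV, xg).
     (\<lambda>us. sU c (xU us), \<lambda>vs. sV c (xV vs), \<lambda>us. sV c (xg us)))"

definition S_cochains ::
  "('k::field \<Rightarrow> 'u::ab_group_add \<Rightarrow> 'u) \<Rightarrow> ('k \<Rightarrow> 'v::ab_group_add \<Rightarrow> 'v) \<Rightarrow> nat \<Rightarrow>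
   ('u, 'v) cochain set"
where
  "S_cochains sU sV n =
     alternating_maps sU sU n \<times> alternating_maps sV sV n \<times> alternating_maps sU sV (n - 1)"

definition S_differential ::
  "('k::field \<Rightarrow> 'u::ab_group_add \<Rightarrow> 'u) \<Rightarrow> ('u \<Rightarrow> 'u \<Rightarrow> 'u) \<Rightarrow>
   ('k \<Rightarrow> 'v::ab_group_add \<Rightarrow> 'v) \<Rightarrow> ('v \<Rightarrow> 'v \<Rightarrow> 'v) \<Rightarrow> ('u \<Rightarrow> 'v) \<Rightarrow>
   nat \<Rightarrow> ('u, 'v) cochain \<Rightarrow> ('u, 'v) cochain"
where
  "S_differential sU brU sV brV g n = (\<lambda>(xU, xV, xg).
     (ce_differential sU brU brU n xU,
      ce_differential sV brV brV n xV,
      \<lambda>us. sV ((- 1) ^ (n - 1)) (g (xU us)) - sV ((- 1) ^ (n - 1)) (xV (map g us))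
           + ce_differential sV brU (\<lambda>u. brV (g u)) (n - 1) xg us))"

definition S_graded ::
  "('k::field \<Rightarrow> 'u::ab_group_add \<Rightarrow> 'u) \<Rightarrow> ('k \<Rightarrow> 'v::ab_group_add \<Rightarrow> 'v) \<Rightarrow> int \<Rightarrow>
   ('u, 'v) cochain set"
where
  "S_graded sU sV p = (if 1 \<le> p then S_cochains sU sV (nat p + 1) else {0})"


section \<open>The differential graded PROP \<open>F(E)\<close>\<close>

datatype color = B | W

datatype gen = Mu nat | Nu nat | Fm nat

primrec gen_valid :: "gen \<Rightarrow> bool" where
  "gen_valid (Mu n) \<longleftrightarrow> 2 \<le> n"
| "gen_valid (Nu n) \<longleftrightarrow> 2 \<le> n"
| "gen_valid (Fm n) \<longleftrightarrow> 1 \<le> n"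

primrec gen_src :: "gen \<Rightarrow> color list" where
  "gen_src (Mu n) = replicate n B"
| "gen_src (Nu n) = replicate n W"
| "gen_src (Fm n) = replicate n B"

primrec gen_tgt :: "gen \<Rightarrow> color list" where
  "gen_tgt (Mu n) = [B]"
| "gen_tgt (Nu n) = [W]"
| "gen_tgt (Fm n) = [W]"

primrec gen_deg :: "gen \<Rightarrow> int" where
  "gen_deg (Mu n) = int n - 2"
| "gen_deg (Nu n) = int n - 2"
| "gen_deg (Fm n) = int n - 1"

text \<open>
  The free PROP is built from formal expressions modulo the congruence \<open>prop_eq\<close> below. A
  2-colored PROP is taken as a strict symmetric monoidal category, enriched in graded vector
  spaces, whose objects are words in the colors. \<open>Perm c \<sigma>\<close> is the permutation morphism from \<open>c\<close>
  to \<open>permute_list \<sigma> c\<close>, acting on an algebra by \<open>xs \<mapsto> permute_list \<sigma> xs\<close>. \<open>Comp a b\<close> is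
  \<open>a \<circ> b\<close>. \<open>Zero c d n\<close> is the zero morphism from \<open>c\<close> to \<open>d\<close> in degree \<open>n\<close>; every well-formed
  expression is thus homogeneous with a definite source, target and degree.
\<close>

datatype 'k pexp =
    Gen gen
  | Perm "color list" "nat \<Rightarrow> nat"
  | Comp "'k pexp" "'k pexp"
  | Tens "'k pexp" "'k pexp"
  | Zero "color list" "color list" int
  | Plus "'k pexp" "'k pexp"
  | Scale 'k "'k pexp"

primrec src :: "'k pexp \<Rightarrow> color list" where
  "src (Gen x) = gen_src x"
| "src (Perm c \<sigma>) = c"
| "src (Comp a b) = src b"
| "src (Tens a b) = src a @ src b"
| "src (Zero c d n) = c"
| "src (Plus a b) = src a"
| "src (Scale r a) = src a"

primrec tgt :: "'k pexp \<Rightarrow> color list" where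
  "tgt (Gen x) = gen_tgt x"
| "tgt (Perm c \<sigma>) = permute_list \<sigma> c"
| "tgt (Comp a b) = tgt a"
| "tgt (Tens a b) = tgt a @ tgt b"
| "tgt (Zero c d n) = d"
| "tgt (Plus a b) = tgt a"
| "tgt (Scale r a) = tgt a"

primrec deg :: "'k pexp \<Rightarrow> int" where
  "deg (Gen x) = gen_deg x"
| "deg (Perm c \<sigma>) = 0"
| "deg (Comp a b) = deg a + deg b"
| "deg (Tens a b) = deg a + deg b"
| "deg (Zero c d n) = n"
| "deg (Plus a b) = deg a"
| "deg (Scale r a) = deg a"

primrec wf_pexp :: "'k pexp \<Rightarrow> bool" where
  "wf_pexp (Gen x) \<longleftrightarrow> gen_valid x"
| "wf_pexp (Perm c \<sigma>) \<longleftrightarrow> \<sigma> permutes {..<length c}"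
| "wf_pexp (Comp a b) \<longleftrightarrow> wf_pexp a \<and> wf_pexp b \<and> src a = tgt b"
| "wf_pexp (Tens a b) \<longleftrightarrow> wf_pexp a \<and> wf_pexp b"
| "wf_pexp (Zero c d n) \<longleftrightarrow> True"
| "wf_pexp (Plus a b) \<longleftrightarrow>
     wf_pexp a \<and> wf_pexp b \<and> src a = src b \<and> tgt a = tgt b \<and> deg a = deg b"
| "wf_pexp (Scale r a) \<longleftrightarrow> wf_pexp a"

definition perm_sum :: "nat \<Rightarrow> (nat \<Rightarrow> nat) \<Rightarrow> (nat \<Rightarrow> nat) \<Rightarrow> nat \<Rightarrow> nat" where
  "perm_sum m \<sigma> \<tau> i = (if i < m then \<sigma> i else \<tau> (i - m) + m)"

text \<open>\<open>permute_list (block_swap m n)\<close> maps \<open>xs @ ys\<close> to \<open>ys @ xs\<close> if \<open>xs\<close>, \<open>ys\<close> have lengths \<open>m\<close>, \<open>n\<close>.\<close>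

definition block_swap :: "nat \<Rightarrow> nat \<Rightarrow> nat \<Rightarrow> nat" where
  "block_swap m n i = (if i < n then i + m else if i < m + n then i - n else i)"

text \<open>The defining relations; only their instances with two well-formed sides are used.\<close>

inductive prop_axiom :: "'k::field pexp \<Rightarrow> 'k pexp \<Rightarrow> bool" where
  plus_assoc: "prop_axiom (Plus (Plus a b) c) (Plus a (Plus b c))"
| plus_commute: "prop_axiom (Plus a b) (Plus b a)"
| plus_zero: "prop_axiom (Plus a (Zero c d n)) a"
| plus_minus: "prop_axiom (Plus a (Scale (- 1) a)) (Zero (src a) (tgt a) (deg a))"
| scale_plus: "prop_axiom (Scale r (Plus a b)) (Plus (Scale r a) (Scale r b))"
| plus_scale: "prop_axiom (Scale (r + q) a) (Plus (Scale r a) (Scale q a))"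
| scale_scale: "prop_axiom (Scale r (Scale q a)) (Scale (r * q) a)"
| scale_one: "prop_axiom (Scale 1 a) a"
| comp_plus_left: "prop_axiom (Comp (Plus a b) c) (Plus (Comp a c) (Comp b c))"
| comp_plus_right: "prop_axiom (Comp a (Plus b c)) (Plus (Comp a b) (Comp a c))"
| comp_scale_left: "prop_axiom (Comp (Scale r a) b) (Scale r (Comp a b))"
| comp_scale_right: "prop_axiom (Comp a (Scale r b)) (Scale r (Comp a b))"
| tens_plus_left: "prop_axiom (Tens (Plus a b) c) (Plus (Tens a c) (Tens b c))"
| tens_plus_right: "prop_axiom (Tens a (Plus b c)) (Plus (Tens a b) (Tens a c))"
| tens_scale_left: "prop_axiom (Tens (Scale r a) b) (Scale r (Tens a b))"
| tens_scale_right: "prop_axiom (Tens a (Scale r b)) (Scale r (Tens a b))"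
| comp_assoc: "prop_axiom (Comp (Comp a b) c) (Comp a (Comp b c))"
| comp_id_left: "prop_axiom (Comp (Perm (tgt a) id) a) a"
| comp_id_right: "prop_axiom (Comp a (Perm (src a) id)) a"
| tens_assoc: "prop_axiom (Tens (Tens a b) c) (Tens a (Tens b c))"
| tens_unit_left: "prop_axiom (Tens (Perm [] id) a) a"
| tens_unit_right: "prop_axiom (Tens a (Perm [] id)) a"
| interchange:
    "prop_axiom (Comp (Tens a b) (Tens a' b'))
       (Scale (sign_pow (deg b * deg a')) (Tens (Comp a a') (Comp b b')))"
| perm_comp: "prop_axiom (Comp (Perm (permute_list \<sigma> c) \<tau>) (Perm c \<sigma>)) (Perm c (\<sigma> \<circ> \<tau>))"
| perm_tens: "prop_axiom (Tens (Perm c \<sigma>) (Perm d \<tau>)) (Perm (c @ d) (perm_sum (length c) \<sigma> \<tau>))"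
| swap_natural:
    "prop_axiom
       (Comp (Perm (tgt a @ tgt b) (block_swap (length (tgt a)) (length (tgt b)))) (Tens a b))
       (Scale (sign_pow (deg a * deg b))
         (Comp (Tens b a) (Perm (src a @ src b) (block_swap (length (src a)) (length (src b))))))"
| gen_skew:
    "prop_axiom (Comp (Gen x) (Perm (gen_src x) \<sigma>)) (Scale (of_int (sign \<sigma>)) (Gen x))"

inductive prop_eq :: "'k::field pexp \<Rightarrow> 'k pexp \<Rightarrow> bool" where
  axiom: "prop_axiom a b \<Longrightarrow> wf_pexp a \<Longrightarrow> wf_pexp b \<Longrightarrow> prop_eq a b"
| refl: "wf_pexp a \<Longrightarrow> prop_eq a a"
| sym: "prop_eq a b \<Longrightarrow> prop_eq b a"
| trans: "prop_eq a b \<Longrightarrow> prop_eq b c \<Longrightarrow> prop_eq a c"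
| comp: "prop_eq a a' \<Longrightarrow> prop_eq b b' \<Longrightarrow> wf_pexp (Comp a b) \<Longrightarrow> prop_eq (Comp a b) (Comp a' b')"
| tens: "prop_eq a a' \<Longrightarrow> prop_eq b b' \<Longrightarrow> prop_eq (Tens a b) (Tens a' b')"
| plus: "prop_eq a a' \<Longrightarrow> prop_eq b b' \<Longrightarrow> wf_pexp (Plus a b) \<Longrightarrow> prop_eq (Plus a b) (Plus a' b')"
| scale: "prop_eq a a' \<Longrightarrow> prop_eq (Scale r a) (Scale r a')"

text \<open>A finite sum of expressions from \<open>c\<close> to \<open>d\<close> of degree \<open>n\<close>. The order of summation is chosen
  arbitrarily; different orders give \<open>prop_eq\<close>-equivalent expressions.\<close>

definition psum ::
  "color list \<Rightarrow> color list \<Rightarrow> int \<Rightarrow> ('i \<Rightarrow> 'k pexp) \<Rightarrow> 'i set \<Rightarrow> 'k pexp"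
where
  "psum c d n e I =
     foldr (\<lambda>i. Plus (e i)) (SOME is. set is = I \<and> distinct is) (Zero c d n)"

definition tens_list :: "'k pexp list \<Rightarrow> 'k pexp" where
  "tens_list es = foldr Tens es (Perm [] id)"

text \<open>The sum \<open>\<Sum> (-1)\<^bsup>j(i-1)\<^esup> sgn(\<sigma>) h\<^sub>i \<circ> (m\<^sub>j \<otimes> Id\<^bsup>\<otimes>i-1\<^esup>) \<circ> \<sigma>\<close> over \<open>i + j = n + 1\<close>, \<open>i \<ge> lo\<close>, \<open>j \<ge> 2\<close>
  and \<open>(j, i - 1)\<close>-unshuffles \<open>\<sigma>\<close>; all inputs have color \<open>x\<close> and the output has color \<open>y\<close>.\<close>

definition insertion_sum ::
  "color \<Rightarrow> color \<Rightarrow> int \<Rightarrow> nat \<Rightarrow> (nat \<Rightarrow> gen) \<Rightarrow> (nat \<Rightarrow> gen) \<Rightarrow> nat \<Rightarrow> 'k::field pexp"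
where
  "insertion_sum x y q lo h m n =
     psum (replicate n x) [y] q
       (\<lambda>(i, j). Scale ((- 1) ^ (j * (i - 1)))
          (psum (replicate n x) [y] q
             (\<lambda>\<sigma>. Scale (of_int (sign \<sigma>))
                (Comp (Comp (Gen (h i)) (Tens (Gen (m j)) (Perm (replicate (i - 1) x) id)))
                   (Perm (replicate n x) \<sigma>)))
             (unshuffles [j, i - 1])))
       {(i, j). i + j = n + 1 \<and> lo \<le> i \<and> 2 \<le> j}"

text \<open>In the exponent below \<open>i\<close> counts from \<open>1\<close>, so \<open>r\<^sub>i\<close> is \<open>rs ! (i - 1)\<close>.\<close>

definition splitting_sum :: "nat \<Rightarrow> 'k::field pexp" where
  "splitting_sum n =
     psum (replicate n B) [W] (int n - 2)
       (\<lambda>rs. let l = length rs in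
          Scale ((- 1) ^ (l * (l - 1) div 2 + (\<Sum>i\<in>{1..l - 1}. rs ! (i - 1) * (l - i))))
            (psum (replicate n B) [W] (int n - 2)
               (\<lambda>\<sigma>. Scale (of_int (sign \<sigma>))
                  (Comp (Comp (Gen (Nu l)) (tens_list (map (\<lambda>r. Gen (Fm r)) rs)))
                     (Perm (replicate n B) \<sigma>)))
               (ordered_unshuffles rs)))
       {rs. 2 \<le> length rs \<and> length rs \<le> n \<and> (\<forall>r\<in>set rs. 1 \<le> r) \<and> sum_list rs = n \<and> sorted rs}"

primrec gen_boundary :: "gen \<Rightarrow> 'k::field pexp" where
  "gen_boundary (Mu n) = insertion_sum B B (int n - 3) 2 Mu Mu n"
| "gen_boundary (Nu n) = insertion_sum W W (int n - 3) 2 Nu Nu n"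
| "gen_boundary (Fm n) =
     Plus (splitting_sum n) (Scale (- 1) (insertion_sum B W (int n - 2) 1 Fm Mu n))"

text \<open>The extension to a degree \<open>-1\<close> derivation of the PROP.\<close>

primrec boundary :: "'k::field pexp \<Rightarrow> 'k pexp" where
  "boundary (Gen x) = gen_boundary x"
| "boundary (Perm c \<sigma>) = Zero c (permute_list \<sigma> c) (- 1)"
| "boundary (Comp a b) =
     Plus (Comp (boundary a) b) (Scale (sign_pow (deg a)) (Comp a (boundary b)))"
| "boundary (Tens a b) =
     Plus (Tens (boundary a) b) (Scale (sign_pow (deg a)) (Tens a (boundary b)))"
| "boundary (Zero c d n) = Zero c d (n - 1)"
| "boundary (Plus a b) = Plus (boundary a) (boundary b)"
| "boundary (Scale r a) = Scale r (boundary a)"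


section \<open>The endomorphism PROP and \<open>F(E)\<close>-algebras\<close>

text \<open>\<open>T = U \<oplus> V\<close> is the type \<open>'u \<times> 'v\<close> with the two summands as colored pieces.\<close>

definition T_scale :: "('k \<Rightarrow> 'u \<Rightarrow> 'u) \<Rightarrow> ('k \<Rightarrow> 'v \<Rightarrow> 'v) \<Rightarrow> 'k \<Rightarrow> 'u \<times> 'v \<Rightarrow> 'u \<times> 'v" where
  "T_scale sU sV c = (\<lambda>(u, v). (sU c u, sV c v))"

primrec T_piece :: "color \<Rightarrow> ('u::zero \<times> 'v::zero) set" where
  "T_piece B = range (\<lambda>u. (u, 0))"
| "T_piece W = range (\<lambda>v. (0, v))"

abbreviation T_pieces :: "color list \<Rightarrow> ('u::zero \<times> 'v::zero) set list" where
  "T_pieces c \<equiv> map T_piece c"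

text \<open>\<open>End\<^sub>T(c, d)\<close>: linear maps from the tensor product of the \<open>T\<^bsub>c\<^sub>i\<^esub>\<close> to that of the \<open>T\<^bsub>d\<^sub>j\<^esub>\<close>,
  given as multilinear maps. As \<open>U\<close> and \<open>V\<close> are ungraded, \<open>End\<^sub>T\<close> is concentrated in degree \<open>0\<close>.\<close>

type_synonym ('k, 'u, 'v) end_map = "('u \<times> 'v) list \<Rightarrow> ('k, 'u \<times> 'v) tensor"

definition End_T ::
  "('k::field \<Rightarrow> 'u::ab_group_add \<Rightarrow> 'u) \<Rightarrow> ('k \<Rightarrow> 'v::ab_group_add \<Rightarrow> 'v) \<Rightarrow>
   color list \<Rightarrow> color list \<Rightarrow> int \<Rightarrow> ('k, 'u, 'v) end_map set"
where
  "End_T sU sV c d n =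
     (if n = 0 then
        {F\<in>multilinear_maps (T_scale sU sV) tensor_scale (T_pieces c).
           \<forall>xs. F xs \<in> tensor_space (T_scale sU sV) (T_pieces d)}
      else {0})"

definition end_comp ::
  "('k, 'u, 'v) end_map \<Rightarrow> ('k, 'u, 'v) end_map \<Rightarrow> ('k, 'u, 'v) end_map"
where
  "end_comp F G = (\<lambda>xs. tensor_lift F (G xs))"

text \<open>The tensor product of \<open>F \<in> End\<^sub>T(c, d)\<close> and \<open>G \<in> End\<^sub>T(c', d')\<close>.\<close>

definition end_tens ::
  "('k::field \<Rightarrow> 'u::ab_group_add \<Rightarrow> 'u) \<Rightarrow> ('k \<Rightarrow> 'v::ab_group_add \<Rightarrow> 'v) \<Rightarrow>
   color list \<Rightarrow> color list \<Rightarrow> color list \<Rightarrow>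
   ('k, 'u, 'v) end_map \<Rightarrow> ('k, 'u, 'v) end_map \<Rightarrow> ('k, 'u, 'v) end_map"
where
  "end_tens sU sV c d d' F G =
     (\<lambda>xs. tensor_append (T_scale sU sV) (T_pieces d) (T_pieces d')
             (F (take (length c) xs)) (G (drop (length c) xs)))"

definition end_perm ::
  "('k::field \<Rightarrow> 'u::ab_group_add \<Rightarrow> 'u) \<Rightarrow> ('k \<Rightarrow> 'v::ab_group_add \<Rightarrow> 'v) \<Rightarrow>
   color list \<Rightarrow> (nat \<Rightarrow> nat) \<Rightarrow> ('k, 'u, 'v) end_map"
where
  "end_perm sU sV c \<sigma> =
     (\<lambda>xs. if xs \<in> listset (T_pieces c)
           then pure_tensor (T_scale sU sV) (T_pieces (permute_list \<sigma> c)) (permute_list \<sigma> xs)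
           else 0)"

text \<open>
  Morphisms of differential graded 2-colored PROPs from \<open>F(E)\<close> to \<open>End\<^sub>T\<close>: maps on well-formed
  expressions that factor through \<open>prop_eq\<close>, extended by \<open>0\<close> to the other expressions so that
  equality of morphisms is equality of functions. The boundary condition reflects the zero
  differential of \<open>End\<^sub>T\<close>.
\<close>

definition FE_algebras ::
  "('k::field \<Rightarrow> 'u::ab_group_add \<Rightarrow> 'u) \<Rightarrow> ('k \<Rightarrow> 'v::ab_group_add \<Rightarrow> 'v) \<Rightarrow>
   ('k pexp \<Rightarrow> ('k, 'u, 'v) end_map) set"
where
  "FE_algebras sU sV =
     {\<alpha>. (\<forall>a. \<not> wf_pexp a \<longrightarrow> \<alpha> a = 0) \<and>
         (\<forall>a b. prop_eq a b \<longrightarrow> \<alpha> a = \<alpha> b) \<and>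
         (\<forall>a. wf_pexp a \<longrightarrow> \<alpha> a \<in> End_T sU sV (src a) (tgt a) (deg a)) \<and>
         (\<forall>c d n. \<alpha> (Zero c d n) = 0) \<and>
         (\<forall>a b. wf_pexp (Plus a b) \<longrightarrow> \<alpha> (Plus a b) = \<alpha> a + \<alpha> b) \<and>
         (\<forall>r a. wf_pexp a \<longrightarrow> \<alpha> (Scale r a) = (\<lambda>xs. tensor_scale r (\<alpha> a xs))) \<and>
         (\<forall>a b. wf_pexp (Comp a b) \<longrightarrow> \<alpha> (Comp a b) = end_comp (\<alpha> a) (\<alpha> b)) \<and>
         (\<forall>a b. wf_pexp (Tens a b) \<longrightarrow>
            \<alpha> (Tens a b) = end_tens sU sV (src a) (tgt a) (tgt b) (\<alpha> a) (\<alpha> b)) \<and>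
         (\<forall>c \<sigma>. wf_pexp (Perm c \<sigma> :: 'k pexp) \<longrightarrow> \<alpha> (Perm c \<sigma>) = end_perm sU sV c \<sigma>) \<and>
         (\<forall>a. wf_pexp a \<longrightarrow> \<alpha> (boundary a) = 0)}"

text \<open>
  The structure \<open>\<alpha>\<close> deforms the given one by \<open>\<kappa>\<close>: the brackets become \<open>[-,-]\<^sub>U + \<kappa>\<^sub>U\<close> and
  \<open>[-,-]\<^sub>V + \<kappa>\<^sub>V\<close> and the morphism becomes \<open>g - \<kappa>\<^sub>g\<close>. The last sign is forced by the signs in the
  differential \<open>\<Delta>\<^sup>2\<close>: its third component is \<open>-g x\<^sub>U + x\<^sub>V g\<^bsup>\<otimes>2\<^esup> + b x\<^sub>g\<close>, while the linear part in
  \<open>(x\<^sub>U, x\<^sub>V, h)\<close> of \<open>f\<mu> - \<nu>(f \<otimes> f)\<close>, for \<open>f = g + h\<close>, is \<open>g x\<^sub>U - x\<^sub>V g\<^bsup>\<otimes>2\<^esup> + b h\<close>.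
\<close>

definition deformed_by ::
  "('k::field \<Rightarrow> 'u::ab_group_add \<Rightarrow> 'u) \<Rightarrow> ('u \<Rightarrow> 'u \<Rightarrow> 'u) \<Rightarrow>
   ('k \<Rightarrow> 'v::ab_group_add \<Rightarrow> 'v) \<Rightarrow> ('v \<Rightarrow> 'v \<Rightarrow> 'v) \<Rightarrow> ('u \<Rightarrow> 'v) \<Rightarrow>
   ('u, 'v) cochain \<Rightarrow> ('k pexp \<Rightarrow> ('k, 'u, 'v) end_map) \<Rightarrow> bool"
where
  "deformed_by sU brU sV brV g = (\<lambda>(\<kappa>U, \<kappa>V, \<kappa>g) \<alpha>.
     (\<forall>x y. \<alpha> (Gen (Mu 2)) [(x, 0), (y, 0)] =
        pure_tensor (T_scale sU sV) (T_pieces [B]) [(brU x y + \<kappa>U [x, y], 0)]) \<and>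
     (\<forall>x y. \<alpha> (Gen (Nu 2)) [(0, x), (0, y)] =
        pure_tensor (T_scale sU sV) (T_pieces [W]) [(0, brV x y + \<kappa>V [x, y])]) \<and>
     (\<forall>x. \<alpha> (Gen (Fm 1)) [(x, 0)] =
        pure_tensor (T_scale sU sV) (T_pieces [W]) [(0, g x - \<kappa>g [x])]))"

end

theory Submission
  imports Defs
begin

text \<open>
  Shifting degrees by one makes the operations graded symmetric, and every sign becomes the Koszul
  sign of a splitting of the list of arguments. First forget the brackets of \<open>U\<close> and \<open>V\<close> and keep
  only \<open>g\<close>. The shifted operations are then composition of cochains on \<open>U\<close> and on \<open>V\<close>, while the
  third component consists of \<open>g x\<^sub>U\<close>, of \<open>x\<^sub>g \<circ> x\<^sub>U\<close>, and of the insertions of several \<open>x\<^sub>g\<close> and of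
  \<open>g\<close> into \<open>x\<^sub>V\<close>; the \<open>L\<^sub>\<infinity>\<close>-relations reduce to the pre-Lie identity and its analogue for insertions.
  The pair of brackets is a Maurer-Cartan element, because \<open>g\<close> is a morphism of Lie algebras; twisting
  by it gives the structure with \<open>l\<^sub>1 = \<Delta>\<close>. The terms of the master equation for \<open>\<kappa>\<close> vanish beyond
  the third, and the equation says that the deformed brackets satisfy the Jacobi identity and that
  \<open>g - \<kappa>\<^sub>g\<close> preserves them.

  Since \<open>End\<^sub>T\<close> lives in degree \<open>0\<close>, an \<open>F(E)\<close>-algebra is determined by the images of \<open>\<mu>\<^sub>2\<close>, \<open>\<nu>\<^sub>2\<close>
  and \<open>f\<^sub>1\<close>, all other generators being sent to \<open>0\<close>. The only conditions on these three come from
  the boundaries of \<open>\<mu>\<^sub>3\<close>, \<open>\<nu>\<^sub>3\<close> and \<open>f\<^sub>2\<close>, and are again the two Jacobi identities and the morphism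
  property.
\<close>

section \<open>Signed sums over splittings\<close>

text \<open>The obstacle is the bookkeeping of signs. Sums over unshuffles are therefore replaced by
  a recursion along the list, \<open>sps\<close>, which behaves like a graded coassociative and
  cocommutative coproduct; the identities between operations are derived from these laws, and actual
  permutations return only when the result is compared with the definitions. Two signs are compared
  modulo 2, and only on sublists whose lengths match the arities of the maps applied to them; on
  other lengths both sides vanish. The map \<open>g\<close> is kept out of the twisting element
  because it has to fill every slot of an \<open>x_V\<close> that no \<open>x_g\<close> occupies, so
  it occurs an unbounded number of times; the pair of brackets occurs at most once in each twisted
  operation. Twisting needs a division by 2: the relation with two extra copies of the brackets
  yields the desired sum twice. On the PROP side the Koszul signs of interchange and symmetry cause
  no trouble: such a sign is nontrivial only if both degrees are odd, and then both maps are
  zero.\<close>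

definition sg :: "int \<Rightarrow> 'a::ab_group_add \<Rightarrow> 'a" where
  "sg n x = (if even n then x else - x)"

lemma sg_zero [simp]: "sg n 0 = 0" by (simp add: sg_def)
lemma sg_0 [simp]: "sg 0 x = x" by (simp add: sg_def)
lemma sg_add: "sg n (x + y) = sg n x + sg n y" by (simp add: sg_def)
lemma sg_minus: "sg n (- x) = - sg n x" by (simp add: sg_def)
lemma sg_sg: "sg m (sg n x) = sg (m + n) x" by (simp add: sg_def)
lemma minus_sg: "- sg n x = sg (n + 1) x" by (simp add: sg_def)
lemma sg_parity: "even a \<longleftrightarrow> even b \<Longrightarrow> sg a x = sg b x" by (simp add: sg_def)
lemma sg_even: "even a \<Longrightarrow> sg a x = x" by (simp add: sg_def)
lemma sg_apply: "sg n f x = sg n (f x)" by (simp add: sg_def)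
lemma sg_eq_0_iff [simp]: "sg n x = 0 \<longleftrightarrow> x = 0" by (simp add: sg_def)

lemma additive_zero: "additive h \<Longrightarrow> h 0 = 0"
  by (rule additive.zero)
lemma additive_sg: "additive h \<Longrightarrow> h (sg n x) = sg n (h x)"
  by (simp add: sg_def additive.minus)

abbreviation wt :: "('a \<Rightarrow> int) \<Rightarrow> 'a list \<Rightarrow> int" where
  "wt par p \<equiv> sum_list (map par p)"

lemma wt_one [simp]: "wt (\<lambda>_. 1) p = int (length p)"
  by (induct p) auto

text \<open>The sum over all pairs of complementary sublists \<open>p\<close>, \<open>q\<close>, that is over all unshuffles of the
  list, with the Koszul sign for entries of degrees \<open>par\<close>.\<close>

primrec sps :: "('a \<Rightarrow> int) \<Rightarrow> 'a list \<Rightarrow> ('a list \<Rightarrow> 'a list \<Rightarrow> 'b::ab_group_add) \<Rightarrow> 'b" where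
  "sps par [] f = f [] []"
| "sps par (x # xs) f =
     sps par xs (\<lambda>p q. f (x # p) q) + sps par xs (\<lambda>p q. sg (par x * wt par p) (f p (x # q)))"

lemma sps_cong:
  assumes "\<And>p q. wt par p + wt par q = wt par xs \<Longrightarrow> length p + length q = length xs \<Longrightarrow>
     set p \<union> set q = set xs \<Longrightarrow> f p q = h p q"
  shows "sps par xs f = sps par xs h"
  using assms
proof (induct xs arbitrary: f h)
  case (Cons x xs)
  show ?case
    unfolding sps.simps
    by (intro arg_cong2[where f = plus] Cons.hyps arg_cong[where f = "sg _"] Cons.prems; force)
qed simp

lemma sps_add: "sps par xs (\<lambda>p q. f p q + h p q) = sps par xs f + sps par xs h"
  by (induct xs arbitrary: f h) (simp_all add: sg_add)

lemma sps_hom: "additive h \<Longrightarrow> h (sps par xs f) = sps par xs (\<lambda>p q. h (f p q))"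
  by (induct xs arbitrary: f) (simp_all add: additive.add additive_sg)

lemma additive_sgI: "additive (sg n)" by (simp add: additive_def sg_add)

lemma sps_sg: "sps par xs (\<lambda>p q. sg n (f p q)) = sg n (sps par xs f)"
  using sps_hom[OF additive_sgI] by metis

lemma sps_zero [simp]: "sps par xs (\<lambda>p q. 0) = 0"
  by (induct xs) simp_all

lemma sps_uminus: "sps par xs (\<lambda>p q. - f p q) = - sps par xs f"
  using sps_sg[of par xs 1 f] by (simp add: sg_def)

lemma sps_fubini:
  "sps par xs (\<lambda>p q. sps par' ys (\<lambda>r s. F p q r s)) =
   sps par' ys (\<lambda>r s. sps par xs (\<lambda>p q. F p q r s))"
  by (induct xs arbitrary: F) (simp_all add: sps_add sps_sg[symmetric])

text \<open>Coassociativity of the unshuffle coproduct: both sides run over the splittings into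
  three parts, and an entry of the last part passes the first two parts whether these are still
  joined or already separated.\<close>

lemma sps_assoc:
  "sps par xs (\<lambda>t s. sps par t (\<lambda>p r. F p r s)) = sps par xs (\<lambda>p q. sps par q (\<lambda>r s. F p r s))"
proof (induct xs arbitrary: F)
  case (Cons x xs)
  have 1: "sps par xs (\<lambda>t s. sps par t (\<lambda>p r. sg (par x * wt par p) (F p (x # r) s)))
     = sps par xs (\<lambda>p q. sg (par x * wt par p) (sps par q (\<lambda>r s. F p (x # r) s)))"
    by (simp only: Cons[of "\<lambda>p r s. sg (par x * wt par p) (F p (x # r) s)"] sps_sg)
  have 2: "sps par xs (\<lambda>t s. sg (par x * wt par t) (sps par t (\<lambda>p r. F p r (x # s))))
     = sps par xs (\<lambda>t s. sps par t (\<lambda>p r. sg (par x * (wt par p + wt par r)) (F p r (x # s))))"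
    by (intro sps_cong) (simp only: sps_sg[symmetric], intro sps_cong, simp)
  have 3: "\<dots> = sps par xs (\<lambda>p q. sg (par x * wt par p) (sps par q (\<lambda>r s. sg (par x * wt par r) (F p r (x # s)))))"
    by (simp only: sps_sg[symmetric] sg_sg distrib_left)
      (rule Cons[of "\<lambda>p r s. sg (par x * wt par p + par x * wt par r) (F p r (x # s))"])
  show ?case
    by (simp add: sps_add sg_add Cons[of "\<lambda>p r s. F (x # p) r s"] 1 2 3 add.assoc)
qed simp

text \<open>Graded cocommutativity. In the recursion the exchange of the parts interchanges the
  summand with \<open>x\<close> in the first part and the one with \<open>x\<close> in the
  second.\<close>

lemma sps_comm: "sps par xs f = sps par xs (\<lambda>p q. sg (wt par p * wt par q) (f q p))"
proof (induct xs arbitrary: f)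
  case (Cons x xs)
  show ?case
    apply (simp add: sg_sg)
    apply (subst add.commute)
    apply (rule arg_cong2[where f = plus])
     apply (rule HOL.trans[OF Cons], rule sps_cong, (simp only: sg_sg)?, rule sg_parity, auto)[1]
    apply (rule HOL.trans[OF Cons], rule sps_cong, (simp only: sg_sg)?, rule sg_parity, auto)[1]
    done
qed simp

text \<open>Coassociativity and cocommutativity combined: of three parts, the first two can be
  chosen in either order. It is used whenever two maps are to receive their arguments in the
  opposite order.\<close>

lemma sps_exch:
  "sps par xs (\<lambda>p q. sps par q (\<lambda>r s. F p r s)) =
   sps par xs (\<lambda>r q. sps par q (\<lambda>p s. sg (wt par p * wt par r) (F p r s)))"
proof -
  have "sps par xs (\<lambda>p q. sps par q (\<lambda>r s. F p r s)) = sps par xs (\<lambda>t s. sps par t (\<lambda>p r. F p r s))"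
    by (simp only: sps_assoc)
  also have "\<dots> = sps par xs (\<lambda>t s. sps par t (\<lambda>r p. sg (wt par r * wt par p) (F p r s)))"
    by (rule sps_cong, rule sps_comm)
  also have "\<dots> = sps par xs (\<lambda>r q. sps par q (\<lambda>p s. sg (wt par r * wt par p) (F p r s)))"
    by (rule sps_assoc)
  finally show ?thesis by (simp only: mult.commute)
qed

lemma sps_map: "sps par (map g us) f = sps (\<lambda>x. par (g x)) us (\<lambda>p q. f (map g p) (map g q))"
  by (induct us arbitrary: f) (simp_all add: comp_def)

text \<open>Compatibility of the coproduct with concatenation; the sign moves the first part of
  \<open>ys\<close> past the second part of \<open>xs\<close>. This gives access to a slot in the
  middle of a list.\<close>

lemma sps_append:
  "sps par (xs @ ys) f =
   sps par xs (\<lambda>p q. sps par ys (\<lambda>r s. sg (wt par q * wt par r) (f (p @ r) (q @ s))))"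
proof (induct xs arbitrary: f)
  case (Cons x xs)
  show ?case
    apply (simp add: Cons)
    apply (rule sps_cong)
    apply (subst sps_sg[symmetric])
    apply (rule sps_cong)
    apply (simp add: sg_sg)
    apply (rule sg_parity)
    apply (auto simp: algebra_simps)
    done
qed simp

lemma sps_fst_Nil: "sps par xs (\<lambda>p q. if p = [] then h q else 0) = h xs"
  by (induct xs arbitrary: h) (simp_all add: if_distrib[of "sg _"] cong: if_cong)

section \<open>Composition and insertion of cochains\<close>

text \<open>The arity \<open>n\<close> is an integer so that it can be written as a shifted degree plus a constant; a
  cochain of negative arity is \<open>0\<close>.\<close>

definition coch ::
  "('k \<Rightarrow> 'a \<Rightarrow> 'a) \<Rightarrow> ('k \<Rightarrow> 'b \<Rightarrow> 'b) \<Rightarrow> int \<Rightarrow> ('a::ab_group_add list \<Rightarrow> 'b::ab_group_add) \<Rightarrow> bool"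
where
  "coch s t n \<phi> \<longleftrightarrow>
     (\<forall>p v w q. \<phi> (p @ (v + w) # q) = \<phi> (p @ v # q) + \<phi> (p @ w # q)) \<and>
     (\<forall>p c v q. \<phi> (p @ s c v # q) = t c (\<phi> (p @ v # q))) \<and>
     (\<forall>p v w q. \<phi> (p @ v # w # q) = - \<phi> (p @ w # v # q)) \<and>
     (\<forall>us. \<phi> us \<noteq> 0 \<longrightarrow> int (length us) = n)"

lemma cochD:
  assumes "coch s t n \<phi>"
  shows coch_add: "\<phi> (p @ (v + w) # q) = \<phi> (p @ v # q) + \<phi> (p @ w # q)"
    and coch_scale: "\<phi> (p @ s c v # q) = t c (\<phi> (p @ v # q))"
    and coch_swap: "\<phi> (p @ v # w # q) = - \<phi> (p @ w # v # q)"
    and coch_len: "int (length us) \<noteq> n \<Longrightarrow> \<phi> us = 0"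
    and coch_add1: "\<phi> ((v + w) # q) = \<phi> (v # q) + \<phi> (w # q)"
    and coch_scale1: "\<phi> (s c v # q) = t c (\<phi> (v # q))"
    and coch_swap1: "\<phi> (v # w # q) = - \<phi> (w # v # q)"
proof -
  show *: "\<phi> (p @ (v + w) # q) = \<phi> (p @ v # q) + \<phi> (p @ w # q)"
    "\<phi> (p @ s c v # q) = t c (\<phi> (p @ v # q))"
    "\<phi> (p @ v # w # q) = - \<phi> (p @ w # v # q)"
    "int (length us) \<noteq> n \<Longrightarrow> \<phi> us = 0" for p v w q c us
    using assms unfolding coch_def by blast+
  show "\<phi> ((v + w) # q) = \<phi> (v # q) + \<phi> (w # q)"
    using *(1)[of "[]" v w q] unfolding append_Nil .
  show "\<phi> (s c v # q) = t c (\<phi> (v # q))"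
    using *(2)[of "[]" c v q] unfolding append_Nil .
  show "\<phi> (v # w # q) = - \<phi> (w # v # q)"
    using *(3)[of "[]" v w q] unfolding append_Nil .
qed

lemma coch_additive1: "coch s t n \<phi> \<Longrightarrow> additive (\<lambda>v. \<phi> (v # q))"
  by (simp add: additive_def coch_add1)

lemma coch_zero1: "coch s t n \<phi> \<Longrightarrow> \<phi> (0 # q) = 0"
  using additive_zero[OF coch_additive1, of s t n \<phi> q] by simp

lemma coch_additive: "coch s t n \<phi> \<Longrightarrow> additive (\<lambda>v. \<phi> (p @ v # q))"
  by (simp add: additive_def coch_add)

lemma coch_zero_slot: "coch s t n \<phi> \<Longrightarrow> \<phi> (p @ 0 # q) = 0"
  using additive_zero[OF coch_additive, of s t n \<phi> p q] by simp

text \<open>Inductions over a list of insertions proceed by contraction with the value of the first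
  inserted map, which is why they generalize over the cochain and its arity.\<close>

lemma coch_contract: "coch s t n \<phi> \<Longrightarrow> coch s t (n - 1) (\<lambda>l. \<phi> (v # l))"
proof -
  assume c: "coch s t n \<phi>"
  have "int (length us) = n - 1" if "\<phi> (v # us) \<noteq> 0" for us
  proof -
    have "int (length (v # us)) = n" using coch_len[OF c, of "v # us"] that by blast
    then show ?thesis by simp
  qed
  then show ?thesis
    unfolding coch_def
    using coch_add[OF c, of "v # p" for p] coch_scale[OF c, of "v # p" for p]
      coch_swap[OF c, of "v # p" for p]
    unfolding append_Cons by blast
qed

text \<open>The composition product underlying the Nijenhuis-Richardson bracket: since every
  argument has degree 1, the Koszul sign in \<open>sps\<close> is the sign of the unshuffle.\<close>

definition comp :: "('b::ab_group_add list \<Rightarrow> 'c::ab_group_add) \<Rightarrow> ('b list \<Rightarrow> 'b) \<Rightarrow> 'b list \<Rightarrow> 'c" where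
  "comp x y us = sps (\<lambda>_. 1) us (\<lambda>p q. x (y p # q))"

text \<open>The signed sum of \<open>x (a\<^sub>1(\<dots>), \<dots>, a\<^sub>k(\<dots>), g(\<cdot>), \<dots>, g(\<cdot>))\<close> over all distributions of the arguments.
  The maps \<open>a\<^sub>i\<close> come with their shifted degrees, which are one less than their arities.\<close>

primrec br ::
  "('a \<Rightarrow> 'b) \<Rightarrow> (int \<times> ('a list \<Rightarrow> 'b)) list \<Rightarrow> ('b list \<Rightarrow> 'c::ab_group_add) \<Rightarrow> 'a list \<Rightarrow> 'c"
where
  "br g [] x us = x (map g us)"
| "br g (a # as) x us = sps (\<lambda>_. 1) us
     (\<lambda>p q. sg (wt fst as * int (length p)) (br g as (\<lambda>l. x (snd a p # l)) q))"

lemma br_add: "br g as (\<lambda>l. x l + y l) us = br g as x us + br g as y us"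
  by (induct as arbitrary: x y us) (simp_all add: sg_add sps_add)

lemma br_zero [simp]: "br g as (\<lambda>l. 0) us = 0"
  by (induct as arbitrary: us) simp_all

lemma br_sg: "br g as (\<lambda>l. sg n (x l)) us = sg n (br g as x us)"
  by (induct as arbitrary: x us) (simp_all add: sps_sg[symmetric] sg_sg add.commute)

lemma br_uminus: "br g as (\<lambda>l. - x l) us = - br g as x us"
  using br_sg[of g as 1 x us] by (simp add: sg_def)

lemma br_sps: "br g as (\<lambda>l. sps par zs (\<lambda>p q. F p q l)) us = sps par zs (\<lambda>p q. br g as (F p q) us)"
  by (induct zs arbitrary: F) (simp_all add: br_add br_sg)

lemma additive_br_head: "coch s t n x \<Longrightarrow> additive (\<lambda>v. br g as (\<lambda>l. x (v # l)) q)"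
  by (simp add: additive_def coch_add1 br_add)

lemma br_head_zero: "coch s t n x \<Longrightarrow> br g as (\<lambda>l. x (0 # l)) q = 0"
  using additive_zero[OF additive_br_head] by blast

lemma br_head_add:
  assumes "coch s t n x"
  shows "br g ((k, \<lambda>l. f l + h l) # as) x us = br g ((k, f) # as) x us + br g ((k, h) # as) x us"
  by (simp add: additive.add[OF additive_br_head[OF assms]] sg_add sps_add)

lemma br_head_sg:
  assumes "coch s t n x"
  shows "br g ((k, \<lambda>l. sg m (f l)) # as) x us = sg m (br g ((k, f) # as) x us)"
  by (simp add: additive_sg[OF additive_br_head[OF assms]] sps_sg[symmetric] sg_sg add.commute)

lemma br_head_uminus:
  assumes "coch s t n x"
  shows "br g ((k, \<lambda>l. - f l) # as) x us = - br g ((k, f) # as) x us"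
  using br_head_sg[OF assms, of g k 1 f as us] by (simp add: sg_def)

lemma br_head_0:
  assumes "coch s t n x"
  shows "br g ((k, \<lambda>l. 0) # as) x us = 0"
  by (simp add: br_head_zero[OF assms])

lemma br_head_sps:
  assumes "coch s t n x"
  shows "br g ((k, \<lambda>l. sps par zs (\<lambda>p q. F p q l)) # as) x us =
    sps par zs (\<lambda>p q. br g ((k, F p q) # as) x us)"
  by (simp add: sps_hom[OF additive_br_head[OF assms]] sps_fubini[of par zs] sps_sg)

text \<open>An inserted map of shifted degree \<open>d\<close> takes \<open>d + 1\<close> arguments
  and fills one slot, so it raises the arity by \<open>d\<close>.\<close>

lemma br_len:
  assumes "coch s t n x" "\<forall>a\<in>set as. coch r s (fst a + 1) (snd a)" "int (length us) \<noteq> n + wt fst as"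
  shows "br g as x us = 0"
  using assms
proof (induct as arbitrary: x n us)
  case Nil
  then show ?case by (simp add: coch_len)
next
  case (Cons a as)
  have "br g as (\<lambda>l. x (snd a p # l)) q = 0" if l: "length p + length q = length us" for p q
  proof (cases "int (length p) = fst a + 1")
    case True
    show ?thesis
      by (rule Cons.hyps[OF coch_contract[OF Cons.prems(1)]]) (use Cons.prems l True in auto)
  next
    case False
    then have "snd a p = 0" using Cons.prems(2) coch_len[of r s "fst a + 1" "snd a"] by auto
    then show ?thesis by (simp add: br_head_zero[OF Cons.prems(1)])
  qed
  then have "br g (a # as) x us = sps (\<lambda>_. 1) us (\<lambda>p q. 0)"
    unfolding br.simps by (intro sps_cong) simp
  then show ?case by simp
qed

text \<open>Contraction is a graded derivation of the composition: the first argument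
  \<open>v\<close> lands inside \<open>y\<close> or directly in \<open>x\<close>. In the second case
  it moves past the value of \<open>y\<close>, whose degree is \<open>ny - 1\<close>.\<close>

lemma comp_Cons:
  assumes x: "coch s t nx x" and y: "coch s s ny y"
  shows "comp x y (v # l) = comp x (\<lambda>l. y (v # l)) l + sg (ny + 1) (comp (\<lambda>l. x (v # l)) y l)"
proof -
  have "sps (\<lambda>_. 1) l (\<lambda>p q. sg (int (length p)) (x (y p # v # q)))
    = sps (\<lambda>_. 1) l (\<lambda>p q. sg (ny + 1) (x (v # y p # q)))"
  proof (rule sps_cong)
    fix p q
    \<comment> \<open>The signs agree only for \<open>length p = ny\<close>; for other lengths
      \<open>y p\<close> is \<open>0\<close>.\<close>
    show "sg (int (length p)) (x (y p # v # q)) = sg (ny + 1) (x (v # y p # q))"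
    proof (cases "int (length p) = ny")
      case True
      then show ?thesis by (simp add: coch_swap1[OF x, of "y p" v q] sg_minus minus_sg)
    next
      case False
      then have "y p = 0" using coch_len[OF y] by blast
      then show ?thesis using coch_zero1[OF x] coch_zero_slot[OF x, of "[v]"] by simp
    qed
  qed
  then show ?thesis by (simp add: comp_def sps_sg)
qed

text \<open>Every inserted map meets one of the two composed cochains: those in \<open>I\<close> go
  into \<open>y\<close>, whose value fills one slot of \<open>x\<close>, and those in
  \<open>J\<close> go into \<open>x\<close> directly. The compound map carries the total degree of
  its ingredients.\<close>

lemma br_comp:
  assumes "coch s t nx x" "coch s s ny y" "\<forall>a\<in>set as. coch r s (fst a + 1) (snd a)"
  shows "br g as (comp x y) us =
    sps fst as (\<lambda>I J. br g ((ny - 1 + wt fst I, br g I y) # J) x us)"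
  using assms
proof (induct as arbitrary: x y nx ny us)
  case Nil
  show ?case by (simp add: comp_def sps_map)
next
  case (Cons a as)
  note x = Cons.prems(1) and y = Cons.prems(2)
  have a: "coch r s (fst a + 1) (snd a)" and as: "\<forall>a\<in>set as. coch r s (fst a + 1) (snd a)"
    using Cons.prems(3) by auto
  let ?A = "wt fst as"
  let ?i = "\<lambda>v f l. f (v # l)"
  \<comment> \<open>The value of the head map is split off first; by \<open>comp_Cons\<close> it
    lands in \<open>y\<close> or in \<open>x\<close>, and the induction hypothesis distributes the
    remaining maps.\<close>
  have L: "br g (a # as) (comp x y) us =
      sps (\<lambda>_. 1) us (\<lambda>p q. sps fst as (\<lambda>I J. sg (?A * int (length p))
         (br g ((ny - 2 + wt fst I, br g I (?i (snd a p) y)) # J) x q))) +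
      sps (\<lambda>_. 1) us (\<lambda>p q. sps fst as (\<lambda>I J. sg (?A * int (length p) + ny + 1)
         (br g ((ny - 1 + wt fst I, br g I y) # J) (?i (snd a p) x) q)))"
    unfolding br.simps(2)[of g a as]
  proof (subst sps_add[symmetric], rule sps_cong)
    fix p q
    let ?v = "snd a p"
    have "br g as (?i ?v (comp x y)) q =
       br g as (comp x (?i ?v y)) q + sg (ny + 1) (br g as (comp (?i ?v x) y) q)"
      by (simp only: comp_Cons[OF x y] br_add br_sg)
    also have "br g as (comp x (?i ?v y)) q =
        sps fst as (\<lambda>I J. br g ((ny - 2 + wt fst I, br g I (?i ?v y)) # J) x q)"
      using Cons.hyps[OF x coch_contract[OF y] as] by simp
    also have "br g as (comp (?i ?v x) y) q =
        sps fst as (\<lambda>I J. br g ((ny - 1 + wt fst I, br g I y) # J) (?i ?v x) q)"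
      by (rule Cons.hyps[OF coch_contract[OF x] y as])
    finally show "sg (?A * int (length p)) (br g as (?i ?v (comp x y)) q) =
       sps fst as (\<lambda>I J. sg (?A * int (length p))
         (br g ((ny - 2 + wt fst I, br g I (?i ?v y)) # J) x q)) +
       sps fst as (\<lambda>I J. sg (?A * int (length p) + ny + 1)
         (br g ((ny - 1 + wt fst I, br g I y) # J) (?i ?v x) q))"
      by (simp only: sps_sg sg_add sg_sg add.assoc)
  qed
  \<comment> \<open>The head map went into \<open>y\<close>: by coassociativity its arguments and
    those of the compound map merge into one argument list.\<close>
  have 1: "sps (\<lambda>_. 1) us (\<lambda>p q. sg (?A * int (length p))
         (br g ((ny - 2 + wt fst I, br g I (?i (snd a p) y)) # J) x q)) =
       br g ((ny - 1 + (fst a + wt fst I), br g (a # I) y) # J) x us"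
    if IJ: "wt fst I + wt fst J = ?A" for I J
  proof -
    have "br g ((ny - 1 + (fst a + wt fst I), br g (a # I) y) # J) x us =
      sps (\<lambda>_. 1) us (\<lambda>t q. sps (\<lambda>_. 1) t (\<lambda>p r. sg (wt fst J * int (length t) + wt fst I * int (length p))
         (br g J (\<lambda>l. x (br g I (?i (snd a p) y) r # l)) q)))"
      by (simp add: sps_hom[OF additive_br_head[OF x]] additive_sg[OF additive_br_head[OF x]]
          sps_sg[symmetric] sg_sg)
    also have "\<dots> = sps (\<lambda>_. 1) us (\<lambda>t q. sps (\<lambda>_. 1) t (\<lambda>p r. sg (wt fst J * (int (length p) + int (length r)) + wt fst I * int (length p))
         (br g J (\<lambda>l. x (br g I (?i (snd a p) y) r # l)) q)))"
      by (rule sps_cong, rule sps_cong) (simp flip: of_nat_add)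
    also have "\<dots> = sps (\<lambda>_. 1) us (\<lambda>p q. sps (\<lambda>_. 1) q (\<lambda>r s. sg (wt fst J * (int (length p) + int (length r)) + wt fst I * int (length p))
         (br g J (\<lambda>l. x (br g I (?i (snd a p) y) r # l)) s)))"
      by (rule sps_assoc)
    finally show ?thesis
      by (simp add: sps_sg[symmetric] sg_sg IJ[symmetric] algebra_simps)
  qed
  \<comment> \<open>The head map stands beside the compound map. The two trade places, which costs
    the exchange of their argument lists and one skew swap of slots of \<open>x\<close>; at matching
    lengths this leaves the sign with which \<open>sps\<close> puts \<open>a\<close> into the second
    part.\<close>
  have 2: "sps (\<lambda>_. 1) us (\<lambda>p q. sg (?A * int (length p) + ny + 1)
         (br g ((ny - 1 + wt fst I, br g I y) # J) (?i (snd a p) x) q)) =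
       sg (fst a * wt fst I) (br g ((ny - 1 + wt fst I, br g I y) # a # J) x us)"
    if IJ: "wt fst I + wt fst J = ?A" and I: "set I \<subseteq> set as" for I J
  proof -
    have "sps (\<lambda>_. 1) us (\<lambda>p q. sg (?A * int (length p) + ny + 1)
         (br g ((ny - 1 + wt fst I, br g I y) # J) (?i (snd a p) x) q)) =
       sps (\<lambda>_. 1) us (\<lambda>p q. sps (\<lambda>_. 1) q (\<lambda>r s. sg (?A * int (length p) + ny + 1 + wt fst J * int (length r))
         (br g J (\<lambda>l. x (snd a p # br g I y r # l)) s)))"
      by (simp add: sps_sg[symmetric] sg_sg)
    also have "\<dots> = sps (\<lambda>_. 1) us (\<lambda>r q. sps (\<lambda>_. 1) q (\<lambda>p s. sg (int (length p) * int (length r))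
        (sg (?A * int (length p) + ny + 1 + wt fst J * int (length r))
         (br g J (\<lambda>l. x (snd a p # br g I y r # l)) s))))"
      by (subst sps_exch) simp
    also have "\<dots> = sps (\<lambda>_. 1) us (\<lambda>r q. sps (\<lambda>_. 1) q (\<lambda>p s.
        sg (fst a * wt fst I + (fst a + wt fst J) * int (length r) + wt fst J * int (length p))
         (br g J (\<lambda>l. x (br g I y r # snd a p # l)) s)))"
    proof (rule sps_cong, rule sps_cong)
      fix r q p s
      let ?C = "br g J (\<lambda>l. x (snd a p # br g I y r # l)) s"
      have sw: "br g J (\<lambda>l. x (br g I y r # snd a p # l)) s = sg 1 ?C"
        by (subst coch_swap1[OF x]) (simp add: br_uminus sg_def)
      show "sg (int (length p) * int (length r))
        (sg (?A * int (length p) + ny + 1 + wt fst J * int (length r)) ?C) =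
        sg (fst a * wt fst I + (fst a + wt fst J) * int (length r) + wt fst J * int (length p))
         (br g J (\<lambda>l. x (br g I y r # snd a p # l)) s)"
      proof (cases "int (length p) = fst a + 1 \<and> int (length r) = ny + wt fst I")
        case True
        then show ?thesis
          unfolding sw sg_sg IJ[symmetric] by (intro sg_parity) auto
      next
        case False
        then have "snd a p = 0 \<or> br g I y r = 0"
          using coch_len[OF a] br_len[OF y] I as by blast
        then have "?C = 0"
          using coch_zero1[OF x] coch_zero_slot[OF x, of "[_]"] by auto
        then show ?thesis unfolding sw by simp
      qed
    qed
    also have "\<dots> = sg (fst a * wt fst I) (br g ((ny - 1 + wt fst I, br g I y) # a # J) x us)"
      by (simp add: sps_sg[symmetric] sg_sg add.assoc)
    finally show ?thesis .
  qed
  have "br g (a # as) (comp x y) us =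
    sps fst as (\<lambda>I J. br g ((ny - 1 + (fst a + wt fst I), br g (a # I) y) # J) x us) +
    sps fst as (\<lambda>I J. sg (fst a * wt fst I) (br g ((ny - 1 + wt fst I, br g I y) # a # J) x us))"
    unfolding L sps_fubini[of "\<lambda>_. 1" us fst as]
    by (intro arg_cong2[where f = plus] sps_cong 1 2) auto
  then show ?case by simp
qed

text \<open>The shift of degrees makes insertions graded symmetric: argument lists of lengths
  \<open>fst a + 1\<close> and \<open>fst b + 1\<close> and two skew slots of \<open>x\<close> are
  exchanged, and together with the prefactors only \<open>fst a * fst b\<close> survives modulo
  2.\<close>

lemma br_swap_head:
  assumes x: "coch s t nx x" and a: "coch r s (fst a + 1) (snd a)" and b: "coch r s (fst b + 1) (snd b)"
  shows "br g (a # b # as) x us = sg (fst a * fst b) (br g (b # a # as) x us)"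
proof -
  let ?A = "wt fst as"
  have "br g (a # b # as) x us = sps (\<lambda>_. 1) us (\<lambda>p q. sps (\<lambda>_. 1) q (\<lambda>r s.
      sg ((fst b + ?A) * int (length p) + ?A * int (length r)) (br g as (\<lambda>l. x (snd a p # snd b r # l)) s)))"
    by (simp add: sps_sg[symmetric] sg_sg)
  also have "\<dots> = sps (\<lambda>_. 1) us (\<lambda>r q. sps (\<lambda>_. 1) q (\<lambda>p s. sg (int (length p) * int (length r))
      (sg ((fst b + ?A) * int (length p) + ?A * int (length r)) (br g as (\<lambda>l. x (snd a p # snd b r # l)) s))))"
    by (subst sps_exch) simp
  also have "\<dots> = sps (\<lambda>_. 1) us (\<lambda>r q. sps (\<lambda>_. 1) q (\<lambda>p s.
      sg (fst a * fst b + (fst a + ?A) * int (length r) + ?A * int (length p)) (br g as (\<lambda>l. x (snd b r # snd a p # l)) s)))"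
  proof (rule sps_cong, rule sps_cong)
    fix r q p s
    let ?C = "br g as (\<lambda>l. x (snd a p # snd b r # l)) s"
    have sw: "br g as (\<lambda>l. x (snd b r # snd a p # l)) s = sg 1 ?C"
      by (subst coch_swap1[OF x]) (simp add: br_uminus sg_def)
    show "sg (int (length p) * int (length r))
        (sg ((fst b + ?A) * int (length p) + ?A * int (length r)) ?C) =
      sg (fst a * fst b + (fst a + ?A) * int (length r) + ?A * int (length p))
        (br g as (\<lambda>l. x (snd b r # snd a p # l)) s)"
    proof (cases "int (length p) = fst a + 1 \<and> int (length r) = fst b + 1")
      case True
      then show ?thesis
        unfolding sw sg_sg by (intro sg_parity) auto
    next
      case False
      then have "snd a p = 0 \<or> snd b r = 0"
        using coch_len[OF a] coch_len[OF b] by blast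
      then have "?C = 0"
        using coch_zero1[OF x] coch_zero_slot[OF x, of "[_]"] by auto
      then show ?thesis unfolding sw by simp
    qed
  qed
  also have "\<dots> = sg (fst a * fst b) (br g (b # a # as) x us)"
    by (simp add: sps_sg[symmetric] sg_sg add.assoc)
  finally show ?thesis .
qed

lemma br_swap:
  assumes "coch s t nx x" and a: "coch r s (fst a + 1) (snd a)" and b: "coch r s (fst b + 1) (snd b)"
  shows "br g (ps @ a # b # as) x us = sg (fst a * fst b) (br g (ps @ b # a # as) x us)"
  using assms(1)
proof (induct ps arbitrary: x nx us)
  case Nil
  show ?case using br_swap_head[OF Nil a b] by simp
next
  case (Cons c ps)
  have "br g (ps @ a # b # as) (\<lambda>l. x (v # l)) us = sg (fst a * fst b) (br g (ps @ b # a # as) (\<lambda>l. x (v # l)) us)" for v us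
    by (rule Cons.hyps[OF coch_contract[OF Cons.prems]])
  then show ?case by (simp add: sps_sg[symmetric] sg_sg algebra_simps)
qed

text \<open>\<open>br_comp\<close> with a single insertion. The associator is the simultaneous
  insertion of \<open>y\<close> and \<open>z\<close>, which is graded symmetric by
  \<open>br_swap_head\<close>; this is the pre-Lie identity.\<close>

lemma comp_comp:
  assumes "coch s t nx x" "coch s s ny y" "coch s s nz z"
  shows "comp (comp x y) z us = comp x (comp y z) us + br id [(ny - 1, y), (nz - 1, z)] x us"
proof -
  have br1: "br id [(k, f)] h = comp h f" for k :: int and f :: "'d::ab_group_add list \<Rightarrow> 'd" and h :: "'d list \<Rightarrow> 'e::ab_group_add"
    by (rule ext) (simp add: comp_def)
  have "comp (comp x y) z us = br id [(nz - 1, z)] (comp x y) us"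
    by (simp only: br1)
  also have "\<dots> = br id [(ny - 1 + (nz - 1), br id [(nz - 1, z)] y)] x us +
      br id [(ny - 1, br id [] y), (nz - 1, z)] x us"
    by (subst br_comp[OF assms(1,2), of _ s]) (use assms(3) in simp_all)
  also have "br id [(nz - 1, z)] y = comp y z"
    by (rule ext) (simp add: comp_def)
  also have "br id [] y = y" by (rule ext) simp
  finally show ?thesis by (simp only: br1)
qed


lemma sps_slot_add:
  assumes "\<And>P R Q. h (P @ (v + w) # R) Q = h (P @ v # R) Q + h (P @ w # R) Q"
    and "\<And>P R Q. h P (R @ (v + w) # Q) = h P (R @ v # Q) + h P (R @ w # Q)"
  shows "sps (\<lambda>_. 1) (p @ (v + w) # q) h = sps (\<lambda>_. 1) (p @ v # q) h + sps (\<lambda>_. 1) (p @ w # q) h"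
  unfolding sps_append
  apply (subst sps_add[symmetric])
  apply (rule sps_cong)
  apply (simp add: assms sps_add sg_add)
  done

lemma sps_slot_scale:
  assumes "additive t"
    and "\<And>P R Q. h (P @ u # R) Q = t (h (P @ v # R) Q)"
    and "\<And>P R Q. h P (R @ u # Q) = t (h P (R @ v # Q))"
  shows "sps (\<lambda>_. 1) (p @ u # q) h = t (sps (\<lambda>_. 1) (p @ v # q) h)"
  unfolding sps_append
  by (simp add: assms sps_hom[OF assms(1)] additive_sg[OF assms(1)] additive.add[OF assms(1)])

text \<open>Where \<open>v\<close> and \<open>w\<close> fall into the same part, the hypotheses
  supply the sign; where they fall into different parts, the exchange permutes two terms of the
  recursion and \<open>sps\<close> itself supplies it.\<close>

lemma sps_swap:
  assumes 1: "\<And>P R Q. h (P @ v # w # R) Q = sg (par v * par w) (h (P @ w # v # R) Q)"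
    and 2: "\<And>P R Q. h P (R @ v # w # Q) = sg (par v * par w) (h P (R @ w # v # Q))"
  shows "sps par (p @ v # w # q) h = sg (par v * par w) (sps par (p @ w # v # q) h)"
proof -
  have *: "sps par (v # w # q) F = sg (par v * par w) (sps par (w # v # q) F)"
    if F: "\<And>R Q. F (v # w # R) Q = sg (par v * par w) (F (w # v # R) Q)"
      "\<And>P Q. F P (v # w # Q) = sg (par v * par w) (F P (w # v # Q))"
    for F :: "'a list \<Rightarrow> 'a list \<Rightarrow> 'b" and q
  proof -
    have e: "sps par q (\<lambda>P Q. sg (par v * (par w + wt par P)) (F (w # P) (v # Q))) =
      sps par q (\<lambda>P Q. sg (par v * par w + par v * wt par P) (F (w # P) (v # Q)))"
      "sps par q (\<lambda>P Q. sg (par v * par w + (par w * (par v + wt par P))) (F (v # P) (w # Q))) =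
       sps par q (\<lambda>P Q. sg (par w * wt par P) (F (v # P) (w # Q)))"
      "sps par q (\<lambda>P Q. sg (par v * wt par P + (par w * wt par P + par v * par w)) (F P (w # v # Q))) =
       sps par q (\<lambda>P Q. sg (par v * par w + (par w * wt par P + par v * wt par P)) (F P (w # v # Q)))"
      by (rule sps_cong; rule sg_parity; simp; blast)+
    show ?thesis
      by (simp add: F sg_add sps_sg[symmetric] sg_sg e algebra_simps)
        (simp add: sg_def)
  qed
  show ?thesis
    unfolding sps_append
    apply (subst sps_sg[symmetric])
    apply (rule sps_cong)
    apply (rule *)
     apply (simp add: 1 sg_sg, rule sg_parity, auto)[1]
    apply (simp add: 2 sg_sg add.commute)
    done
qed

lemma coch_br:
  assumes "coch s t n x" and "\<forall>a\<in>set as. coch r s (fst a + 1) (snd a)"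
    and t: "\<And>c. additive (t c)" and g: "additive g" "\<And>c v. g (r c v) = s c (g v)"
  shows "coch r t (n + wt fst as) (br g as x)"
proof -
  have "br g as x (p @ (v + w) # q) = br g as x (p @ v # q) + br g as x (p @ w # q) \<and>
     br g as x (p @ r c v # q) = t c (br g as x (p @ v # q)) \<and>
     br g as x (p @ v # w # q) = - br g as x (p @ w # v # q)" for p v w q c
    using assms(1,2)
  proof (induct as arbitrary: x n p v w q c)
    case Nil
    then show ?case
      by (simp add: additive.add[OF g(1)] g(2) coch_add coch_scale) (rule coch_swap)
  next
    case (Cons a as)
    let ?h = "\<lambda>p q. sg (wt fst as * int (length p)) (br g as (\<lambda>l. x (snd a p # l)) q)"
    have a: "coch r s (fst a + 1) (snd a)" and as: "\<forall>a\<in>set as. coch r s (fst a + 1) (snd a)"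
      using Cons.prems(2) by auto
    note IH = Cons.hyps[OF coch_contract[OF Cons.prems(1)] as, THEN conjunct1]
      Cons.hyps[OF coch_contract[OF Cons.prems(1)] as, THEN conjunct2, THEN conjunct1]
      Cons.hyps[OF coch_contract[OF Cons.prems(1)] as, THEN conjunct2, THEN conjunct2]
    note hd = additive.add[OF additive_br_head[OF Cons.prems(1)]]
      additive.minus[OF additive_br_head[OF Cons.prems(1)]]
    have sc: "br g as (\<lambda>l. x (s c v # l)) q = t c (br g as (\<lambda>l. x (v # l)) q)" for c v q
    proof -
      have *: "br g as (\<lambda>l. t c (z l)) q = t c (br g as z q)" for z :: "'b list \<Rightarrow> 'c"
        by (induct as arbitrary: z q)
          (simp_all add: sps_hom[OF t] additive_sg[OF t])
      show ?thesis unfolding *[symmetric] by (simp add: coch_scale1[OF Cons.prems(1)])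
    qed
    have "sps (\<lambda>_. 1) (p @ (v + w) # q) ?h = sps (\<lambda>_. 1) (p @ v # q) ?h + sps (\<lambda>_. 1) (p @ w # q) ?h"
      by (rule sps_slot_add) (simp_all add: coch_add[OF a] hd IH(1) sg_add)
    moreover have "sps (\<lambda>_. 1) (p @ r c v # q) ?h = t c (sps (\<lambda>_. 1) (p @ v # q) ?h)"
      by (rule sps_slot_scale[OF t]) (simp_all add: coch_scale[OF a] sc IH(2) additive_sg[OF t])
    moreover have "sps (\<lambda>_. 1) (p @ v # w # q) ?h = sg (1 * 1) (sps (\<lambda>_. 1) (p @ w # v # q) ?h)"
    proof (rule sps_swap)
      fix P R Q
      show "?h (P @ v # w # R) Q = sg (1 * 1) (?h (P @ w # v # R) Q)"
        unfolding coch_swap[OF a, of P v w R] by (simp add: hd sg_def)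
      show "?h P (R @ v # w # Q) = sg (1 * 1) (?h P (R @ w # v # Q))"
        unfolding IH(3)[of _ R v w Q] by (simp add: sg_def)
    qed
    ultimately show ?case by (simp add: sg_def)
  qed
  moreover have "int (length us) = n + wt fst as" if "br g as x us \<noteq> 0" for us
    using br_len[OF assms(1,2), of us] that by blast
  ultimately show ?thesis unfolding coch_def by blast
qed

text \<open>Makes the lemmas about insertions available for \<open>comp\<close>; with a single map
  in the list the prefactor is trivial, whatever degree \<open>k\<close> is attached to it.\<close>

lemma comp_eq_br: "comp x y = br id [(k, y)] x"
  by (rule ext) (simp add: comp_def)

lemma coch_comp:
  assumes "coch s t n x" and "coch s s m y" and t: "\<And>c. additive (t c)"
  shows "coch s t (n + m - 1) (comp x y)"
  unfolding comp_eq_br[of x y "m - 1"]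
  using coch_br[OF assms(1) _ t, of "[(m - 1, y)]" s id] assms(2)
  by (simp add: additive_def algebra_simps)

section \<open>Choosing one or two entries of a list\<close>

definition single :: "'z list \<Rightarrow> ('z \<Rightarrow> 'b::ab_group_add) \<Rightarrow> 'b" where
  "single p h = (case p of [z] \<Rightarrow> h z | _ \<Rightarrow> 0)"

lemma single_simps [simp]:
  "single [] h = 0" "single [z] h = h z" "single (z # z' # p) h = 0"
  by (simp_all add: single_def)

lemma single_Cons: "single (z # p) h = (if p = [] then h z else 0)"
  by (cases p) simp_all

lemma single_hom: "additive f \<Longrightarrow> f (single p h) = single p (\<lambda>z. f (h z))"
  by (cases p rule: remdups_adj.cases) (simp_all add: additive_zero)

lemma single_sg: "sg n (single p h) = single p (\<lambda>z. sg n (h z))"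
  by (rule single_hom[OF additive_sgI])

lemma single_add: "single p (\<lambda>z. f z + h z) = single p f + single p h"
  by (cases p rule: remdups_adj.cases) simp_all

lemma single_uminus: "single p (\<lambda>z. - f z) = - single p f"
  by (cases p rule: remdups_adj.cases) simp_all

lemma single_0 [simp]: "single p (\<lambda>z. 0) = 0"
  by (cases p rule: remdups_adj.cases) simp_all

lemma single_cong: "(\<And>z. p = [z] \<Longrightarrow> f z = h z) \<Longrightarrow> single p f = single p h"
  by (cases p rule: remdups_adj.cases) simp_all

lemma single_sps: "sps par xs (\<lambda>p q. single P (F p q)) = single P (\<lambda>c. sps par xs (\<lambda>p q. F p q c))"
  by (cases P rule: remdups_adj.cases) simp_all

lemma sps_single_Cons:
  "sps par xs (\<lambda>p q. single (x # p) (h p q)) = h [] xs x"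
  unfolding single_Cons by (subst sps_fst_Nil[of par xs "\<lambda>q. h [] q x", symmetric]) (rule sps_cong, simp)

text \<open>The value of \<open>y\<close> replaces one argument of the insertion, and that argument
  belongs either to an inserted map or to a copy of \<open>g\<close>. In the first case the affected
  map is brought to the head by symmetry; in the second, \<open>g\<close> after \<open>y\<close>
  becomes one more inserted map.\<close>

lemma comp_br:
  assumes "coch s t nx x" and y: "coch r r ny y" and "\<forall>a\<in>set as. coch r s (fst a + 1) (snd a)"
    and g: "additive g" "\<And>c v. g (r c v) = s c (g v)"
    and s: "\<And>c. additive (s c)" and t: "\<And>c. additive (t c)"
  shows "comp (br g as x) y us =
    sps fst as (\<lambda>p q. single p (\<lambda>a. sg ((ny - 1) * wt fst q)
      (br g ((fst a + (ny - 1), comp (snd a) y) # q) x us))) +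
    sg ((ny - 1) * wt fst as) (br g ((ny - 1, \<lambda>l. g (y l)) # as) x us)"
  using assms(1,3)
proof (induct as arbitrary: x nx us)
  case Nil
  show ?case by (simp add: comp_def)
next
  case (Cons a as)
  note x = Cons.prems(1)
  have a: "coch r s (fst a + 1) (snd a)" and as: "\<forall>a\<in>set as. coch r s (fst a + 1) (snd a)"
    using Cons.prems(2) by auto
  have gy: "coch r s ny (\<lambda>l. g (y l))"
    unfolding coch_def
    by (auto simp: coch_add[OF y] coch_scale[OF y] additive.add[OF g(1)] g(2)
        additive.minus[OF g(1), symmetric] intro!: arg_cong[where f = g] coch_swap[OF y])
      (metis additive_zero coch_len g(1) y)
  let ?A = "wt fst as"
  let ?m = "ny - 1"
  let ?i = "\<lambda>r l. x (snd a r # l)"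
  let ?rhs = "\<lambda>x us P Q. single P (\<lambda>c. sg (?m * wt fst Q) (br g ((fst c + ?m, comp (snd c) y) # Q) x us))"
  \<comment> \<open>The value \<open>y p\<close> goes to the head map \<open>a\<close> in the first
    sum and past it in the second, where the induction hypothesis applies.\<close>
  have "comp (br g (a # as) x) y us =
     sps (\<lambda>_. 1) us (\<lambda>p q. sps (\<lambda>_. 1) q (\<lambda>R S. sg (?A * (1 + int (length R))) (br g as (?i (y p # R)) S))) +
     sps (\<lambda>_. 1) us (\<lambda>p q. sps (\<lambda>_. 1) q (\<lambda>R S. sg (int (length R) + ?A * int (length R)) (br g as (?i R) (y p # S))))"
    by (simp add: comp_def sps_add sg_sg algebra_simps)
  also have "sps (\<lambda>_. 1) us (\<lambda>p q. sps (\<lambda>_. 1) q (\<lambda>R S. sg (?A * (1 + int (length R))) (br g as (?i (y p # R)) S)))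
    = sps (\<lambda>_. 1) us (\<lambda>p q. sps (\<lambda>_. 1) q (\<lambda>R S. sg (?m * ?A + ?A * (int (length p) + int (length R))) (br g as (?i (y p # R)) S)))"
  proof (rule sps_cong, rule sps_cong)
    fix p q R S
    show "sg (?A * (1 + int (length R))) (br g as (?i (y p # R)) S) =
       sg (?m * ?A + ?A * (int (length p) + int (length R))) (br g as (?i (y p # R)) S)"
    proof (cases "int (length p) = ny")
      case True
      then show ?thesis by (intro sg_parity) auto
    next
      case False
      then have "y p = 0" using coch_len[OF y] by blast
      then show ?thesis by (simp add: coch_zero1[OF a] coch_zero1[OF x])
    qed
  qed
  also have "\<dots> = sps (\<lambda>_. 1) us (\<lambda>t S. sps (\<lambda>_. 1) t (\<lambda>p R. sg (?m * ?A + ?A * (int (length p) + int (length R))) (br g as (?i (y p # R)) S)))"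
    by (simp only: sps_assoc)
  also have "\<dots> = sps (\<lambda>_. 1) us (\<lambda>t S. sg (?m * ?A + ?A * int (length t)) (sps (\<lambda>_. 1) t (\<lambda>p R. br g as (?i (y p # R)) S)))"
    by (rule sps_cong, subst sps_sg[symmetric], rule sps_cong) (simp flip: of_nat_add)
  also have "\<dots> = sg (?m * ?A) (br g ((fst a + ?m, comp (snd a) y) # as) x us)"
    unfolding br.simps(2) snd_conv comp_def sps_hom[OF additive_br_head[OF x]]
    by (subst sps_sg[symmetric]) (simp only: sg_sg)
  also have "sps (\<lambda>_. 1) us (\<lambda>p q. sps (\<lambda>_. 1) q (\<lambda>R S. sg (int (length R) + ?A * int (length R)) (br g as (?i R) (y p # S))))
     = sps (\<lambda>_. 1) us (\<lambda>R q. sps (\<lambda>_. 1) q (\<lambda>p S. sg (?m * int (length R) + ?A * int (length R)) (br g as (?i R) (y p # S))))"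
  proof (subst sps_exch, rule sps_cong, rule sps_cong)
    fix R q p S
    show "sg (wt (\<lambda>_. 1) p * wt (\<lambda>_. 1) R) (sg (int (length R) + ?A * int (length R)) (br g as (?i R) (y p # S))) =
      sg (?m * int (length R) + ?A * int (length R)) (br g as (?i R) (y p # S))"
    proof (cases "int (length p) = ny")
      case True
      then show ?thesis unfolding sg_sg by (intro sg_parity) auto
    next
      case False
      then have "y p = 0" using coch_len[OF y] by blast
      moreover have "br g as (?i R) (0 # S) = 0"
        using coch_zero1[OF coch_br[OF coch_contract[OF x] as t g(1)], OF g(2)] .
      ultimately show ?thesis by simp
    qed
  qed
  also have "\<dots> = sps (\<lambda>_. 1) us (\<lambda>R q. sg (?m * int (length R) + ?A * int (length R)) (comp (br g as (?i R)) y q))"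
    by (simp only: comp_def sps_sg)
  also have "\<dots> = sps (\<lambda>_. 1) us (\<lambda>R q. sps fst as (\<lambda>P Q. sg (?m * int (length R) + ?A * int (length R)) (?rhs (?i R) q P Q)))
     + sps (\<lambda>_. 1) us (\<lambda>R q. sg (?m * int (length R) + ?A * int (length R) + ?m * ?A) (br g ((?m, \<lambda>l. g (y l)) # as) (?i R) q))"
    by (simp only: Cons.hyps[OF coch_contract[OF x] as] sps_add[symmetric] sg_add sg_sg sps_sg)
  also have "sps (\<lambda>_. 1) us (\<lambda>R q. sps fst as (\<lambda>P Q. sg (?m * int (length R) + ?A * int (length R)) (?rhs (?i R) q P Q)))
    = sps fst as (\<lambda>P Q. sps (\<lambda>_. 1) us (\<lambda>R q. sg (?m * int (length R) + ?A * int (length R)) (?rhs (?i R) q P Q)))"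
    by (rule sps_fubini)
  also have "\<dots> = sps fst as (\<lambda>P Q. sg (fst a * wt fst P) (?rhs x us P (a # Q)))"
  proof (rule sps_cong)
    fix P Q assume PQ: "wt fst P + wt fst Q = wt fst as" "set P \<union> set Q = set as"
    show "sps (\<lambda>_. 1) us (\<lambda>R q. sg (?m * int (length R) + ?A * int (length R)) (?rhs (?i R) q P Q)) =
       sg (fst a * wt fst P) (?rhs x us P (a # Q))"
      unfolding single_sg single_sps
    proof (rule single_cong)
      fix c assume P: "P = [c]"
      have c: "coch r s (fst c + 1) (snd c)" using PQ as P by auto
      have cy: "coch r s (fst c + ?m + 1) (comp (snd c) y)"
        using coch_comp[OF c y s] by (simp add: algebra_simps)
      let ?b = "br g (a # (fst c + ?m, comp (snd c) y) # Q) x us"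
      have 1: "br g ((fst c + ?m, comp (snd c) y) # a # Q) x us = sg ((fst c + ?m) * fst a) ?b"
        using br_swap_head[OF x, of r "(fst c + ?m, comp (snd c) y)" a] cy a by simp
      have 2: "sg (fst a * wt fst P) (sg (?m * wt fst (a # Q)) (br g ((fst c + ?m, comp (snd c) y) # a # Q) x us)) =
         sg (?m * wt fst Q) ?b"
        unfolding 1 sg_sg P by (intro sg_parity) auto
      show "sps (\<lambda>_. 1) us (\<lambda>R q. sg (?m * int (length R) + ?A * int (length R))
            (sg (?m * wt fst Q) (br g ((fst c + ?m, comp (snd c) y) # Q) (?i R) q))) =
        sg (fst a * wt fst P) (sg (?m * wt fst (a # Q)) (br g ((fst c + ?m, comp (snd c) y) # a # Q) x us))"
        unfolding 2
        unfolding br.simps(2)[of g a "(fst c + ?m, comp (snd c) y) # Q"] sps_sg[symmetric] sg_sg PQ(1)[symmetric] P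
        by (rule sps_cong, rule sg_parity) auto
    qed
  qed
  also have "sps (\<lambda>_. 1) us (\<lambda>R q. sg (?m * int (length R) + ?A * int (length R) + ?m * ?A) (br g ((?m, \<lambda>l. g (y l)) # as) (?i R) q))
    = sg (?m * wt fst (a # as)) (br g ((?m, \<lambda>l. g (y l)) # a # as) x us)"
  proof -
    have "br g ((?m, \<lambda>l. g (y l)) # a # as) x us = sg (?m * fst a) (br g (a # (?m, \<lambda>l. g (y l)) # as) x us)"
      using br_swap_head[OF x, of r "(?m, \<lambda>l. g (y l))" a] gy a by simp
    note sw = this
    show ?thesis
      unfolding sw
      unfolding br.simps(2)[of g a "(?m, \<lambda>l. g (y l)) # as"] sps_sg[symmetric] sg_sg
      by (rule sps_cong, rule sg_parity) auto
  qed
  finally show ?case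
    by (simp add: sps_single_Cons sg_add add.assoc)
qed


lemma sps_snd_Nil: "sps par xs (\<lambda>p q. if q = [] then h p else 0) = h xs"
  by (subst sps_comm, subst sps_fst_Nil[of par xs h, symmetric]) (rule sps_cong, simp)

lemma sps_single_snd_Cons:
  "sps par xs (\<lambda>p q. single (x # q) (h p q)) = h xs [] x"
  unfolding single_Cons by (subst sps_snd_Nil[of par xs "\<lambda>p. h p [] x", symmetric]) (rule sps_cong, simp)

text \<open>Only a list of length 2 splits into two singletons, and it does so in two ways that
  differ by the sign \<open>par b * par c\<close>.\<close>

lemma sps_pair_zero:
  assumes "\<And>b c. b \<in> set R \<Longrightarrow> c \<in> set R \<Longrightarrow> G b c + sg (par b * par c) (G c b) = 0"
  shows "sps par R (\<lambda>p q. single p (\<lambda>b. single q (\<lambda>c. G b c))) = 0"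
proof -
  consider "length R \<noteq> 2" | b c where "R = [b, c]"
    by (metis One_nat_def Suc_1 length_0_conv length_Suc_conv)
  then show ?thesis
  proof cases
    case 1
    have "sps par R (\<lambda>p q. single p (\<lambda>b. single q (\<lambda>c. G b c))) = sps par R (\<lambda>p q. 0)"
      by (rule sps_cong) (use 1 in \<open>auto simp: single_def split: list.splits\<close>)
    then show ?thesis by simp
  next
    case 2
    then show ?thesis using assms by simp
  qed
qed

text \<open>An ordered choice of two entries with the Koszul sign of moving them to the front. The
  terms of the quadratic relations are all brought to this form before they are compared.\<close>

definition pick2 ::
  "('z \<Rightarrow> int) \<Rightarrow> 'z list \<Rightarrow> ('z \<Rightarrow> 'z \<Rightarrow> 'z list \<Rightarrow> 'b::ab_group_add) \<Rightarrow> 'b"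
where
  "pick2 par zs G = sps par zs (\<lambda>p R. sps par R (\<lambda>p' R'. single p (\<lambda>z. single p' (\<lambda>z'. G z z' R'))))"

lemma pick2_cong:
  assumes "\<And>z z' R. z \<in> set zs \<Longrightarrow> z' \<in> set zs \<Longrightarrow> set R \<subseteq> set zs \<Longrightarrow> G z z' R = G' z z' R"
  shows "pick2 par zs G = pick2 par zs G'"
  unfolding pick2_def
  by (rule sps_cong, rule sps_cong, rule single_cong, rule single_cong, rule assms) auto

lemma pick2_add: "pick2 par zs (\<lambda>z z' R. F z z' R + G z z' R) = pick2 par zs F + pick2 par zs G"
  by (simp add: pick2_def single_add sps_add)

lemma pick2_0 [simp]: "pick2 par zs (\<lambda>z z' R. 0) = 0"
  by (simp add: pick2_def)

lemma pick2_add_0: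
  assumes "\<And>z z' R. z \<in> set zs \<Longrightarrow> z' \<in> set zs \<Longrightarrow> set R \<subseteq> set zs \<Longrightarrow> F z z' R + G z z' R = 0"
  shows "pick2 par zs F + pick2 par zs G = 0"
proof -
  have "pick2 par zs (\<lambda>z z' R. F z z' R + G z z' R) = pick2 par zs (\<lambda>z z' R. 0)"
    by (rule pick2_cong) (rule assms)
  then show ?thesis by (simp add: pick2_add)
qed

lemma pick2_fst_pair:
  "sps par zs (\<lambda>I J. sps par I (\<lambda>p p'. single p (\<lambda>z. single p' (\<lambda>z'. G z z' J)))) = pick2 par zs G"
  unfolding pick2_def by (rule sps_assoc)

lemma pick2_fst_last:
  "sps par zs (\<lambda>I J. sps par I (\<lambda>p R. single p (\<lambda>z. single J (\<lambda>z'. G z z' R)))) =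
   pick2 par zs (\<lambda>z z' R. sg (par z' * wt par R) (G z z' R))"
proof -
  have "sps par zs (\<lambda>I J. sps par I (\<lambda>p R. single p (\<lambda>z. single J (\<lambda>z'. G z z' R))))
     = sps par zs (\<lambda>p Q. sps par Q (\<lambda>R J. single p (\<lambda>z. single J (\<lambda>z'. G z z' R))))"
    by (rule sps_assoc)
  also have "\<dots> = sps par zs (\<lambda>p Q. sps par Q (\<lambda>J R. sg (wt par J * wt par R) (single p (\<lambda>z. single J (\<lambda>z'. G z z' R)))))"
    by (rule sps_cong, rule sps_comm)
  also have "\<dots> = pick2 par zs (\<lambda>z z' R. sg (par z' * wt par R) (G z z' R))"
    unfolding pick2_def
    by (rule sps_cong, rule sps_cong, simp only: single_sg) (rule single_cong, rule single_cong, simp)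
  finally show ?thesis .
qed

text \<open>The last argument of \<open>G\<close> is what remains of the second part, the one before it what remains
  of the first part.\<close>

lemma pick2_both:
  "sps par zs (\<lambda>I J. sps par I (\<lambda>p' r'. single p' (\<lambda>z'. sps par J (\<lambda>p r. single p (\<lambda>z. G z z' r' r))))) =
   pick2 par zs (\<lambda>z z' R. sps par R (\<lambda>r' r. sg (par z * (par z' + wt par r')) (G z z' r' r)))"
proof -
  let ?F = "\<lambda>p' r' p r. single p' (\<lambda>z'. single p (\<lambda>z. G z z' r' r))"
  have "sps par zs (\<lambda>I J. sps par I (\<lambda>p' r'. single p' (\<lambda>z'. sps par J (\<lambda>p r. single p (\<lambda>z. G z z' r' r)))))
     = sps par zs (\<lambda>I J. sps par I (\<lambda>p' r'. sps par J (\<lambda>p r. ?F p' r' p r)))"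
    by (simp only: single_sps)
  also have "\<dots> = sps par zs (\<lambda>p' Q. sps par Q (\<lambda>r' J. sps par J (\<lambda>p r. ?F p' r' p r)))"
    by (rule sps_assoc)
  also have "\<dots> = sps par zs (\<lambda>p' Q. sps par Q (\<lambda>p J. sps par J (\<lambda>r' r. sg (wt par r' * wt par p) (?F p' r' p r))))"
    by (rule sps_cong, rule sps_exch)
  also have "\<dots> = sps par zs (\<lambda>p Q. sps par Q (\<lambda>p' J. sg (wt par p' * wt par p) (sps par J (\<lambda>r' r. sg (wt par r' * wt par p) (?F p' r' p r)))))"
    by (rule sps_exch)
  also have "\<dots> = pick2 par zs (\<lambda>z z' R. sps par R (\<lambda>r' r. sg (par z * (par z' + wt par r')) (G z z' r' r)))"
    unfolding pick2_def
    apply (rule sps_cong, rule sps_cong)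
    subgoal for p q p' q'
      by (cases p rule: remdups_adj.cases; cases p' rule: remdups_adj.cases)
        (simp_all add: sps_sg[symmetric] sg_sg algebra_simps)
    done
  finally show ?thesis .
qed

section \<open>Shifted operations with the morphism as background\<close>

text \<open>Only lists of two entries contribute. On them this is the graded commutator of the
  composition product, with the sign \<open>par z\<close> that makes it symmetric for the shifted
  degrees.\<close>

definition bop :: "('z \<Rightarrow> int) \<Rightarrow> ('z \<Rightarrow> 'a list \<Rightarrow> 'a) \<Rightarrow> 'z list \<Rightarrow> 'a::ab_group_add list \<Rightarrow> 'a" where
  "bop par f zs us = sps par zs (\<lambda>p q. single p (\<lambda>z. single q (\<lambda>z'. sg (par z) (comp (f z) (f z') us))))"

lemma comp_hom_left: "comp (\<lambda>l. sps par zs (\<lambda>p q. F p q l)) y us = sps par zs (\<lambda>p q. comp (F p q) y us)"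
  unfolding comp_eq_br[of _ y 0] by (rule br_sps)

lemma comp_sg_left: "comp (\<lambda>l. sg n (x l)) y us = sg n (comp x y us)"
  unfolding comp_eq_br[of _ y 0] by (rule br_sg)

lemma comp_add_left: "comp (\<lambda>l. x l + x' l) y us = comp x y us + comp x' y us"
  unfolding comp_eq_br[of _ y 0] by (rule br_add)

lemma comp_0_left [simp]: "comp (\<lambda>l. 0) y us = 0"
  by (simp add: comp_def)

lemma comp_uminus_left: "comp (\<lambda>l. - x l) y us = - comp x y us"
  by (simp add: comp_def sps_uminus)

lemma comp_single_left: "comp (\<lambda>l. single p (\<lambda>z. F z l)) y us = single p (\<lambda>z. comp (F z) y us)"
  by (cases p rule: remdups_adj.cases) simp_all

lemma comp_hom_right:
  assumes "coch s t n x"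
  shows "comp x (\<lambda>l. sps par zs (\<lambda>p q. F p q l)) us = sps par zs (\<lambda>p q. comp x (F p q) us)"
  unfolding comp_eq_br[of x _ 0] by (rule br_head_sps[OF assms])

lemma comp_sg_right: "coch s t n x \<Longrightarrow> comp x (\<lambda>l. sg m (y l)) us = sg m (comp x y us)"
  unfolding comp_eq_br[of x _ 0] by (rule br_head_sg)

lemma comp_add_right: "coch s t n x \<Longrightarrow> comp x (\<lambda>l. y l + y' l) us = comp x y us + comp x y' us"
  unfolding comp_eq_br[of x _ 0] by (rule br_head_add)

lemma comp_0_right: "coch s t n x \<Longrightarrow> comp x (\<lambda>l. 0) us = 0"
  unfolding comp_eq_br[of x _ 0] by (rule br_head_0)

lemma comp_single_right:
  "coch s t n x \<Longrightarrow> comp x (\<lambda>l. single p (\<lambda>z. F z l)) us = single p (\<lambda>z. comp x (F z) us)"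
  by (cases p rule: remdups_adj.cases) (simp_all add: comp_0_right)

lemma br_head_single:
  "coch s t n x \<Longrightarrow> br g ((k, \<lambda>l. single p (\<lambda>z. F z l)) # as) x us = single p (\<lambda>z. br g ((k, F z) # as) x us)"
  by (cases p rule: remdups_adj.cases) (simp_all add: br_head_zero)

lemma br_single: "br g as (\<lambda>l. single p (\<lambda>z. F z l)) us = single p (\<lambda>z. br g as (F z) us)"
  by (cases p rule: remdups_adj.cases) simp_all

lemma bop_Cons:
  "bop par f (q # J) us = single J (\<lambda>z. sg (par q) (comp (f q) (f z) us) + sg (par q * par z + par z) (comp (f z) (f q) us))"
proof -
  have "bop par f (q # J) us =
     single J (\<lambda>z. sg (par q) (comp (f q) (f z) us)) +
     sps par J (\<lambda>p r. single (q # r) (\<lambda>z'. sg (par q * wt par p) (single p (\<lambda>z. sg (par z) (comp (f z) (f z') us)))))"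
    unfolding bop_def sps.simps
    by (simp only: sps_single_Cons)
      (rule arg_cong2[where f = plus, OF HOL.refl], rule sps_cong,
       auto simp: single_def sg_def split: list.splits)
  also have "sps par J (\<lambda>p r. single (q # r) (\<lambda>z'. sg (par q * wt par p) (single p (\<lambda>z. sg (par z) (comp (f z) (f z') us)))))
     = sg (par q * wt par J) (single J (\<lambda>z. sg (par z) (comp (f z) (f q) us)))"
    by (rule sps_single_snd_Cons)
  also have "\<dots> = single J (\<lambda>z. sg (par q * par z + par z) (comp (f z) (f q) us))"
    unfolding single_sg by (rule single_cong) (simp add: sg_sg)
  finally show ?thesis by (simp only: single_add)
qed

lemma pick2_last:
  "pick2 par zs (\<lambda>z z' R. single R (G z z')) =
   sps par zs (\<lambda>p R. single p (\<lambda>z. sps par R (\<lambda>q r. single q (\<lambda>z'. single r (G z z')))))"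
  unfolding pick2_def by (simp only: single_sps)

lemma pick2_pair_0:
  assumes "\<And>a b c. a \<in> set zs \<Longrightarrow> b \<in> set zs \<Longrightarrow> c \<in> set zs \<Longrightarrow> G a b c + sg (par b * par c) (G a c b) = 0"
  shows "pick2 par zs (\<lambda>z z' R. single R (G z z')) = 0"
proof -
  have "sps par zs (\<lambda>p R. single p (\<lambda>z. sps par R (\<lambda>q r. single q (\<lambda>z'. single r (G z z'))))) = sps par zs (\<lambda>p q. 0)"
    by (rule sps_cong, rule HOL.trans[OF single_cong single_0], rule sps_pair_zero, rule assms) auto
  then show ?thesis by (simp add: pick2_last)
qed

lemma pick2_rotate:
  "pick2 par zs (\<lambda>z z' R. single R (G z z')) =
   pick2 par zs (\<lambda>a b R. single R (\<lambda>c. sg (par a * (par b + par c)) (G b c a)))"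
proof -
  let ?F = "\<lambda>p q r. single p (\<lambda>z. single q (\<lambda>z'. single r (G z z')))"
  have "pick2 par zs (\<lambda>z z' R. single R (G z z')) = sps par zs (\<lambda>p Q. sps par Q (\<lambda>q r. ?F p q r))"
    by (simp add: pick2_def)
  also have "\<dots> = sps par zs (\<lambda>I r. sps par I (\<lambda>p q. ?F p q r))"
    by (rule sps_assoc[symmetric])
  also have "\<dots> = sps par zs (\<lambda>r I. sg (wt par r * wt par I) (sps par I (\<lambda>p q. ?F p q r)))"
    by (rule sps_comm)
  also have "\<dots> = sps par zs (\<lambda>r I. sps par I (\<lambda>p q. sg (wt par r * (wt par p + wt par q)) (?F p q r)))"
    by (rule sps_cong, subst sps_sg[symmetric], rule sps_cong, simp)
  also have "\<dots> = pick2 par zs (\<lambda>a b R. single R (\<lambda>c. sg (par a * (par b + par c)) (G b c a)))"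
    unfolding pick2_def
    apply (rule sps_cong, rule sps_cong)
    subgoal for r I p q
      by (cases r rule: remdups_adj.cases; cases p rule: remdups_adj.cases; cases q rule: remdups_adj.cases) simp_all
    done
  finally show ?thesis .
qed

text \<open>The graded Jacobi identity as a consequence of the pre-Lie identity: once both kinds of
  double composition are written for the same ordered triple, their sum consists of associators, and
  the two orders of the last two entries cancel. \<open>F I\<close> is an entry carrying the output
  on \<open>I\<close>; it stays abstract so that the \<open>U\<close> and the \<open>V\<close>
  component can share the lemma.\<close>

lemma bop_relation:
  assumes f: "\<And>z. z \<in> set zs \<Longrightarrow> coch s s (par z + 2) (f z)" and s: "\<And>c. additive (s c)"
    and F: "\<And>I. par (F I) = wt par I + 1" "\<And>I us. f (F I) us = bop par f I us"
  shows "sps par zs (\<lambda>I J. bop par f (F I # J) us) = 0"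
proof -
  have fF: "f (F I) = (\<lambda>us. sps par I (\<lambda>p q. single p (\<lambda>z. single q (\<lambda>z'. sg (par z) (comp (f z) (f z') us)))))" for I
    by (rule ext) (simp add: F bop_def)
  have 1: "sps par zs (\<lambda>I J. single J (\<lambda>z''. sg (par (F I)) (comp (f (F I)) (f z'') us))) =
    pick2 par zs (\<lambda>a b R. single R (\<lambda>c. sg (1 + par b) (comp (comp (f a) (f b)) (f c) us)))"
  proof -
    have "sps par zs (\<lambda>I J. single J (\<lambda>z''. sg (par (F I)) (comp (f (F I)) (f z'') us))) =
      sps par zs (\<lambda>I J. sps par I (\<lambda>p q. single p (\<lambda>z. single q (\<lambda>z'. single J (\<lambda>z''. sg (1 + par z') (comp (comp (f z) (f z')) (f z'') us))))))"
    proof (rule sps_cong)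
      fix I J
      have "single J (\<lambda>z''. sg (par (F I)) (comp (f (F I)) (f z'') us)) =
        sps par I (\<lambda>p q. single J (\<lambda>z''. single p (\<lambda>z. single q (\<lambda>z'. sg (par (F I) + par z) (comp (comp (f z) (f z')) (f z'') us)))))"
        unfolding single_sps fF
        by (simp only: comp_hom_left comp_single_left comp_sg_left sps_sg[symmetric] single_sg sg_sg)
      also have "\<dots> = sps par I (\<lambda>p q. single p (\<lambda>z. single q (\<lambda>z'. single J (\<lambda>z''. sg (1 + par z') (comp (comp (f z) (f z')) (f z'') us)))))"
      proof (rule sps_cong)
        fix p q assume "wt par p + wt par q = wt par I"
        note this[symmetric]
        then show "single J (\<lambda>z''. single p (\<lambda>z. single q (\<lambda>z'. sg (par (F I) + par z) (comp (comp (f z) (f z')) (f z'') us)))) =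
          single p (\<lambda>z. single q (\<lambda>z'. single J (\<lambda>z''. sg (1 + par z') (comp (comp (f z) (f z')) (f z'') us))))"
          by (cases p rule: remdups_adj.cases; cases q rule: remdups_adj.cases; cases J rule: remdups_adj.cases)
            (auto simp: F intro!: sg_parity)
      qed
      finally show "single J (\<lambda>z''. sg (par (F I)) (comp (f (F I)) (f z'') us)) =
        sps par I (\<lambda>p q. single p (\<lambda>z. single q (\<lambda>z'. single J (\<lambda>z''. sg (1 + par z') (comp (comp (f z) (f z')) (f z'') us)))))" .
    qed
    then show ?thesis by (simp only: pick2_fst_pair)
  qed
  have 2: "sps par zs (\<lambda>I J. single J (\<lambda>z. sg (par (F I) * par z + par z) (comp (f z) (f (F I)) us))) =
    pick2 par zs (\<lambda>a b R. single R (\<lambda>c. sg (par b) (comp (f a) (comp (f b) (f c)) us)))"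
  proof -
    let ?G = "\<lambda>z z' z''. sg ((par z + par z') * par z'' + par z) (comp (f z'') (comp (f z) (f z')) us)"
    have "sps par zs (\<lambda>I J. single J (\<lambda>z. sg (par (F I) * par z + par z) (comp (f z) (f (F I)) us))) =
      sps par zs (\<lambda>I J. sps par I (\<lambda>p q. single p (\<lambda>z. single q (\<lambda>z'. single J (\<lambda>z''. ?G z z' z'')))))"
    proof (rule sps_cong)
      fix I J assume "set I \<union> set J = set zs"
      then have J: "J = [z''] \<Longrightarrow> coch s s (par z'' + 2) (f z'')" for z'' using f by auto
      have "single J (\<lambda>z. sg (par (F I) * par z + par z) (comp (f z) (f (F I)) us)) =
        sps par I (\<lambda>p q. single J (\<lambda>z''. single p (\<lambda>z. single q (\<lambda>z'. sg (par (F I) * par z'' + par z'' + par z) (comp (f z'') (comp (f z) (f z')) us)))))"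
        unfolding single_sps fF
        by (rule single_cong)
          (simp only: comp_hom_right[OF J] comp_single_right[OF J] comp_sg_right[OF J] sps_sg[symmetric] single_sg sg_sg)
      also have "\<dots> = sps par I (\<lambda>p q. single p (\<lambda>z. single q (\<lambda>z'. single J (\<lambda>z''. ?G z z' z''))))"
      proof (rule sps_cong)
        fix p q assume "wt par p + wt par q = wt par I"
        note this[symmetric]
        then show "single J (\<lambda>z''. single p (\<lambda>z. single q (\<lambda>z'. sg (par (F I) * par z'' + par z'' + par z) (comp (f z'') (comp (f z) (f z')) us)))) =
          single p (\<lambda>z. single q (\<lambda>z'. single J (\<lambda>z''. ?G z z' z'')))"
          by (cases p rule: remdups_adj.cases; cases q rule: remdups_adj.cases; cases J rule: remdups_adj.cases)
            (auto simp: F intro!: sg_parity)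
      qed
      finally show "single J (\<lambda>z. sg (par (F I) * par z + par z) (comp (f z) (f (F I)) us)) =
         sps par I (\<lambda>p q. single p (\<lambda>z. single q (\<lambda>z'. single J (\<lambda>z''. ?G z z' z''))))" .
    qed
    also have "\<dots> = pick2 par zs (\<lambda>z z' R. single R (\<lambda>z''. ?G z z' z''))"
      by (rule pick2_fst_pair)
    also have "\<dots> = pick2 par zs (\<lambda>a b R. single R (\<lambda>c. sg (par b) (comp (f a) (comp (f b) (f c)) us)))"
      by (subst pick2_rotate, rule pick2_cong, rule single_cong, unfold sg_sg, rule sg_parity) auto
    finally show ?thesis .
  qed
  have "sps par zs (\<lambda>I J. bop par f (F I # J) us) =
     pick2 par zs (\<lambda>a b R. single R (\<lambda>c. sg (1 + par b) (comp (comp (f a) (f b)) (f c) us) +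
        sg (par b) (comp (f a) (comp (f b) (f c)) us)))"
    unfolding bop_Cons single_add sps_add 1 2 pick2_add ..
  also have "\<dots> = 0"
  proof (rule pick2_pair_0)
    fix a b c assume m: "a \<in> set zs" "b \<in> set zs" "c \<in> set zs"
    let ?br = "\<lambda>b c. br id [(par b + 1, f b), (par c + 1, f c)] (f a) us"
    have e: "comp (comp (f a) (f b)) (f c) us = comp (f a) (comp (f b) (f c)) us + ?br b c"
      if "b \<in> set zs" "c \<in> set zs" for b c
      using comp_comp[OF f f f, OF m(1) that] by (simp add: algebra_simps)
    \<comment> \<open>In the pre-Lie identity a cochain counts with its arity minus one, that is
      with \<open>par + 1\<close>.\<close>
    have sw: "?br c b = sg ((par b + 1) * (par c + 1)) (?br b c)"
      using br_swap_head[OF f[OF m(1)], of s "(par c + 1, f c)" "(par b + 1, f b)" id "[]" us]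
        f[OF m(2)] f[OF m(3)] by (simp add: algebra_simps)
    show "sg (1 + par b) (comp (comp (f a) (f b)) (f c) us) + sg (par b) (comp (f a) (comp (f b) (f c)) us) +
      sg (par b * par c) (sg (1 + par c) (comp (comp (f a) (f c)) (f b) us) + sg (par c) (comp (f a) (comp (f c) (f b)) us)) = 0"
      unfolding e[OF m(2,3)] e[OF m(3,2)] sw
      by (auto simp: sg_def)
  qed
  finally show ?thesis .
qed

text \<open>An input is a cochain \<open>(x\<^sub>U, x\<^sub>V, x\<^sub>g)\<close> preceded by its shifted degree \<open>d\<close>; its components have the
  arities \<open>d + 2\<close>, \<open>d + 2\<close> and \<open>d + 1\<close>.\<close>

type_synonym ('u, 'v) inp = "int \<times> ('u list \<Rightarrow> 'u) \<times> ('v list \<Rightarrow> 'v) \<times> ('u list \<Rightarrow> 'v)"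

abbreviation zU :: "('u, 'v) inp \<Rightarrow> 'u list \<Rightarrow> 'u" where "zU z \<equiv> fst (snd z)"
abbreviation zV :: "('u, 'v) inp \<Rightarrow> 'v list \<Rightarrow> 'v" where "zV z \<equiv> fst (snd (snd z))"
abbreviation zg :: "('u, 'v) inp \<Rightarrow> 'u list \<Rightarrow> 'v" where "zg z \<equiv> snd (snd (snd z))"

abbreviation ga :: "('u, 'v) inp list \<Rightarrow> (int \<times> ('u list \<Rightarrow> 'v)) list" where
  "ga q \<equiv> map (\<lambda>z. (fst z, zg z)) q"

lemma wt_ga [simp]: "wt fst (ga q) = wt fst q" by (induct q) auto

locale lin_hom =
  fixes sU :: "'k \<Rightarrow> 'u::ab_group_add \<Rightarrow> 'u" and sV :: "'k \<Rightarrow> 'v::ab_group_add \<Rightarrow> 'v" and g :: "'u \<Rightarrow> 'v"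
  assumes sU: "additive (sU c)" and sV: "additive (sV c)" and g: "additive g" and g_scale: "g (sU c u) = sV c (g u)"
begin

definition valid :: "('u, 'v) inp \<Rightarrow> bool" where
  "valid z \<longleftrightarrow> coch sU sU (fst z + 2) (zU z) \<and> coch sV sV (fst z + 2) (zV z) \<and> coch sU sV (fst z + 1) (zg z)"

text \<open>Polarization of the morphism defect \<open>f \<mu> - \<nu> (f, ..., f)\<close> at
  \<open>f = g\<close>: the entry \<open>z\<close> supplies \<open>\<mu>\<close> or
  \<open>\<nu>\<close>, and the entries of \<open>q\<close> supply variations of
  \<open>f\<close>.\<close>

definition H :: "('u, 'v) inp \<Rightarrow> ('u, 'v) inp list \<Rightarrow> 'u list \<Rightarrow> 'v" where
  "H z q us = - br g (ga q) (zV z) us + single q (\<lambda>z'. sg ((fst z + 1) * fst z') (comp (zg z') (zU z) us)) +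
     (if q = [] then g (zU z us) else 0)"

definition bgop :: "('u, 'v) inp list \<Rightarrow> 'u list \<Rightarrow> 'v" where
  "bgop zs us = sps fst zs (\<lambda>p q. single p (\<lambda>z. H z q us))"

definition bz :: "('u, 'v) inp list \<Rightarrow> ('u, 'v) inp" where
  "bz zs = (wt fst zs + 1, bop fst zU zs, bop fst zV zs, bgop zs)"

lemma bz_sel [simp]:
  "fst (bz zs) = wt fst zs + 1" "zU (bz zs) = bop fst zU zs" "zV (bz zs) = bop fst zV zs" "zg (bz zs) = bgop zs"
  by (simp_all add: bz_def)

lemma H_Cons: "H z (q # r) us = - br g (ga (q # r)) (zV z) us +
    (if r = [] then sg ((fst z + 1) * fst q) (comp (zg q) (zU z) us) else 0)"
  by (simp add: H_def single_Cons)

lemma bgop_Cons: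
  "bgop (q # J) us = H q J us + sps fst J (\<lambda>p r. single p (\<lambda>z. sg (fst q * fst z) (H z (q # r) us)))"
proof -
  have "bgop (q # J) us = H q J us + sps fst J (\<lambda>p r. sg (fst q * wt fst p) (single p (\<lambda>z. H z (q # r) us)))"
    unfolding bgop_def sps.simps by (simp only: sps_single_Cons)
  also have "sps fst J (\<lambda>p r. sg (fst q * wt fst p) (single p (\<lambda>z. H z (q # r) us))) =
     sps fst J (\<lambda>p r. single p (\<lambda>z. sg (fst q * fst z) (H z (q # r) us)))"
    unfolding single_sg by (rule sps_cong, rule single_cong) simp
  finally show ?thesis .
qed

text \<open>In the relation the head \<open>q\<close> will be the output of the inner operation. It
  is used through its \<open>V\<close> or \<open>U\<close> component in the first three terms and
  through its third component in the last two.\<close>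

lemma bgop_relation_terms:
  "bgop (q # J) us =
     - br g (ga J) (zV q) us +
     single J (\<lambda>z. sg ((fst q + 1) * fst z) (comp (zg z) (zU q) us)) +
     (if J = [] then g (zU q us) else 0) +
     (- sps fst J (\<lambda>p r. single p (\<lambda>z. sg (fst q * fst z) (br g ((fst q, zg q) # ga r) (zV z) us))) +
      single J (\<lambda>z. sg (fst q) (comp (zg q) (zU z) us)))"
proof -
  have e: "sps fst J (\<lambda>p r. single p (\<lambda>z. sg (fst q * fst z) (H z (q # r) us)))
     = sps fst J (\<lambda>p r. single p (\<lambda>z. - sg (fst q * fst z) (br g ((fst q, zg q) # ga r) (zV z) us))) +
       sps fst J (\<lambda>p r. if r = [] then single p (\<lambda>z. sg (fst q) (comp (zg q) (zU z) us)) else 0)"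
    unfolding sps_add[symmetric]
  proof (rule sps_cong)
    fix p r
    have "sg (fst q * fst z) (sg ((fst z + 1) * fst q) w) = sg (fst q) w" for z :: "('u, 'v) inp" and w :: 'v
      unfolding sg_sg by (rule sg_parity) auto
    then show "single p (\<lambda>z. sg (fst q * fst z) (H z (q # r) us)) =
        single p (\<lambda>z. - sg (fst q * fst z) (br g ((fst q, zg q) # ga r) (zV z) us)) +
        (if r = [] then single p (\<lambda>z. sg (fst q) (comp (zg q) (zU z) us)) else 0)"
      by (cases p rule: remdups_adj.cases) (simp_all only: H_Cons sg_add sg_minus single_simps list.map if_distrib[of "sg _"] sg_zero add_0_left split: if_splits, simp_all)
  qed
  show ?thesis
    unfolding bgop_Cons e sps_snd_Nil single_uminus sps_uminus unfolding H_def ..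
qed

lemma sps_ga: "sps fst (ga zs) f = sps fst zs (\<lambda>p q. f (ga p) (ga q))"
  by (simp add: sps_map)

context
  fixes zs :: "('u, 'v) inp list"
  assumes v: "\<And>z. z \<in> set zs \<Longrightarrow> valid z"
begin

lemma validD:
  assumes "z \<in> set zs"
  shows "coch sU sU (fst z + 2) (zU z)" "coch sV sV (fst z + 2) (zV z)" "coch sU sV (fst z + 1) (zg z)"
  using v[OF assms] by (auto simp: valid_def)

lemma valid_ga: "set R \<subseteq> set zs \<Longrightarrow> \<forall>a\<in>set (ga R). coch sU sV (fst a + 1) (snd a)"
  using validD(3) by auto

text \<open>The inner output is a composition of two \<open>V\<close> components, and
  \<open>br_comp\<close> distributes the inserted maps over the two factors.\<close>

lemma rel_A:
  "sps fst zs (\<lambda>I J. - br g (ga J) (bop fst zV I) us) =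
   pick2 fst zs (\<lambda>z z' R. sps fst R (\<lambda>r' r. - sg (fst z) (br g ((0, br g (ga r') (zV z')) # ga r) (zV z) us)))"
proof -
  have "sps fst zs (\<lambda>I J. - br g (ga J) (bop fst zV I) us) =
    sps fst zs (\<lambda>I J. sps fst I (\<lambda>p q. single p (\<lambda>z. single q (\<lambda>z'. - sg (fst z) (br g (ga J) (comp (zV z) (zV z')) us)))))"
  proof (rule sps_cong)
    fix I J
    have "br g (ga J) (bop fst zV I) us = sps fst I (\<lambda>p q. single p (\<lambda>z. single q (\<lambda>z'. sg (fst z) (br g (ga J) (comp (zV z) (zV z')) us))))"
      unfolding bop_def[abs_def] by (simp only: br_sps br_single br_sg)
    then show "- br g (ga J) (bop fst zV I) us = sps fst I (\<lambda>p q. single p (\<lambda>z. single q (\<lambda>z'. - sg (fst z) (br g (ga J) (comp (zV z) (zV z')) us))))"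
      by (simp only: single_uminus sps_uminus)
  qed
  also have "\<dots> = pick2 fst zs (\<lambda>z z' R. - sg (fst z) (br g (ga R) (comp (zV z) (zV z')) us))"
    by (rule pick2_fst_pair)
  also have "\<dots> = pick2 fst zs (\<lambda>z z' R. sps fst R (\<lambda>r' r. - sg (fst z) (br g ((0, br g (ga r') (zV z')) # ga r) (zV z) us)))"
  proof (rule pick2_cong)
    fix z z' R assume m: "z \<in> set zs" "z' \<in> set zs" "set R \<subseteq> set zs"
    have "br g (ga R) (comp (zV z) (zV z')) us = sps fst R (\<lambda>r' r. br g ((0, br g (ga r') (zV z')) # ga r) (zV z) us)"
      unfolding br_comp[OF validD(2)[OF m(1)] validD(2)[OF m(2)] valid_ga[OF m(3)]] sps_ga
      by (rule sps_cong) simp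
    then show "- sg (fst z) (br g (ga R) (comp (zV z) (zV z')) us) =
      sps fst R (\<lambda>r' r. - sg (fst z) (br g ((0, br g (ga r') (zV z')) # ga r) (zV z) us))"
      by (simp only: sps_uminus sps_sg)
  qed
  finally show ?thesis .
qed

text \<open>The inner third component is inserted into an outer \<open>V\<close> component; the
  three summands of \<open>H\<close> give the three sums.\<close>

lemma rel_D:
  "sps fst zs (\<lambda>I J. - sps fst J (\<lambda>p r. single p (\<lambda>z. sg ((wt fst I + 1) * fst z) (br g ((wt fst I + 1, bgop I) # ga r) (zV z) us)))) =
   pick2 fst zs (\<lambda>z z' R. sps fst R (\<lambda>r' r. sg (fst z) (br g ((0, br g (ga r') (zV z')) # ga r) (zV z) us))) +
   (pick2 fst zs (\<lambda>z z' R. sps fst R (\<lambda>r' r. single r' (\<lambda>a. - sg (fst z + (fst z' + 1) * fst a) (br g ((0, comp (zg a) (zU z')) # ga r) (zV z) us)))) +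
    pick2 fst zs (\<lambda>z z' R. - sg (fst z) (br g ((0, \<lambda>l. g (zU z' l)) # ga R) (zV z) us)))"
proof -
  let ?G = "\<lambda>z z' r' r. - sg ((fst z' + wt fst r' + 1) * fst z) (br g ((0, H z' r') # ga r) (zV z) us)"
  have "sps fst zs (\<lambda>I J. - sps fst J (\<lambda>p r. single p (\<lambda>z. sg ((wt fst I + 1) * fst z) (br g ((wt fst I + 1, bgop I) # ga r) (zV z) us)))) =
    sps fst zs (\<lambda>I J. sps fst I (\<lambda>p' r'. single p' (\<lambda>z'. sps fst J (\<lambda>p r. single p (\<lambda>z. ?G z z' r' r)))))"
  proof (rule sps_cong)
    fix I J assume "set I \<union> set J = set zs"
    then have J: "set J \<subseteq> set zs" by auto
    have "- sps fst J (\<lambda>p r. single p (\<lambda>z. sg ((wt fst I + 1) * fst z) (br g ((wt fst I + 1, bgop I) # ga r) (zV z) us))) =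
       sps fst J (\<lambda>p r. single p (\<lambda>z. - sg ((wt fst I + 1) * fst z) (br g ((0, bgop I) # ga r) (zV z) us)))"
      by (simp only: single_uminus sps_uminus br.simps snd_conv)
    also have "\<dots> = sps fst J (\<lambda>p r. sps fst I (\<lambda>p' r'. single p' (\<lambda>z'. single p (\<lambda>z. ?G z z' r' r))))"
    proof (rule sps_cong)
      fix p r assume "set p \<union> set r = set J"
      then have m: "p = [z] \<Longrightarrow> coch sV sV (fst z + 2) (zV z)" for z using J by (intro validD(2)) auto
      have "single p (\<lambda>z. - sg ((wt fst I + 1) * fst z) (br g ((0, bgop I) # ga r) (zV z) us)) =
        sps fst I (\<lambda>p' r'. single p (\<lambda>z. single p' (\<lambda>z'. - sg ((wt fst I + 1) * fst z) (br g ((0, H z' r') # ga r) (zV z) us))))"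
        unfolding single_sps bgop_def[abs_def]
        by (rule single_cong)
          (simp only: br_head_sps[OF m] br_head_single[OF m] single_uminus sps_uminus,
            simp only: sps_sg[symmetric] single_sg)
      also have "\<dots> = sps fst I (\<lambda>p' r'. single p' (\<lambda>z'. single p (\<lambda>z. ?G z z' r' r)))"
      proof (rule sps_cong)
        fix p' r' :: "('u, 'v) inp list" assume "wt fst p' + wt fst r' = wt fst I"
        note this[symmetric]
        then show "single p (\<lambda>z. single p' (\<lambda>z'. - sg ((wt fst I + 1) * fst z) (br g ((0, H z' r') # ga r) (zV z) us))) =
          single p' (\<lambda>z'. single p (\<lambda>z. ?G z z' r' r))"
          by (cases p rule: remdups_adj.cases; cases p' rule: remdups_adj.cases) simp_all
      qed
      finally show "single p (\<lambda>z. - sg ((wt fst I + 1) * fst z) (br g ((0, bgop I) # ga r) (zV z) us)) =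
        sps fst I (\<lambda>p' r'. single p' (\<lambda>z'. single p (\<lambda>z. ?G z z' r' r)))" .
    qed
    also have "\<dots> = sps fst I (\<lambda>p' r'. single p' (\<lambda>z'. sps fst J (\<lambda>p r. single p (\<lambda>z. ?G z z' r' r))))"
      by (subst sps_fubini) (simp only: single_sps)
    finally show "- sps fst J (\<lambda>p r. single p (\<lambda>z. sg ((wt fst I + 1) * fst z) (br g ((wt fst I + 1, bgop I) # ga r) (zV z) us))) =
      sps fst I (\<lambda>p' r'. single p' (\<lambda>z'. sps fst J (\<lambda>p r. single p (\<lambda>z. ?G z z' r' r))))" .
  qed
  also have "\<dots> = pick2 fst zs (\<lambda>z z' R. sps fst R (\<lambda>r' r. sg (fst z * (fst z' + wt fst r')) (?G z z' r' r)))"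
    by (rule pick2_both)
  also have "\<dots> = pick2 fst zs (\<lambda>z z' R.
      sps fst R (\<lambda>r' r. sg (fst z) (br g ((0, br g (ga r') (zV z')) # ga r) (zV z) us)) +
      (sps fst R (\<lambda>r' r. single r' (\<lambda>a. - sg (fst z + (fst z' + 1) * fst a) (br g ((0, comp (zg a) (zU z')) # ga r) (zV z) us))) +
       - sg (fst z) (br g ((0, \<lambda>l. g (zU z' l)) # ga R) (zV z) us)))"
  proof (rule pick2_cong)
    fix z z' :: "('u, 'v) inp" and R assume "z \<in> set zs"
    note x = validD(2)[OF this]
    let ?T1 = "\<lambda>r' r. br g ((0, br g (ga r') (zV z')) # ga r) (zV z) us"
    let ?T2 = "\<lambda>a r. br g ((0, comp (zg a) (zU z')) # ga r) (zV z) us"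
    let ?T3 = "\<lambda>r. br g ((0, \<lambda>l. g (zU z' l)) # ga r) (zV z) us"
    have "sps fst R (\<lambda>r' r. sg (fst z * (fst z' + wt fst r')) (?G z z' r' r)) =
      sps fst R (\<lambda>r' r. sg (fst z) (?T1 r' r) +
        (single r' (\<lambda>a. - sg (fst z + (fst z' + 1) * fst a) (?T2 a r)) +
         (if r' = [] then - sg (fst z) (?T3 r) else 0)))"
    proof (rule sps_cong)
      fix r' r
      have eB: "br g ((0, H z' r') # ga r) (zV z) us = - ?T1 r' r +
          single r' (\<lambda>a. sg ((fst z' + 1) * fst a) (?T2 a r)) + (if r' = [] then ?T3 r else 0)"
        unfolding H_def[abs_def]
        by (simp only: br_head_add[OF x] br_head_uminus[OF x] br_head_single[OF x] br_head_sg[OF x])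
          (simp add: br_head_zero[OF x])
      have key: "sg (fst z * (fst z' + wt fst r')) (- sg ((fst z' + wt fst r' + 1) * fst z) w) = - sg (fst z) w" for w :: 'v
        unfolding sg_minus sg_sg by (rule arg_cong[where f = uminus], rule sg_parity) auto
      have gen: "- sg n (- T + single r' (\<lambda>a. sg (m a) (T2 a)) + (if c then T3 else 0)) =
          sg n T + (single r' (\<lambda>a. - sg (n + m a) (T2 a)) + (if c then - sg n T3 else 0))"
        for n m c and T T3 :: 'v and T2
        by (cases r' rule: remdups_adj.cases) (auto simp: sg_def)
      show "sg (fst z * (fst z' + wt fst r')) (?G z z' r' r) = sg (fst z) (?T1 r' r) +
        (single r' (\<lambda>a. - sg (fst z + (fst z' + 1) * fst a) (?T2 a r)) +
         (if r' = [] then - sg (fst z) (?T3 r) else 0))"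
        unfolding key eB by (rule gen)
    qed
    then show "sps fst R (\<lambda>r' r. sg (fst z * (fst z' + wt fst r')) (?G z z' r' r)) =
      sps fst R (\<lambda>r' r. sg (fst z) (?T1 r' r)) +
      (sps fst R (\<lambda>r' r. single r' (\<lambda>a. - sg (fst z + (fst z' + 1) * fst a) (?T2 a r))) +
       - sg (fst z) (?T3 R))"
      by (simp only: sps_add sps_fst_Nil)
  qed
  finally show ?thesis by (simp only: pick2_add)
qed

lemma single_ga: "single (ga p) h = single p (\<lambda>z. h (fst z, zg z))"
  by (cases p rule: remdups_adj.cases) simp_all

text \<open>The inner third component is composed with an outer \<open>U\<close> component. By
  \<open>comp_br\<close> the first summand of \<open>H\<close> yields two sums, according to whether
  an inserted map or a copy of \<open>g\<close> is hit; the other two summands yield one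
  each.\<close>

lemma rel_E:
  "sps fst zs (\<lambda>I J. single J (\<lambda>z. sg (wt fst I + 1) (comp (bgop I) (zU z) us))) =
   pick2 fst zs (\<lambda>z z' R. sps fst R (\<lambda>r' r. single r' (\<lambda>a. sg (fst z + (fst z' + 1) * fst a) (br g ((0, comp (zg a) (zU z')) # ga r) (zV z) us)))) +
   pick2 fst zs (\<lambda>z z' R. sg (fst z) (br g ((0, \<lambda>l. g (zU z' l)) # ga R) (zV z) us)) +
   (pick2 fst zs (\<lambda>z z' R. single R (\<lambda>a. - sg ((fst z + fst z') * fst a + fst z) (comp (comp (zg a) (zU z)) (zU z') us))) +
    pick2 fst zs (\<lambda>z z' R. if R = [] then - sg (fst z) (g (comp (zU z) (zU z') us)) else 0))"
proof -
  let ?G = "\<lambda>z z' R. sg (fst z + wt fst R + 1) (comp (H z R) (zU z') us)"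
  have "sps fst zs (\<lambda>I J. single J (\<lambda>z. sg (wt fst I + 1) (comp (bgop I) (zU z) us))) =
    sps fst zs (\<lambda>I J. sps fst I (\<lambda>p R. single p (\<lambda>z. single J (\<lambda>z'. ?G z z' R))))"
  proof (rule sps_cong)
    fix I J
    have "single J (\<lambda>z. sg (wt fst I + 1) (comp (bgop I) (zU z) us)) =
       sps fst I (\<lambda>p R. single J (\<lambda>z'. single p (\<lambda>z. sg (wt fst I + 1) (comp (H z R) (zU z') us))))"
      unfolding single_sps bgop_def[abs_def]
      by (simp only: comp_hom_left comp_single_left sps_sg single_sg[symmetric])
    also have "\<dots> = sps fst I (\<lambda>p R. single p (\<lambda>z. single J (\<lambda>z'. ?G z z' R)))"
    proof (rule sps_cong)
      fix p R :: "('u, 'v) inp list" assume "wt fst p + wt fst R = wt fst I"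
      note this[symmetric]
      then show "single J (\<lambda>z'. single p (\<lambda>z. sg (wt fst I + 1) (comp (H z R) (zU z') us))) =
        single p (\<lambda>z. single J (\<lambda>z'. ?G z z' R))"
        by (cases p rule: remdups_adj.cases; cases J rule: remdups_adj.cases) simp_all
    qed
    finally show "single J (\<lambda>z. sg (wt fst I + 1) (comp (bgop I) (zU z) us)) =
      sps fst I (\<lambda>p R. single p (\<lambda>z. single J (\<lambda>z'. ?G z z' R)))" .
  qed
  also have "\<dots> = pick2 fst zs (\<lambda>z z' R. sg (fst z' * wt fst R) (?G z z' R))"
    by (rule pick2_fst_last)
  also have "\<dots> = pick2 fst zs (\<lambda>z z' R.
     sps fst R (\<lambda>r' r. single r' (\<lambda>a. sg (fst z + (fst z' + 1) * fst a) (br g ((0, comp (zg a) (zU z')) # ga r) (zV z) us))) +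
     sg (fst z) (br g ((0, \<lambda>l. g (zU z' l)) # ga R) (zV z) us) +
     (single R (\<lambda>a. - sg ((fst z + fst z') * fst a + fst z) (comp (comp (zg a) (zU z)) (zU z') us)) +
      (if R = [] then - sg (fst z) (g (comp (zU z) (zU z') us)) else 0)))"
  proof (rule pick2_cong)
    fix z z' R assume m: "z \<in> set zs" "z' \<in> set zs" "set R \<subseteq> set zs"
    let ?T2 = "\<lambda>a r. br g ((0, comp (zg a) (zU z')) # ga r) (zV z) us"
    let ?T3 = "br g ((0, \<lambda>l. g (zU z' l)) # ga R) (zV z) us"
    let ?n = "fst z' * wt fst R + (fst z + wt fst R + 1)"
    have c: "comp (br g (ga R) (zV z)) (zU z') us =
       sps fst R (\<lambda>p q. single p (\<lambda>a. sg ((fst z' + 1) * wt fst q) (?T2 a q))) + sg ((fst z' + 1) * wt fst R) ?T3"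
    proof -
      have k: "br g ((k, f) # as) x us = br g ((0, f) # as) x us" for k f as and x :: "'v list \<Rightarrow> 'v"
        by simp
      have n: "fst z' + 2 - 1 = fst z' + 1" by simp
      show ?thesis
        unfolding comp_br[OF validD(2)[OF m(1)] validD(1)[OF m(2)] valid_ga[OF m(3)] g g_scale sV sV, of us]
          n sps_ga single_ga wt_ga fst_conv snd_conv k[of "_ + _"] ..
    qed
    have g': "comp (\<lambda>l. g (zU z l)) (zU z') us = g (comp (zU z) (zU z') us)"
      by (simp add: comp_def sps_hom[OF g])
    have s4: "sg a (sg b (- (S + T) + U + W)) = - sg (a + b) S + - sg (a + b) T + (sg (a + b) U + sg (a + b) W)"
      for a b and S T U W :: 'v by (simp add: sg_def)
    have "comp (H z R) (zU z') us = - comp (br g (ga R) (zV z)) (zU z') us +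
       single R (\<lambda>a. sg ((fst z + 1) * fst a) (comp (comp (zg a) (zU z)) (zU z') us)) +
       (if R = [] then g (comp (zU z) (zU z') us) else 0)"
      unfolding H_def[abs_def] comp_add_left comp_uminus_left comp_single_left comp_sg_left
      by (simp add: g')
    then have "sg (fst z' * wt fst R) (?G z z' R) =
       - sg ?n (sps fst R (\<lambda>p q. single p (\<lambda>a. sg ((fst z' + 1) * wt fst q) (?T2 a q)))) +
       - sg ?n (sg ((fst z' + 1) * wt fst R) ?T3) +
       (sg ?n (single R (\<lambda>a. sg ((fst z + 1) * fst a) (comp (comp (zg a) (zU z)) (zU z') us))) +
       sg ?n (if R = [] then g (comp (zU z) (zU z') us) else 0))"
      unfolding c by (simp only: s4)
    also have "- sg ?n (sps fst R (\<lambda>p q. single p (\<lambda>a. sg ((fst z' + 1) * wt fst q) (?T2 a q)))) =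
       sps fst R (\<lambda>r' r. single r' (\<lambda>a. sg (fst z + (fst z' + 1) * fst a) (?T2 a r)))"
      unfolding minus_sg
      unfolding sps_sg[symmetric]
    proof (rule sps_cong)
      fix p q :: "('u, 'v) inp list" assume w: "wt fst p + wt fst q = wt fst R"
      show "sg (?n + 1) (single p (\<lambda>a. sg ((fst z' + 1) * wt fst q) (?T2 a q))) =
        single p (\<lambda>a. sg (fst z + (fst z' + 1) * fst a) (?T2 a q))"
        unfolding single_sg sg_sg w[symmetric] by (rule single_cong, rule sg_parity) auto
    qed
    also have "- sg ?n (sg ((fst z' + 1) * wt fst R) ?T3) = sg (fst z) ?T3"
      unfolding minus_sg sg_sg by (rule sg_parity) auto
    also have "sg ?n (single R (\<lambda>a. sg ((fst z + 1) * fst a) (comp (comp (zg a) (zU z)) (zU z') us))) =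
       single R (\<lambda>a. - sg ((fst z + fst z') * fst a + fst z) (comp (comp (zg a) (zU z)) (zU z') us))"
      unfolding single_sg sg_sg minus_sg by (rule single_cong, rule sg_parity) auto
    also have "sg ?n (if R = [] then g (comp (zU z) (zU z') us) else 0) =
       (if R = [] then - sg (fst z) (g (comp (zU z) (zU z') us)) else 0)"
      by (auto simp: minus_sg)
    finally show "sg (fst z' * wt fst R) (?G z z' R) =
      sps fst R (\<lambda>r' r. single r' (\<lambda>a. sg (fst z + (fst z' + 1) * fst a) (?T2 a r))) +
      sg (fst z) ?T3 +
      (single R (\<lambda>a. - sg ((fst z + fst z') * fst a + fst z) (comp (comp (zg a) (zU z)) (zU z') us)) +
       (if R = [] then - sg (fst z) (g (comp (zU z) (zU z') us)) else 0))" .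
  qed
  finally show ?thesis by (simp only: pick2_add)
qed

lemma rel_B:
  "sps fst zs (\<lambda>I J. single J (\<lambda>a. sg ((wt fst I + 1 + 1) * fst a) (comp (zg a) (bop fst zU I) us))) =
   pick2 fst zs (\<lambda>z z' R. single R (\<lambda>a. sg ((fst z + fst z') * fst a + fst z) (comp (zg a) (comp (zU z) (zU z')) us)))"
proof -
  let ?G = "\<lambda>z z' a. sg ((fst z + fst z') * fst a + fst z) (comp (zg a) (comp (zU z) (zU z')) us)"
  have "sps fst zs (\<lambda>I J. single J (\<lambda>a. sg ((wt fst I + 1 + 1) * fst a) (comp (zg a) (bop fst zU I) us))) =
     sps fst zs (\<lambda>I J. sps fst I (\<lambda>p q. single p (\<lambda>z. single q (\<lambda>z'. single J (\<lambda>a. ?G z z' a)))))"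
  proof (rule sps_cong)
    fix I J assume "set I \<union> set J = set zs"
    then have J: "J = [a] \<Longrightarrow> coch sU sV (fst a + 1) (zg a)" for a by (intro validD(3)) auto
    have "single J (\<lambda>a. sg ((wt fst I + 1 + 1) * fst a) (comp (zg a) (bop fst zU I) us)) =
      sps fst I (\<lambda>p q. single J (\<lambda>a. single p (\<lambda>z. single q (\<lambda>z'. sg ((wt fst I + 1 + 1) * fst a + fst z) (comp (zg a) (comp (zU z) (zU z')) us)))))"
      unfolding single_sps bop_def[abs_def]
      by (rule single_cong)
        (simp only: comp_hom_right[OF J] comp_single_right[OF J] comp_sg_right[OF J] sps_sg[symmetric] single_sg sg_sg)
    also have "\<dots> = sps fst I (\<lambda>p q. single p (\<lambda>z. single q (\<lambda>z'. single J (\<lambda>a. ?G z z' a))))"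
    proof (rule sps_cong)
      fix p q :: "('u, 'v) inp list" assume "wt fst p + wt fst q = wt fst I"
      note this[symmetric]
      then show "single J (\<lambda>a. single p (\<lambda>z. single q (\<lambda>z'. sg ((wt fst I + 1 + 1) * fst a + fst z) (comp (zg a) (comp (zU z) (zU z')) us)))) =
        single p (\<lambda>z. single q (\<lambda>z'. single J (\<lambda>a. ?G z z' a)))"
        by (cases p rule: remdups_adj.cases; cases q rule: remdups_adj.cases; cases J rule: remdups_adj.cases)
          (auto intro!: sg_parity)
    qed
    finally show "single J (\<lambda>a. sg ((wt fst I + 1 + 1) * fst a) (comp (zg a) (bop fst zU I) us)) =
      sps fst I (\<lambda>p q. single p (\<lambda>z. single q (\<lambda>z'. single J (\<lambda>a. ?G z z' a))))" .
  qed
  then show ?thesis by (simp only: pick2_fst_pair)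
qed

lemma rel_C:
  "sps fst zs (\<lambda>I J. if J = [] then g (bop fst zU I us) else 0) =
   pick2 fst zs (\<lambda>z z' R. if R = [] then sg (fst z) (g (comp (zU z) (zU z') us)) else 0)"
proof -
  have "pick2 fst zs (\<lambda>z z' R. if R = [] then sg (fst z) (g (comp (zU z) (zU z') us)) else 0) =
    sps fst zs (\<lambda>I J. sps fst I (\<lambda>p q. single p (\<lambda>z. single q (\<lambda>z'. if J = [] then sg (fst z) (g (comp (zU z) (zU z') us)) else 0))))"
    by (rule pick2_fst_pair[symmetric])
  also have "\<dots> = sps fst zs (\<lambda>I J. if J = [] then g (bop fst zU I us) else 0)"
  proof (rule sps_cong)
    fix I J
    have "g (bop fst zU I us) = sps fst I (\<lambda>p q. single p (\<lambda>z. single q (\<lambda>z'. sg (fst z) (g (comp (zU z) (zU z') us)))))"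
      unfolding bop_def by (simp only: sps_hom[OF g] single_hom[OF g] additive_sg[OF g])
    then show "sps fst I (\<lambda>p q. single p (\<lambda>z. single q (\<lambda>z'. if J = [] then sg (fst z) (g (comp (zU z) (zU z') us)) else 0))) =
      (if J = [] then g (bop fst zU I us) else 0)"
      by (cases "J = []") simp_all
  qed
  finally show ?thesis by simp
qed

text \<open>Cancelling pairs: nested insertions (\<open>?A\<close>, \<open>?D1\<close>), insertions
  of \<open>zg\<close> after \<open>zU\<close> (\<open>?D2\<close>, \<open>?E1\<close>), insertions
  of \<open>g\<close> after \<open>zU\<close> (\<open>?D3\<close>, \<open>?E1b\<close>), and
  \<open>g\<close> after a composition (\<open>?C\<close>, \<open>?E3\<close>). Only
  \<open>?B\<close> and \<open>?E2\<close>, with one \<open>zg\<close> and two \<open>zU\<close>, do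
  not cancel term by term.\<close>

lemma bgop_relation: "sps fst zs (\<lambda>I J. bgop (bz I # J) us) = 0"
proof -
  let ?A = "pick2 fst zs (\<lambda>z z' R. sps fst R (\<lambda>r' r. - sg (fst z) (br g ((0, br g (ga r') (zV z')) # ga r) (zV z) us)))"
  let ?D1 = "pick2 fst zs (\<lambda>z z' R. sps fst R (\<lambda>r' r. sg (fst z) (br g ((0, br g (ga r') (zV z')) # ga r) (zV z) us)))"
  let ?D2 = "pick2 fst zs (\<lambda>z z' R. sps fst R (\<lambda>r' r. single r' (\<lambda>a. - sg (fst z + (fst z' + 1) * fst a) (br g ((0, comp (zg a) (zU z')) # ga r) (zV z) us))))"
  let ?E1 = "pick2 fst zs (\<lambda>z z' R. sps fst R (\<lambda>r' r. single r' (\<lambda>a. sg (fst z + (fst z' + 1) * fst a) (br g ((0, comp (zg a) (zU z')) # ga r) (zV z) us))))"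
  let ?D3 = "pick2 fst zs (\<lambda>z z' R. - sg (fst z) (br g ((0, \<lambda>l. g (zU z' l)) # ga R) (zV z) us))"
  let ?E1b = "pick2 fst zs (\<lambda>z z' R. sg (fst z) (br g ((0, \<lambda>l. g (zU z' l)) # ga R) (zV z) us))"
  let ?B = "pick2 fst zs (\<lambda>z z' R. single R (\<lambda>a. sg ((fst z + fst z') * fst a + fst z) (comp (zg a) (comp (zU z) (zU z')) us)))"
  let ?E2 = "pick2 fst zs (\<lambda>z z' R. single R (\<lambda>a. - sg ((fst z + fst z') * fst a + fst z) (comp (comp (zg a) (zU z)) (zU z') us)))"
  let ?C = "pick2 fst zs (\<lambda>z z' R. if R = [] then sg (fst z) (g (comp (zU z) (zU z') us)) else 0)"
  let ?E3 = "pick2 fst zs (\<lambda>z z' R. if R = [] then - sg (fst z) (g (comp (zU z) (zU z') us)) else 0)"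
  have "sps fst zs (\<lambda>I J. bgop (bz I # J) us) = ?A + ?B + ?C + (?D1 + (?D2 + ?D3) + (?E1 + ?E1b + (?E2 + ?E3)))"
    unfolding bgop_relation_terms bz_sel sps_add rel_A rel_B rel_C rel_D rel_E ..
  moreover have "?A + ?D1 = 0" "?D2 + ?E1 = 0"
    by (rule pick2_add_0, simp only: sps_uminus single_uminus, simp)+
  moreover have "?D3 + ?E1b = 0" by (rule pick2_add_0) simp
  moreover have "?C + ?E3 = 0" by (rule pick2_add_0) simp
  \<comment> \<open>The difference of the two bracketings is the associator, whose symmetry in the
    two \<open>zU\<close> makes the two orders of these entries cancel.\<close>
  moreover have "?B + ?E2 = 0"
  proof -
    let ?b = "\<lambda>z z' a. br id [(fst z + 1, zU z), (fst z' + 1, zU z')] (zg a) us"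
    have e: "comp (comp (zg a) (zU z)) (zU z') us = comp (zg a) (comp (zU z) (zU z')) us + ?b z z' a"
      if "z \<in> set zs" "z' \<in> set zs" "a \<in> set zs" for z z' a
      using comp_comp[OF validD(3)[OF that(3)] validD(1)[OF that(1)] validD(1)[OF that(2)], of us] by (simp add: algebra_simps)
    have "?B + ?E2 = pick2 fst zs (\<lambda>z z' R. single R (\<lambda>a. - sg ((fst z + fst z') * fst a + fst z) (?b z z' a)))"
      unfolding pick2_add[symmetric] single_add[symmetric]
      by (rule pick2_cong, rule single_cong) (simp add: e sg_add)
    \<comment> \<open>The rotation moves the entry with \<open>zg\<close> to the front, so that the
      entries to be exchanged come last, as \<open>pick2_pair_0\<close> expects.\<close>
    also have "\<dots> = pick2 fst zs (\<lambda>a z R. single R (\<lambda>z'. - sg (fst z) (?b z z' a)))"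
      by (subst pick2_rotate, rule pick2_cong, rule single_cong) (auto simp: sg_def)
    also have "\<dots> = 0"
    proof (rule pick2_pair_0)
      fix a z z' assume m: "a \<in> set zs" "z \<in> set zs" "z' \<in> set zs"
      have sw: "?b z' z a = sg ((fst z + 1) * (fst z' + 1)) (?b z z' a)"
        using br_swap_head[OF validD(3)[OF m(1)], of sU "(fst z' + 1, zU z')" "(fst z + 1, zU z)" id "[]" us]
          validD(1)[OF m(2)] validD(1)[OF m(3)] by (simp add: algebra_simps)
      show "- sg (fst z) (?b z z' a) + sg (fst z * fst z') (- sg (fst z') (?b z' z a)) = 0"
        unfolding sw by (auto simp: sg_def)
    qed
    finally show ?thesis .
  qed
  ultimately show ?thesis by (simp add: algebra_simps)
qed

end
end

section \<open>Multilinearity and graded symmetry of the shifted operations\<close>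

lemma sps_slot_add':
  assumes "\<And>P R Q. h (P @ u # R) Q = h (P @ v # R) Q + h (P @ w # R) Q"
    and "\<And>P R Q. h P (R @ u # Q) = h P (R @ v # Q) + h P (R @ w # Q)"
    and "par u = par v" "par u = par w"
  shows "sps par (p @ u # q) h = sps par (p @ v # q) h + sps par (p @ w # q) h"
  unfolding sps_append
  apply (subst sps_add[symmetric])
  apply (rule sps_cong)
  apply (simp add: assms(1,2) assms(3,4)[symmetric] sps_add sg_add)
  done

lemma sps_slot_scale':
  assumes "additive t"
    and "\<And>P R Q. h (P @ u # R) Q = t (h (P @ v # R) Q)"
    and "\<And>P R Q. h P (R @ u # Q) = t (h P (R @ v # Q))"
    and "par u = par v"
  shows "sps par (p @ u # q) h = t (sps par (p @ v # q) h)"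
  unfolding sps_append
  by (simp add: assms(2-4) sps_hom[OF assms(1)] additive_sg[OF assms(1)] additive.add[OF assms(1)])

lemma single_append_Cons: "single (P @ u # R) F = (if P = [] \<and> R = [] then F u else 0)"
  by (cases P; cases R; cases "tl P") (auto simp: single_def)

lemma single_append_Cons2: "single (P @ u # v # R) F = 0"
  by (cases P; cases "tl P") (auto simp: single_def)

lemma coch_0: "(\<And>c. additive (t c)) \<Longrightarrow> coch s t n (\<lambda>l. 0)"
  by (simp add: coch_def additive_zero)

lemma coch_plus:
  assumes "coch s t n f" "coch s t n h" and t: "\<And>c. additive (t c)"
  shows "coch s t n (\<lambda>l. f l + h l)"
  unfolding coch_def
proof (intro conjI allI impI)
  fix p q v w
  show "f (p @ v # w # q) + h (p @ v # w # q) = - (f (p @ w # v # q) + h (p @ w # v # q))"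
    using coch_swap[OF assms(1), of p v w q] coch_swap[OF assms(2), of p v w q] by simp
next
  fix us assume "f us + h us \<noteq> 0"
  then show "int (length us) = n"
    using coch_len[OF assms(1), of us] coch_len[OF assms(2), of us] by force
qed (simp_all add: coch_add[OF assms(1)] coch_add[OF assms(2)] coch_scale[OF assms(1)] coch_scale[OF assms(2)] additive.add[OF t])

lemma coch_scaled:
  assumes "coch s t n f" and h: "additive h" and t: "\<And>c x. h (t c x) = t c (h x)"
  shows "coch s t n (\<lambda>l. h (f l))"
  unfolding coch_def
proof (intro conjI allI impI)
  fix p q v w
  show "h (f (p @ v # w # q)) = - h (f (p @ w # v # q))"
    using coch_swap[OF assms(1), of p v w q] by (simp add: additive.minus[OF h])
next
  fix us assume "h (f us) \<noteq> 0"
  then show "int (length us) = n"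
    using coch_len[OF assms(1), of us] additive_zero[OF h] by force
qed (simp_all add: coch_add[OF assms(1)] coch_scale[OF assms(1)] additive.add[OF h] t)

lemma coch_sg:
  assumes "coch s t n f" and t: "\<And>c. additive (t c)"
  shows "coch s t n (\<lambda>l. sg m (f l))"
  by (rule coch_scaled[OF assms(1) additive_sgI]) (simp add: additive_sg[OF t])

lemma coch_uminus:
  assumes "coch s t n f" and t: "\<And>c. additive (t c)"
  shows "coch s t n (\<lambda>l. - f l)"
  using coch_sg[OF assms, of 1] by (simp add: sg_def)

lemma coch_sps:
  assumes "\<And>p q. wt par p + wt par q = wt par zs \<Longrightarrow> length p + length q = length zs \<Longrightarrow>
     set p \<union> set q = set zs \<Longrightarrow> coch s t n (F p q)"
    and t: "\<And>c. additive (t c)"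
  shows "coch s t n (\<lambda>l. sps par zs (\<lambda>p q. F p q l))"
  using assms(1)
proof (induct zs arbitrary: F)
  case (Cons z zs)
  show ?case
    unfolding sps.simps
    by (intro coch_plus t Cons.hyps coch_sg Cons.prems; force)
qed simp

lemma coch_single:
  assumes "\<And>z. p = [z] \<Longrightarrow> coch s t n (F z)" and t: "\<And>c. additive (t c)"
  shows "coch s t n (\<lambda>l. single p (\<lambda>z. F z l))"
  using assms by (cases p rule: remdups_adj.cases) (simp_all add: coch_0)

lemma br_slot_add:
  assumes "coch s t n x"
  shows "br g (P @ (k, \<lambda>l. f l + h l) # as) x us = br g (P @ (k, f) # as) x us + br g (P @ (k, h) # as) x us"
  using assms
proof (induct P arbitrary: x n us)
  case Nil
  show ?case unfolding append_Nil by (rule br_head_add[OF Nil])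
next
  case (Cons a P)
  show ?case by (simp add: Cons.hyps[OF coch_contract[OF Cons.prems]] sg_add sps_add)
qed

lemma br_scale:
  assumes t: "\<And>c. additive (t c)"
  shows "br g as (\<lambda>l. t c (x l)) us = t c (br g as x us)"
  by (induct as arbitrary: x us) (simp_all add: sps_hom[OF t] additive_sg[OF t])

lemma br_slot_scale:
  assumes "coch s t n x" and t: "\<And>c. additive (t c)"
  shows "br g (P @ (k, \<lambda>l. s c (f l)) # as) x us = t c (br g (P @ (k, f) # as) x us)"
  using assms(1)
proof (induct P arbitrary: x n us)
  case Nil
  show ?case
    by (simp add: coch_scale1[OF Nil] br_scale[of t, OF t] sps_hom[OF t] additive_sg[OF t])
next
  case (Cons a P)
  show ?case by (simp add: Cons.hyps[OF coch_contract[OF Cons.prems]] sps_hom[OF t] additive_sg[OF t])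
qed

lemma bop_swap:
  "bop par f (ps @ v # w # qs) us = sg (par v * par w) (bop par f (ps @ w # v # qs) us)"
  unfolding bop_def
  by (rule sps_swap) (simp_all add: single_append_Cons2)

text \<open>The summands are additive and symmetric only for valid entries, whereas the slot lemmas
  ask for this on arbitrary sublists. Replacing the summand by \<open>0\<close> on invalid sublists
  reconciles the two.\<close>

lemma sps_guard:
  assumes "\<forall>z\<in>set zs. V z"
  shows "sps par zs h = sps par zs (\<lambda>p q. if \<forall>z\<in>set p \<union> set q. V z then h p q else 0)"
  by (rule sps_cong) (use assms in auto)

lemma sps_slot_addV:
  assumes V: "\<forall>z\<in>set (p @ u # v # w # q). V z"
    and 1: "\<And>P R Q. \<forall>z\<in>set P \<union> set R \<union> set Q. V z \<Longrightarrow> h (P @ u # R) Q = h (P @ v # R) Q + h (P @ w # R) Q"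
    and 2: "\<And>P R Q. \<forall>z\<in>set P \<union> set R \<union> set Q. V z \<Longrightarrow> h P (R @ u # Q) = h P (R @ v # Q) + h P (R @ w # Q)"
    and par: "par u = par v" "par u = par w"
  shows "sps par (p @ u # q) h = sps par (p @ v # q) h + sps par (p @ w # q) h"
proof -
  have *: "sps par (p @ x # q) h = sps par (p @ x # q) (\<lambda>p q. if \<forall>z\<in>set p \<union> set q. V z then h p q else 0)"
    if "x \<in> {u, v, w}" for x
    by (rule sps_guard) (use V that in auto)
  show ?thesis
    unfolding *[of u, simplified] *[of v, simplified] *[of w, simplified]
    by (rule sps_slot_add'[where par = par]) (use 1 2 V par in auto)
qed

lemma sps_slot_scaleV:
  assumes V: "\<forall>z\<in>set (p @ u # v # q). V z" and t: "additive t"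
    and 1: "\<And>P R Q. \<forall>z\<in>set P \<union> set R \<union> set Q. V z \<Longrightarrow> h (P @ u # R) Q = t (h (P @ v # R) Q)"
    and 2: "\<And>P R Q. \<forall>z\<in>set P \<union> set R \<union> set Q. V z \<Longrightarrow> h P (R @ u # Q) = t (h P (R @ v # Q))"
    and par: "par u = par v"
  shows "sps par (p @ u # q) h = t (sps par (p @ v # q) h)"
proof -
  have *: "sps par (p @ x # q) h = sps par (p @ x # q) (\<lambda>p q. if \<forall>z\<in>set p \<union> set q. V z then h p q else 0)"
    if "x \<in> {u, v}" for x
    by (rule sps_guard) (use V that in auto)
  show ?thesis
    unfolding *[of u, simplified] *[of v, simplified]
    by (rule sps_slot_scale'[where par = par and t = t]) (use 1 2 V par t in \<open>auto simp: additive_zero[OF t]\<close>)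
qed

lemma sps_swapV:
  assumes V: "\<forall>z\<in>set (p @ v # w # q). V z"
    and 1: "\<And>P R Q. \<forall>z\<in>set P \<union> set R \<union> set Q. V z \<Longrightarrow> h (P @ v # w # R) Q = sg (par v * par w) (h (P @ w # v # R) Q)"
    and 2: "\<And>P R Q. \<forall>z\<in>set P \<union> set R \<union> set Q. V z \<Longrightarrow> h P (R @ v # w # Q) = sg (par v * par w) (h P (R @ w # v # Q))"
  shows "sps par (p @ v # w # q) h = sg (par v * par w) (sps par (p @ w # v # q) h)"
proof -
  let ?h = "\<lambda>p q. if \<forall>z\<in>set p \<union> set q. V z then h p q else 0"
  have "sps par (p @ v # w # q) h = sps par (p @ v # w # q) ?h"
    by (rule sps_guard[OF V])
  also have "\<dots> = sg (par v * par w) (sps par (p @ w # v # q) ?h)"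
    by (rule sps_swap) (use 1 2 V in auto)
  also have "sps par (p @ w # v # q) ?h = sps par (p @ w # v # q) h"
    by (rule sps_guard[symmetric]) (use V in auto)
  finally show ?thesis .
qed

lemma bop_slot_add:
  assumes V: "\<forall>z\<in>set (ps @ u # v # w # qs). coch s s (par z + 2) (f z)"
    and u: "par u = par v" "par u = par w" "f u = (\<lambda>l. f v l + f w l)"
  shows "bop par f (ps @ u # qs) us = bop par f (ps @ v # qs) us + bop par f (ps @ w # qs) us"
  unfolding bop_def
proof (rule sps_slot_addV[OF V])
  fix P R Q assume V': "\<forall>z\<in>set P \<union> set R \<union> set Q. coch s s (par z + 2) (f z)"
  show "single (P @ u # R) (\<lambda>z. single Q (\<lambda>z'. sg (par z) (comp (f z) (f z') us))) =
    single (P @ v # R) (\<lambda>z. single Q (\<lambda>z'. sg (par z) (comp (f z) (f z') us))) +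
    single (P @ w # R) (\<lambda>z. single Q (\<lambda>z'. sg (par z) (comp (f z) (f z') us)))"
    by (simp add: single_append_Cons single_add[symmetric] u(3) comp_add_left sg_add)
      (simp add: u(1)[symmetric] u(2)[symmetric])
  show "single P (\<lambda>z. single (R @ u # Q) (\<lambda>z'. sg (par z) (comp (f z) (f z') us))) =
    single P (\<lambda>z. single (R @ v # Q) (\<lambda>z'. sg (par z) (comp (f z) (f z') us))) +
    single P (\<lambda>z. single (R @ w # Q) (\<lambda>z'. sg (par z) (comp (f z) (f z') us)))"
    unfolding single_add[symmetric]
    by (rule single_cong) (use V' in \<open>auto simp: single_append_Cons u(3) comp_add_right sg_add\<close>)
qed (use u in auto)

lemma bop_slot_scale:
  assumes V: "\<forall>z\<in>set (ps @ u # v # qs). coch s s (par z + 2) (f z)" and s: "\<And>c. additive (s c)"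
    and u: "par u = par v" "f u = (\<lambda>l. s c (f v l))"
  shows "bop par f (ps @ u # qs) us = s c (bop par f (ps @ v # qs) us)"
  unfolding bop_def
proof (rule sps_slot_scaleV[OF V s])
  have cl: "comp (\<lambda>l. s c (x l)) y us = s c (comp x y us)" for x y
    by (simp add: comp_def sps_hom[OF s])
  have cr: "comp x (\<lambda>l. s c (y l)) us = s c (comp x y us)" if "coch s s n x" for x y n
    by (simp add: comp_def sps_hom[OF s] coch_scale1[OF that])
  fix P R Q assume V': "\<forall>z\<in>set P \<union> set R \<union> set Q. coch s s (par z + 2) (f z)"
  show "single (P @ u # R) (\<lambda>z. single Q (\<lambda>z'. sg (par z) (comp (f z) (f z') us))) =
    s c (single (P @ v # R) (\<lambda>z. single Q (\<lambda>z'. sg (par z) (comp (f z) (f z') us))))"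
    by (simp add: single_append_Cons single_hom[OF s] u cl additive_sg[OF s] additive_zero[OF s])
  show "single P (\<lambda>z. single (R @ u # Q) (\<lambda>z'. sg (par z) (comp (f z) (f z') us))) =
    s c (single P (\<lambda>z. single (R @ v # Q) (\<lambda>z'. sg (par z) (comp (f z) (f z') us))))"
    unfolding single_hom[OF s]
    by (rule single_cong) (use V' in \<open>auto simp: single_append_Cons u cr additive_sg[OF s] additive_zero[OF s]\<close>)
qed (use u in auto)

lemma coch_bop:
  assumes V: "\<forall>z\<in>set zs. coch s s (par z + 2) (f z)" and s: "\<And>c. additive (s c)"
  shows "coch s s (wt par zs + 3) (bop par f zs)"
  unfolding bop_def[abs_def]
proof (intro coch_sps coch_single coch_sg s)
  fix p q z z' assume "wt par p + wt par q = wt par zs" "set p \<union> set q = set zs" and p: "p = [z]" "q = [z']"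
  then have n: "wt par zs + 3 = (par z + 2) + (par z' + 2) - 1" and "z \<in> set zs" "z' \<in> set zs"
    by auto
  then show "coch s s (wt par zs + 3) (comp (f z) (f z'))"
    unfolding n using V by (intro coch_comp s) auto
qed

lemma (in lin_hom) coch_H:
  assumes z: "valid z" and q: "\<forall>z\<in>set q. valid z"
  shows "coch sU sV (fst z + wt fst q + 2) (H z q)"
  unfolding H_def[abs_def]
proof (intro coch_plus coch_uminus coch_single coch_sg sV)
  have n: "fst z + wt fst q + 2 = (fst z + 2) + wt fst (ga q)" unfolding wt_ga by simp
  show "coch sU sV (fst z + wt fst q + 2) (br g (ga q) (zV z))"
  proof -
    have 1: "coch sV sV (fst z + 2) (zV z)" using z by (simp add: valid_def)
    have 2: "\<forall>a\<in>set (ga q). coch sU sV (fst a + 1) (snd a)" using q by (simp add: valid_def)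
    have "coch sU sV ((fst z + 2) + wt fst (ga q)) (br g (ga q) (zV z))"
      by (rule coch_br[OF 1 2]) (simp_all add: sV g g_scale)
    then show ?thesis by (simp only: n)
  qed
  show "coch sU sV (fst z + wt fst q + 2) (comp (zg z') (zU z))" if "q = [z']" for z'
  proof -
    have n: "fst z + wt fst q + 2 = (fst z' + 1) + (fst z + 2) - 1" using that by simp
    show ?thesis unfolding n
    proof (rule coch_comp[OF _ _ sV])
      show "coch sU sV (fst z' + 1) (zg z')" using q that by (simp add: valid_def)
      show "coch sU sU (fst z + 2) (zU z)" using z by (simp add: valid_def)
    qed
  qed
  show "coch sU sV (fst z + wt fst q + 2) (\<lambda>us. if q = [] then g (zU z us) else 0)"
  proof (cases "q = []")
    case True
    have c: "coch sU sU (fst z + 2) (zU z)" using z by (simp add: valid_def)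
    have "coch sU sV (fst z + 2) (\<lambda>us. g (zU z us))"
      unfolding coch_def
    proof (intro conjI allI impI)
      fix p v w q show "g (zU z (p @ v # w # q)) = - g (zU z (p @ w # v # q))"
        using coch_swap[OF c, of p v w q] by (simp add: additive.minus[OF g])
    next
      fix us assume "g (zU z us) \<noteq> 0"
      then show "int (length us) = fst z + 2" using coch_len[OF c, of us] additive_zero[OF g] by force
    qed (simp_all add: coch_add[OF c] coch_scale[OF c] additive.add[OF g] g_scale)
    then show ?thesis using True by simp
  qed (simp add: coch_0 sV)
qed

locale vs_hom = lin_hom sU sV g + U: vector_space sU + V: vector_space sV
  for sU :: "'k::field_char_0 \<Rightarrow> 'u::ab_group_add \<Rightarrow> 'u" and sV :: "'k \<Rightarrow> 'v::ab_group_add \<Rightarrow> 'v" and g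
begin

lemma double_U: "(x::'u) + x = 0 \<Longrightarrow> x = 0"
proof -
  assume "x + x = 0"
  then have "sU 2 x = 0" using U.scale_left_distrib[of 1 1 x] by simp
  then show ?thesis by (simp add: U.scale_eq_0_iff)
qed

lemma double_V: "(x::'v) + x = 0 \<Longrightarrow> x = 0"
proof -
  assume "x + x = 0"
  then have "sV 2 x = 0" using V.scale_left_distrib[of 1 1 x] by simp
  then show ?thesis by (simp add: V.scale_eq_0_iff)
qed

abbreviation cscale :: "'k \<Rightarrow> ('u, 'v) cochain \<Rightarrow> ('u, 'v) cochain" where
  "cscale \<equiv> cochain_scale sU sV"

lemma cscale_sel [simp]:
  "fst (cscale c x) = (\<lambda>l. sU c (fst x l))" "fst (snd (cscale c x)) = (\<lambda>l. sV c (fst (snd x) l))"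
  "snd (snd (cscale c x)) = (\<lambda>l. sV c (snd (snd x) l))"
  by (simp_all add: cochain_scale_def split: prod.splits)

definition bc :: "('u, 'v) inp list \<Rightarrow> ('u, 'v) cochain" where
  "bc zs = (bop fst zU zs, bop fst zV zs, bgop zs)"

lemma bz_bc: "bz zs = (wt fst zs + 1, bc zs)" by (simp add: bz_def bc_def)

lemma bc_sel [simp]: "fst (bc zs) = bop fst zU zs" "fst (snd (bc zs)) = bop fst zV zs" "snd (snd (bc zs)) = bgop zs"
  by (simp_all add: bc_def)

lemma valid_bc:
  assumes v: "\<forall>z\<in>set zs. valid z"
  shows "valid (wt fst zs + 1, bc zs)"
proof -
  have "coch sU sV (wt fst zs + 2) (bgop zs)"
    unfolding bgop_def[abs_def]
  proof (intro coch_sps coch_single sV)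
    fix p q z assume "wt fst p + wt fst q = wt fst zs" "set p \<union> set q = set zs" "p = [z]"
    then show "coch sU sV (wt fst zs + 2) (H z q)"
      using coch_H[of z q] v by auto
  qed
  then show ?thesis
    using coch_bop[of zs sU fst zU, OF _ sU] coch_bop[of zs sV fst zV, OF _ sV] v
    by (auto simp: valid_def algebra_simps)
qed

lemma H_swap:
  assumes "valid z" "valid v" "valid w"
  shows "H z (R @ v # w # Q) us = sg (fst v * fst w) (H z (R @ w # v # Q) us)"
  using assms br_swap[of sV sV "fst z + 2" "zV z" sU "(fst v, zg v)" "(fst w, zg w)" g "ga R" "ga Q" us]
  by (simp add: H_def single_append_Cons2 valid_def sg_minus)

lemma bc_swap:
  assumes v: "\<forall>z\<in>set (ps @ z # z' # qs). valid z"
  shows "bc (ps @ z # z' # qs) = sg (fst z * fst z') (bc (ps @ z' # z # qs))"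
proof -
  have sgp: "fst (sg n x) = sg n (fst x)" "snd (sg n x) = sg n (snd x)"
    for n and x :: "'x::ab_group_add \<times> 'y::ab_group_add"
    by (simp_all add: sg_def)
  have "bgop (ps @ z # z' # qs) us = sg (fst z * fst z') (bgop (ps @ z' # z # qs) us)" for us
    unfolding bgop_def
  proof (rule sps_swapV[OF v])
    fix P R Q assume v': "\<forall>z\<in>set P \<union> set R \<union> set Q. valid z"
    show "single (P @ z # z' # R) (\<lambda>z. H z Q us) = sg (fst z * fst z') (single (P @ z' # z # R) (\<lambda>z. H z Q us))"
      by (simp add: single_append_Cons2)
    show "single P (\<lambda>y. H y (R @ z # z' # Q) us) = sg (fst z * fst z') (single P (\<lambda>y. H y (R @ z' # z # Q) us))"
      unfolding single_sg by (rule single_cong, rule H_swap) (use v v' in auto)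
  qed
  then show ?thesis
    by (intro prod_eqI ext) (simp_all only: sgp bc_sel sg_apply bop_swap[of fst _ ps z z' qs])
qed

lemma bc_slot_add:
  assumes v: "\<forall>z\<in>set (ps @ (k, x) # (k, y) # qs). valid z"
  shows "bc (ps @ (k, x + y) # qs) = bc (ps @ (k, x) # qs) + bc (ps @ (k, y) # qs)"
proof -
  have plus: "fst (x + y) = (\<lambda>l. fst x l + fst y l)" "fst (snd (x + y)) = (\<lambda>l. fst (snd x) l + fst (snd y) l)"
    "snd (snd (x + y)) = (\<lambda>l. snd (snd x) l + snd (snd y) l)"
    by (auto simp: plus_fun_def)
  have v': "\<forall>z\<in>set (ps @ (k, x + y) # (k, x) # (k, y) # qs). valid z"
    using v by (auto simp: valid_def plus_fun_def intro!: coch_plus sU sV)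
  have "bgop (ps @ (k, x + y) # qs) us = bgop (ps @ (k, x) # qs) us + bgop (ps @ (k, y) # qs) us" for us
    unfolding bgop_def
  proof (rule sps_slot_addV[OF v'])
    fix P R Q assume w: "\<forall>z\<in>set P \<union> set R \<union> set Q. valid z"
    show "single (P @ (k, x + y) # R) (\<lambda>z. H z Q us) =
      single (P @ (k, x) # R) (\<lambda>z. H z Q us) + single (P @ (k, y) # R) (\<lambda>z. H z Q us)"
    proof -
      have "single Q (\<lambda>z'. sg n (comp (zg z') (\<lambda>l. fst x l + fst y l) us)) =
        single Q (\<lambda>z'. sg n (comp (zg z') (fst x) us) + sg n (comp (zg z') (fst y) us))" for n
        by (rule single_cong) (use w in \<open>auto simp: valid_def comp_add_right sg_add\<close>)
      moreover have "single Q (\<lambda>z'. sg ((k + 1) * fst z') (comp (zg z') (\<lambda>l. fst x l + fst y l) us)) =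
        single Q (\<lambda>z'. sg ((k + 1) * fst z') (comp (zg z') (fst x) us)) +
        single Q (\<lambda>z'. sg ((k + 1) * fst z') (comp (zg z') (fst y) us))"
        unfolding single_add[symmetric]
        by (rule single_cong) (use w in \<open>auto simp: valid_def comp_add_right sg_add\<close>)
      ultimately show ?thesis
        unfolding single_append_Cons H_def fst_conv snd_conv plus br_add additive.add[OF g]
        by (simp add: algebra_simps)
    qed
    show "single P (\<lambda>z. H z (R @ (k, x + y) # Q) us) =
      single P (\<lambda>z. H z (R @ (k, x) # Q) us) + single P (\<lambda>z. H z (R @ (k, y) # Q) us)"
      unfolding single_add[symmetric]
    proof (rule single_cong)
      fix z assume "P = [z]"
      then have "coch sV sV (fst z + 2) (zV z)" using w by (auto simp: valid_def)
      note b = br_slot_add[OF this]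
      show "H z (R @ (k, x + y) # Q) us = H z (R @ (k, x) # Q) us + H z (R @ (k, y) # Q) us"
        unfolding H_def single_append_Cons map_append list.map fst_conv snd_conv plus b comp_add_left sg_add
        by simp
    qed
  qed simp_all
  moreover have "bop fst zU (ps @ (k, x + y) # qs) us = bop fst zU (ps @ (k, x) # qs) us + bop fst zU (ps @ (k, y) # qs) us" for us
    by (rule bop_slot_add[where s = sU]) (use v' in \<open>auto simp: valid_def plus_fun_def\<close>)
  moreover have "bop fst zV (ps @ (k, x + y) # qs) us = bop fst zV (ps @ (k, x) # qs) us + bop fst zV (ps @ (k, y) # qs) us" for us
    by (rule bop_slot_add[where s = sV]) (use v' in \<open>auto simp: valid_def plus_fun_def\<close>)
  ultimately show ?thesis by (auto simp: bc_def plus_fun_def)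
qed

lemma valid_cscale: "valid (k, x) \<Longrightarrow> valid (k, cscale c x)"
  unfolding valid_def snd_conv fst_conv cscale_sel
  by (blast intro: coch_scaled[where h = "sU c" and t = sU, OF _ sU U.scale_left_commute]
      coch_scaled[where h = "sV c" and t = sV, OF _ sV V.scale_left_commute])

lemma bc_slot_scale:
  assumes v: "\<forall>z\<in>set (ps @ (k, x) # qs). valid z"
  shows "bc (ps @ (k, cscale c x) # qs) = cscale c (bc (ps @ (k, x) # qs))"
proof -
  have v': "\<forall>z\<in>set (ps @ (k, cscale c x) # (k, x) # qs). valid z"
    using v valid_cscale by auto
  have "bgop (ps @ (k, cscale c x) # qs) us = sV c (bgop (ps @ (k, x) # qs) us)" for us
    unfolding bgop_def
  proof (rule sps_slot_scaleV[OF v' sV])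
    fix P R Q assume w: "\<forall>z\<in>set P \<union> set R \<union> set Q. valid z"
    have "single Q (\<lambda>z'. sg ((k + 1) * fst z') (comp (zg z') (\<lambda>l. sU c (fst x l)) us)) =
      sV c (single Q (\<lambda>z'. sg ((k + 1) * fst z') (comp (zg z') (fst x) us)))"
      unfolding single_hom[OF sV]
      by (rule single_cong)
        (use w in \<open>auto simp: valid_def comp_def sps_hom[OF sV] coch_scale1 additive_sg[OF sV]\<close>)
    then show "single (P @ (k, cscale c x) # R) (\<lambda>z. H z Q us) = sV c (single (P @ (k, x) # R) (\<lambda>z. H z Q us))"
      unfolding single_append_Cons H_def fst_conv snd_conv cscale_sel br_scale[of sV, OF sV] g_scale
      by (simp add: V.scale_right_distrib V.scale_right_diff_distrib)
    show "single P (\<lambda>z. H z (R @ (k, cscale c x) # Q) us) = sV c (single P (\<lambda>z. H z (R @ (k, x) # Q) us))"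
      unfolding single_hom[OF sV]
    proof (rule single_cong)
      fix z assume "P = [z]"
      then have "coch sV sV (fst z + 2) (zV z)" using w by (auto simp: valid_def)
      note b = br_slot_scale[OF this sV]
      have cl: "comp (\<lambda>l. sV c (h l)) y us = sV c (comp h y us)" for h y
        by (simp add: comp_def sps_hom[OF sV])
      show "H z (R @ (k, cscale c x) # Q) us = sV c (H z (R @ (k, x) # Q) us)"
        unfolding H_def single_append_Cons map_append list.map fst_conv snd_conv cscale_sel b cl
        by (simp add: V.scale_right_distrib V.scale_right_diff_distrib additive_sg[OF sV])
    qed
  qed simp
  moreover have "bop fst zU (ps @ (k, cscale c x) # qs) us = sU c (bop fst zU (ps @ (k, x) # qs) us)" for us
    by (rule bop_slot_scale[where s = sU, OF _ sU]) (use v' in \<open>auto simp: valid_def\<close>)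
  moreover have "bop fst zV (ps @ (k, cscale c x) # qs) us = sV c (bop fst zV (ps @ (k, x) # qs) us)" for us
    by (rule bop_slot_scale[where s = sV, OF _ sV]) (use v' in \<open>auto simp: valid_def\<close>)
  ultimately show ?thesis by (auto simp: bc_def cochain_scale_def)
qed

lemma bc_relation:
  assumes v: "\<forall>z\<in>set zs. valid z"
  shows "sps fst zs (\<lambda>I J. bc ((wt fst I + 1, bc I) # J)) = 0"
proof -
  let ?S = "sps fst zs (\<lambda>I J. bc ((wt fst I + 1, bc I) # J))"
  have add: "additive (\<lambda>x::('u, 'v) cochain. fst x us)" "additive (\<lambda>x::('u, 'v) cochain. fst (snd x) vs)"
    "additive (\<lambda>x::('u, 'v) cochain. snd (snd x) us)" for us vs
    by (simp_all add: additive_def)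
  have "fst ?S us = 0" for us
    unfolding sps_hom[OF add(1)] bc_sel
    by (rule bop_relation[where s = sU, OF _ sU]) (use v in \<open>auto simp: valid_def\<close>)
  moreover have "fst (snd ?S) vs = 0" for vs
    unfolding sps_hom[OF add(2)] bc_sel
    by (rule bop_relation[where s = sV, OF _ sV]) (use v in \<open>auto simp: valid_def\<close>)
  moreover have "snd (snd ?S) us = 0" for us
    unfolding sps_hom[OF add(3)] bc_sel bz_bc[symmetric]
    by (rule bgop_relation) (use v in auto)
  ultimately show ?thesis
    by (intro prod_eqI ext) auto
qed

end

section \<open>Twisting by the pair of brackets\<close>

locale background = vs_hom sU sV g
  for sU :: "'k::field_char_0 \<Rightarrow> 'u::ab_group_add \<Rightarrow> 'u" and sV :: "'k \<Rightarrow> 'v::ab_group_add \<Rightarrow> 'v" and g +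
  fixes mU :: "'u list \<Rightarrow> 'u" and mV :: "'v list \<Rightarrow> 'v"
  assumes mU: "coch sU sU 2 mU" and mV: "coch sV sV 2 mV"
    and jacU: "comp mU mU us = 0" and jacV: "comp mV mV vs = 0"
    and hom: "length us = 2 \<Longrightarrow> g (mU us) = mV (map g us)"
begin

text \<open>The Maurer-Cartan element. Its shifted degree is \<open>0\<close>, so it passes other
  entries without a sign; its third component is \<open>0\<close> because \<open>g\<close> already
  serves as background.\<close>

definition X0 :: "('u, 'v) inp" where
  "X0 = (0, mU, mV, \<lambda>_. 0)"

lemma X0_sel [simp]: "fst X0 = 0" "zU X0 = mU" "zV X0 = mV" "zg X0 = (\<lambda>_. 0)"
  by (simp_all add: X0_def)

lemma valid_X0: "valid X0"
  by (simp add: valid_def mU mV coch_0 sV)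

lemma bc_0:
  assumes "\<forall>z\<in>set qs. valid z"
  shows "bc ((k, 0) # qs) = 0"
proof -
  have "cscale 0 x = 0" for x :: "('u, 'v) cochain"
    by (auto simp: cochain_scale_def zero_prod_def zero_fun_def split: prod.splits)
  moreover have "valid (k, 0)" by (simp add: valid_def zero_fun_def coch_0 sU sV)
  ultimately show ?thesis
    using bc_slot_scale[of "[]" k 0 qs 0] assms by simp
qed

lemma bc_Nil: "bc [] = 0"
  by (simp add: bc_def bop_def[abs_def] bgop_def[abs_def] zero_prod_def zero_fun_def)

text \<open>The unary part of the Maurer-Cartan equation: the only possible contribution is the
  defect of \<open>g\<close> as a morphism.\<close>

lemma bc_X0: "bc [X0] = 0"
proof -
  have "g (mU us) = mV (map g us)" for us
    using hom coch_len[OF mU, of us] coch_len[OF mV, of "map g us"] additive_zero[OF g] by fastforce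
  then have "bgop [X0] = 0"
    by (auto simp: bgop_def H_def)
  then show ?thesis
    by (simp add: bc_def bop_def[abs_def] zero_prod_def zero_fun_def)
qed

text \<open>In the third component only one entry is used through its \<open>U\<close> or
  \<open>V\<close> part, so some copy of \<open>X0\<close> would have to be used through its third
  part, which is \<open>0\<close>. In the other components only lists of length two matter, and
  there the Jacobi identities apply.\<close>

lemma bc_X0_X0:
  assumes v: "\<forall>z\<in>set zs. valid z"
  shows "bc (X0 # X0 # zs) = 0"
proof -
  have "bop fst zU (X0 # X0 # zs) us = 0" "bop fst zV (X0 # X0 # zs) vs = 0" for us vs
    by (simp_all add: bop_Cons single_Cons jacU jacV)
  moreover have "bgop (X0 # X0 # zs) us = 0" for us
  proof -
    have H0: "H z (X0 # r) us = 0" if z: "valid z" for z r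
    proof -
      have "coch sV sV (fst z + 2) (zV z)" using z by (simp add: valid_def)
      then have "br g (ga (X0 # r)) (zV z) us = 0"
        using br_head_0[of sV sV "fst z + 2" "zV z" g 0 "ga r" us] by (simp only: list.map X0_sel)
      then show ?thesis by (simp add: H_Cons del: br.simps list.map)
    qed
    have "sps fst (X0 # zs) (\<lambda>p r. single p (\<lambda>z. sg (fst X0 * fst z) (H z (X0 # r) us))) = sps fst (X0 # zs) (\<lambda>p r. 0)"
    proof (rule sps_cong, rule HOL.trans[OF single_cong single_0])
      fix p r z assume "set p \<union> set r = set (X0 # zs)" "p = [z]"
      then have "z \<in> set (X0 # zs)" by auto
      then have "valid z" using v valid_X0 by (auto simp del: X0_sel)
      then show "sg (fst X0 * fst z) (H z (X0 # r) us) = 0" by (simp add: H0)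
    qed
    then show ?thesis
      unfolding bgop_Cons[of X0 "X0 # zs"] using H0[OF valid_X0] by simp
  qed
  ultimately show ?thesis
    by (auto simp: bc_def zero_prod_def)
qed

text \<open>Two or more copies of \<open>X0\<close> contribute nothing, so the twisting series stops after two terms.\<close>

definition bt :: "('u, 'v) inp list \<Rightarrow> ('u, 'v) cochain" where
  "bt zs = bc zs + bc (X0 # zs)"

lemma bt_Nil: "bt [] = 0"
  by (simp add: bt_def bc_Nil bc_X0)

lemma valid_plus: "valid (k, x) \<Longrightarrow> valid (k, y) \<Longrightarrow> valid (k, x + y)"
  by (auto simp: valid_def plus_fun_def intro!: coch_plus sU sV)

lemma valid_bt:
  assumes v: "\<forall>z\<in>set zs. valid z"
  shows "valid (wt fst zs + 1, bt zs)"
  unfolding bt_def using valid_bc[of "X0 # zs"] valid_bc[OF v] v valid_X0 by (intro valid_plus) auto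

lemma bt_swap:
  assumes v: "\<forall>z\<in>set (ps @ z # z' # qs). valid z"
  shows "bt (ps @ z # z' # qs) = sg (fst z * fst z') (bt (ps @ z' # z # qs))"
  unfolding bt_def using bc_swap[OF v] bc_swap[of "X0 # ps" z z' qs] v valid_X0 by (simp add: sg_add)

lemma bt_slot_add:
  assumes v: "\<forall>z\<in>set (ps @ (k, x) # (k, y) # qs). valid z"
  shows "bt (ps @ (k, x + y) # qs) = bt (ps @ (k, x) # qs) + bt (ps @ (k, y) # qs)"
  unfolding bt_def using bc_slot_add[OF v] bc_slot_add[of "X0 # ps" k x y qs] v valid_X0 by simp

lemma cscale_add: "cscale c (x + y) = cscale c x + cscale c y"
  by (auto simp: cochain_scale_def plus_fun_def U.scale_right_distrib V.scale_right_distrib split: prod.splits)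

lemma bt_slot_scale:
  assumes v: "\<forall>z\<in>set (ps @ (k, x) # qs). valid z"
  shows "bt (ps @ (k, cscale c x) # qs) = cscale c (bt (ps @ (k, x) # qs))"
  unfolding bt_def using bc_slot_scale[OF v] bc_slot_scale[of "X0 # ps" k x qs] v valid_X0 by (simp add: cscale_add)

lemma double_cochain: "(x::('u, 'v) cochain) + x = 0 \<Longrightarrow> x = 0"
proof -
  assume x: "x + x = 0"
  have "fst (x + x) us = 0" "fst (snd (x + x)) vs = 0" "snd (snd (x + x)) us = 0" for us vs
    unfolding x by simp_all
  then have "fst x us + fst x us = 0" "fst (snd x) vs + fst (snd x) vs = 0" "snd (snd x) us + snd (snd x) us = 0" for us vs
    by simp_all
  then have "fst x us = 0" "fst (snd x) vs = 0" "snd (snd x) us = 0" for us vs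
    using double_U double_V by blast+
  then show ?thesis by (intro prod_eqI ext) simp_all
qed

text \<open>The untwisted relations for \<open>zs\<close>, \<open>X0 # zs\<close> and
  \<open>X0 # X0 # zs\<close> account for the terms with no, one and two copies of
  \<open>X0\<close>.\<close>

lemma bt_relation:
  assumes v: "\<forall>z\<in>set zs. valid z"
  shows "sps fst zs (\<lambda>I J. bt ((wt fst I + 1, bt I) # J)) = 0"
proof -
  let ?q = "\<lambda>I. (wt fst I + 1, bc I)"
  let ?qx = "\<lambda>I. (wt fst I + 1, bc (X0 # I))"
  let ?S = "sps fst zs (\<lambda>I J. bc (X0 # ?qx I # J))"
  have val: "valid (?q I)" "valid (?qx I)" "\<forall>z\<in>set J. valid z" if "set I \<union> set J = set zs" for I J
    using valid_bc[of I] valid_bc[of "X0 # I"] that v valid_X0 by auto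
  have sw: "bc (q' # X0 # J) = bc (X0 # q' # J)" if "valid q'" "\<forall>z\<in>set J. valid z" for q' J
    using bc_swap[of "[]" q' X0 J] that valid_X0 by simp
  have 0: "sps fst zs (\<lambda>I J. bc (?q I # J)) = 0"
    by (rule bc_relation[OF v])
  have 1: "sps fst zs (\<lambda>I J. bc (?qx I # J)) + sps fst zs (\<lambda>I J. bc (X0 # ?q I # J)) = 0"
  proof -
    have "sps fst zs (\<lambda>I J. bc (?q I # X0 # J)) = sps fst zs (\<lambda>I J. bc (X0 # ?q I # J))"
      by (rule sps_cong, rule sw) (rule val; assumption)+
    then show ?thesis using bc_relation[of "X0 # zs"] v valid_X0 by simp
  qed
  \<comment> \<open>Two copies of \<open>X0\<close> can go to the inner and the outer operation in
    four ways. Both in the same operation gives \<open>0\<close>; the two mixed ways agree, so the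
    desired sum appears twice.\<close>
  have 2: "?S + ?S = 0"
  proof -
    have a: "sps fst zs (\<lambda>I J. bc ((wt fst I + 1, bc (X0 # X0 # I)) # J)) = sps fst zs (\<lambda>I J. 0)"
    proof (rule sps_cong)
      fix I J assume m: "set I \<union> set J = set zs"
      have "bc (X0 # X0 # I) = 0" by (rule bc_X0_X0) (use m v in auto)
      then show "bc ((wt fst I + 1, bc (X0 # X0 # I)) # J) = 0"
        using bc_0[of J] val(3)[OF m] by simp
    qed
    have b: "sps fst zs (\<lambda>I J. bc (?qx I # X0 # J)) = ?S"
      by (rule sps_cong, rule sw) (rule val; assumption)+
    have c: "sps fst zs (\<lambda>I J. bc (?q I # X0 # X0 # J)) = sps fst zs (\<lambda>I J. 0)"
    proof (rule sps_cong)
      fix I J assume m: "set I \<union> set J = set zs"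
      note val = val[OF m]
      have "bc (?q I # X0 # X0 # J) = bc (X0 # ?q I # X0 # J)"
        by (rule sw) (use val valid_X0 in auto)
      also have "\<dots> = bc (X0 # X0 # ?q I # J)"
        using bc_swap[of "[X0]" "?q I" X0 J] val valid_X0 by simp
      also have "\<dots> = 0" by (rule bc_X0_X0) (use val in auto)
      finally show "bc (?q I # X0 # X0 # J) = 0" .
    qed
    show ?thesis
      using bc_relation[of "X0 # X0 # zs"] v valid_X0 by (simp add: a b c)
  qed
  have "sps fst zs (\<lambda>I J. bt ((wt fst I + 1, bt I) # J)) =
    sps fst zs (\<lambda>I J. (bc (?q I # J) + (bc (?qx I # J) + bc (X0 # ?q I # J))) + bc (X0 # ?qx I # J))"
  proof (rule sps_cong)
    fix I J assume m: "set I \<union> set J = set zs"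
    note val = val[OF m]
    have "bc (ps @ (wt fst I + 1, bc I + bc (X0 # I)) # J) = bc (ps @ ?q I # J) + bc (ps @ ?qx I # J)"
      if "\<forall>z\<in>set ps. valid z" for ps
      by (rule bc_slot_add) (use val that in auto)
    from this[of "[]"] this[of "[X0]"]
    show "bt ((wt fst I + 1, bt I) # J) =
      (bc (?q I # J) + (bc (?qx I # J) + bc (X0 # ?q I # J))) + bc (X0 # ?qx I # J)"
      by (simp add: bt_def valid_X0 algebra_simps)
  qed
  also have "\<dots> = 0"
    unfolding sps_add 0 1 double_cochain[OF 2] by simp
  finally show ?thesis .
qed

end

section \<open>Permutations and unshuffles\<close>

definition invs :: "nat \<Rightarrow> (nat \<Rightarrow> nat) \<Rightarrow> (nat \<times> nat) set" where
  "invs n \<sigma> = {(a, b). a < b \<and> b < n \<and> \<sigma> b < \<sigma> a}"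

text \<open>A weighted inversion number: constant weight 1 gives the exponent of the sign, products
  of degrees give that of the Koszul sign.\<close>

definition isum :: "nat \<Rightarrow> (nat \<Rightarrow> nat \<Rightarrow> int) \<Rightarrow> (nat \<Rightarrow> nat) \<Rightarrow> int" where
  "isum n c \<sigma> = (\<Sum>(a, b)\<in>invs n \<sigma>. c (\<sigma> a) (\<sigma> b))"

lemma finite_invs [simp]: "finite (invs n \<sigma>)"
  by (rule finite_subset[of _ "{..<n} \<times> {..<n}"]) (auto simp: invs_def)

lemma invs_adjacent:
  fixes k :: nat
  assumes "Suc k < n" "\<sigma> k < \<sigma> (Suc k)"
  defines "\<tau> \<equiv> Transposition.transpose k (Suc k)"
  shows "invs n (\<sigma> \<circ> \<tau>) = insert (k, Suc k) (map_prod \<tau> \<tau> ` invs n \<sigma>)"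
    and "(k, Suc k) \<notin> map_prod \<tau> \<tau> ` invs n \<sigma>"
proof -
  have \<tau>: "\<tau> i = (if i = k then Suc k else if i = Suc k then k else i)" for i
    by (simp add: \<tau>_def Transposition.transpose_def)
  have inv: "\<tau> (\<tau> i) = i" for i by (simp add: \<tau>)
  have mono: "\<tau> a < \<tau> b" if "a < b" "(a, b) \<noteq> (k, Suc k)" for a b
    using that by (auto simp: \<tau>)
  have lt: "\<tau> b < n" if "b < n" for b using that assms(1) by (auto simp: \<tau>)
  show "(k, Suc k) \<notin> map_prod \<tau> \<tau> ` invs n \<sigma>"
  proof
    assume "(k, Suc k) \<in> map_prod \<tau> \<tau> ` invs n \<sigma>"
    then obtain a b where ab: "a < b" "k = \<tau> a" "Suc k = \<tau> b"
      unfolding invs_def by auto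
    from ab(2,3) have "a = \<tau> k" "b = \<tau> (Suc k)" by (simp_all add: inv)
    then show False using ab(1) by (simp add: \<tau>)
  qed
  show "invs n (\<sigma> \<circ> \<tau>) = insert (k, Suc k) (map_prod \<tau> \<tau> ` invs n \<sigma>)"
  proof (intro set_eqI iffI)
    fix x assume x: "x \<in> invs n (\<sigma> \<circ> \<tau>)"
    obtain a b where ab: "x = (a, b)" by (cases x)
    show "x \<in> insert (k, Suc k) (map_prod \<tau> \<tau> ` invs n \<sigma>)"
    proof (cases "x = (k, Suc k)")
      case False
      then have "(\<tau> a, \<tau> b) \<in> invs n \<sigma>"
        using x mono[of a b] lt[of b] by (auto simp: invs_def ab)
      then have "map_prod \<tau> \<tau> (\<tau> a, \<tau> b) \<in> map_prod \<tau> \<tau> ` invs n \<sigma>" by blast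
      then show ?thesis by (simp add: inv ab)
    qed simp
  next
    fix x assume "x \<in> insert (k, Suc k) (map_prod \<tau> \<tau> ` invs n \<sigma>)"
    then consider "x = (k, Suc k)" | a b where "x = (\<tau> a, \<tau> b)" "(a, b) \<in> invs n \<sigma>" by auto
    then show "x \<in> invs n (\<sigma> \<circ> \<tau>)"
    proof cases
      case 1
      then show ?thesis using assms(1,2) by (simp add: invs_def \<tau>)
    next
      case 2
      then have "(a, b) \<noteq> (k, Suc k)" using assms(2) by (auto simp: invs_def)
      then show ?thesis using 2 mono[of a b] lt[of b] by (auto simp: invs_def inv)
    qed
  qed
qed

lemma inj_transpose': "inj (Transposition.transpose a b)"
  by (metis injI transpose_involutory)

lemma isum_adjacent:
  fixes k :: nat
  assumes "Suc k < n" "\<sigma> k < \<sigma> (Suc k)"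
  shows "isum n c (\<sigma> \<circ> Transposition.transpose k (Suc k)) = c (\<sigma> (Suc k)) (\<sigma> k) + isum n c \<sigma>"
proof -
  let ?\<tau> = "Transposition.transpose k (Suc k)"
  have inj: "inj_on (map_prod ?\<tau> ?\<tau>) (invs n \<sigma>)"
    by (rule inj_on_subset[OF prod.inj_map[OF inj_transpose' inj_transpose'] subset_UNIV])
  show ?thesis
    unfolding isum_def invs_adjacent(1)[OF assms]
    using invs_adjacent(2)[OF assms]
    by (simp add: sum.reindex[OF inj] comp_def case_prod_beta) 
qed

text \<open>Bubble sort: a permutation other than the identity has a descent, and undoing the
  descent removes exactly one inversion.\<close>

lemma perm_adjacent_induct [consumes 1, case_names id adjacent]:
  assumes "\<sigma> permutes {..<n::nat}" and "P id"
    and step: "\<And>\<sigma> k. \<sigma> permutes {..<n} \<Longrightarrow> P \<sigma> \<Longrightarrow> Suc k < n \<Longrightarrow> \<sigma> k < \<sigma> (Suc k) \<Longrightarrow>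
      P (\<sigma> \<circ> Transposition.transpose k (Suc k))"
  shows "P \<sigma>"
  using assms(1)
proof (induct "card (invs n \<sigma>)" arbitrary: \<sigma>)
  case 0
  \<comment> \<open>Without inversions \<open>\<sigma>\<close> is increasing, hence nowhere below
    the identity, which forces a permutation to be the identity.\<close>
  have "k \<le> \<sigma> k" if "k < n" for k
    using that
  proof (induct k)
    case (Suc k)
    have "(k, Suc k) \<notin> invs n \<sigma>" using 0(1) finite_invs[of n \<sigma>] by (metis card_0_eq empty_iff)
    then have "\<sigma> k \<le> \<sigma> (Suc k)" using Suc(2) by (auto simp: invs_def)
    moreover have "\<sigma> k \<noteq> \<sigma> (Suc k)" using permutes_inj[OF 0(2)] by (metis injD n_not_Suc_n)
    ultimately show ?case using Suc by simp
  qed simp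
  then have id: "\<sigma> = id" by (intro permutes_natset_ge[OF 0(2)]) auto
  show ?case unfolding id by (rule assms(2))
next
  case (Suc m)
  have "\<exists>k. Suc k < n \<and> \<sigma> (Suc k) < \<sigma> k"
  proof (rule ccontr)
    assume neg: "\<not> ?thesis"
    have le: "\<sigma> a \<le> \<sigma> b" if "a \<le> b" "b < n" for a b
      using that
    proof (induct b rule: dec_induct)
      case (step b)
      then show ?case using neg by (metis Suc_lessD le_trans not_less)
    qed simp
    have "invs n \<sigma> = {}"
    proof -
      have False if "a < b" "b < n" "\<sigma> b < \<sigma> a" for a b
        using le[of a b] that by simp
      then show ?thesis by (auto simp: invs_def)
    qed
    then show False using Suc(2) by simp
  qed
  then obtain k where k: "Suc k < n" "\<sigma> (Suc k) < \<sigma> k" by blast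
  let ?\<tau> = "Transposition.transpose k (Suc k)"
  let ?\<rho> = "\<sigma> \<circ> ?\<tau>"
  have \<rho>: "?\<rho> permutes {..<n}"
    using k by (intro permutes_compose[OF permutes_swap_id Suc(3)]) auto
  have \<rho>k: "?\<rho> k < ?\<rho> (Suc k)" using k(2) by simp
  have \<sigma>: "\<sigma> = ?\<rho> \<circ> ?\<tau>" by (auto simp: fun_eq_iff)
  have "card (invs n \<sigma>) = Suc (card (invs n ?\<rho>))"
  proof -
    have "inj_on (map_prod ?\<tau> ?\<tau>) (invs n ?\<rho>)"
      by (rule inj_on_subset[OF prod.inj_map[OF inj_transpose' inj_transpose'] subset_UNIV])
    from card_image[OF this] have "card (map_prod ?\<tau> ?\<tau> ` invs n ?\<rho>) = card (invs n ?\<rho>)" .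
    moreover have "card (invs n \<sigma>) = Suc (card (map_prod ?\<tau> ?\<tau> ` invs n ?\<rho>))"
      by (subst \<sigma>, subst invs_adjacent(1)[OF k(1) \<rho>k], rule card_insert_disjoint)
        (use invs_adjacent(2)[OF k(1) \<rho>k] finite_invs in blast)+
    ultimately show ?thesis by (simp only:)
  qed
  then have "P ?\<rho>" using Suc(2) by (intro Suc(1) \<rho>) simp
  from step[OF \<rho> this k(1) \<rho>k] show ?case unfolding \<sigma>[symmetric] .
qed

lemma isum_id [simp]: "isum n c id = 0" "isum n c (\<lambda>a. a) = 0"
  by (auto simp: isum_def invs_def intro!: sum.neutral)

lemma permute_list_adjacent:
  assumes \<sigma>: "\<sigma> permutes {..<length ws}" and k: "Suc k < length ws"
  defines "ys \<equiv> permute_list \<sigma> ws"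
  shows "permute_list (\<sigma> \<circ> Transposition.transpose k (Suc k)) ws =
      take k ys @ ws ! \<sigma> (Suc k) # ws ! \<sigma> k # drop (Suc (Suc k)) ys"
    and "ys = take k ys @ ws ! \<sigma> k # ws ! \<sigma> (Suc k) # drop (Suc (Suc k)) ys"
proof -
  have len: "length ys = length ws" by (simp add: ys_def)
  have nth: "ys ! i = ws ! \<sigma> i" if "i < length ws" for i
    using permute_list_nth[OF \<sigma> that] by (simp add: ys_def)
  show "ys = take k ys @ ws ! \<sigma> k # ws ! \<sigma> (Suc k) # drop (Suc (Suc k)) ys"
    using id_take_nth_drop[of k ys] k len nth Cons_nth_drop_Suc[of "Suc k" ys] by simp
  let ?\<tau> = "Transposition.transpose k (Suc k)"
  have "?\<tau> permutes {..<length ws}" using k by (intro permutes_swap_id) auto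
  then have p: "\<sigma> \<circ> ?\<tau> permutes {..<length ws}" using \<sigma> by (rule permutes_compose)
  show "permute_list (\<sigma> \<circ> ?\<tau>) ws = take k ys @ ws ! \<sigma> (Suc k) # ws ! \<sigma> k # drop (Suc (Suc k)) ys"
  proof (rule nth_equalityI)
    show "length (permute_list (\<sigma> \<circ> ?\<tau>) ws) = length (take k ys @ ws ! \<sigma> (Suc k) # ws ! \<sigma> k # drop (Suc (Suc k)) ys)"
      using k len by simp
  next
    fix i assume "i < length (permute_list (\<sigma> \<circ> ?\<tau>) ws)"
    then have i: "i < length ws" by simp
    consider "i < k" | "i = k" | "i = Suc k" | "i > Suc k" by linarith
    then show "permute_list (\<sigma> \<circ> ?\<tau>) ws ! i = (take k ys @ ws ! \<sigma> (Suc k) # ws ! \<sigma> k # drop (Suc (Suc k)) ys) ! i"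
    proof cases
      case 4
      then obtain m where m: "i = Suc (Suc k) + m" using less_iff_Suc_add by auto
      show ?thesis
        using i k len nth[OF i] unfolding m
        by (simp add: permute_list_nth[OF p] nth_append transpose_apply_other min_def)
    qed (use i k len nth[OF i] in \<open>auto simp: permute_list_nth[OF p] nth_append transpose_apply_other min_def\<close>)
  qed
qed

text \<open>Sign rules are proved for neighbours only; the adjacent induction extends them to all
  permutations, with exponents adding up to \<open>isum\<close>. The rule is required only for
  rearrangements of \<open>ws\<close>, so its proof may use properties of these entries, such as
  validity.\<close>

lemma anti_permute:
  assumes \<Phi>: "\<And>p v w q. mset (p @ v # w # q) = mset ws \<Longrightarrow> \<Phi> (p @ v # w # q) = sg (c v w) (\<Phi> (p @ w # v # q))"
    and "\<sigma> permutes {..<length ws}"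
  shows "\<Phi> (permute_list \<sigma> ws) = sg (isum (length ws) (\<lambda>i j. c (ws ! i) (ws ! j)) \<sigma>) (\<Phi> ws)"
  using assms(2)
proof (induct rule: perm_adjacent_induct)
  case id
  then show ?case by simp
next
  case (adjacent \<sigma> k)
  let ?ys = "permute_list \<sigma> ws" and ?\<tau> = "Transposition.transpose k (Suc k)"
  have p: "\<sigma> \<circ> ?\<tau> permutes {..<length ws}"
    using adjacent(3) by (intro permutes_compose[OF permutes_swap_id adjacent(1)]) auto
  note eqs = permute_list_adjacent[OF adjacent(1,3)]
  have "\<Phi> (permute_list (\<sigma> \<circ> ?\<tau>) ws) = sg (c (ws ! \<sigma> (Suc k)) (ws ! \<sigma> k)) (\<Phi> ?ys)"
    by (subst eqs(2), subst eqs(1), rule \<Phi>, subst eqs(1)[symmetric], rule mset_permute_list[OF p])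
  then show ?case
    unfolding adjacent(2) sg_sg isum_adjacent[OF adjacent(3,4)] .
qed

lemma sign_pow_add: "sign_pow (a + b) = sign_pow a * sign_pow b"
  by (simp add: sign_pow_def)

lemma sign_isum:
  assumes "\<sigma> permutes {..<n}"
  shows "sign \<sigma> = sign_pow (isum n (\<lambda>_ _. 1) \<sigma>)"
  using assms
proof (induct rule: perm_adjacent_induct)
  case (adjacent \<sigma> k)
  have "permutation \<sigma>" using adjacent(1) permutation_permutes by blast
  then have "sign (\<sigma> \<circ> Transposition.transpose k (Suc k)) = - sign \<sigma>"
    by (subst sign_compose) (simp_all add: permutation_swap_id sign_swap_id)
  then show ?case
    unfolding isum_adjacent[OF adjacent(3,4)] adjacent(2)
    by (simp only: sign_pow_add) (simp add: sign_pow_def)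
qed (simp add: sign_pow_def)

lemma sign_pow_sum: "finite A \<Longrightarrow> (\<Prod>x\<in>A. (sign_pow (f x) :: 'r::comm_ring_1)) = sign_pow (\<Sum>x\<in>A. f x)"
  by (induct A rule: finite_induct) (simp_all add: sign_pow_add, simp add: sign_pow_def)

lemma koszul_sign_isum: "koszul_sign \<sigma> ds = sign_pow (isum (length ds) (\<lambda>i j. ds ! i * ds ! j) \<sigma>)"
  unfolding koszul_sign_def isum_def sign_pow_sum[OF finite_invs, symmetric]
  by (simp add: invs_def case_prod_beta)

lemma antisym_koszul_sign_isum:
  assumes "\<sigma> permutes {..<length ds}"
  shows "antisym_koszul_sign \<sigma> ds = (sign_pow (isum (length ds) (\<lambda>i j. 1 + ds ! i * ds ! j) \<sigma>) :: 'r::comm_ring_1)"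
proof -
  have "isum (length ds) (\<lambda>i j. 1 + ds ! i * ds ! j) \<sigma> = isum (length ds) (\<lambda>_ _. 1) \<sigma> + isum (length ds) (\<lambda>i j. ds ! i * ds ! j) \<sigma>"
    by (simp add: isum_def sum.distrib case_prod_beta)
  moreover have "of_int (sign_pow m) = (sign_pow m :: 'r)" for m by (simp add: sign_pow_def)
  ultimately show ?thesis
    by (simp add: antisym_koszul_sign_def sign_isum[OF assms] koszul_sign_isum sign_pow_add)
qed

text \<open>The Koszul exponent of moving the entries at positions in \<open>I\<close> to the front:
  one product of degrees for each entry outside \<open>I\<close> that precedes one inside.\<close>

definition split_sum :: "('a \<Rightarrow> int) \<Rightarrow> 'a list \<Rightarrow> nat set \<Rightarrow> int" where
  "split_sum par ws I = (\<Sum>t<length ws. \<Sum>s<t. if t \<in> I \<and> s \<notin> I then par (ws ! s) * par (ws ! t) else 0)"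

lemma wt_nths: "wt par (nths ws I) = (\<Sum>t<length ws. if t \<in> I then par (ws ! t) else 0)"
  by (induct ws arbitrary: I) (simp_all add: nths_Cons sum.lessThan_Suc_shift del: sum.lessThan_Suc cong: if_cong)

lemma split_sum_Cons:
  "split_sum par (x # ws) I =
     (if 0 \<in> I then 0 else par x * wt par (nths ws {j. Suc j \<in> I})) + split_sum par ws {j. Suc j \<in> I}"
  unfolding split_sum_def wt_nths
  by (simp add: sum.lessThan_Suc_shift sum.distrib sum_distrib_left if_distrib[of "(*) _"]
      del: sum.lessThan_Suc cong: if_cong)

text \<open>The successive decisions of the recursion, first or second part, amount to the choice of
  a subset of positions.\<close>

lemma sps_Pow:
  "sps par ws f = (\<Sum>I\<in>Pow {..<length ws}. sg (split_sum par ws I) (f (nths ws I) (nths ws (- I))))"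
proof (induct ws arbitrary: f)
  case (Cons x ws)
  let ?n = "length ws"
  let ?G = "\<lambda>I. sg (split_sum par (x # ws) I) (f (nths (x # ws) I) (nths (x # ws) (- I)))"
  have P: "Pow {..<Suc ?n} = (`) Suc ` Pow {..<?n} \<union> insert 0 ` (`) Suc ` Pow {..<?n}"
    unfolding lessThan_Suc_eq_insert_0 Pow_insert image_Pow_surj[OF HOL.refl] ..
  have i1: "inj_on ((`) Suc) (Pow {..<?n})"
    by (simp add: inj_on_def inj_image_eq_iff)
  have i2: "inj_on (insert 0) ((`) Suc ` Pow {..<?n})"
    by (rule inj_onI) (metis (no_types, lifting) Diff_insert_absorb Zero_not_Suc imageE)
  have "(\<Sum>I\<in>Pow {..<Suc ?n}. ?G I) = (\<Sum>J\<in>Pow {..<?n}. ?G (Suc ` J)) + (\<Sum>J\<in>Pow {..<?n}. ?G (insert 0 (Suc ` J)))"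
    unfolding P
    by (subst sum.union_disjoint) (auto simp: sum.reindex[OF i1] sum.reindex[OF i2])
  moreover have "{j. Suc j \<in> Suc ` J} = J" "{j. Suc j \<in> - (Suc ` J)} = - J"
    "{j. Suc j \<in> insert 0 (Suc ` J)} = J" "{j. Suc j \<in> - insert 0 (Suc ` J)} = - J" for J
    by auto
  ultimately show ?case
    by (simp add: Cons split_sum_Cons nths_Cons sg_sg add.commute)
qed (simp add: split_sum_def)


lemma nths_conv_sorted: "nths xs I = map ((!) xs) (sorted_list_of_set (I \<inter> {..<length xs}))"
proof -
  have "sorted_list_of_set (I \<inter> {..<length xs}) = filter (\<lambda>i. i \<in> I) [0..<length xs]"
    by (rule sorted_distinct_set_unique) (auto simp: sorted_wrt_filter)
  moreover have "nths xs I = map ((!) xs) (filter (\<lambda>i. i \<in> I) [0..<length xs])"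
  proof (induct xs rule: rev_induct)
    case (snoc x xs)
    have "map ((!) (xs @ [x])) (filter (\<lambda>i. i \<in> I) [0..<length xs]) = map ((!) xs) (filter (\<lambda>i. i \<in> I) [0..<length xs])"
      by (auto simp: nth_append)
    then show ?case using snoc by (simp add: nths_append)
  qed simp
  ultimately show ?thesis by simp
qed

lemma length_nths_subset: "I \<subseteq> {..<length xs} \<Longrightarrow> length (nths xs I) = card I"
  by (simp add: nths_conv_sorted Int_absorb2 finite_subset)

lemma unshuffles_pair:
  assumes "i \<le> n"
  shows "unshuffles [i, n - i] = {\<sigma>. \<sigma> permutes {..<n} \<and> strict_mono_on {..<i} \<sigma> \<and> strict_mono_on {i..<n} \<sigma>}"
proof -
  have "(\<forall>b<length [i, n - i]. P b) \<longleftrightarrow> P 0 \<and> P 1" for P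
    by (auto simp: less_Suc_eq)
  then show ?thesis
    unfolding unshuffles_def using assms by (simp add: atLeast0LessThan)
qed

lemma sorted_list_of_image:
  fixes f :: "nat \<Rightarrow> nat"
  assumes "strict_mono_on {a..<b} f"
  shows "map f [a..<b] = sorted_list_of_set (f ` {a..<b})"
proof -
  have "sorted_wrt (<) (map f [a..<b])"
    unfolding sorted_wrt_map
  proof (rule sorted_wrt_mono_rel[OF _ sorted_wrt_upt])
    fix x y assume "x \<in> set [a..<b]" "y \<in> set [a..<b]" "x < y"
    then show "f x < f y" using strict_mono_onD[OF assms, of x y] by simp
  qed
  then have "sorted (map f [a..<b])" "distinct (map f [a..<b])"
    by (simp_all only: strict_sorted_iff)
  then show ?thesis
    by (rule sorted_distinct_set_unique) simp_all
qed

lemma unshuffle_lists: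
  assumes "\<sigma> \<in> unshuffles [i, length ws - i]" and i: "i \<le> length ws"
  shows "take i (permute_list \<sigma> ws) = nths ws (\<sigma> ` {..<i})"
    and "drop i (permute_list \<sigma> ws) = nths ws (- \<sigma> ` {..<i})"
proof -
  let ?n = "length ws"
  have \<sigma>: "\<sigma> permutes {..<?n}" "strict_mono_on {..<i} \<sigma>" "strict_mono_on {i..<?n} \<sigma>"
    using assms unfolding unshuffles_pair[OF i] by auto
  have sub: "\<sigma> ` {..<i} \<subseteq> {..<?n}" using permutes_image[OF \<sigma>(1)] i by auto
  have c: "- \<sigma> ` {..<i} \<inter> {..<?n} = \<sigma> ` {i..<?n}"
  proof -
    have "{..<?n} = \<sigma> ` ({..<i} \<union> {i..<?n})"
      using permutes_image[OF \<sigma>(1)] i by (simp add: ivl_disj_un)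
    moreover have "\<sigma> ` {..<i} \<inter> \<sigma> ` {i..<?n} = {}"
      unfolding image_Int[OF permutes_inj[OF \<sigma>(1)], symmetric] by auto
    ultimately show ?thesis by (auto simp: image_Un)
  qed
  have "take i (permute_list \<sigma> ws) = map (\<lambda>j. ws ! \<sigma> j) [0..<i]"
    using i by (simp add: permute_list_def take_map)
  also have "\<dots> = map ((!) ws) (map \<sigma> [0..<i])" by simp
  also have "map \<sigma> [0..<i] = sorted_list_of_set (\<sigma> ` {..<i})"
    using sorted_list_of_image[of 0 i \<sigma>] \<sigma>(2) by (simp add: atLeast0LessThan)
  finally show "take i (permute_list \<sigma> ws) = nths ws (\<sigma> ` {..<i})"
    using sub by (simp add: nths_conv_sorted Int_absorb2)
  have "drop i (permute_list \<sigma> ws) = map (\<lambda>j. ws ! \<sigma> j) [i..<?n]"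
    by (simp add: permute_list_def drop_map)
  also have "\<dots> = map ((!) ws) (map \<sigma> [i..<?n])" by simp
  also have "map \<sigma> [i..<?n] = sorted_list_of_set (\<sigma> ` {i..<?n})"
    by (rule sorted_list_of_image[OF \<sigma>(3)])
  finally show "drop i (permute_list \<sigma> ws) = nths ws (- \<sigma> ` {..<i})"
    by (simp add: nths_conv_sorted c)
qed

text \<open>The image of the first block determines an unshuffle, because both blocks have to be
  listed in increasing order.\<close>

lemma unshuffles_bij:
  assumes i: "i \<le> n"
  shows "bij_betw (\<lambda>\<sigma>. \<sigma> ` {..<i}) (unshuffles [i, n - i]) {I. I \<subseteq> {..<n} \<and> card I = i}"
proof (rule bij_betwI')
  fix \<sigma> \<tau> assume m: "\<sigma> \<in> unshuffles [i, n - i]" "\<tau> \<in> unshuffles [i, n - i]"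
  show "\<sigma> ` {..<i} = \<tau> ` {..<i} \<longleftrightarrow> \<sigma> = \<tau>"
  proof
    assume e: "\<sigma> ` {..<i} = \<tau> ` {..<i}"
    have l: "permute_list \<sigma> [0..<n] = permute_list \<tau> [0..<n]"
      using unshuffle_lists[of \<sigma> i "[0..<n]"] unshuffle_lists[of \<tau> i "[0..<n]"] m i e
      by (metis append_take_drop_id diff_zero length_upt)
    have p: "\<sigma> permutes {..<n}" "\<tau> permutes {..<n}" using m unfolding unshuffles_pair[OF i] by auto
    have lt: "\<rho> j < n" if "\<rho> permutes {..<n}" "j < n" for \<rho> j
      using permutes_in_image[OF that(1), of j] that(2) by simp
    have "\<sigma> j = \<tau> j" for j
    proof (cases "j < n")
      case True
      then show ?thesis
        using arg_cong[OF l, of "\<lambda>l. l ! j"] lt[OF p(1) True] lt[OF p(2) True] by (simp add: permute_list_def)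
    next
      case False
      then show ?thesis using permutes_not_in[OF p(1), of j] permutes_not_in[OF p(2), of j] by simp
    qed
    then show "\<sigma> = \<tau>" by (rule ext)
  qed simp
next
  fix \<sigma> assume "\<sigma> \<in> unshuffles [i, n - i]"
  then have p: "\<sigma> permutes {..<n}" unfolding unshuffles_pair[OF i] by auto
  show "\<sigma> ` {..<i} \<in> {I. I \<subseteq> {..<n} \<and> card I = i}"
    using permutes_image[OF p] i card_image[OF inj_on_subset[OF permutes_inj[OF p] subset_UNIV], of "{..<i}"]
    by auto
next
  fix I assume "I \<in> {I. I \<subseteq> {..<n} \<and> card I = i}"
  then have I: "I \<subseteq> {..<n}" "card I = i" "finite I" by (auto intro: finite_subset)
  \<comment> \<open>The preimage of \<open>I\<close>: its elements in increasing order, followed by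
    those of the complement.\<close>
  define L where "L = sorted_list_of_set I @ sorted_list_of_set ({..<n} - I)"
  define \<sigma> where "\<sigma> j = (if j < n then L ! j else j)" for j
  have len: "length L = n" using I card_mono[OF _ I(1)] by (simp add: L_def card_Diff_subset)
  have dist: "distinct L" and setL: "set L = {..<n}" using I by (auto simp: L_def)
  have "bij_betw \<sigma> {..<n} {..<n}"
    using bij_betw_nth[OF dist, of "{..<n}" "{..<n}"] len setL
    by (subst bij_betw_cong[of _ _ "(!) L"]) (auto simp: \<sigma>_def lessThan_atLeast0)
  then have p: "\<sigma> permutes {..<n}" by (rule bij_imp_permutes) (simp add: \<sigma>_def)
  have nth1: "\<sigma> j = sorted_list_of_set I ! j" if "j < i" for j
    using that i I by (simp add: \<sigma>_def L_def nth_append)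
  have nth2: "\<sigma> j = sorted_list_of_set ({..<n} - I) ! (j - i)" if "i \<le> j" "j < n" for j
    using that i I by (simp add: \<sigma>_def L_def nth_append)
  have "strict_mono_on {..<i} \<sigma>"
    using I by (auto simp: strict_mono_on_def nth1 intro!: sorted_wrt_nth_less[OF strict_sorted_list_of_set])
  moreover have "strict_mono_on {i..<n} \<sigma>"
    using I len by (auto simp: strict_mono_on_def nth2 L_def intro!: sorted_wrt_nth_less[OF strict_sorted_list_of_set])
  ultimately have "\<sigma> \<in> unshuffles [i, n - i]" unfolding unshuffles_pair[OF i] using p by simp
  moreover have "\<sigma> ` {..<i} = I"
  proof -
    have "\<sigma> ` {..<i} = (!) (sorted_list_of_set I) ` {..<i}" by (rule image_cong) (auto simp: nth1)
    also have "\<dots> = I" using I nth_image[of i "sorted_list_of_set I"] by (simp add: lessThan_atLeast0)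
    finally show ?thesis .
  qed
  ultimately show "\<exists>\<sigma>\<in>unshuffles [i, n - i]. I = \<sigma> ` {..<i}" by blast
qed

text \<open>An unshuffle has inversions only between its two blocks; they correspond to the pairs of
  a position outside the chosen set and a later one inside it.\<close>

lemma isum_unshuffle:
  assumes "\<sigma> \<in> unshuffles [i, length ws - i]" and i: "i \<le> length ws"
  shows "isum (length ws) (\<lambda>a b. par (ws ! a) * par (ws ! b)) \<sigma> = split_sum par ws (\<sigma> ` {..<i})"
proof -
  let ?n = "length ws" and ?I = "\<sigma> ` {..<i}"
  have \<sigma>: "\<sigma> permutes {..<?n}" "strict_mono_on {..<i} \<sigma>" "strict_mono_on {i..<?n} \<sigma>"
    using assms unfolding unshuffles_pair[OF i] by auto
  note inj = permutes_inj[OF \<sigma>(1)]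
  have I: "\<sigma> a \<in> ?I \<longleftrightarrow> a < i" for a by (simp add: inj_image_mem_iff[OF inj])
  have lt: "\<sigma> a < ?n \<longleftrightarrow> a < ?n" for a using permutes_in_image[OF \<sigma>(1), of a] by simp
  have tr: "b < ?n" if "\<sigma> b < \<sigma> a" "a < ?n" for a b
    using order.strict_trans[of "\<sigma> b" "\<sigma> a" ?n] lt[of a] lt[of b] that by blast
  have ord: "a < i \<and> i \<le> b" if "(a, b) \<in> invs ?n \<sigma>" for a b
  proof -
    have ab: "a < b" "b < ?n" "\<sigma> b < \<sigma> a" using that by (auto simp: invs_def)
    have "\<not> b < i" using strict_mono_onD[OF \<sigma>(2), of a b] ab by auto
    moreover have "\<not> i \<le> a" using strict_mono_onD[OF \<sigma>(3), of a b] ab by auto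
    ultimately show ?thesis by auto
  qed
  have im: "map_prod \<sigma> \<sigma> ` invs ?n \<sigma> = {(t, s). t < ?n \<and> s < t \<and> t \<in> ?I \<and> s \<notin> ?I}"
  proof (intro set_eqI iffI)
    fix x assume "x \<in> map_prod \<sigma> \<sigma> ` invs ?n \<sigma>"
    then obtain a b where x: "x = (\<sigma> a, \<sigma> b)" and ab: "(a, b) \<in> invs ?n \<sigma>" by auto
    then show "x \<in> {(t, s). t < ?n \<and> s < t \<and> t \<in> ?I \<and> s \<notin> ?I}"
      using ord[OF ab] I lt by (auto simp: invs_def)
  next
    fix x assume "x \<in> {(t, s). t < ?n \<and> s < t \<and> t \<in> ?I \<and> s \<notin> ?I}"
    moreover obtain t s where x: "x = (t, s)" by (cases x)
    moreover obtain a b where "t = \<sigma> a" "s = \<sigma> b"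
      using permutes_surj[OF \<sigma>(1)] by (metis surjD)
    ultimately have "(a, b) \<in> invs ?n \<sigma>" "x = map_prod \<sigma> \<sigma> (a, b)"
      using I lt tr by (auto simp: invs_def)
    then show "x \<in> map_prod \<sigma> \<sigma> ` invs ?n \<sigma>" by blast
  qed
  have "isum ?n (\<lambda>a b. par (ws ! a) * par (ws ! b)) \<sigma> =
    (\<Sum>(t, s)\<in>map_prod \<sigma> \<sigma> ` invs ?n \<sigma>. par (ws ! t) * par (ws ! s))"
    unfolding isum_def
    by (subst sum.reindex[OF inj_on_subset[OF prod.inj_map[OF inj inj] subset_UNIV]])
      (auto intro!: sum.cong)
  also have "\<dots> = (\<Sum>(t, s)\<in>(SIGMA t:{..<?n}. {..<t}). if t \<in> ?I \<and> s \<notin> ?I then par (ws ! s) * par (ws ! t) else 0)"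
    unfolding im by (rule sum.mono_neutral_cong_left) (auto split: if_splits)
  also have "\<dots> = split_sum par ws ?I"
    unfolding split_sum_def by (subst sum.Sigma) auto
  finally show ?thesis .
qed

text \<open>The bridge between the unshuffle sums in the definitions and \<open>sps\<close>; it
  serves both the \<open>L_infinity_structure\<close> relations and the boundaries of the ternary
  generators.\<close>

lemma sum_unshuffles:
  assumes i: "i \<le> length ws"
  shows "(\<Sum>\<sigma>\<in>unshuffles [i, length ws - i].
      sg (isum (length ws) (\<lambda>a b. par (ws ! a) * par (ws ! b)) \<sigma>)
        (f (take i (permute_list \<sigma> ws)) (drop i (permute_list \<sigma> ws)))) =
    sps par ws (\<lambda>p q. if length p = i then f p q else 0)"
proof -
  let ?n = "length ws"
  let ?G = "\<lambda>I. sg (split_sum par ws I) (f (nths ws I) (nths ws (- I)))"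
  have "(\<Sum>\<sigma>\<in>unshuffles [i, ?n - i].
      sg (isum ?n (\<lambda>a b. par (ws ! a) * par (ws ! b)) \<sigma>)
        (f (take i (permute_list \<sigma> ws)) (drop i (permute_list \<sigma> ws)))) =
     (\<Sum>\<sigma>\<in>unshuffles [i, ?n - i]. ?G (\<sigma> ` {..<i}))"
    by (rule sum.cong) (simp_all add: isum_unshuffle[OF _ i] unshuffle_lists[OF _ i])
  also have "\<dots> = (\<Sum>I\<in>{I. I \<subseteq> {..<?n} \<and> card I = i}. ?G I)"
    by (rule sum.reindex_bij_betw[OF unshuffles_bij[OF i]])
  also have "\<dots> = (\<Sum>I\<in>Pow {..<?n}. sg (split_sum par ws I) (if length (nths ws I) = i then f (nths ws I) (nths ws (- I)) else 0))"
    by (rule sum.mono_neutral_cong_left) (auto simp: length_nths_subset)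
  also have "\<dots> = sps par ws (\<lambda>p q. if length p = i then f p q else 0)"
    by (rule sps_Pow[symmetric])
  finally show ?thesis .
qed

section \<open>Alternating maps as skew-symmetric functions of lists\<close>

lemma mem_listset: "xs \<in> listset As \<longleftrightarrow> length xs = length As \<and> (\<forall>i<length As. xs ! i \<in> As ! i)"
proof (induct As arbitrary: xs)
  case (Cons A As)
  show ?case
    by (cases xs) (auto simp: set_Cons_def Cons All_less_Suc2)
qed auto

lemma set_Cons_iff: "x # xs \<in> set_Cons A A' \<longleftrightarrow> x \<in> A \<and> xs \<in> A'"
  by (auto simp: set_Cons_def)

lemma mem_listset_UNIV: "xs \<in> listset (replicate n UNIV) \<longleftrightarrow> length xs = n"
  by (auto simp: mem_listset)

text \<open>Skew symmetry brings two equal entries next to each other, where it makes the value its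
  own negative; characteristic 0 then gives \<open>0\<close>.\<close>

lemma coch_not_distinct:
  assumes f: "coch s t n f" and t: "vector_space (t :: 'k::field_char_0 \<Rightarrow> 'b::ab_group_add \<Rightarrow> 'b)"
    and "\<not> distinct xs"
  shows "f xs = 0"
proof -
  interpret vector_space t by (rule t)
  have 0: "f (p @ v # r @ v # q) = 0" for p v r q
  proof (induct r arbitrary: p)
    case Nil
    have "f (p @ v # v # q) = - f (p @ v # v # q)" by (rule coch_swap[OF f])
    then have "t 2 (f (p @ v # v # q)) = 0"
      using scale_left_distrib[of 1 1 "f (p @ v # v # q)"] by (simp add: eq_neg_iff_add_eq_0)
    then show ?case by simp
  next
    case (Cons a r)
    show ?case using coch_swap[OF f, of p v a "r @ v # q"] Cons[of "p @ [a]"] by simp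
  qed
  from not_distinct_decomp[OF assms(3)] obtain p v r q where "xs = p @ [v] @ r @ [v] @ q" by auto
  then show ?thesis using 0[of p v r q] by simp
qed

text \<open>One inclusion is polarization of the vanishing on repeated entries, the other is
  \<open>coch_not_distinct\<close>.\<close>

lemma alternating_maps_eq_coch:
  assumes t: "vector_space (t :: 'k::field_char_0 \<Rightarrow> 'b::ab_group_add \<Rightarrow> 'b)"
  shows "alternating_maps s t n = {f. coch s t (int n) f}"
proof -
  interpret vector_space t by (rule t)
  have "coch s t (int n) f" if f: "f \<in> alternating_maps s t n" for f
  proof -
    have 0: "f xs = 0" if "length xs \<noteq> n" for xs
      using f that by (auto simp: alternating_maps_def multilinear_maps_def mem_listset_UNIV)
    have add: "f (p @ (v + w) # q) = f (p @ v # q) + f (p @ w # q)" for p v w q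
    proof (cases "length (p @ v # q) = n")
      case True
      have "\<forall>xs\<in>listset (replicate n UNIV). \<forall>i<n. \<forall>x y. f (xs[i := x + y]) = f (xs[i := x]) + f (xs[i := y])"
        using f by (simp add: alternating_maps_def multilinear_maps_def)
      from this[rule_format, of "p @ v # q" "length p" v w] True show ?thesis
        by (simp add: mem_listset_UNIV)
    qed (use 0 in simp)
    have scale: "f (p @ s c v # q) = t c (f (p @ v # q))" for p c v q
    proof (cases "length (p @ v # q) = n")
      case True
      have "\<forall>xs\<in>listset (replicate n UNIV). \<forall>i<n. \<forall>x c. f (xs[i := s c x]) = t c (f (xs[i := x]))"
        using f by (simp add: alternating_maps_def multilinear_maps_def)
      from this[rule_format, of "p @ v # q" "length p" c v] True show ?thesis
        by (simp add: mem_listset_UNIV)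
    qed (use 0 in simp)
    have alt: "f xs = 0" if "\<not> distinct xs" for xs using f that by (auto simp: alternating_maps_def)
    have "f (p @ v # w # q) = - f (p @ w # v # q)" for p v w q
    proof -
      have "f (p @ (v + w) # (v + w) # q) = 0" "f (p @ v # v # q) = 0" "f (p @ w # w # q) = 0"
        by (rule alt, simp)+
      moreover have "f (p @ (v + w) # (v + w) # q) = f (p @ v # v # q) + f (p @ v # w # q) + (f (p @ w # v # q) + f (p @ w # w # q))"
        using add[of "p @ [v]" v w q] add[of "p @ [w]" v w q] add[of p v w "(v + w) # q"] by simp
      ultimately show ?thesis by (simp add: eq_neg_iff_add_eq_0)
    qed
    moreover have "int (length us) = int n" if "f us \<noteq> 0" for us using 0 that by auto
    ultimately show ?thesis unfolding coch_def using add scale by blast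
  qed
  moreover have "f \<in> alternating_maps s t n" if f: "coch s t (int n) f" for f
  proof -
    have upd: "xs[i := x] = take i xs @ x # drop (Suc i) xs" if "i < length xs" for xs :: "'a list" and i x
      using that by (rule upd_conv_take_nth_drop)
    show ?thesis
      unfolding alternating_maps_def multilinear_maps_def
      using coch_not_distinct[OF f t] coch_len[OF f]
      by (auto simp: mem_listset_UNIV upd coch_add[OF f] coch_scale[OF f])
  qed
  ultimately show ?thesis by blast
qed

section \<open>The \<open>L\<^sub>\<infinity>\<close>-structure\<close>

text \<open>The exponent of the sign relating graded symmetric operations on the shifted module to
  antisymmetric operations on the original one.\<close>

primrec dec_exp :: "int list \<Rightarrow> int" where
  "dec_exp [] = 0"
| "dec_exp (d # ds) = int (length ds) * d + dec_exp ds"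

lemma dec_exp_append: "dec_exp (ds @ es) = dec_exp ds + int (length es) * sum_list ds + dec_exp es"
  by (induct ds) (simp_all add: algebra_simps)

lemma isum_cong: "\<sigma> permutes {..<n} \<Longrightarrow> (\<And>i j. i < n \<Longrightarrow> j < n \<Longrightarrow> c i j = c' i j) \<Longrightarrow> isum n c \<sigma> = isum n c' \<sigma>"
  unfolding isum_def using permutes_in_image[of \<sigma> "{..<n}"] by (intro sum.cong) (auto simp: invs_def)

text \<open>Exchanging neighbours of degrees \<open>d\<close> and \<open>e\<close> changes the
  exponent by \<open>d - e\<close>, which modulo 2 is what separates
  \<open>(d - 1) * (e - 1)\<close> from \<open>1 + d * e\<close>.\<close>

lemma sg_dec_exp_permute:
  assumes "\<sigma> permutes {..<length ds}"
  shows "sg (dec_exp (permute_list \<sigma> ds)) x = sg (isum (length ds) (\<lambda>i j. ds ! i + ds ! j) \<sigma> + dec_exp ds) x"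
  unfolding sg_sg[symmetric]
  by (rule anti_permute[OF _ assms, of "\<lambda>ds. sg (dec_exp ds) x"])
    (unfold sg_sg, rule sg_parity, auto simp: dec_exp_append)

text \<open>Rescaling each degree \<open>d\<close> by the sign \<open>(-1)\<^bsup>eps d\<^esup>\<close> brings the signs to the form they have in
  \<open>L_infinity_structure\<close> and in the master equation; \<open>neg\<close> is there because the morphism is deformed to
  \<open>g - \<kappa>\<^sub>g\<close>.\<close>

definition eps :: "int \<Rightarrow> int" where "eps d = d * (d + 1) div 2"

definition neg :: "('u, 'v::uminus) cochain \<Rightarrow> ('u, 'v) cochain" where
  "neg = (\<lambda>(x, y, z). (x, y, \<lambda>l. - z l))"

lemma neg_sel [simp]: "fst (neg x) = fst x" "fst (snd (neg x)) = fst (snd x)" "snd (snd (neg x)) = (\<lambda>l. - snd (snd x) l)"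
  by (simp_all add: neg_def split: prod.splits)

lemma additive_neg: "additive (neg :: ('u::ab_group_add, 'v::ab_group_add) cochain \<Rightarrow> _)"
  by (auto simp: additive_def neg_def plus_fun_def)

lemma neg_neg [simp]: "neg (neg (x :: ('u, 'v::ab_group_add) cochain)) = x"
  by (simp add: neg_def split: prod.splits)

definition enc :: "int \<Rightarrow> ('u::ab_group_add, 'v::ab_group_add) cochain \<Rightarrow> ('u, 'v) inp" where
  "enc d x = (d - 1, sg (eps d) (neg x))"

lemma fst_enc [simp]: "fst (enc d x) = d - 1" by (simp add: enc_def)

definition encs :: "(int \<times> ('u::ab_group_add, 'v::ab_group_add) cochain) list \<Rightarrow> ('u, 'v) inp list" where
  "encs ws = map (\<lambda>w. enc (fst w) (snd w)) ws"

lemma encs_simps [simp]: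
  "encs [] = []" "encs (w # ws) = enc (fst w) (snd w) # encs ws" "encs (p @ q) = encs p @ encs q"
  "length (encs ws) = length ws" "set (encs ws) = (\<lambda>w. enc (fst w) (snd w)) ` set ws"
  by (simp_all add: encs_def)

lemma encs_take_drop: "take i (encs ws) = encs (take i ws)" "drop i (encs ws) = encs (drop i ws)"
  by (simp_all add: encs_def take_map drop_map)

lemma encs_nth: "i < length ws \<Longrightarrow> encs ws ! i = enc (fst (ws ! i)) (snd (ws ! i))"
  by (simp add: encs_def)

lemma wt_enc: "wt fst (encs ws) = sum_list (map fst ws) - int (length ws)"
  by (induct ws) auto

context background
begin

lemma cscale_sign_pow: "cscale (sign_pow n) x = sg n x"
  by (auto simp: sign_pow_def sg_def cochain_scale_def zero_fun_def fun_eq_iff split: prod.splits)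

lemma vector_space_cscale: "vector_space cscale"
  by unfold_locales
    (intro prod_eqI ext; simp add: U.scale_right_distrib V.scale_right_distrib
      U.scale_left_distrib V.scale_left_distrib)+

text \<open>The bound is essential: below degree 1 the graded piece is zero, while nonzero cochains
  of small arity can still be \<open>valid\<close>. Hence the case distinctions on degrees
  below.\<close>

lemma S_graded_iff: "1 \<le> d \<Longrightarrow> x \<in> S_graded sU sV d \<longleftrightarrow> valid (d - 1, x)"
  by (auto simp: S_graded_def S_cochains_def valid_def alternating_maps_eq_coch U.vector_space_axioms V.vector_space_axioms
      mem_Times_iff algebra_simps)

lemma valid_sg: "valid (k, x) \<Longrightarrow> valid (k, sg n x)"
  using valid_cscale[of k x "sign_pow n"] by (simp add: cscale_sign_pow)

lemma valid_neg: "valid (k, x) \<Longrightarrow> valid (k, neg x)"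
  by (simp add: valid_def coch_uminus sV)

lemma valid_0: "valid (k, 0)"
  by (simp add: valid_def zero_fun_def coch_0 sU sV)

lemma valid_enc: "x \<in> S_graded sU sV d \<Longrightarrow> valid (enc d x)"
  by (cases "1 \<le> d")
    (auto simp: enc_def S_graded_iff intro!: valid_sg valid_neg, auto simp: S_graded_def valid_0)

lemma subspace_S_graded: "module.subspace cscale (S_graded sU sV p)"
proof -
  interpret C: vector_space cscale by (rule vector_space_cscale)
  show ?thesis
  proof (cases "1 \<le> p")
    case True
    then show ?thesis
      by (auto simp: C.subspace_def S_graded_iff valid_0 valid_plus valid_cscale)
  next
    case False
    then have "S_graded sU sV p = {0}" by (simp add: S_graded_def)
    then show ?thesis by (simp add: C.subspace_def)
  qed
qed

lemma bt_slot_sg: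
  assumes "\<forall>z\<in>set (ps @ (k, x) # qs). valid z"
  shows "bt (ps @ (k, sg n x) # qs) = sg n (bt (ps @ (k, x) # qs))"
  using bt_slot_scale[OF assms, of "sign_pow n"] by (simp add: cscale_sign_pow)

lemma bt_slot_0:
  assumes "\<forall>z\<in>set ps \<union> set qs. valid z"
  shows "bt (ps @ (k, 0) # qs) = 0"
proof -
  interpret C: vector_space cscale by (rule vector_space_cscale)
  show ?thesis using bt_slot_scale[of ps k 0 qs 0] assms valid_0 by auto
qed

abbreviation L :: "int \<Rightarrow> ('u, 'v) cochain set" where "L \<equiv> S_graded sU sV"

text \<open>The decalage sign of the list of degrees, and the rescaling \<open>eps\<close> at the
  output degree; the inputs are rescaled inside \<open>enc\<close>.\<close>

definition lop :: "int list \<Rightarrow> ('u, 'v) cochain list \<Rightarrow> ('u, 'v) cochain" where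
  "lop ds xs = (if xs \<in> listset (map L ds)
     then sg (dec_exp ds + eps (sum_list ds + 2 - int (length ds))) (neg (bt (encs (zip ds xs)))) else 0)"

lemma valid_encs: "\<forall>w\<in>set ws. snd w \<in> L (fst w) \<Longrightarrow> \<forall>z\<in>set (encs ws). valid z"
  by (auto simp: valid_enc)

lemma listset_zip:
  "xs \<in> listset (map L ds) \<longleftrightarrow> length xs = length ds \<and> (\<forall>w\<in>set (zip ds xs). snd w \<in> L (fst w))"
  by (auto simp: mem_listset all_set_conv_all_nth)

lemma lop_in_L:
  assumes xs: "xs \<in> listset (map L ds)" and ds: "ds \<noteq> []"
  shows "lop ds xs \<in> L (sum_list ds + 2 - int (length ds))"
proof -
  let ?zs = "encs (zip ds xs)"
  have v: "\<forall>z\<in>set ?zs. valid z" and len: "length xs = length ds"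
    using xs valid_encs unfolding listset_zip by blast+
  interpret C: vector_space cscale by (rule vector_space_cscale)
  show ?thesis
  proof (cases "\<forall>d\<in>set ds. 1 \<le> d")
    case True
    then have "int (length ds) \<le> sum_list ds"
      by (induct ds) auto
    then have e: "1 \<le> sum_list ds + 2 - int (length ds)" by simp
    have "valid (sum_list ds + 2 - int (length ds) - 1, bt ?zs)"
      using valid_bt[OF v] len by (simp add: wt_enc algebra_simps)
    then show ?thesis
      unfolding S_graded_iff[OF e] lop_def using xs by (simp add: valid_sg valid_neg)
  next
    case False
    \<comment> \<open>A degree below 1 forces the corresponding input to be \<open>0\<close>, so the
      value is \<open>0\<close>, which lies in the output piece whatever its degree.\<close>
    then obtain i where i: "i < length ds" "\<not> 1 \<le> ds ! i" by (auto simp: in_set_conv_nth)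
    then have "xs ! i = 0" using xs by (auto simp: mem_listset S_graded_def)
    then have "?zs ! i = (ds ! i - 1, 0)" using i len additive_zero[OF additive_neg] by (simp add: enc_def encs_nth)
    moreover have "?zs = take i ?zs @ ?zs ! i # drop (Suc i) ?zs"
      using i len by (intro id_take_nth_drop) simp
    ultimately have "bt ?zs = 0"
      using bt_slot_0[of "take i ?zs" "drop (Suc i) ?zs" "ds ! i - 1"] v
      by (metis Un_iff in_set_dropD in_set_takeD)
    then have "lop ds xs = 0" by (simp add: lop_def additive_zero[OF additive_neg])
    then show ?thesis using C.subspace_0[OF subspace_S_graded] by simp
  qed
qed

lemma lop_multilinear: "lop ds \<in> multilinear_maps cscale cscale (map L ds)"
proof -
  interpret C: vector_space cscale by (rule vector_space_cscale)
  let ?n = "dec_exp ds + eps (sum_list ds + 2 - int (length ds))"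
  have neg_cscale: "neg (cscale c x) = cscale c (neg x)" for c x
    by (intro prod_eqI) (auto simp: fun_eq_iff)
  have sg_cscale: "sg n (cscale c x) = cscale c (sg n x)" for n c x
    by (simp add: sg_def)
  have upd: "encs (zip ds (xs[i := x])) = take i (encs (zip ds xs)) @ enc (ds ! i) x # drop (Suc i) (encs (zip ds xs))"
    if "i < length ds" "length xs = length ds" for xs i x
  proof -
    have "zip ds (xs[i := x]) = (zip ds xs)[i := (ds ! i, x)]"
      using zip_update[of ds i "ds ! i" xs x] by simp
    then have "zip ds (xs[i := x]) = take i (zip ds xs) @ (ds ! i, x) # drop (Suc i) (zip ds xs)"
      using that by (simp add: upd_conv_take_nth_drop)
    then show ?thesis by (simp only: encs_simps fst_conv snd_conv encs_take_drop)
  qed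
  have mem: "xs[i := x] \<in> listset (map L ds)" if "xs \<in> listset (map L ds)" "x \<in> L (ds ! i)" for xs i x
    using that unfolding mem_listset by (simp, metis nth_list_update_eq nth_list_update_neq)
  have v: "\<forall>z\<in>set (take i (encs (zip ds xs))) \<union> set (drop (Suc i) (encs (zip ds xs))). valid z"
    if "xs \<in> listset (map L ds)" for xs i
    using that valid_encs[of "zip ds xs"] unfolding listset_zip by (blast dest: in_set_takeD in_set_dropD)
  have "lop ds (xs[i := x + y]) = lop ds (xs[i := x]) + lop ds (xs[i := y])"
    if xs: "xs \<in> listset (map L ds)" and i: "i < length ds" and x: "x \<in> L (ds ! i)" and y: "y \<in> L (ds ! i)" for xs i x y
  proof -
    have len: "length xs = length ds" using xs by (simp add: mem_listset)
    have "x + y \<in> L (ds ! i)" by (rule C.subspace_add[OF subspace_S_graded x y])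
    moreover have "enc (ds ! i) (x + y) = (ds ! i - 1, sg (eps (ds ! i)) (neg x) + sg (eps (ds ! i)) (neg y))"
      by (simp add: enc_def additive.add[OF additive_neg] sg_add)
    ultimately show ?thesis
      using v[OF xs, of i] mem[OF xs] x y valid_enc[OF x] valid_enc[OF y]
      by (simp add: lop_def upd[OF i len])
        (subst bt_slot_add, auto simp: enc_def additive.add[OF additive_neg] sg_add)
  qed
  moreover have "lop ds (xs[i := cscale c x]) = cscale c (lop ds (xs[i := x]))"
    if xs: "xs \<in> listset (map L ds)" and i: "i < length ds" and x: "x \<in> L (ds ! i)" for xs i x c
  proof -
    have len: "length xs = length ds" using xs by (simp add: mem_listset)
    have "cscale c x \<in> L (ds ! i)" by (rule C.subspace_scale[OF subspace_S_graded x])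
    moreover have "enc (ds ! i) (cscale c x) = (ds ! i - 1, cscale c (sg (eps (ds ! i)) (neg x)))"
      by (simp add: enc_def neg_cscale sg_cscale)
    ultimately show ?thesis
      using v[OF xs, of i] mem[OF xs] x valid_enc[OF x]
      by (simp add: lop_def upd[OF i len])
        (subst bt_slot_scale, auto simp: enc_def neg_cscale sg_cscale)
  qed
  moreover have "lop ds xs = 0" if "xs \<notin> listset (map L ds)" for xs
    using that by (simp add: lop_def)
  ultimately show ?thesis
    by (simp add: multilinear_maps_def)
qed

lemma listset_permute:
  assumes "xs \<in> listset (map L ds)" "\<sigma> permutes {..<length ds}"
  shows "permute_list \<sigma> xs \<in> listset (map L (permute_list \<sigma> ds))"
  using assms permutes_in_image[OF assms(2)]
  by (auto simp: mem_listset permute_list_nth)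

lemma sum_list_permute: "\<sigma> permutes {..<length ds} \<Longrightarrow> sum_list (permute_list \<sigma> ds) = sum_list (ds :: int list)"
  by (metis mset_permute_list sum_mset_sum_list)

text \<open>The sign \<open>(d - 1) * (e - 1)\<close> of the shifted operation and the change
  \<open>d - e\<close> of \<open>dec_exp\<close> add up to \<open>1 + d * e\<close> modulo 2, the
  antisymmetric Koszul sign of two neighbours.\<close>

lemma lop_antisym:
  assumes xs: "xs \<in> listset (map L ds)" and \<sigma>: "\<sigma> permutes {..<length ds}"
  shows "lop (permute_list \<sigma> ds) (permute_list \<sigma> xs) = cscale (antisym_koszul_sign \<sigma> ds) (lop ds xs)"
proof -
  let ?ws = "zip ds xs"
  have len: "length xs = length ds" and w: "\<forall>w\<in>set ?ws. snd w \<in> L (fst w)" using xs unfolding listset_zip by auto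
  let ?\<Phi> = "\<lambda>ws. sg (dec_exp (map fst ws)) (bt (encs ws))"
  have "?\<Phi> (permute_list \<sigma> ?ws) = sg (isum (length ?ws) (\<lambda>i j. 1 + fst (?ws ! i) * fst (?ws ! j)) \<sigma>) (?\<Phi> ?ws)"
  proof (rule anti_permute)
    fix p v w q assume m: "mset (p @ v # w # q) = mset ?ws"
    have "\<forall>z\<in>set (encs (p @ v # w # q)). valid z"
      using valid_encs[OF w] by (simp only: encs_simps(5) mset_eq_setD[OF m])
    then have "bt (encs p @ enc (fst v) (snd v) # enc (fst w) (snd w) # encs q) =
       sg (fst (enc (fst v) (snd v)) * fst (enc (fst w) (snd w))) (bt (encs p @ enc (fst w) (snd w) # enc (fst v) (snd v) # encs q))"
      by (intro bt_swap) simp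
    then show "?\<Phi> (p @ v # w # q) = sg (1 + fst v * fst w) (?\<Phi> (p @ w # v # q))"
      by (simp add: sg_sg dec_exp_append) (rule sg_parity, auto)
  qed (use \<sigma> len in simp)
  also have "isum (length ?ws) (\<lambda>i j. 1 + fst (?ws ! i) * fst (?ws ! j)) \<sigma> = isum (length ds) (\<lambda>i j. 1 + ds ! i * ds ! j) \<sigma>"
    using len \<sigma> by (simp, intro isum_cong) auto
  also have "permute_list \<sigma> ?ws = zip (permute_list \<sigma> ds) (permute_list \<sigma> xs)"
    by (rule permute_list_zip[OF \<sigma>]) (simp_all add: len)
  finally have eq: "sg (dec_exp (map fst (zip (permute_list \<sigma> ds) (permute_list \<sigma> xs)))) (bt (encs (zip (permute_list \<sigma> ds) (permute_list \<sigma> xs)))) =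
    sg (isum (length ds) (\<lambda>i j. 1 + ds ! i * ds ! j) \<sigma>) (sg (dec_exp (map fst ?ws)) (bt (encs ?ws)))" .
  have c: "sg (a + b) (neg x) = neg (sg b (sg a x))" for a b and x :: "('u, 'v) cochain"
    by (simp add: additive_sg[OF additive_neg] sg_sg add.commute)
  have c': "sg a (neg x) = neg (sg a x)" for a and x :: "('u, 'v) cochain"
    by (simp add: additive_sg[OF additive_neg])
  have c2: "sg a (sg b (sg c x)) = sg b (sg a (sg c x))" for a b c and x :: "('u, 'v) cochain"
    by (simp add: sg_sg algebra_simps)
  show ?thesis
    using listset_permute[OF xs \<sigma>] xs len \<sigma> eq
    by (simp add: lop_def antisym_koszul_sign_isum[OF \<sigma>] cscale_sign_pow sum_list_permute c)
      (simp only: c' c2)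
qed

text \<open>The rescaling of the inner output cancels against that in \<open>enc e\<close>. The
  degree \<open>e\<close> differs from the sum of the degrees of \<open>p\<close> by
  \<open>2 - length p\<close>, and \<open>dec_exp\<close> multiplies this by
  \<open>length q\<close>; this is the origin of the product of lengths.\<close>

lemma lop_nested:
  assumes w: "\<forall>w\<in>set (p @ q). snd w \<in> L (fst w)" and p: "p \<noteq> []"
  defines "e \<equiv> sum_list (map fst p) + 2 - int (length p)"
  shows "lop (e # map fst q) (lop (map fst p) (map snd p) # map snd q) =
    sg (dec_exp (map fst (p @ q)) + int (length p) * int (length q) + eps (sum_list (map fst (p @ q)) + 3 - int (length (p @ q))))
      (neg (bt ((wt fst (encs p) + 1, bt (encs p)) # encs q)))"
proof -
  have z: "zip (map fst r) (map snd r) = r" for r :: "(int \<times> ('u, 'v) cochain) list"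
    by (simp add: zip_map_fst_snd)
  have pl: "map snd p \<in> listset (map L (map fst p))" and ql: "map snd q \<in> listset (map L (map fst q))"
    using w unfolding listset_zip by (auto simp: z)
  have y: "lop (map fst p) (map snd p) \<in> L e"
    using lop_in_L[OF pl] p by (simp add: e_def)
  then have l: "lop (map fst p) (map snd p) # map snd q \<in> listset (map L (e # map fst q))"
    using ql by (simp add: set_Cons_iff)
  have v: "\<forall>z\<in>set (encs p). valid z" "\<forall>z\<in>set (encs q). valid z"
    using w by (auto simp: valid_enc)
  have "enc e (lop (map fst p) (map snd p)) = (wt fst (encs p) + 1, sg (dec_exp (map fst p)) (bt (encs p)))"
    using pl by (simp add: enc_def lop_def z wt_enc e_def additive_sg[OF additive_neg] sg_sg)
      (auto simp: sg_def)
  then have "lop (e # map fst q) (lop (map fst p) (map snd p) # map snd q) =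
     sg (dec_exp (e # map fst q) + eps (sum_list (e # map fst q) + 2 - int (length (e # map fst q))))
       (neg (bt ([] @ (wt fst (encs p) + 1, sg (dec_exp (map fst p)) (bt (encs p))) # encs q)))"
    unfolding lop_def[of "e # map fst q"] using l by (simp add: z)
  also have "\<dots> = sg (dec_exp (e # map fst q) + dec_exp (map fst p) + eps (sum_list (e # map fst q) + 2 - int (length (e # map fst q))))
       (neg (bt ((wt fst (encs p) + 1, bt (encs p)) # encs q)))"
    by (subst bt_slot_sg) (use v valid_bt[OF v(1)] in \<open>auto simp: additive_sg[OF additive_neg] sg_sg algebra_simps\<close>)
  also have "eps (sum_list (e # map fst q) + 2 - int (length (e # map fst q))) = eps (sum_list (map fst (p @ q)) + 3 - int (length (p @ q)))"
    by (rule arg_cong[where f = eps]) (simp add: e_def)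
  finally show ?thesis
    by (simp add: dec_exp_append e_def, intro sg_parity) (auto simp: algebra_simps)
qed

lemma sum_sps: "(\<Sum>i\<in>A. sps par zs (F i)) = sps par zs (\<lambda>p q. \<Sum>i\<in>A. F i p q)"
  by (induct A rule: infinite_finite_induct) (simp_all add: sps_add)

text \<open>Since \<open>j - 1\<close> is the length of the second part, the factor
  \<open>(- 1) ^ (i * (j - 1))\<close> cancels the product of lengths in \<open>lop_nested\<close>.
  Up to a common sign each term then carries the Koszul sign for shifted degrees, so the sum is that
  of \<open>bt_relation\<close>.\<close>

lemma lop_relation:
  assumes xs: "xs \<in> listset (map L ds)" and ds: "ds \<noteq> []"
  shows "(\<Sum>(i, j)\<in>{(i, j). 1 \<le> i \<and> 1 \<le> j \<and> i + j = length ds + 1}.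
      \<Sum>\<sigma>\<in>unshuffles [i, length ds - i].
        let ds' = permute_list \<sigma> ds; xs' = permute_list \<sigma> xs in
        cscale (antisym_koszul_sign \<sigma> ds * (- 1) ^ (i * (j - 1)))
          (lop ((sum_list (take i ds') + 2 - int i) # drop i ds')
             (lop (take i ds') (take i xs') # drop i xs'))) = 0"
proof -
  let ?n = "length ds" and ?ws = "zip ds xs"
  let ?zs = "encs ?ws"
  let ?F = "\<lambda>P Q. bt ((wt fst P + 1, bt P) # Q)"
  let ?E = "eps (sum_list ds + 3 - int ?n) + dec_exp ds"
  have len: "length xs = ?n" and w: "\<forall>w\<in>set ?ws. snd w \<in> L (fst w)" using xs unfolding listset_zip by auto
  have summand: "cscale (antisym_koszul_sign \<sigma> ds * (- 1) ^ (i * (j - 1)))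
      (lop ((sum_list (take i (permute_list \<sigma> ds)) + 2 - int i) # drop i (permute_list \<sigma> ds))
        (lop (take i (permute_list \<sigma> ds)) (take i (permute_list \<sigma> xs)) # drop i (permute_list \<sigma> xs))) =
     neg (sg ?E (sg (isum (length ?zs) (\<lambda>a b. fst (?zs ! a) * fst (?zs ! b)) \<sigma>)
       (?F (take i (permute_list \<sigma> ?zs)) (drop i (permute_list \<sigma> ?zs)))))"
    if i: "1 \<le> i" "1 \<le> j" "i + j = ?n + 1" and \<sigma>: "\<sigma> permutes {..<?n}" for i j \<sigma>
  proof -
    let ?ws' = "permute_list \<sigma> ?ws"
    let ?p = "take i ?ws'" and ?q = "drop i ?ws'"
    have ws': "?ws' = zip (permute_list \<sigma> ds) (permute_list \<sigma> xs)"
      by (rule permute_list_zip[OF \<sigma>]) (simp_all add: len)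
    have fs: "map fst ?ws' = permute_list \<sigma> ds" "map snd ?ws' = permute_list \<sigma> xs"
      by (simp_all add: ws' len)
    have f: "map fst ?p = take i (permute_list \<sigma> ds)" "map fst ?q = drop i (permute_list \<sigma> ds)"
      "map snd ?p = take i (permute_list \<sigma> xs)" "map snd ?q = drop i (permute_list \<sigma> xs)"
      by (simp_all only: take_map[symmetric] drop_map[symmetric] fs)
    have pl: "length ?p = i" "int (length ?q) = int j - 1" using i len by auto
    have wp: "\<forall>w\<in>set (?p @ ?q). snd w \<in> L (fst w)"
      using w \<sigma> len by (simp add: set_permute_list)
    have e: "encs ?p = take i (permute_list \<sigma> ?zs)" "encs ?q = drop i (permute_list \<sigma> ?zs)"
      unfolding encs_take_drop[symmetric] encs_def
      using permute_list_map[of \<sigma> ?ws "\<lambda>w. enc (fst w) (snd w)"] \<sigma> len by (simp_all add: take_map drop_map)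
    have "?p \<noteq> []" using pl(1) i(1) by (metis list.size(3) not_one_le_zero)
    from lop_nested[OF wp this] have nested:
      "lop ((sum_list (take i (permute_list \<sigma> ds)) + 2 - int i) # drop i (permute_list \<sigma> ds))
        (lop (take i (permute_list \<sigma> ds)) (take i (permute_list \<sigma> xs)) # drop i (permute_list \<sigma> xs)) =
      sg (dec_exp (permute_list \<sigma> ds) + int i * (int j - 1) + eps (sum_list ds + 3 - int ?n))
        (neg (?F (take i (permute_list \<sigma> ?zs)) (drop i (permute_list \<sigma> ?zs))))"
      unfolding pl f append_take_drop_id fs e by (simp add: sum_list_permute[OF \<sigma>] len)
    have sp: "(- 1) ^ m = (sign_pow (int m) :: 'k)" for m
      by (simp add: sign_pow_def minus_one_power_iff)
    have ij: "int (i * (j - 1)) = int i * (int j - 1)" using i by (simp add: of_nat_diff)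
    let ?I1 = "isum ?n (\<lambda>i j. 1 + ds ! i * ds ! j) \<sigma>" and ?I2 = "isum ?n (\<lambda>i j. ds ! i + ds ! j) \<sigma>"
    \<comment> \<open>The shifted Koszul exponent is the antisymmetric one minus the change of the
      decalage exponent under \<open>\<sigma>\<close>.\<close>
    have I: "isum (length ?zs) (\<lambda>a b. fst (?zs ! a) * fst (?zs ! b)) \<sigma> = ?I1 - ?I2"
    proof -
      have "isum (length ?zs) (\<lambda>a b. fst (?zs ! a) * fst (?zs ! b)) \<sigma> = isum ?n (\<lambda>a b. (ds ! a - 1) * (ds ! b - 1)) \<sigma>"
        using len \<sigma> by (simp, intro isum_cong) (auto simp: encs_nth)
      also have "\<dots> = ?I1 - ?I2"
        unfolding isum_def sum_subtractf[symmetric] by (rule sum.cong) (auto simp: algebra_simps)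
      finally show ?thesis .
    qed
    have D: "sg (a + (dec_exp (permute_list \<sigma> ds) + b)) x = sg (a + (?I2 + dec_exp ds + b)) x" for a b and x :: "('u, 'v) cochain"
      using sg_dec_exp_permute[OF \<sigma>, of "sg (a + b) x"] by (simp add: sg_sg algebra_simps)
    show ?thesis
      unfolding nested sp sign_pow_add[symmetric] antisym_koszul_sign_isum[OF \<sigma>] cscale_sign_pow sg_sg ij I
        additive_sg[OF additive_neg]
      unfolding D add.assoc[of "dec_exp _"]
      by (rule sg_parity) auto
  qed
  have "(\<Sum>(i, j)\<in>{(i, j). 1 \<le> i \<and> 1 \<le> j \<and> i + j = ?n + 1}.
      \<Sum>\<sigma>\<in>unshuffles [i, ?n - i].
        let ds' = permute_list \<sigma> ds; xs' = permute_list \<sigma> xs in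
        cscale (antisym_koszul_sign \<sigma> ds * (- 1) ^ (i * (j - 1)))
          (lop ((sum_list (take i ds') + 2 - int i) # drop i ds')
             (lop (take i ds') (take i xs') # drop i xs'))) =
    (\<Sum>(i, j)\<in>{(i, j). 1 \<le> i \<and> 1 \<le> j \<and> i + j = ?n + 1}.
      neg (sg ?E (sps fst ?zs (\<lambda>I J. if length I = i then ?F I J else 0))))"
  proof (rule sum.cong[OF HOL.refl], clarify, unfold Let_def)
    fix i j assume i: "1 \<le> i" "1 \<le> j" "i + j = ?n + 1"
    then have il: "i \<le> length ?zs" using len by simp
    have "(\<Sum>\<sigma>\<in>unshuffles [i, ?n - i]. cscale (antisym_koszul_sign \<sigma> ds * (- 1) ^ (i * (j - 1)))
      (lop ((sum_list (take i (permute_list \<sigma> ds)) + 2 - int i) # drop i (permute_list \<sigma> ds))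
        (lop (take i (permute_list \<sigma> ds)) (take i (permute_list \<sigma> xs)) # drop i (permute_list \<sigma> xs)))) =
      (\<Sum>\<sigma>\<in>unshuffles [i, length ?zs - i]. neg (sg ?E (sg (isum (length ?zs) (\<lambda>a b. fst (?zs ! a) * fst (?zs ! b)) \<sigma>)
       (?F (take i (permute_list \<sigma> ?zs)) (drop i (permute_list \<sigma> ?zs))))))"
      using i len by (intro sum.cong summand) (auto simp: unshuffles_def)
    also have "\<dots> = neg (sg ?E (sps fst ?zs (\<lambda>I J. if length I = i then ?F I J else 0)))"
      unfolding additive.sum[OF additive_neg, symmetric] additive.sum[OF additive_sgI, symmetric]
        sum_unshuffles[OF il, where par = fst and f = ?F] ..
    finally show "(\<Sum>\<sigma>\<in>unshuffles [i, ?n - i]. cscale (antisym_koszul_sign \<sigma> ds * (- 1) ^ (i * (j - 1)))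
      (lop ((sum_list (take i (permute_list \<sigma> ds)) + 2 - int i) # drop i (permute_list \<sigma> ds))
        (lop (take i (permute_list \<sigma> ds)) (take i (permute_list \<sigma> xs)) # drop i (permute_list \<sigma> xs)))) =
      neg (sg ?E (sps fst ?zs (\<lambda>I J. if length I = i then ?F I J else 0)))" .
  qed
  also have "\<dots> = (\<Sum>i\<in>{1..?n}. neg (sg ?E (sps fst ?zs (\<lambda>I J. if length I = i then ?F I J else 0))))"
    by (rule sum.reindex_bij_witness[of _ "\<lambda>i. (i, ?n + 1 - i)" fst]) auto
  also have "\<dots> = neg (sg ?E (sps fst ?zs (\<lambda>I J. \<Sum>i\<in>{1..?n}. if length I = i then ?F I J else 0)))"
    unfolding additive.sum[OF additive_neg, symmetric] additive.sum[OF additive_sgI, symmetric] sum_sps ..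
  \<comment> \<open>Each nonempty \<open>I\<close> is counted once, at \<open>i = length I\<close>.
    The empty one is absent on the left and contributes \<open>0\<close> on the right, because
    \<open>bt [] = 0\<close>.\<close>
  also have "sps fst ?zs (\<lambda>I J. \<Sum>i\<in>{1..?n}. if length I = i then ?F I J else 0) = sps fst ?zs ?F"
  proof (rule sps_cong)
    fix I J :: "('u, 'v) inp list" assume a: "length I + length J = length ?zs" "set I \<union> set J = set ?zs"
    show "(\<Sum>i\<in>{1..?n}. if length I = i then ?F I J else 0) = ?F I J"
    proof (cases "I = []")
      case True
      then have "\<forall>z\<in>set J. valid z" using a(2) valid_encs[OF w] by auto
      then show ?thesis using True bt_slot_0[of "[]" J 1] by (simp add: bt_Nil)
    next
      case False
      then have "1 \<le> length I" by (cases I) auto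
      then have "length I \<in> {1..?n}" using a(1) len by simp
      then show ?thesis by (simp add: sum.delta)
    qed
  qed
  also have "\<dots> = 0" by (rule bt_relation[OF valid_encs[OF w]])
  finally show ?thesis by (simp add: additive_zero[OF additive_neg])
qed

lemma L_infinity_lop: "L_infinity_structure cscale L lop"
  unfolding L_infinity_structure_def
  using vector_space_cscale subspace_S_graded lop_multilinear lop_in_L lop_antisym lop_relation by blast

end

text \<open>Moving the entry at position \<open>t\<close> to the front takes \<open>t\<close>
  transpositions; positions count from 0.\<close>

lemma sps_single_sum:
  "sps (\<lambda>_. 1) us (\<lambda>p q. single p (\<lambda>u. F u q)) = (\<Sum>t<length us. sg (int t) (F (us ! t) (nths us (- {t}))))"
proof (induct us arbitrary: F)
  case (Cons u us)
  have "sps (\<lambda>_. 1) us (\<lambda>p q. sg (int (length p)) (single p (\<lambda>u'. F u' (u # q)))) =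
    sps (\<lambda>_. 1) us (\<lambda>p q. single p (\<lambda>u'. sg 1 (F u' (u # q))))"
    unfolding single_sg by (rule sps_cong, rule single_cong) simp
  moreover have "nths (u # us) (- {Suc t}) = u # nths us (- {t})" for t
    by (auto simp: nths_Cons intro!: arg_cong[where f = "nths us"])
  moreover have "nths (u # us) (- {0}) = us"
    by (simp add: nths_Cons nths_all)
  ultimately show ?case
    by (simp add: sps_single_Cons Cons sum.lessThan_Suc_shift sg_sg add.commute del: sum.lessThan_Suc)
qed simp

section \<open>The differential and the master equation\<close>

definition pair :: "'z list \<Rightarrow> ('z \<Rightarrow> 'z \<Rightarrow> 'b::zero) \<Rightarrow> 'b" where
  "pair p h = (case p of [z, z'] \<Rightarrow> h z z' | _ \<Rightarrow> 0)"

lemma pair_Cons: "pair (z # p) h = single p (h z)"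
  by (auto simp: pair_def single_def split: list.splits)

text \<open>Moving the entries at positions \<open>s < t\<close> to the front takes
  \<open>s + (t - 1)\<close> transpositions, because the second need not pass the first.\<close>

lemma sps_pair_sum:
  fixes F :: "'a \<Rightarrow> 'a \<Rightarrow> 'a list \<Rightarrow> 'b::ab_group_add"
  shows "sps (\<lambda>_. 1) us (\<lambda>p q. pair p (\<lambda>u v. F u v q)) =
   (\<Sum>(s, t)\<in>{(s, t). s < t \<and> t < length us}. sg (int s + int t - 1) (F (us ! s) (us ! t) (nths us (- {s, t}))))"
proof (induct us arbitrary: F)
  case (Cons u us)
  let ?n = "length us"
  have S: "{(s, t). s < t \<and> t < Suc ?n} = (\<lambda>t. (0, Suc t)) ` {..<?n} \<union> map_prod Suc Suc ` {(s, t). s < t \<and> t < ?n}"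
    by (auto simp: image_iff less_Suc_eq_0_disj)
  have fin: "finite {(s, t). s < t \<and> t < ?n}"
    by (rule finite_subset[of _ "{..<?n} \<times> {..<?n}"]) auto
  have n0: "nths (u # us) (- {0, Suc t}) = nths us (- {t})" and n1: "nths (u # us) (- {Suc s, Suc t}) = u # nths us (- {s, t})" for s t
    by (auto simp: nths_Cons intro!: arg_cong[where f = "nths us"])
  have e: "sps (\<lambda>_. 1) us (\<lambda>p q. sg (int (length p)) (pair p (\<lambda>v w. F v w (u # q)))) =
    sps (\<lambda>_. 1) us (\<lambda>p q. pair p (\<lambda>v w. F v w (u # q)))"
    by (rule sps_cong) (auto simp: pair_def sg_even split: list.splits)
  have "sps (\<lambda>_. 1) (u # us) (\<lambda>p q. pair p (\<lambda>u v. F u v q)) =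
     (\<Sum>t<?n. sg (int t) (F u (us ! t) (nths us (- {t})))) +
     (\<Sum>(s, t)\<in>{(s, t). s < t \<and> t < ?n}. sg (int s + int t - 1) (F (us ! s) (us ! t) (u # nths us (- {s, t}))))"
    by (simp add: pair_Cons sps_single_sum e Cons[of "\<lambda>v w q. F v w (u # q)"])
  also have "\<dots> = (\<Sum>(s, t)\<in>{(s, t). s < t \<and> t < Suc ?n}. sg (int s + int t - 1) (F ((u # us) ! s) ((u # us) ! t) (nths (u # us) (- {s, t}))))"
    unfolding S
  proof (subst sum.union_disjoint)
    show "(\<lambda>t. (0, Suc t)) ` {..<?n} \<inter> map_prod Suc Suc ` {(s, t). s < t \<and> t < ?n} = {}" by auto
    have i: "inj_on (\<lambda>t. (0::nat, Suc t)) {..<?n}" "inj_on (map_prod Suc Suc) {(s, t). s < t \<and> t < ?n}"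
      by (auto simp: inj_on_def)
    have "sg (int (Suc s) + int (Suc t) - 1) x = sg (int s + int t - 1) x" for s t and x :: 'b
      by (rule sg_parity) auto
    then show "(\<Sum>t<?n. sg (int t) (F u (us ! t) (nths us (- {t})))) +
       (\<Sum>(s, t)\<in>{(s, t). s < t \<and> t < ?n}. sg (int s + int t - 1) (F (us ! s) (us ! t) (u # nths us (- {s, t})))) =
      (\<Sum>(s, t)\<in>(\<lambda>t. (0, Suc t)) ` {..<?n}. sg (int s + int t - 1) (F ((u # us) ! s) ((u # us) ! t) (nths (u # us) (- {s, t})))) +
      (\<Sum>(s, t)\<in>map_prod Suc Suc ` {(s, t). s < t \<and> t < ?n}. sg (int s + int t - 1) (F ((u # us) ! s) ((u # us) ! t) (nths (u # us) (- {s, t}))))"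
      unfolding sum.reindex[OF i(1)] sum.reindex[OF i(2)]
      by (intro arg_cong2[where f = plus] sum.cong) (auto simp del: of_nat_Suc simp: n0 n1, simp)
  qed (use fin in auto)
  finally show ?case by simp
qed (simp add: pair_def)

lemma scale_power_minus_one:
  assumes "vector_space (s :: 'k::field \<Rightarrow> 'a::ab_group_add \<Rightarrow> 'a)"
  shows "s ((- 1) ^ n) x = sg (int n) x"
proof -
  interpret vector_space s by (rule assms)
  show ?thesis by (simp add: sg_def minus_one_power_iff)
qed

text \<open>The list function of a binary operation; it vanishes on lists of length other than \<open>2\<close>.\<close>

definition binary :: "('a \<Rightarrow> 'a \<Rightarrow> 'b::zero) \<Rightarrow> 'a list \<Rightarrow> 'b" where
  "binary h us = pair us h"

lemma binary_simps [simp]: "binary h [x, y] = h x y"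
  by (simp add: binary_def pair_def)

text \<open>\<open>h\<close> is the bracket as a function of lists, so that the adjoint modules and
  \<open>V\<close> as a \<open>U\<close>-module are covered at once. The factor
  \<open>sg (int n)\<close> moves the acting argument past the \<open>n\<close> arguments of
  \<open>\<phi>\<close>; the minus sign in the hypothesis on \<open>h\<close> accounts for positions
  counted from 1.\<close>

lemma ce_differential_eq:
  fixes act :: "'a::ab_group_add \<Rightarrow> 'w::ab_group_add \<Rightarrow> 'w" and n :: nat
  assumes sW: "vector_space (sW :: 'k::field \<Rightarrow> 'w \<Rightarrow> 'w)"
    and \<phi>: "coch s sW (int n) \<phi>" and h: "\<And>p u. h (\<phi> p # map g [u]) = - act u (\<phi> p)"
    and h0: "\<And>l. h (0 # l) = 0" and h1: "\<And>p q. length q \<noteq> 1 \<Longrightarrow> h (\<phi> p # map g q) = 0"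
  shows "ce_differential sW lb act n \<phi> us =
    sg (int n) (sps (\<lambda>_. 1) us (\<lambda>p q. h (\<phi> p # map g q))) + comp \<phi> (binary lb) us"
proof (cases "length us = n + 1")
  case True
  have "sps (\<lambda>_. 1) us (\<lambda>p q. h (\<phi> p # map g q)) = sps (\<lambda>_. 1) us (\<lambda>q p. single q (\<lambda>u. sg (int n + 1) (act u (\<phi> p))))"
  proof (subst sps_comm, rule sps_cong)
    fix p q :: "'a list" assume l: "length p + length q = length us"
    show "sg (wt (\<lambda>_. 1) p * wt (\<lambda>_. 1) q) (h (\<phi> q # map g p)) = single p (\<lambda>u. sg (int n + 1) (act u (\<phi> q)))"
    proof (cases p rule: remdups_adj.cases)
      case (2 u)
      then have "int (length q) = int n" using l True by simp
      then show ?thesis using h[of q u] 2 by (simp add: sg_minus minus_sg)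
    qed (use h1[of p q] in simp_all)
  qed
  then have a: "sg (int n) (sps (\<lambda>_. 1) us (\<lambda>p q. h (\<phi> p # map g q))) =
    (\<Sum>t<n + 1. sg (int t + 1) (act (us ! t) (\<phi> (nths us (- {t})))))"
    by (simp only: sps_single_sum True additive.sum[OF additive_sgI] sg_sg)
      (rule sum.cong, auto intro: sg_parity)
  have b: "comp \<phi> (binary lb) us = (\<Sum>(s, t)\<in>{(s, t). s < t \<and> t < n + 1}. sg (int s + int t - 1) (\<phi> (lb (us ! s) (us ! t) # nths us (- {s, t}))))"
    unfolding comp_def True[symmetric] sps_pair_sum[of us "\<lambda>u v q. \<phi> (lb u v # q)", symmetric]
    by (rule sps_cong) (auto simp: binary_def pair_def coch_zero1[OF \<phi>] split: list.splits)
  have "(\<Sum>s\<in>{1..n + 1}. sW ((- 1) ^ s) (act (us ! (s - 1)) (\<phi> (nths us (- {s - 1}))))) =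
    (\<Sum>t<n + 1. sg (int t + 1) (act (us ! t) (\<phi> (nths us (- {t})))))"
    by (rule sum.reindex_bij_witness[of _ Suc "\<lambda>s. s - 1"]) (auto simp: scale_power_minus_one[OF sW] of_nat_diff)
  moreover have "(\<Sum>(s, t)\<in>{(s, t). 1 \<le> s \<and> s < t \<and> t \<le> n + 1}. sW ((- 1) ^ (s + t - 1))
      (\<phi> (lb (us ! (s - 1)) (us ! (t - 1)) # nths us (- {s - 1, t - 1})))) =
    (\<Sum>(s, t)\<in>{(s, t). s < t \<and> t < n + 1}. sg (int s + int t - 1) (\<phi> (lb (us ! s) (us ! t) # nths us (- {s, t}))))"
    by (rule sum.reindex_bij_witness[of _ "map_prod Suc Suc" "map_prod (\<lambda>s. s - 1) (\<lambda>s. s - 1)"])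
      (auto simp: scale_power_minus_one[OF sW] of_nat_diff intro!: sg_parity)
  ultimately show ?thesis unfolding ce_differential_def a b using True by simp
next
  case False
  have "sps (\<lambda>_. 1) us (\<lambda>p q. h (\<phi> p # map g q)) = sps (\<lambda>_. 1) us (\<lambda>p q. 0)"
    by (rule sps_cong) (use False h0 h1 coch_len[OF \<phi>] in \<open>metis of_nat_eq_iff\<close>)
  moreover have "comp \<phi> (binary lb) us = sps (\<lambda>_. 1) us (\<lambda>p q. 0)"
    unfolding comp_def
  proof (rule sps_cong)
    fix p q :: "'a list" assume l: "length p + length q = length us"
    show "\<phi> (binary lb p # q) = 0"
    proof (cases "length p = 2")
      case True
      then show ?thesis using l False by (intro coch_len[OF \<phi>]) simp
    next
      case False
      then have "binary lb p = 0" by (auto simp: binary_def pair_def split: list.splits)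
      then show ?thesis by (simp add: coch_zero1[OF \<phi>])
    qed
  qed
  ultimately show ?thesis using False by (simp add: ce_differential_def)
qed

text \<open>Stated with \<open>comp\<close> because both the master equation and the boundaries of
  the generators produce it; for skew-symmetric binary maps \<open>comp x x = 0\<close> is the
  Jacobi identity.\<close>

definition lie_hom_data ::
  "('u::ab_group_add list \<Rightarrow> 'u) \<times> ('v::ab_group_add list \<Rightarrow> 'v) \<times> ('u \<Rightarrow> 'v) \<Rightarrow> bool"
 where
  "lie_hom_data = (\<lambda>(\<mu>, \<nu>, f). (\<forall>us. comp \<mu> \<mu> us = 0) \<and> (\<forall>vs. comp \<nu> \<nu> vs = 0) \<and>
     (\<forall>x y. f (\<mu> [x, y]) = \<nu> [f x, f y]))"

locale lie_hom_background = lie_algebra_hom sU brU sV brV g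
  for sU :: "'k::field_char_0 \<Rightarrow> 'u::ab_group_add \<Rightarrow> 'u" and brU
    and sV :: "'k \<Rightarrow> 'v::ab_group_add \<Rightarrow> 'v" and brV and g

lemma (in lie_algebra) bracket_swap: "bracket x y = - bracket y x"
proof -
  have "bracket (x + y) (x + y) = 0" by (rule bracket_self)
  then have "bracket x y + bracket y x = 0"
    unfolding bracket_add_left bracket_add_right by (simp add: bracket_self add.commute)
  then show ?thesis by (simp add: eq_neg_iff_add_eq_0)
qed

lemma (in lie_algebra) bracket_0_left: "bracket 0 y = 0"
  using bracket_add_left[of 0 0 y] by simp

lemma (in lie_algebra) ce_differential_bracket:
  assumes "coch s scale (int n) \<phi>"
  shows "ce_differential scale lb (\<lambda>u. bracket (g u)) n \<phi> us =
    sg (int n) (sps (\<lambda>_. 1) us (\<lambda>p q. binary bracket (\<phi> p # map g q))) + comp \<phi> (binary lb) us"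
proof (rule ce_differential_eq[OF vector_space_axioms assms])
  show "binary bracket (\<phi> p # map g [u]) = - bracket (g u) (\<phi> p)" for p u
    by simp (rule bracket_swap)
  show "binary bracket (0 # l) = 0" for l
    by (auto simp: binary_def pair_def bracket_0_left split: list.splits)
  show "binary bracket (\<phi> p # map g q) = 0" if "length q \<noteq> 1" for p q
    using that by (auto simp: binary_def pair_def split: list.splits)
qed

lemma (in lie_algebra) ce_differential_adjoint:
  assumes "coch scale scale (int n) \<phi>"
  shows "ce_differential scale bracket bracket n \<phi> us =
    sg (int n) (comp (binary bracket) \<phi> us) + comp \<phi> (binary bracket) us"
  using ce_differential_bracket[OF assms, of bracket "\<lambda>u. u" us] by (simp add: comp_def)

lemma pair_neq_0: "pair us h \<noteq> 0 \<Longrightarrow> length us = 2"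
  by (auto simp: pair_def split: list.splits)

lemma list_length_2_cases:
  assumes "length us = 2" obtains x y where "us = [x, y]"
  using assms by (auto simp: numeral_2_eq_2 length_Suc_conv)

lemma coch_binary:
  assumes add: "\<And>x y z. h (x + y) z = h x z + h y z" "\<And>x y z. h z (x + y) = h z x + h z y"
    and scale: "\<And>c x y. h (s c x) y = t c (h x y)" "\<And>c x y. h x (s c y) = t c (h x y)"
    and swap: "\<And>x y. h x y = - h y x" and t: "\<And>c. additive (t c)"
  shows "coch s t 2 (binary h)"
  unfolding coch_def binary_def
proof (intro conjI allI impI)
  fix p v w q
  show "pair (p @ (v + w) # q) h = pair (p @ v # q) h + pair (p @ w # q) h"
    by (cases p; cases q rule: remdups_adj.cases) (simp_all add: pair_Cons single_append_Cons single_append_Cons2 add)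
  show "pair (p @ v # w # q) h = - pair (p @ w # v # q) h"
    by (cases p; cases q) (simp_all add: pair_Cons single_append_Cons2 single_Cons, rule swap)
next
  fix p c v q
  show "pair (p @ s c v # q) h = t c (pair (p @ v # q) h)"
    by (cases p; cases q rule: remdups_adj.cases)
      (simp_all add: pair_Cons single_append_Cons single_append_Cons2 scale additive_zero[OF t])
next
  fix us assume "pair us h \<noteq> 0"
  then show "int (length us) = 2" using pair_neq_0 by fastforce
qed

lemma comp_binary_self:
  assumes x: "coch s s 2 x" and s: "\<And>c. additive (s c)"
  shows "(\<forall>us. comp x x us = 0) \<longleftrightarrow> (\<forall>u v w. x [x [u, v], w] + x [x [v, w], u] + x [x [w, u], v] = 0)"
proof -
  have e: "comp x x [u, v, w] = x [x [u, v], w] + x [x [v, w], u] + x [x [w, u], v]" for u v w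
  proof -
    have z: "x [] = 0" "x [a] = 0" "x [a, b, c] = 0" "x [a, b, c, d] = 0" for a b c d
      by (rule coch_len[OF x], simp)+
    \<comment> \<open>The odd one among the three unshuffles; reversing its inner pair absorbs the
      sign and restores the cyclic form.\<close>
    have "x [x [u, w], v] = - x [x [w, u], v]"
      using coch_swap1[OF x, of u w "[]"] additive.minus[OF coch_additive1[OF x], of "x [w, u]" "[v]"] by simp
    then show ?thesis by (simp add: comp_def z coch_zero1[OF x] sg_def)
  qed
  have "comp x x us = 0" if "length us \<noteq> 3" for us
    by (rule coch_len[OF coch_comp[OF x x s]]) (use that in simp)
  then have "comp x x us = 0" if "\<And>u v w. comp x x [u, v, w] = 0" for us
    using that by (cases "length us = 3") (auto simp: numeral_3_eq_3 length_Suc_conv)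
  then show ?thesis by (auto simp: e[symmetric])
qed

lemma vector_space_additive: "vector_space (s :: 'k::field \<Rightarrow> 'a::ab_group_add \<Rightarrow> 'a) \<Longrightarrow> additive (s c)"
  unfolding additive_def vector_space_def by blast

sublocale lie_hom_background \<subseteq> background sU sV g "binary brU" "binary brV"
proof (intro background.intro vs_hom.intro lin_hom.intro background_axioms.intro)
  show "vector_space sU" "vector_space sV" by unfold_locales
  show U: "additive (sU c)" for c by (rule vector_space_additive) unfold_locales
  show V: "additive (sV c)" for c by (rule vector_space_additive) unfold_locales
  show "additive g" by (simp add: additive_def add)
  show "g (sU c u) = sV c (g u)" for c u by (rule scale)
  show bU: "coch sU sU 2 (binary brU)"
    by (rule coch_binary) (fact dom.bracket_add_left dom.bracket_add_right dom.bracket_scale_left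
        dom.bracket_scale_right dom.bracket_swap U)+
  show bV: "coch sV sV 2 (binary brV)"
    by (rule coch_binary) (fact cod.bracket_add_left cod.bracket_add_right cod.bracket_scale_left
        cod.bracket_scale_right cod.bracket_swap V)+
  show "comp (binary brU) (binary brU) us = 0" for us
    using comp_binary_self[OF bU U] dom.jacobi by simp
  show "comp (binary brV) (binary brV) us = 0" for us
    using comp_binary_self[OF bV V] cod.jacobi by simp
  show "g (binary brU us) = binary brV (map g us)" if "length us = 2" for us
    using that by (elim list_length_2_cases) (simp add: map_bracket)
qed

context lie_hom_background
begin

text \<open>\<open>bc [z]\<close> contributes only \<open>g\<close> after \<open>zU z\<close> and
  \<open>zV z\<close> on values of \<open>g\<close>; the remaining terms come from
  \<open>bc [X0, z]\<close>, where \<open>X0\<close> cannot be used through its third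
  component.\<close>

lemma bt_single:
  "fst (bt [z]) us = comp (binary brU) (zU z) us + sg (fst z) (comp (zU z) (binary brU) us)"
  "fst (snd (bt [z])) vs = comp (binary brV) (zV z) vs + sg (fst z) (comp (zV z) (binary brV) vs)"
  "valid z \<Longrightarrow> snd (snd (bt [z])) us = g (zU z us) - zV z (map g us)
     - br g [(0, zg z)] (binary brV) us + sg (fst z) (comp (zg z) (binary brU) us)"
proof -
  have B: "bop fst f [z] l = 0" for f :: "('u, 'v) inp \<Rightarrow> 'c::ab_group_add list \<Rightarrow> 'c" and l
    by (simp add: bop_def)
  show "fst (bt [z]) us = comp (binary brU) (zU z) us + sg (fst z) (comp (zU z) (binary brU) us)"
    "fst (snd (bt [z])) vs = comp (binary brV) (zV z) vs + sg (fst z) (comp (zV z) (binary brV) vs)"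
    by (simp_all add: bt_def B bop_Cons)
  assume v: "valid z"
  then have "br g (ga [X0]) (zV z) us = 0"
    using br_head_0[of sV sV "fst z + 2" "zV z" g 0 "[]" us] by (simp add: valid_def)
  then have "bgop [X0, z] us = H X0 [z] us"
    unfolding bgop_Cons[of X0 "[z]"] by (simp add: H_def)
  then show "snd (snd (bt [z])) us = g (zU z us) - zV z (map g us)
     - br g [(0, zg z)] (binary brV) us + sg (fst z) (comp (zg z) (binary brU) us)"
    by (simp add: bt_def bgop_def H_def)
qed

lemma coch_S_cochains:
  assumes "x \<in> S_cochains sU sV n" "1 \<le> n"
  shows "coch sU sU (int n) (fst x)" "coch sV sV (int n) (fst (snd x))" "coch sU sV (int n - 1) (snd (snd x))"
  using assms unfolding S_cochains_def alternating_maps_eq_coch[OF dom.vector_space_axioms]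
    alternating_maps_eq_coch[OF cod.vector_space_axioms]
  by (simp_all add: mem_Times_iff of_nat_diff)

text \<open>The rescaling was chosen for this: \<open>eps n + eps (n - 1)\<close> is congruent to
  \<open>n\<close>, the sign by which the twisted unary operation differs from the differential in
  the first two components. In the third, \<open>neg\<close> corrects the relative sign of the terms
  in \<open>x_g\<close>.\<close>

lemma lop_differential:
  assumes n: "2 \<le> n" and x: "x \<in> S_cochains sU sV n"
  shows "lop [int n - 1] [x] = S_differential sU brU sV brV g n x"
proof -
  have xL: "x \<in> L (int n - 1)"
    using n x by (simp add: S_graded_def nat_diff_distrib)
  have "1 \<le> n" using n by simp
  note c = coch_S_cochains[OF x this]
  have e: "eps (int n) + eps (int n - 1) = int n + 2 * eps (int n - 1)"
  proof -
    have "int n * (int n + 1) = (int n - 1) * (int n - 1 + 1) + int n * 2" by (simp add: algebra_simps)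
    then show ?thesis unfolding eps_def by simp
  qed
  have vz: "valid (int n - 2, neg x)"
    using xL n S_graded_iff[of "int n - 1" x] by (simp add: valid_neg)
  have "lop [int n - 1] [x] = sg (eps (int n)) (neg (bt ([] @ (int n - 2, sg (eps (int n - 1)) (neg x)) # [])))"
    using xL by (simp add: lop_def set_Cons_iff enc_def)
  also have "\<dots> = sg (int n) (neg (bt [(int n - 2, neg x)]))"
    by (subst bt_slot_sg) (use vz in \<open>auto simp: additive_sg[OF additive_neg] sg_sg e intro!: sg_parity\<close>)
  finally have l: "lop [int n - 1] [x] = sg (int n) (neg (bt [(int n - 2, neg x)]))" .
  have sgp: "fst (sg m y) us = sg m (fst y us)" "fst (snd (sg m y)) vs = sg m (fst (snd y) vs)"
    "snd (snd (sg m y)) us = sg m (snd (snd y) us)" for m and y :: "('u, 'v) cochain" and us vs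
    by (simp_all add: sg_def)
  have sub2: "sg (int n - 2) y = sg (int n) y" for y :: "'c::ab_group_add"
    by (rule sg_parity) simp
  have U: "fst (lop [int n - 1] [x]) us = ce_differential sU brU brU n (fst x) us" for us
    by (simp add: dom.ce_differential_adjoint[OF c(1)] l sgp bt_single sg_add sg_sg sub2 sg_even)
  have V: "fst (snd (lop [int n - 1] [x])) us = ce_differential sV brV brV n (fst (snd x)) us" for us
    by (simp add: cod.ce_differential_adjoint[OF c(2)] l sgp bt_single sg_add sg_sg sub2 sg_even)
  have G: "snd (snd (lop [int n - 1] [x])) us =
    sV ((- 1) ^ (n - 1)) (g (fst x us)) - sV ((- 1) ^ (n - 1)) (fst (snd x) (map g us)) +
    ce_differential sV brU (\<lambda>u. brV (g u)) (n - 1) (snd (snd x)) us" for us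
  proof -
    have cg: "coch sU sV (int (n - 1)) (snd (snd x))" using c(3) n by (simp add: of_nat_diff)
    have ce: "ce_differential sV brU (\<lambda>u. brV (g u)) (n - 1) (snd (snd x)) us =
      sg (int (n - 1)) (br g [(0, snd (snd x))] (binary brV) us) + comp (snd (snd x)) (binary brU) us"
      unfolding cod.ce_differential_bracket[OF cg] by simp
    have m: "sg (int (n - 1)) y = - sg (int n) y" for y :: 'v
      using n by (simp add: of_nat_diff minus_sg, intro sg_parity) auto
    show ?thesis
      unfolding l sgp neg_sel bt_single(3)[OF vz] ce scale_power_minus_one[OF cod.vector_space_axioms] m
        fst_conv snd_conv comp_uminus_left br_head_uminus[OF mV] sub2
      by (simp add: sg_def)
  qed
  show ?thesis
    unfolding S_differential_def by (cases x) (use U V G in \<open>auto intro!: prod_eqI ext\<close>)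
qed

section \<open>The terms of the master equation\<close>

lemma br_zero_arity:
  assumes "coch s t n x" "n < int (length as)"
  shows "br g' as x us = 0"
  using assms
proof (induct as arbitrary: x n us)
  case Nil
  then show ?case by (simp add: coch_len)
next
  case (Cons a as)
  then have "br g' as (\<lambda>l. x (v # l)) us = 0" for v us
    by (intro Cons.hyps[OF coch_contract[OF Cons.prems(1)]]) simp
  then show ?case by simp
qed

text \<open>A composition uses two entries, and a binary \<open>V\<close> component has room for two
  inserted maps, so at most three copies of \<open>z\<close> can occur. The multiplicities 2 and 3
  of \<open>H\<close> count the choices of the distinguished entry.\<close>

lemma bt_replicate:
  assumes v: "valid (0, x)"
  defines "z \<equiv> (0, x)"
  shows "bt [z, z] = (\<lambda>us. comp (fst x) (fst x) us + comp (fst x) (fst x) us,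
      \<lambda>vs. comp (fst (snd x)) (fst (snd x)) vs + comp (fst (snd x)) (fst (snd x)) vs,
      \<lambda>us. H z [z] us + H z [z] us - br g [(0, zg z), (0, zg z)] (binary brV) us)"
    and "bt [z, z, z] = (\<lambda>us. 0, \<lambda>vs. 0, \<lambda>us. H z [z, z] us + H z [z, z] us + H z [z, z] us)"
    and "4 \<le> k \<Longrightarrow> bt (replicate k z) = 0"
proof -
  have vz: "valid z" using v by (simp add: z_def)
  have z0: "fst z = 0" by (simp add: z_def)
  have HX: "H z (X0 # r) us = 0" for r us
  proof -
    have "br g (ga (X0 # r)) (zV z) us = 0"
      using vz br_head_0[of sV sV "fst z + 2" "zV z" g 0 "ga r" us] by (simp only: list.map X0_sel valid_def)
    then show ?thesis by (simp add: H_Cons del: br.simps list.map)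
  qed
  have H3: "H z' q us = 0" if "valid z'" "fst z' = 0" "3 \<le> length q" for z' q us
  proof -
    have "br g (ga q) (zV z') us = 0"
      by (rule br_zero_arity[of sV sV 2]) (use that in \<open>auto simp: valid_def\<close>)
    moreover have "q \<noteq> []" "single q h = (0::'v)" for h :: "('u, 'v) inp \<Rightarrow> 'v"
      using that(3) by (auto simp: single_def split: list.splits)
    ultimately show ?thesis by (simp add: H_def)
  qed
  \<comment> \<open>With third component \<open>0\<close>, \<open>X0\<close> contributes only as the
    distinguished entry.\<close>
  have X3: "bgop (X0 # q) us = H X0 q us" if "set q \<subseteq> {z}" for q us
  proof -
    have "sps fst q (\<lambda>p r. single p (\<lambda>z. sg (fst X0 * fst z) (H z (X0 # r) us))) = sps fst q (\<lambda>p r. 0)"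
      by (rule sps_cong, rule HOL.trans[OF single_cong single_0]) (use that HX in auto)
    then show ?thesis by (simp add: bgop_Cons[of X0 q])
  qed
  have gX: "ga [z, z] = [(0, zg z), (0, zg z)]" by (simp add: z0)
  have HX2: "H X0 [z, z] us = - br g [(0, zg z), (0, zg z)] (binary brV) us" for us
    unfolding H_def gX by simp
  have HX3: "H X0 [z, z, z] us = 0" for us
    using valid_X0 by (intro H3) simp_all
  show "bt [z, z] = (\<lambda>us. comp (fst x) (fst x) us + comp (fst x) (fst x) us,
      \<lambda>vs. comp (fst (snd x)) (fst (snd x)) vs + comp (fst (snd x)) (fst (snd x)) vs,
      \<lambda>us. H z [z] us + H z [z] us - br g [(0, zg z), (0, zg z)] (binary brV) us)"
    unfolding bt_def
    by (intro prod_eqI ext)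
      (simp_all add: X3 HX2 bop_Cons single_Cons bgop_Cons[of z] z0 del: br.simps, simp_all add: z_def)
  show "bt [z, z, z] = (\<lambda>us. 0, \<lambda>vs. 0, \<lambda>us. H z [z, z] us + H z [z, z] us + H z [z, z] us)"
    unfolding bt_def
    by (intro prod_eqI ext) (simp_all add: X3 HX3 bop_Cons single_Cons bgop_Cons[of z] z0)
  assume k: "4 \<le> k"
  have b: "bop fst f (q # replicate k z) us = 0" "bop fst f (replicate k z) us = 0" for f :: "('u, 'v) inp \<Rightarrow> 'c::ab_group_add list \<Rightarrow> 'c" and q us
    using k by (cases k; cases "k - 1"; cases "k - 2"; simp add: bop_Cons single_Cons)+
  have "sps fst (replicate k z) (\<lambda>p q. single p (\<lambda>z. H z q us)) = sps fst (replicate k z) (\<lambda>p q. 0)" for us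
  proof (rule sps_cong, rule HOL.trans[OF single_cong single_0])
    fix p q y assume l: "length p + length q = length (replicate k z)" "set p \<union> set q = set (replicate k z)" "p = [y]"
    then have "y = z" using k by auto
    then show "H y q us = 0" using l k vz z0 by (intro H3) auto
  qed
  then have "bgop (replicate k z) us = 0" for us by (simp add: bgop_def)
  moreover have "bgop (X0 # replicate k z) us = 0" for us
    using X3[of "replicate k z" us] H3[OF valid_X0, of "replicate k z" us] k by auto
  ultimately show "bt (replicate k z) = 0"
    unfolding bt_def by (intro prod_eqI ext) (simp_all add: b)
qed

definition deform :: "('u, 'v) cochain \<Rightarrow> ('u list \<Rightarrow> 'u) \<times> ('v list \<Rightarrow> 'v) \<times> ('u \<Rightarrow> 'v)" where
  "deform \<kappa> = (\<lambda>us. binary brU us + fst \<kappa> us, \<lambda>vs. binary brV vs + fst (snd \<kappa>) vs, \<lambda>u. g u - snd (snd \<kappa>) [u])"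

text \<open>The exponents add up to an even number: \<open>k * (k + 1) div 2 + 1\<close> from the
  master equation, \<open>k * (k - 1) div 2\<close> from the decalage, \<open>eps 2 = 3\<close> from
  the output and \<open>eps 1 = 1\<close> from each of the \<open>k\<close> inputs. This confirms
  the choice of \<open>eps\<close>.\<close>

lemma master_term_eq:
  assumes \<kappa>: "\<kappa> \<in> S_cochains sU sV 2"
  shows "master_term cscale lop \<kappa> k = cscale (1 / fact k) (neg (bt (replicate k (0, neg \<kappa>))))"
proof -
  have L1: "\<kappa> \<in> L 1" using \<kappa> by (simp add: S_graded_def numeral_2_eq_2)
  have v: "valid (0, neg \<kappa>)" using L1 S_graded_iff[of 1 \<kappa>] by (simp add: valid_neg)
  have e: "eps 1 = 1" "eps 2 = 3" by (simp_all add: eps_def)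
  have z: "encs (zip (replicate k 1) (replicate k \<kappa>)) = replicate k (0, sg 1 (neg \<kappa>))"
    by (induct k) (simp_all add: enc_def e)
  \<comment> \<open>The input signs are pulled out slot by slot; the list is a mixture of cleared
    and uncleared slots so that the induction can shift the boundary.\<close>
  have pull: "bt (replicate i (0, neg \<kappa>) @ replicate j (0, sg 1 (neg \<kappa>))) = sg (int j) (bt (replicate (i + j) (0, neg \<kappa>)))" for i j
  proof (induct j arbitrary: i)
    case (Suc j)
    have "bt (replicate i (0, neg \<kappa>) @ (0, sg 1 (neg \<kappa>)) # replicate j (0, sg 1 (neg \<kappa>))) =
      sg 1 (bt (replicate i (0, neg \<kappa>) @ (0, neg \<kappa>) # replicate j (0, sg 1 (neg \<kappa>))))"
      by (rule bt_slot_sg) (use v valid_sg[OF v, of 1] in \<open>simp add: ball_Un\<close>)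
    also have "replicate i (0, neg \<kappa>) @ (0, neg \<kappa>) # replicate j (0, sg 1 (neg \<kappa>)) = replicate (Suc i) (0, neg \<kappa>) @ replicate j (0, sg 1 (neg \<kappa>))"
      by (simp add: replicate_app_Cons_same)
    finally show ?case using Suc[of "Suc i"] by (simp add: sg_sg)
  qed simp
  have "replicate k \<kappa> \<in> listset (map L (replicate k 1))" using L1 by (simp add: mem_listset)
  then have l: "lop (replicate k 1) (replicate k \<kappa>) = sg (dec_exp (replicate k 1) + 3 + int k) (neg (bt (replicate k (0, neg \<kappa>))))"
    unfolding lop_def z using pull[of 0 k]
    by (simp add: sum_list_replicate e sg_sg additive_sg[OF additive_neg])
  have "2 * dec_exp (replicate k 1) = int k * (int k - 1)"
    by (induct k) (simp_all add: algebra_simps)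
  then have d: "dec_exp (replicate k 1) = int (k * (k + 1) div 2) - int k"
    by (simp add: zdiv_int algebra_simps)
  have s: "cscale (c / fact k) x = cscale (1 / fact k) (cscale c x)" for c x
    by (intro prod_eqI ext) simp_all
  have m: "cscale (- ((- 1) ^ m)) x = sg (int m + 1) x" for m x
    using cscale_sign_pow[of "int m + 1" x] by (cases "even m") (simp_all add: sign_pow_def minus_one_power_iff)
  have n: "int (k * (k + 1) div 2) + 1 + (dec_exp (replicate k 1) + 3 + int k) = 2 * (int (k * (k + 1) div 2) + 2)"
    unfolding d by simp
  show ?thesis
    unfolding master_term_def s[of "- _"] l m sg_sg n by (simp add: sg_even)
qed

text \<open>The nonzero terms are the homogeneous parts, in \<open>\<kappa>\<close>, of the two
  Jacobi expressions and of \<open>\<nu> (f, f) - f \<mu>\<close> for the deformed data. The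
  constant parts are absent because the given data already satisfy these equations.\<close>

lemma master_terms:
  assumes \<kappa>: "\<kappa> \<in> S_cochains sU sV 2"
  shows "finite {k. 1 \<le> k \<and> master_term cscale lop \<kappa> k \<noteq> 0}"
    and "quantum_master_equation cscale lop \<kappa> \<longleftrightarrow> lie_hom_data (deform \<kappa>)"
proof -
  define M where "M k = master_term cscale lop \<kappa> k" for k
  define \<kappa>U where "\<kappa>U = fst \<kappa>"
  define \<kappa>V where "\<kappa>V = fst (snd \<kappa>)"
  define a where "a = (\<lambda>l. - snd (snd \<kappa>) l)"
  let ?x = "neg \<kappa>"
  let ?mU = "binary brU" and ?mV = "binary brV"
  have x: "fst ?x = \<kappa>U" "fst (snd ?x) = \<kappa>V" "snd (snd ?x) = a"
    by (simp_all add: \<kappa>U_def \<kappa>V_def a_def)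
  have c: "coch sU sU 2 \<kappa>U" "coch sV sV 2 \<kappa>V" "coch sU sV 1 a"
    using coch_S_cochains[OF \<kappa>] by (simp_all add: \<kappa>U_def \<kappa>V_def a_def coch_uminus[OF _ sV])
  have v: "valid (0, ?x)" using c unfolding \<kappa>U_def \<kappa>V_def a_def by (simp add: valid_def)
  have M: "M k = cscale (1 / fact k) (neg (bt (replicate k (0, ?x))))" for k
    unfolding M_def by (rule master_term_eq[OF \<kappa>])
  have M4: "M k = 0" if "4 \<le> k" for k
    unfolding M bt_replicate(3)[OF v that] additive_zero[OF additive_neg]
    by (simp add: cochain_scale_def zero_prod_def zero_fun_def)
  have sub: "{k. 1 \<le> k \<and> M k \<noteq> 0} \<subseteq> {1, 2, 3}"
  proof
    fix k assume "k \<in> {k. 1 \<le> k \<and> M k \<noteq> 0}"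
    then have "1 \<le> k" "\<not> 4 \<le> k" using M4 by auto
    then show "k \<in> {1, 2, 3}" by auto
  qed
  then show "finite {k. 1 \<le> k \<and> master_term cscale lop \<kappa> k \<noteq> 0}"
    unfolding M_def[symmetric] by (rule finite_subset) simp
  let ?S = "M 1 + M 2 + M 3"
  have "(\<Sum>k\<in>{k. 1 \<le> k \<and> M k \<noteq> 0}. M k) = (\<Sum>k\<in>{1, 2, 3}. M k)"
    by (rule sum.mono_neutral_left) (use sub in auto)
  then have qme: "quantum_master_equation cscale lop \<kappa> \<longleftrightarrow> ?S = 0"
    by (auto simp: quantum_master_equation_def M_def[symmetric] add.assoc)
  have rep: "replicate 1 y = [y]" "replicate 2 y = [y, y]" "replicate 3 y = [y, y, y]" for y :: "('u, 'v) inp"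
    by (simp_all add: numeral_2_eq_2 numeral_3_eq_3)
  \<comment> \<open>The inverse factorials cancel the multiplicities of equal terms.\<close>
  have hU: "sU (1 / 2) (u + u) = u" for u
  proof -
    have "sU (1 / 2) (u + u) = sU (1 / 2 + 1 / 2) u" by (simp only: dom.scale_right_distrib dom.scale_left_distrib)
    then show ?thesis by simp
  qed
  have hV: "sV (1 / 2) (w + w) = w" "sV (1 / 6) ((w + w) + (w + w) + (w + w)) = w" for w
  proof -
    have "sV (1 / 2) (w + w) = sV (1 / 2 + 1 / 2) w" by (simp only: cod.scale_right_distrib cod.scale_left_distrib)
    then show "sV (1 / 2) (w + w) = w" by simp
    have "sV (1 / 6) ((w + w) + (w + w) + (w + w)) = sV ((1 / 6 + 1 / 6) + (1 / 6 + 1 / 6) + (1 / 6 + 1 / 6)) w"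
      by (simp only: cod.scale_right_distrib cod.scale_left_distrib)
    then show "sV (1 / 6) ((w + w) + (w + w) + (w + w)) = w" by simp
  qed
  let ?\<mu> = "\<lambda>us. ?mU us + \<kappa>U us" and ?\<nu> = "\<lambda>vs. ?mV vs + \<kappa>V vs" and ?f = "\<lambda>u. g u + a [u]"
  \<comment> \<open>On the right the product of sums is expanded; its constant term vanishes by
    \<open>jacU\<close>, its linear part is \<open>M 1\<close> and its quadratic part is
    \<open>M 2\<close>.\<close>
  have SU: "fst ?S us = comp ?\<mu> ?\<mu> us" for us
    unfolding comp_add_left comp_add_right[OF mU] comp_add_right[OF c(1)] jacU
    by (simp add: M rep bt_single bt_replicate[OF v] hU fact_numeral \<kappa>U_def add.assoc)
  have SV: "fst (snd ?S) us = comp ?\<nu> ?\<nu> us" for us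
    unfolding comp_add_left comp_add_right[OF mV] comp_add_right[OF c(2)] jacV
    by (simp add: M rep bt_single bt_replicate[OF v] hV(1) fact_numeral \<kappa>V_def add.assoc)
  have z: "a [] = 0" "a [p, q] = 0" "\<kappa>V [w] = 0" "?mV [w] = 0" "\<kappa>U [] = 0" "\<kappa>U [p] = 0" "?mU [] = 0" "?mU [p] = 0" for p q w
    by (rule coch_len[OF c(3)] coch_len[OF c(2)] coch_len[OF mV] coch_len[OF c(1)] coch_len[OF mU], simp)+
  have b1: "br g [(0, a)] N [p, q] = N [a [p], g q] + N [g p, a [q]]" if N: "coch sV sV 2 N" for N p q
    using coch_len[OF N, of "[0]"] coch_swap1[OF N, of "a [q]" "g p" "[]"]
    by (simp add: z coch_zero1[OF N] sg_def)
  \<comment> \<open>Only splittings that give each inserted map one argument survive; there are two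
    of them, and they agree because the inserted maps are equal.\<close>
  have b2: "br g [(0, a), (0, a)] N [p, q] = N [a [p], a [q]] + N [a [p], a [q]]" if N: "coch sV sV 2 N" for N p q
    using coch_swap1[OF N, of "a [q]" "a [p]" "[]"] coch_zero_slot[OF N, of "[_]" "[]"] coch_len[OF N, of "[_, 0, _]"]
    by (simp add: z coch_zero1[OF N] sg_def)
  have cm: "comp a N [p, q] = a [N [p, q]]" if "N [] = 0" "\<And>p. N [p] = 0" for N p q
    by (simp add: comp_def that coch_zero1[OF c(3)] sg_def z)
  have G: "snd (snd ?S) [p, q] = ?\<nu> [?f p, ?f q] - ?f (?\<mu> [p, q])" for p q
  proof -
    have H1: "H (0, ?x) [(0, ?x)] us = - br g [(0, a)] \<kappa>V us + comp a \<kappa>U us" for us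
      by (simp add: H_def x \<kappa>U_def \<kappa>V_def a_def)
    have H2: "H (0, ?x) [(0, ?x), (0, ?x)] us = - br g [(0, a), (0, a)] \<kappa>V us" for us
      by (simp add: H_def x \<kappa>U_def \<kappa>V_def a_def)
    let ?h = "- (\<kappa>V [a [p], g q] + \<kappa>V [g p, a [q]]) + a [\<kappa>U [p, q]]"
    let ?A = "\<kappa>V [a [p], a [q]]" and ?B = "?mV [a [p], a [q]]"
    have s1: "snd (snd (bt [(0, ?x)])) [p, q] = g (\<kappa>U [p, q]) - \<kappa>V [g p, g q] - (?mV [a [p], g q] + ?mV [g p, a [q]]) + a [?mU [p, q]]"
      unfolding bt_single(3)[OF v] fst_conv snd_conv x b1[OF mV] cm[OF z(7,8)] by simp
    have s2: "snd (snd (bt [(0, ?x), (0, ?x)])) [p, q] = (?h - ?B) + (?h - ?B)"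
      unfolding bt_replicate(1)[OF v] fst_conv snd_conv x H1 b1[OF c(2)] b2[OF mV] cm[OF z(5,6)]
      by (simp add: algebra_simps)
    have s3: "snd (snd (bt [(0, ?x), (0, ?x), (0, ?x)])) [p, q] = (- ?A + - ?A) + (- ?A + - ?A) + (- ?A + - ?A)"
      unfolding bt_replicate(2)[OF v] snd_conv H2 b2[OF c(2)] by (simp add: algebra_simps)
    have "snd (snd ?S) [p, q] = - snd (snd (bt [(0, ?x)])) [p, q] - sV (1 / 2) (snd (snd (bt [(0, ?x), (0, ?x)])) [p, q])
       - sV (1 / 6) (snd (snd (bt [(0, ?x), (0, ?x), (0, ?x)])) [p, q])"
      by (simp add: M rep fact_numeral)
    also have "\<dots> = - (g (\<kappa>U [p, q]) - \<kappa>V [g p, g q] - (?mV [a [p], g q] + ?mV [g p, a [q]]) + a [?mU [p, q]])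
       - (?h - ?B) + ?A"
      unfolding s1 s2 s3 hV by simp
    also have "\<dots> = ?\<nu> [?f p, ?f q] - ?f (?\<mu> [p, q])"
      using coch_add1[OF mV, of "g p" "a [p]"] coch_add1[OF c(2), of "g p" "a [p]"] coch_add[OF mV, of "[_]" "g q" "a [q]" "[]"]
        coch_add[OF c(2), of "[_]" "g q" "a [q]" "[]"] coch_add1[OF c(3), of "?mU [p, q]" "\<kappa>U [p, q]" "[]"] hom[of "[p, q]"]
        additive.add[OF g]
      by (simp del: binary_simps add: algebra_simps)
    finally show ?thesis .
  qed
  have G0: "snd (snd ?S) us = 0" if "length us \<noteq> 2" for us
  proof -
    have "snd (snd (M k)) us = 0" for k
    proof -
      have "valid (1, bt (replicate k (0, ?x)))"
        using valid_bt[of "replicate k (0, ?x)"] v by (simp add: sum_list_replicate)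
      then have "coch sU sV 2 (snd (snd (bt (replicate k (0, ?x)))))" by (simp add: valid_def)
      from coch_len[OF this, of us] that show ?thesis by (simp add: M)
    qed
    then show ?thesis by simp
  qed
  have "?S = 0 \<longleftrightarrow> (\<forall>us. fst ?S us = 0) \<and> (\<forall>us. fst (snd ?S) us = 0) \<and> (\<forall>us. snd (snd ?S) us = 0)"
    by (auto simp: prod_eq_iff fun_eq_iff)
  moreover have "(\<forall>us. snd (snd ?S) us = 0) \<longleftrightarrow> (\<forall>p q. ?f (?\<mu> [p, q]) = ?\<nu> [?f p, ?f q])"
  proof
    assume "\<forall>us. snd (snd ?S) us = 0"
    then show "\<forall>p q. ?f (?\<mu> [p, q]) = ?\<nu> [?f p, ?f q]" using G by (metis eq_iff_diff_eq_0)
  next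
    assume f: "\<forall>p q. ?f (?\<mu> [p, q]) = ?\<nu> [?f p, ?f q]"
    show "\<forall>us. snd (snd ?S) us = 0"
    proof
      fix us :: "'u list"
      show "snd (snd ?S) us = 0"
      proof (cases "length us = 2")
        case True
        then obtain p q where "us = [p, q]" by (rule list_length_2_cases)
        then show ?thesis unfolding \<open>us = [p, q]\<close> G using f by simp
      qed (rule G0)
    qed
  qed
  moreover have "deform \<kappa> = (?\<mu>, ?\<nu>, ?f)"
    by (simp add: deform_def \<kappa>U_def \<kappa>V_def a_def)
  ultimately show "quantum_master_equation cscale lop \<kappa> \<longleftrightarrow> lie_hom_data (deform \<kappa>)"
    unfolding qme SU SV lie_hom_data_def by simp
qed

end

section \<open>Tensor products\<close>

lemma vector_space_tensor_scale: "vector_space (tensor_scale :: 'k::field \<Rightarrow> ('k, 'a) tensor \<Rightarrow> _)"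
  by unfold_locales (auto simp: tensor_scale_def fun_eq_iff algebra_simps)

interpretation TS: vector_space "tensor_scale :: 'k::field \<Rightarrow> ('k, 'a) tensor \<Rightarrow> _"
  by (rule vector_space_tensor_scale)

lemma tensor_scale_apply: "tensor_scale c t \<omega> = c * t \<omega>" by (simp add: tensor_scale_def)

lemma multilinearD:
  assumes "f \<in> multilinear_maps s t As"
  shows "xs \<notin> listset As \<Longrightarrow> f xs = 0"
    and "xs \<in> listset As \<Longrightarrow> i < length As \<Longrightarrow> x \<in> As ! i \<Longrightarrow> y \<in> As ! i \<Longrightarrow> f (xs[i := x + y]) = f (xs[i := x]) + f (xs[i := y])"
    and "xs \<in> listset As \<Longrightarrow> i < length As \<Longrightarrow> x \<in> As ! i \<Longrightarrow> f (xs[i := s c x]) = t c (f (xs[i := x]))"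
  using assms unfolding multilinear_maps_def by blast+

lemma listset_length: "xs \<in> listset As \<Longrightarrow> length xs = length As"
  by (simp add: mem_listset)

lemma listset_append: "xs @ ys \<in> listset (As @ Bs) \<longleftrightarrow> xs \<in> listset As \<and> ys \<in> listset Bs" if "length xs = length As"
  using that by (induct xs As rule: list_induct2) (auto simp: set_Cons_iff)

lemma listset_append_iff:
  "xs \<in> listset (As @ Bs) \<longleftrightarrow> take (length As) xs \<in> listset As \<and> drop (length As) xs \<in> listset Bs"
proof (cases "length As \<le> length xs")
  case True
  then show ?thesis using listset_append[of "take (length As) xs" As "drop (length As) xs" Bs] by simp
next
  case False
  then show ?thesis by (auto simp: mem_listset)
qed

lemma mf_add: "\<omega> \<in> multilinear_forms s As \<Longrightarrow> \<omega>' \<in> multilinear_forms s As \<Longrightarrow> (\<lambda>xs. \<omega> xs + \<omega>' xs) \<in> multilinear_forms s As"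
  unfolding multilinear_maps_def by (simp add: algebra_simps)

lemma mf_scale: "\<omega> \<in> multilinear_forms s As \<Longrightarrow> (\<lambda>xs. c * \<omega> xs) \<in> multilinear_forms s As"
  unfolding multilinear_maps_def by (simp add: algebra_simps)

lemma mf_0: "(\<lambda>xs. 0) \<in> multilinear_forms s As"
  unfolding multilinear_maps_def by simp

lemma mf_append_left:
  assumes "\<omega> \<in> multilinear_forms s (As @ Bs)" "ys \<in> listset Bs"
  shows "(\<lambda>xs. \<omega> (xs @ ys)) \<in> multilinear_forms s As"
proof -
  have "\<omega> (xs @ ys) = 0" if "xs \<notin> listset As" for xs
  proof (rule multilinearD(1)[OF assms(1)])
    show "xs @ ys \<notin> listset (As @ Bs)"
    proof
      assume a: "xs @ ys \<in> listset (As @ Bs)"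
      then have "length xs = length As" using listset_length[OF a] listset_length[OF assms(2)] by simp
      then show False using a that listset_append by blast
    qed
  qed
  moreover have "xs @ ys \<in> listset (As @ Bs)" if "xs \<in> listset As" for xs
    using listset_append[OF listset_length[OF that]] that assms(2) by blast
  moreover have u: "(xs @ ys)[i := z] = xs[i := z] @ ys" "i < length (As @ Bs)" "(As @ Bs) ! i = As ! i"
    if "xs \<in> listset As" "i < length As" for xs i z
    using listset_length[OF that(1)] that(2) by (simp_all add: list_update_append nth_append)
  ultimately show ?thesis
    using multilinearD(2,3)[OF assms(1), of "_ @ ys"]
    unfolding multilinear_maps_def by (auto simp del: length_append simp: u(1,3)[symmetric])
qed

lemma mf_append_right:
  assumes "\<omega> \<in> multilinear_forms s (As @ Bs)" "xs \<in> listset As"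
  shows "(\<lambda>ys. \<omega> (xs @ ys)) \<in> multilinear_forms s Bs"
proof -
  note l = listset_length[OF assms(2)]
  note i = listset_append[OF l]
  have u: "(xs @ ys)[length As + i := z] = xs @ ys[i := z]" for ys i z
    using list_update_append[of xs ys "length As + i" z] l by simp
  show ?thesis
    using multilinearD[OF assms(1), of "xs @ _"] assms(2)
      multilinearD(2,3)[OF assms(1), of "xs @ _" "length As + _"]
    unfolding multilinear_maps_def by (auto simp: i u)
qed

lemma pure_tensor_multilinear: "pure_tensor s As \<in> multilinear_maps s tensor_scale As"
  unfolding multilinear_maps_def mem_Collect_eq
  by (intro conjI allI ballI impI ext) (auto simp: pure_tensor_def multilinearD tensor_scale_apply)

lemma pure_in_tensor_space: "xs \<in> listset As \<Longrightarrow> pure_tensor s As xs \<in> tensor_space s As"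
  unfolding tensor_space_def by (intro TS.span_base) simp

lemma tensor_space_induct [consumes 1, case_names pure zero add scale]:
  assumes "t \<in> tensor_space s As" and "\<And>xs. xs \<in> listset As \<Longrightarrow> P (pure_tensor s As xs)"
    and "P 0" "\<And>t u. t \<in> tensor_space s As \<Longrightarrow> u \<in> tensor_space s As \<Longrightarrow> P t \<Longrightarrow> P u \<Longrightarrow> P (t + u)"
    and "\<And>c t. t \<in> tensor_space s As \<Longrightarrow> P t \<Longrightarrow> P (tensor_scale c t)"
  shows "P t"
proof -
  have "t \<in> tensor_space s As \<and> P t"
    using assms(1) unfolding tensor_space_def
  proof (rule TS.span_induct)
    show "TS.subspace {t. t \<in> TS.span (pure_tensor s As ` listset As) \<and> P t}"
      unfolding TS.subspace_def using assms(3-5) unfolding tensor_space_def mem_Collect_eq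
      by (blast intro: TS.span_add TS.span_scale TS.span_zero)
  qed (use assms(2) in \<open>blast intro: TS.span_base\<close>)
  then show ?thesis ..
qed

lemma tensor_space_add: "t \<in> tensor_space s As \<Longrightarrow> u \<in> tensor_space s As \<Longrightarrow> t + u \<in> tensor_space s As"
  unfolding tensor_space_def by (rule TS.span_add)

lemma tensor_space_scale: "t \<in> tensor_space s As \<Longrightarrow> tensor_scale c t \<in> tensor_space s As"
  unfolding tensor_space_def by (rule TS.span_scale)

lemma tensor_space_0: "0 \<in> tensor_space s As"
  unfolding tensor_space_def by (rule TS.span_zero)

text \<open>A tensor is encoded as a function on all functions of lists; linearity is available only
  for elements of the span and on multilinear forms.\<close>

lemma tensor_add:
  "t \<in> tensor_space s As \<Longrightarrow> \<omega> \<in> multilinear_forms s As \<Longrightarrow> \<omega>' \<in> multilinear_forms s As \<Longrightarrow> t (\<lambda>xs. \<omega> xs + \<omega>' xs) = t \<omega> + t \<omega>'"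
  by (induct rule: tensor_space_induct) (auto simp: pure_tensor_def mf_add tensor_scale_apply algebra_simps)

lemma tensor_mult:
  "t \<in> tensor_space s As \<Longrightarrow> \<omega> \<in> multilinear_forms s As \<Longrightarrow> t (\<lambda>xs. c * \<omega> xs) = c * t \<omega>"
  by (induct rule: tensor_space_induct) (auto simp: pure_tensor_def mf_scale tensor_scale_apply algebra_simps)

lemma tensor_zero: "t \<in> tensor_space s As \<Longrightarrow> t (\<lambda>xs. 0) = 0"
  by (induct rule: tensor_space_induct) (auto simp: pure_tensor_def tensor_scale_apply)

lemma mf_component:
  assumes "F \<in> multilinear_maps s tensor_scale As"
  shows "(\<lambda>xs. F xs \<omega>) \<in> multilinear_forms s As"
  using multilinearD[OF assms] unfolding multilinear_maps_def by (simp add: tensor_scale_apply)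

lemma tensor_lift_pure:
  assumes "F \<in> multilinear_maps s tensor_scale As" "xs \<in> listset As"
  shows "tensor_lift F (pure_tensor s As xs) = F xs"
  by (rule ext) (simp add: tensor_lift_def pure_tensor_def mf_component[OF assms(1)])

lemma tensor_lift_add: "tensor_lift F (t + u) = tensor_lift F t + tensor_lift F u"
  by (rule ext) (simp add: tensor_lift_def)

lemma tensor_lift_scale: "tensor_lift F (tensor_scale c t) = tensor_scale c (tensor_lift F t)"
  by (rule ext) (simp add: tensor_lift_def tensor_scale_apply)

lemma tensor_lift_0: "tensor_lift F 0 = 0"
  by (rule ext) (simp add: tensor_lift_def)

text \<open>For \<open>xs\<close> outside the product the function
  \<open>\<lambda>ys. \<omega> (xs @ ys)\<close> may fail to be multilinear, and
  \<open>pure_tensor\<close> then returns its default \<open>0\<close>; this agrees with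
  \<open>\<omega> (xs @ ys)\<close>, which vanishes there.\<close>

lemma pure_append_inner:
  assumes "\<omega> \<in> multilinear_forms s (As @ Bs)" "ys \<in> listset Bs"
  shows "(\<lambda>xs. pure_tensor s Bs ys (\<lambda>ys. \<omega> (xs @ ys))) = (\<lambda>xs. \<omega> (xs @ ys))"
proof
  fix xs
  show "pure_tensor s Bs ys (\<lambda>ys. \<omega> (xs @ ys)) = \<omega> (xs @ ys)"
  proof (cases "xs \<in> listset As")
    case True
    then show ?thesis using mf_append_right[OF assms(1)] by (simp add: pure_tensor_def)
  next
    case False
    then have "\<omega> (xs @ ys) = 0" using multilinearD(1)[OF mf_append_left[OF assms]] by simp
    then show ?thesis by (simp add: pure_tensor_def)
  qed
qed

text \<open>\<open>tensor_append\<close> evaluates \<open>t\<close> on a form whose last arguments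
  have been absorbed by \<open>u\<close>; this form has to be multilinear for the linearity of
  \<open>t\<close> to apply.\<close>

lemma mf_partial:
  assumes u: "u \<in> tensor_space s Bs" and \<omega>: "\<omega> \<in> multilinear_forms s (As @ Bs)"
  shows "(\<lambda>xs. u (\<lambda>ys. \<omega> (xs @ ys))) \<in> multilinear_forms s As"
  using u
proof (induct rule: tensor_space_induct)
  case (pure ys)
  show ?case unfolding pure_append_inner[OF \<omega> pure] by (rule mf_append_left[OF \<omega> pure])
qed (simp_all add: mf_0 mf_add mf_scale tensor_scale_apply)

lemma tensor_append_pure:
  assumes "xs \<in> listset As" "ys \<in> listset Bs"
  shows "tensor_append s As Bs (pure_tensor s As xs) (pure_tensor s Bs ys) = pure_tensor s (As @ Bs) (xs @ ys)"
proof
  fix \<omega>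
  show "tensor_append s As Bs (pure_tensor s As xs) (pure_tensor s Bs ys) \<omega> = pure_tensor s (As @ Bs) (xs @ ys) \<omega>"
  proof (cases "\<omega> \<in> multilinear_forms s (As @ Bs)")
    case True
    then show ?thesis
      unfolding tensor_append_def pure_append_inner[OF True assms(2)]
      using mf_append_left[OF True assms(2)] by (simp add: pure_tensor_def)
  qed (simp add: tensor_append_def pure_tensor_def)
qed

text \<open>Restricted to the tensor spaces because \<open>tensor_append\<close> need not be
  additive in its second argument when the first is an arbitrary function on forms.\<close>

definition bilin ::
  "('k::field \<Rightarrow> 'a::ab_group_add \<Rightarrow> 'a) \<Rightarrow> 'a set list \<Rightarrow> 'a set list \<Rightarrow>
   (('k, 'a) tensor \<Rightarrow> ('k, 'a) tensor \<Rightarrow> ('k, 'b) tensor) \<Rightarrow> bool"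
where
  "bilin s As Bs h \<longleftrightarrow>
     (\<forall>t\<in>tensor_space s As. \<forall>t'\<in>tensor_space s As. \<forall>u\<in>tensor_space s Bs. h (t + t') u = h t u + h t' u) \<and>
     (\<forall>t\<in>tensor_space s As. \<forall>u\<in>tensor_space s Bs. \<forall>u'\<in>tensor_space s Bs. h t (u + u') = h t u + h t u') \<and>
     (\<forall>t\<in>tensor_space s As. \<forall>u\<in>tensor_space s Bs. \<forall>c. h (tensor_scale c t) u = tensor_scale c (h t u)) \<and>
     (\<forall>t\<in>tensor_space s As. \<forall>u\<in>tensor_space s Bs. \<forall>c. h t (tensor_scale c u) = tensor_scale c (h t u))"

lemma bilinD:
  assumes "bilin s As Bs h" "t \<in> tensor_space s As" "u \<in> tensor_space s Bs"
  shows "t' \<in> tensor_space s As \<Longrightarrow> h (t + t') u = h t u + h t' u"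
    and "u' \<in> tensor_space s Bs \<Longrightarrow> h t (u + u') = h t u + h t u'"
    and "h (tensor_scale c t) u = tensor_scale c (h t u)"
    and "h t (tensor_scale c u) = tensor_scale c (h t u)"
  using assms unfolding bilin_def by blast+

lemma bilin_zero:
  assumes "bilin s As Bs h"
  shows "u \<in> tensor_space s Bs \<Longrightarrow> h 0 u = 0" "t \<in> tensor_space s As \<Longrightarrow> h t 0 = 0"
  using bilinD(3)[OF assms tensor_space_0, of u 0] bilinD(4)[OF assms _ tensor_space_0, of t 0]
  unfolding TS.scale_zero_left by blast+

lemma bilin_ext:
  assumes h: "bilin s As Bs h" and k: "bilin s As Bs k"
    and pure: "\<And>xs ys. xs \<in> listset As \<Longrightarrow> ys \<in> listset Bs \<Longrightarrow>
      h (pure_tensor s As xs) (pure_tensor s Bs ys) = k (pure_tensor s As xs) (pure_tensor s Bs ys)"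
    and t: "t \<in> tensor_space s As" and u: "u \<in> tensor_space s Bs"
  shows "h t u = k t u"
  using t
proof (induct rule: tensor_space_induct)
  case (pure xs)
  have p: "pure_tensor s As xs \<in> tensor_space s As" by (rule pure_in_tensor_space[OF pure])
  show ?case
    using u
  proof (induct rule: tensor_space_induct)
    case (pure ys)
    then show ?case using assms(3) \<open>xs \<in> listset As\<close> by blast
  qed (simp_all only: bilin_zero(2)[OF h p] bilin_zero(2)[OF k p] bilinD(2,4)[OF h p] bilinD(2,4)[OF k p])
qed (simp_all only: bilin_zero(1)[OF h u] bilin_zero(1)[OF k u] bilinD(1,3)[OF h _ u] bilinD(1,3)[OF k _ u])

lemma bilin_append: "bilin s As Bs (tensor_append s As Bs)"
  unfolding bilin_def
proof (intro conjI ballI allI ext)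
  fix t u u' \<omega> assume t: "t \<in> tensor_space s As" and u: "u \<in> tensor_space s Bs" and u': "u' \<in> tensor_space s Bs"
  show "tensor_append s As Bs t (u + u') \<omega> = (tensor_append s As Bs t u + tensor_append s As Bs t u') \<omega>"
    by (simp add: tensor_append_def tensor_add[OF t mf_partial[OF u] mf_partial[OF u']])
next
  fix t u c \<omega> assume t: "t \<in> tensor_space s As" and u: "u \<in> tensor_space s Bs"
  show "tensor_append s As Bs t (tensor_scale c u) \<omega> = tensor_scale c (tensor_append s As Bs t u) \<omega>"
    by (simp add: tensor_append_def tensor_mult[OF t mf_partial[OF u]] tensor_scale_apply)
qed (simp_all add: tensor_append_def tensor_scale_apply)

lemma bilin_lift: "bilin s As Bs h \<Longrightarrow> bilin s As Bs (\<lambda>t u. tensor_lift F (h t u))"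
proof -
  assume b: "bilin s As Bs h"
  show ?thesis
    unfolding bilin_def
    by (intro conjI ballI allI) (simp_all only: bilinD[OF b] tensor_lift_add tensor_lift_scale)
qed

lemma tensor_append_in:
  assumes t: "t \<in> tensor_space s As" and u: "u \<in> tensor_space s Bs"
  shows "tensor_append s As Bs t u \<in> tensor_space s (As @ Bs)"
  using t
proof (induct rule: tensor_space_induct)
  case (pure xs)
  have p: "pure_tensor s As xs \<in> tensor_space s As" by (rule pure_in_tensor_space[OF pure])
  show ?case
    using u
  proof (induct rule: tensor_space_induct)
    case (pure ys)
    have "xs @ ys \<in> listset (As @ Bs)"
      using listset_append[OF listset_length[OF \<open>xs \<in> listset As\<close>]] pure \<open>xs \<in> listset As\<close> by blast
    then show ?case
      unfolding tensor_append_pure[OF \<open>xs \<in> listset As\<close> pure] by (rule pure_in_tensor_space)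
  qed (simp_all only: bilin_zero(2)[OF bilin_append p] bilinD(2,4)[OF bilin_append p] tensor_space_0 tensor_space_add tensor_space_scale)
qed (simp_all only: bilin_zero(1)[OF bilin_append u] bilinD(1,3)[OF bilin_append _ u] tensor_space_0 tensor_space_add tensor_space_scale)

lemma permute_block_swap: "permute_list (block_swap (length xs) (length ys)) (xs @ ys) = ys @ xs"
  by (rule nth_equalityI) (auto simp: permute_list_def block_swap_def nth_append)

lemma permute_perm_sum:
  assumes "\<sigma> permutes {..<length xs}" "\<tau> permutes {..<length ys}"
  shows "permute_list (perm_sum (length xs) \<sigma> \<tau>) (xs @ ys) = permute_list \<sigma> xs @ permute_list \<tau> ys"
proof (rule nth_equalityI)
  fix i assume "i < length (permute_list (perm_sum (length xs) \<sigma> \<tau>) (xs @ ys))"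
  moreover have "\<sigma> i < length xs" if "i < length xs" using permutes_in_image[OF assms(1), of i] that by simp
  moreover have "\<tau> j < length ys" if "j < length ys" for j using permutes_in_image[OF assms(2), of j] that by simp
  ultimately show "permute_list (perm_sum (length xs) \<sigma> \<tau>) (xs @ ys) ! i = (permute_list \<sigma> xs @ permute_list \<tau> ys) ! i"
    by (auto simp: permute_list_def perm_sum_def nth_append)
qed simp

lemma tensor_append_zero_left: "tensor_append s As Bs 0 u = 0"
  by (rule ext) (simp add: tensor_append_def)

context
  fixes s :: "'k::field \<Rightarrow> 'a::ab_group_add \<Rightarrow> 'a"
begin

lemma tensor_append_zero_right: "t \<in> tensor_space s As \<Longrightarrow> tensor_append s As Bs t 0 = 0"
  by (rule bilin_zero(2)[OF bilin_append])

lemma tensor_append_assoc: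
  assumes t: "t \<in> tensor_space s As" and u: "u \<in> tensor_space s Bs" and v: "v \<in> tensor_space s Cs"
  shows "tensor_append s (As @ Bs) Cs (tensor_append s As Bs t u) v =
    tensor_append s As (Bs @ Cs) t (tensor_append s Bs Cs u v)"
proof
  fix \<omega>
  show "tensor_append s (As @ Bs) Cs (tensor_append s As Bs t u) v \<omega> =
    tensor_append s As (Bs @ Cs) t (tensor_append s Bs Cs u v) \<omega>"
  proof (cases "\<omega> \<in> multilinear_forms s (As @ Bs @ Cs)")
    case True
    then have w: "(\<lambda>zs. v (\<lambda>ws. \<omega> (zs @ ws))) \<in> multilinear_forms s (As @ Bs)" by (intro mf_partial[OF v]) simp
    note w2 = mf_partial[OF u w]
    \<comment> \<open>The membership test of the inner \<open>tensor_append\<close> can fail only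
      for \<open>xs\<close> outside the product, where the other side is \<open>0\<close> as
      well.\<close>
    have "(if (\<lambda>zs. \<omega> (xs @ zs)) \<in> multilinear_forms s (Bs @ Cs) then u (\<lambda>ys. v (\<lambda>ws. \<omega> (xs @ ys @ ws))) else 0) =
       u (\<lambda>ys. v (\<lambda>ws. \<omega> ((xs @ ys) @ ws)))" for xs
    proof (cases "xs \<in> listset As")
      case xs: True
      then show ?thesis using mf_append_right[OF True xs] by simp
    next
      case False
      then show ?thesis using multilinearD(1)[OF w2 False] by simp
    qed
    then show ?thesis using True w by (simp add: tensor_append_def)
  qed (simp add: tensor_append_def)
qed

lemma tensor_append_unit_left:
  assumes "u \<in> tensor_space s Bs"
  shows "tensor_append s [] Bs (pure_tensor s [] []) u = u"
proof -
  have e: "[] \<in> listset []" by simp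
  note p = pure_in_tensor_space[OF e]
  show ?thesis
    using assms
  proof (induct rule: tensor_space_induct)
    case (pure xs)
    show ?case using tensor_append_pure[OF e pure] by (simp only: append_Nil)
  qed (simp_all only: bilin_zero(2)[OF bilin_append p] bilinD(2,4)[OF bilin_append p])
qed

lemma tensor_append_unit_right:
  assumes "t \<in> tensor_space s As"
  shows "tensor_append s As [] t (pure_tensor s [] []) = t"
proof -
  have e: "[] \<in> listset []" by simp
  note p = pure_in_tensor_space[OF e]
  show ?thesis
    using assms
  proof (induct rule: tensor_space_induct)
    case (pure xs)
    show ?case using tensor_append_pure[OF pure e] by (simp only: append_Nil2)
  qed (simp_all only: bilin_zero(1)[OF bilin_append p] bilinD(1,3)[OF bilin_append _ p])
qed

end

section \<open>Evaluation of PROP expressions\<close>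

locale fe_ground =
  fixes sU :: "'k::field \<Rightarrow> 'u::ab_group_add \<Rightarrow> 'u" and sV :: "'k \<Rightarrow> 'v::ab_group_add \<Rightarrow> 'v"
begin

abbreviation s :: "'k \<Rightarrow> 'u \<times> 'v \<Rightarrow> 'u \<times> 'v" where "s \<equiv> T_scale sU sV"
abbreviation Tp :: "color list \<Rightarrow> ('u \<times> 'v) set list" where "Tp \<equiv> T_pieces"
abbreviation pt :: "color list \<Rightarrow> ('u \<times> 'v) list \<Rightarrow> ('k, 'u \<times> 'v) tensor" where "pt c \<equiv> pure_tensor s (Tp c)"

text \<open>The degree \<open>0\<close> part of \<open>End_T\<close>, where all its nonzero elements
  live.\<close>

definition E0 :: "color list \<Rightarrow> color list \<Rightarrow> ('k, 'u, 'v) end_map set" where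
  "E0 c d = {F \<in> multilinear_maps s tensor_scale (Tp c). \<forall>xs. F xs \<in> tensor_space s (Tp d)}"

lemma E0D: "F \<in> E0 c d \<Longrightarrow> F \<in> multilinear_maps s tensor_scale (Tp c)" "F \<in> E0 c d \<Longrightarrow> F xs \<in> tensor_space s (Tp d)"
  by (simp_all add: E0_def)

lemma E0_off: "F \<in> E0 c d \<Longrightarrow> xs \<notin> listset (Tp c) \<Longrightarrow> F xs = 0"
  by (rule multilinearD(1)[OF E0D(1)])

lemma E0_ext:
  assumes "F \<in> E0 c d" "G \<in> E0 c d" "\<And>xs. xs \<in> listset (Tp c) \<Longrightarrow> F xs = G xs"
  shows "F = G"
proof
  fix xs show "F xs = G xs"
    using assms(3) E0_off[OF assms(1)] E0_off[OF assms(2)] by (cases "xs \<in> listset (Tp c)") auto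
qed

lemma E0I:
  assumes "\<And>xs. xs \<notin> listset (Tp c) \<Longrightarrow> F xs = 0"
    and "\<And>xs i x y. xs \<in> listset (Tp c) \<Longrightarrow> i < length c \<Longrightarrow> x \<in> Tp c ! i \<Longrightarrow> y \<in> Tp c ! i \<Longrightarrow>
       F (xs[i := x + y]) = F (xs[i := x]) + F (xs[i := y])"
    and "\<And>xs i x k. xs \<in> listset (Tp c) \<Longrightarrow> i < length c \<Longrightarrow> x \<in> Tp c ! i \<Longrightarrow>
       F (xs[i := s k x]) = tensor_scale k (F (xs[i := x]))"
    and "\<And>xs. xs \<in> listset (Tp c) \<Longrightarrow> F xs \<in> tensor_space s (Tp d)"
  shows "F \<in> E0 c d"
proof -
  have "F xs \<in> tensor_space s (Tp d)" for xs
    using assms(1)[of xs] assms(4)[of xs] tensor_space_0[of s "Tp d"] by (cases "xs \<in> listset (Tp c)") auto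
  then show ?thesis
    unfolding E0_def multilinear_maps_def mem_Collect_eq length_map using assms(1-3) by blast
qed

lemma E0_slot:
  assumes "F \<in> E0 c d" "xs \<in> listset (Tp c)" "i < length c" "x \<in> Tp c ! i"
  shows "y \<in> Tp c ! i \<Longrightarrow> F (xs[i := x + y]) = F (xs[i := x]) + F (xs[i := y])"
    and "F (xs[i := s k x]) = tensor_scale k (F (xs[i := x]))"
  using multilinearD(2,3)[OF E0D(1)[OF assms(1)] assms(2)] assms(3,4) unfolding length_map by blast+

lemma E0_zero: "0 \<in> E0 c d"
proof -
  have "(0 :: ('k, 'u, 'v) end_map) = (\<lambda>_. 0)" by (rule zero_fun_def)
  moreover have "(\<lambda>_. 0) \<in> E0 c d"
    by (rule E0I) (simp_all only: tensor_space_0 TS.scale_zero_right add_0_left)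
  ultimately show ?thesis by (simp only:)
qed

lemma lift_in:
  assumes "F \<in> E0 c d" "t \<in> tensor_space s (Tp c)"
  shows "tensor_lift F t \<in> tensor_space s (Tp d)"
  using assms(2)
proof (induct rule: tensor_space_induct)
  case (pure xs)
  show ?case unfolding tensor_lift_pure[OF E0D(1)[OF assms(1)] pure] by (rule E0D(2)[OF assms(1)])
qed (simp_all only: tensor_lift_0 tensor_lift_add tensor_lift_scale tensor_space_0 tensor_space_add tensor_space_scale)

lemma E0_comp: "F \<in> E0 d e \<Longrightarrow> G \<in> E0 c d \<Longrightarrow> end_comp F G \<in> E0 c e"
  unfolding end_comp_def
  by (rule E0I) (simp_all only: not_False_eq_True E0_off tensor_lift_0 E0_slot tensor_lift_add tensor_lift_scale lift_in E0D(2))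

lemma E0_plus: "F \<in> E0 c d \<Longrightarrow> G \<in> E0 c d \<Longrightarrow> F + G \<in> E0 c d"
  by (rule E0I)
    (simp_all only: not_False_eq_True plus_fun_apply[of F G] E0_off E0_slot tensor_space_add E0D(2) add_0_left TS.scale_right_distrib add.assoc add.left_commute)

lemma E0_scale: "F \<in> E0 c d \<Longrightarrow> (\<lambda>xs. tensor_scale k (F xs)) \<in> E0 c d"
  by (rule E0I)
    (simp_all only: not_False_eq_True E0_off E0_slot tensor_space_scale E0D(2) TS.scale_zero_right TS.scale_right_distrib TS.scale_left_commute[of k])

lemma E0_tens:
  assumes F: "F \<in> E0 c d" and G: "G \<in> E0 c' d'"
  shows "end_tens sU sV c d d' F G \<in> E0 (c @ c') (d @ d')"
proof (rule E0I)
  let ?n = "length c"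
  note ap = bilinD[OF bilin_append E0D(2)[OF F] E0D(2)[OF G]]
  fix xs
  show "end_tens sU sV c d d' F G xs = 0" if "xs \<notin> listset (Tp (c @ c'))"
  proof -
    have "take ?n xs \<notin> listset (Tp c) \<or> drop ?n xs \<notin> listset (Tp c')"
      using that listset_append_iff[of xs "Tp c" "Tp c'"] by auto
    then show ?thesis
      unfolding end_tens_def using E0_off[OF F] E0_off[OF G] tensor_append_zero_left
        tensor_append_zero_right[OF E0D(2)[OF F]] by metis
  qed
  assume "xs \<in> listset (Tp (c @ c'))"
  then have xs: "take ?n xs \<in> listset (Tp c)" "drop ?n xs \<in> listset (Tp c')"
    using listset_append_iff[of xs "Tp c" "Tp c'"] by auto
  show "end_tens sU sV c d d' F G xs \<in> tensor_space s (Tp (d @ d'))"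
    unfolding end_tens_def map_append by (rule tensor_append_in[OF E0D(2)[OF F] E0D(2)[OF G]])
  fix i x assume i: "i < length (c @ c')" and x: "x \<in> Tp (c @ c') ! i"
  have u1: "take ?n (xs[i := z]) = (if i < ?n then (take ?n xs)[i := z] else take ?n xs)" for z
    by (simp add: take_update_cancel) (simp add: take_update_swap)
  have u2: "drop ?n (xs[i := z]) = (if i < ?n then drop ?n xs else (drop ?n xs)[i - ?n := z])" for z
    by (simp add: drop_update_swap)
  note u = u1 u2
  have n: "Tp (c @ c') ! i = (if i < ?n then Tp c ! i else Tp c' ! (i - ?n))"
    by (simp add: nth_append)
  have slotF: "i < ?n \<Longrightarrow> y \<in> Tp c ! i \<Longrightarrow> F ((take ?n xs)[i := x + y]) = F ((take ?n xs)[i := x]) + F ((take ?n xs)[i := y])"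
    "i < ?n \<Longrightarrow> F ((take ?n xs)[i := s k x]) = tensor_scale k (F ((take ?n xs)[i := x]))" for y k
    using E0_slot[OF F xs(1)] x n by simp_all
  have slotG: "\<not> i < ?n \<Longrightarrow> y \<in> Tp c' ! (i - ?n) \<Longrightarrow> G ((drop ?n xs)[i - ?n := x + y]) = G ((drop ?n xs)[i - ?n := x]) + G ((drop ?n xs)[i - ?n := y])"
    "\<not> i < ?n \<Longrightarrow> G ((drop ?n xs)[i - ?n := s k x]) = tensor_scale k (G ((drop ?n xs)[i - ?n := x]))" for y k
    using E0_slot[OF G xs(2), of "i - ?n"] x n i by simp_all
  show "end_tens sU sV c d d' F G (xs[i := s k x]) = tensor_scale k (end_tens sU sV c d d' F G (xs[i := x]))" for k
    unfolding end_tens_def u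
    by (cases "i < ?n") (simp_all only: not_False_eq_True slotF slotG if_True if_False ap)
  fix y assume y: "y \<in> Tp (c @ c') ! i"
  show "end_tens sU sV c d d' F G (xs[i := x + y]) = end_tens sU sV c d d' F G (xs[i := x]) + end_tens sU sV c d d' F G (xs[i := y])"
    unfolding end_tens_def u using y n
    by (cases "i < ?n") (simp_all only: not_False_eq_True slotF slotG if_True if_False ap E0D(2)[OF F] E0D(2)[OF G])
qed

lemma listset_Tp_permute:
  assumes "\<sigma> permutes {..<length c}" "xs \<in> listset (Tp c)"
  shows "permute_list \<sigma> xs \<in> listset (Tp (permute_list \<sigma> c))"
proof -
  have "\<sigma> i < length c" if "i < length c" for i using permutes_in_image[OF assms(1), of i] that by simp
  then show ?thesis using assms(2) by (simp add: mem_listset permute_list_def)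
qed

lemma permute_list_update:
  assumes "\<sigma> permutes {..<length xs}" "i < length xs"
  obtains j where "j < length xs" "\<sigma> j = i" "\<And>z. permute_list \<sigma> (xs[i := z]) = (permute_list \<sigma> xs)[j := z]"
proof -
  obtain j where j: "\<sigma> j = i" using permutes_surj[OF assms(1)] by (metis surjD)
  then have jl: "j < length xs" using permutes_in_image[OF assms(1), of j] assms(2) by simp
  have eq: "\<sigma> k = i \<longleftrightarrow> k = j" for k using j permutes_inj[OF assms(1)] by (auto dest: injD)
  have "permute_list \<sigma> (xs[i := z]) = (permute_list \<sigma> xs)[j := z]" for z
  proof (rule nth_equalityI)
    fix k assume k: "k < length (permute_list \<sigma> (xs[i := z]))"
    then have "\<sigma> k < length xs" using permutes_in_image[OF assms(1), of k] by simp
    with k show "permute_list \<sigma> (xs[i := z]) ! k = (permute_list \<sigma> xs)[j := z] ! k"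
      using jl eq[of k] assms(2) j by (cases "k = j") (simp_all add: permute_list_def nth_list_update)
  qed simp
  then show thesis by (rule that[OF jl j])
qed

lemma permute_list_listset_iff:
  assumes "\<sigma> permutes {..<length c}" "length xs = length c"
  shows "permute_list \<sigma> xs \<in> listset (Tp (permute_list \<sigma> c)) \<longleftrightarrow> xs \<in> listset (Tp c)"
proof
  assume p: "permute_list \<sigma> xs \<in> listset (Tp (permute_list \<sigma> c))"
  have "xs ! k \<in> Tp c ! k" if "k < length c" for k
  proof -
    obtain j where j: "\<sigma> j = k" using permutes_surj[OF assms(1)] by (metis surjD)
    then have "j < length c" using permutes_in_image[OF assms(1), of j] that by simp
    with p j assms that show ?thesis by (auto simp: mem_listset permute_list_nth)
  qed
  then show "xs \<in> listset (Tp c)" using assms(2) by (simp add: mem_listset)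
qed (rule listset_Tp_permute[OF assms(1)])

lemma end_perm_eq:
  assumes "\<sigma> permutes {..<length c}" "length xs = length c"
  shows "end_perm sU sV c \<sigma> xs = pt (permute_list \<sigma> c) (permute_list \<sigma> xs)"
  using permute_list_listset_iff[OF assms] multilinearD(1)[OF pure_tensor_multilinear]
  by (auto simp: end_perm_def)

lemma E0_perm:
  assumes \<sigma>: "\<sigma> permutes {..<length c}"
  shows "end_perm sU sV c \<sigma> \<in> E0 c (permute_list \<sigma> c)"
proof (rule E0I)
  let ?d = "permute_list \<sigma> c"
  fix xs
  show "end_perm sU sV c \<sigma> xs = 0" if "xs \<notin> listset (Tp c)" using that by (simp add: end_perm_def)
  assume xs: "xs \<in> listset (Tp c)"
  note m = listset_Tp_permute[OF \<sigma> xs]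
  show "end_perm sU sV c \<sigma> xs \<in> tensor_space s (Tp ?d)"
    using xs pure_in_tensor_space[OF m] by (simp add: end_perm_def)
  fix i x assume i: "i < length c" and x: "x \<in> Tp c ! i"
  have l: "length xs = length c" using xs by (simp add: mem_listset)
  obtain j where j: "j < length c" "\<sigma> j = i" "\<And>z. permute_list \<sigma> (xs[i := z]) = (permute_list \<sigma> xs)[j := z]"
    using permute_list_update[of \<sigma> xs i] \<sigma> i l by metis
  have Td: "Tp ?d ! j = Tp c ! i" using j \<sigma> i by (simp add: permute_list_nth)
  have e: "end_perm sU sV c \<sigma> (xs[i := z]) = pt ?d ((permute_list \<sigma> xs)[j := z])" for z
    using end_perm_eq[OF \<sigma>, of "xs[i := z]"] l by (simp add: j(3))
  have jl: "j < length (Tp ?d)" using j by simp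
  note P = multilinearD(2,3)[OF pure_tensor_multilinear m jl, unfolded Td, OF x]
  show "end_perm sU sV c \<sigma> (xs[i := s k x]) = tensor_scale k (end_perm sU sV c \<sigma> (xs[i := x]))" for k
    unfolding e by (rule P(2))
  fix y assume y: "y \<in> Tp c ! i"
  show "end_perm sU sV c \<sigma> (xs[i := x + y]) = end_perm sU sV c \<sigma> (xs[i := x]) + end_perm sU sV c \<sigma> (xs[i := y])"
    unfolding e by (rule P(1)[OF y])
qed

end

lemma prop_axiom_boundaries:
  assumes "prop_axiom a b" "wf_pexp a" "wf_pexp b"
  shows "src a = src b \<and> tgt a = tgt b \<and> deg a = deg b"
  using assms
  by (induct rule: prop_axiom.induct) (simp_all add: permute_block_swap permute_perm_sum permute_list_compose)

lemma prop_eq_boundaries: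
  "prop_eq a b \<Longrightarrow> wf_pexp a \<and> wf_pexp b \<and> src a = src b \<and> tgt a = tgt b \<and> deg a = deg b"
  by (induct rule: prop_eq.induct) (simp_all add: prop_axiom_boundaries)

context fe_ground
begin

text \<open>Defined on all expressions, well-formed or not, for an arbitrary assignment to the
  generators; compatibility with \<open>prop_eq\<close> is a separate matter, settled in
  \<open>E_prop_eq\<close>.\<close>

primrec ev :: "(gen \<Rightarrow> ('k, 'u, 'v) end_map) \<Rightarrow> 'k pexp \<Rightarrow> ('k, 'u, 'v) end_map" where
  "ev gm (Gen x) = gm x"
| "ev gm (Perm c \<sigma>) = end_perm sU sV c \<sigma>"
| "ev gm (Comp a b) = end_comp (ev gm a) (ev gm b)"
| "ev gm (Tens a b) = end_tens sU sV (src a) (tgt a) (tgt b) (ev gm a) (ev gm b)"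
| "ev gm (Zero c d n) = 0"
| "ev gm (Plus a b) = ev gm a + ev gm b"
| "ev gm (Scale r a) = (\<lambda>xs. tensor_scale r (ev gm a xs))"

lemma End_T_eq: "End_T sU sV c d n = (if n = 0 then E0 c d else {0})"
  by (simp add: End_T_def E0_def)

lemma end_comp_zero_left: "G \<in> E0 c d \<Longrightarrow> end_comp 0 G = 0"
  by (intro ext) (simp add: end_comp_def tensor_lift_def tensor_zero[OF E0D(2)])

lemma end_comp_zero_right: "end_comp F 0 = 0"
  by (intro ext) (simp add: end_comp_def tensor_lift_def)

lemma end_comp_add_left:
  assumes "F \<in> E0 d e" "F' \<in> E0 d e" "G \<in> E0 c d"
  shows "end_comp (F + F') G = end_comp F G + end_comp F' G"
  by (intro ext) (simp add: end_comp_def tensor_lift_def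
      tensor_add[OF E0D(2)[OF assms(3)] mf_component[OF E0D(1)[OF assms(1)]] mf_component[OF E0D(1)[OF assms(2)]]])

lemma end_comp_scale_left:
  assumes "F \<in> E0 d e" "G \<in> E0 c d"
  shows "end_comp (\<lambda>xs. tensor_scale r (F xs)) G = (\<lambda>xs. tensor_scale r (end_comp F G xs))"
  by (intro ext) (simp add: end_comp_def tensor_lift_def tensor_scale_apply
      tensor_mult[OF E0D(2)[OF assms(2)] mf_component[OF E0D(1)[OF assms(1)]]])

lemma end_tens_zero_left: "end_tens sU sV c d d' 0 G = 0"
  by (intro ext) (simp add: end_tens_def tensor_append_def)

lemma end_tens_zero_right: "F \<in> E0 c d \<Longrightarrow> end_tens sU sV c d d' F 0 = 0"
proof -
  assume F: "F \<in> E0 c d"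
  have "(0 :: ('k, 'u, 'v) end_map) ys = 0" for ys by (rule zero_fun_apply)
  then show ?thesis by (intro ext) (simp only: end_tens_def tensor_append_zero_right[OF E0D(2)[OF F]] zero_fun_apply)
qed

lemma lift_id: "t \<in> tensor_space s (Tp d) \<Longrightarrow> tensor_lift (end_perm sU sV d id) t = t"
proof (induct rule: tensor_space_induct)
  case (pure xs)
  have "end_perm sU sV d id \<in> E0 d (permute_list id d)" by (rule E0_perm) (rule permutes_id)
  moreover have "end_perm sU sV d id xs = pt d xs" using pure by (simp add: end_perm_def del: id_apply)
  ultimately show ?case using tensor_lift_pure[OF E0D(1) pure] by metis
qed (simp_all only: tensor_lift_0 tensor_lift_add tensor_lift_scale)

text \<open>The interchange law for maps of degree \<open>0\<close>, hence without a sign. Both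
  sides are bilinear, so decomposable tensors suffice.\<close>

lemma lift_tens:
  assumes F: "F \<in> E0 c d" and G: "G \<in> E0 c' d'"
    and t: "t \<in> tensor_space s (Tp c)" and u: "u \<in> tensor_space s (Tp c')"
  shows "tensor_lift (end_tens sU sV c d d' F G) (tensor_append s (Tp c) (Tp c') t u) =
    tensor_append s (Tp d) (Tp d') (tensor_lift F t) (tensor_lift G u)"
proof (rule bilin_ext[OF _ _ _ t u])
  show "bilin s (Tp c) (Tp c') (\<lambda>t u. tensor_lift (end_tens sU sV c d d' F G) (tensor_append s (Tp c) (Tp c') t u))"
    by (rule bilin_lift[OF bilin_append])
  show "bilin s (Tp c) (Tp c') (\<lambda>t u. tensor_append s (Tp d) (Tp d') (tensor_lift F t) (tensor_lift G u))"
    unfolding bilin_def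
    by (intro conjI ballI allI)
      (simp_all only: tensor_lift_add tensor_lift_scale bilinD[OF bilin_append] lift_in[OF F] lift_in[OF G])
  fix xs ys assume xs: "xs \<in> listset (Tp c)" and ys: "ys \<in> listset (Tp c')"
  have l: "length xs = length c" using listset_length[OF xs] by simp
  have m: "xs @ ys \<in> listset (Tp (c @ c'))" using listset_append[of xs "Tp c" ys "Tp c'"] xs ys l by simp
  show "tensor_lift (end_tens sU sV c d d' F G) (tensor_append s (Tp c) (Tp c') (pt c xs) (pt c' ys)) =
    tensor_append s (Tp d) (Tp d') (tensor_lift F (pt c xs)) (tensor_lift G (pt c' ys))"
    unfolding tensor_append_pure[OF xs ys] tensor_lift_pure[OF E0D(1)[OF F] xs] tensor_lift_pure[OF E0D(1)[OF G] ys]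
    using tensor_lift_pure[OF E0D(1)[OF E0_tens[OF F G]] m] l by (simp add: end_tens_def)
qed

lemma lift_swap:
  assumes t: "t \<in> tensor_space s (Tp d)" and u: "u \<in> tensor_space s (Tp d')"
  shows "tensor_lift (end_perm sU sV (d @ d') (block_swap (length d) (length d'))) (tensor_append s (Tp d) (Tp d') t u) =
    tensor_append s (Tp d') (Tp d) u t"
proof (rule bilin_ext[OF _ _ _ t u])
  let ?\<sigma> = "block_swap (length d) (length d')"
  have \<sigma>: "?\<sigma> permutes {..<length (d @ d')}"
    by (rule bij_imp_permutes[OF bij_betw_byWitness[where f' = "block_swap (length d') (length d)"]])
      (auto simp: block_swap_def)
  show "bilin s (Tp d) (Tp d') (\<lambda>t u. tensor_lift (end_perm sU sV (d @ d') ?\<sigma>) (tensor_append s (Tp d) (Tp d') t u))"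
    by (rule bilin_lift[OF bilin_append])
  show "bilin s (Tp d) (Tp d') (\<lambda>t u. tensor_append s (Tp d') (Tp d) u t)"
    unfolding bilin_def by (intro conjI ballI allI) (simp_all only: bilinD[OF bilin_append])
  fix xs ys assume xs: "xs \<in> listset (Tp d)" and ys: "ys \<in> listset (Tp d')"
  have l: "length xs = length d" "length ys = length d'" using listset_length[OF xs] listset_length[OF ys] by simp_all
  have m: "xs @ ys \<in> listset (Tp (d @ d'))" using listset_append[of xs "Tp d" ys "Tp d'"] xs ys l by simp
  show "tensor_lift (end_perm sU sV (d @ d') ?\<sigma>) (tensor_append s (Tp d) (Tp d') (pt d xs) (pt d' ys)) =
    tensor_append s (Tp d') (Tp d) (pt d' ys) (pt d xs)"
    unfolding tensor_append_pure[OF xs ys] tensor_append_pure[OF ys xs]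
    using tensor_lift_pure[OF E0D(1)[OF E0_perm[OF \<sigma>]] m] m permute_block_swap[of xs ys] permute_block_swap[of d d']
    by (simp add: end_perm_def l)
qed

end

text \<open>What the images of the generators must satisfy for \<open>ev\<close> to respect the
  relations of the PROP; skew symmetry is the only relation that speaks of generators. The
  differential is not considered yet.\<close>

locale fe_gens = fe_ground sU sV
  for sU :: "'k::field \<Rightarrow> 'u::ab_group_add \<Rightarrow> 'u" and sV :: "'k \<Rightarrow> 'v::ab_group_add \<Rightarrow> 'v" +
  fixes gm :: "gen \<Rightarrow> ('k, 'u, 'v) end_map"
  assumes gm: "gen_valid x \<Longrightarrow> gm x \<in> End_T sU sV (gen_src x) (gen_tgt x) (gen_deg x)"
    and gm_skew: "gen_valid x \<Longrightarrow> \<sigma> permutes {..<length (gen_src x)} \<Longrightarrow> xs \<in> listset (T_pieces (gen_src x)) \<Longrightarrow>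
      gm x (permute_list \<sigma> xs) = tensor_scale (of_int (sign \<sigma>)) (gm x xs)"
begin

abbreviation E :: "'k pexp \<Rightarrow> ('k, 'u, 'v) end_map" where "E \<equiv> ev gm"

lemma E_E0: "wf_pexp a \<Longrightarrow> E a \<in> E0 (src a) (tgt a)"
proof (induct a)
  case (Gen x)
  then have "gm x \<in> End_T sU sV (gen_src x) (gen_tgt x) (gen_deg x)" using gm by simp
  then show ?case
    using E0_zero unfolding End_T_eq by (cases "gen_deg x = 0") (simp_all del: zero_fun_apply)
qed (simp_all del: zero_fun_apply add: E0_zero E0_perm E0_tens E0_scale, simp_all only: E0_comp E0_plus)

text \<open>\<open>End_T\<close> is zero outside degree \<open>0\<close>, and a sum of two degrees
  is nonzero only if one of them is.\<close>

lemma E_deg: "wf_pexp a \<Longrightarrow> deg a \<noteq> 0 \<Longrightarrow> E a = 0"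
proof (induct a)
  case (Gen x)
  then show ?case using gm[of x] by (auto simp: End_T_eq split: if_splits)
next
  case (Comp a b)
  then have "E a = 0 \<or> E b = 0" by (cases "deg a = 0") (simp_all del: zero_fun_apply)
  then show ?case
    using end_comp_zero_left[OF E_E0, of b] Comp.prems by (auto simp del: zero_fun_apply simp: end_comp_zero_right)
next
  case (Tens a b)
  then have "E a = 0 \<or> E b = 0" by (cases "deg a = 0") (simp_all del: zero_fun_apply)
  then show ?case
    using end_tens_zero_right[OF E_E0, of a] Tens.prems by (auto simp del: zero_fun_apply simp: end_tens_zero_left)
next
  case (Plus a b)
  then have "E a = 0" "E b = 0" by (simp_all del: zero_fun_apply)
  then show ?case by (simp only: ev.simps add_0_left)
next
  case (Scale r a)
  then have "E a = 0" by (simp del: zero_fun_apply)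
  then show ?case by (intro ext) (simp add: tensor_scale_apply)
qed simp_all

lemma E_End: "wf_pexp a \<Longrightarrow> E a \<in> End_T sU sV (src a) (tgt a) (deg a)"
  using E_E0[of a] E_deg[of a] unfolding End_T_eq by auto

lemma E_axiom:
  assumes "prop_axiom a b" "wf_pexp a" "wf_pexp b"
  shows "E a = E b"
  using assms
proof (induct rule: prop_axiom.induct)
  case (comp_plus_left a b c)
  then show ?case
    using end_comp_add_left[of "E a" "tgt c" "tgt a" "E b" "E c" "src c"] E_E0[of a] E_E0[of b] E_E0[of c]
    by (simp del: plus_fun_apply)
next
  case (comp_plus_right a b c)
  show ?case by (rule ext) (simp only: ev.simps end_comp_def tensor_lift_add plus_fun_apply)
next
  case (comp_scale_left r a b)
  then show ?case
    using end_comp_scale_left[of "E a" "tgt b" "tgt a" "E b" "src b" r] E_E0[of a] E_E0[of b] by simp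
next
  case (comp_scale_right a r b)
  show ?case by (simp add: end_comp_def tensor_lift_scale)
next
  case (tens_plus_left a b c)
  then have "E a xs \<in> tensor_space s (Tp (tgt b))" "E b xs \<in> tensor_space s (Tp (tgt b))"
    "E c xs \<in> tensor_space s (Tp (tgt c))" for xs
    using E0D(2)[OF E_E0[of a]] E0D(2)[OF E_E0[of b]] E0D(2)[OF E_E0[of c]] by simp_all
  note ap = bilinD(1)[OF bilin_append this(1,3,2)]
  show ?case using tens_plus_left by (intro ext) (simp add: end_tens_def ap)
next
  case (tens_plus_right a b c)
  then have "E a xs \<in> tensor_space s (Tp (tgt a))" "E b xs \<in> tensor_space s (Tp (tgt c))"
    "E c xs \<in> tensor_space s (Tp (tgt c))" for xs
    using E0D(2)[OF E_E0[of a]] E0D(2)[OF E_E0[of b]] E0D(2)[OF E_E0[of c]] by simp_all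
  note ap = bilinD(2)[OF bilin_append this]
  show ?case using tens_plus_right by (intro ext) (simp add: end_tens_def ap)
next
  case (tens_scale_left r a b)
  then show ?case
    using bilinD(3)[OF bilin_append E0D(2)[OF E_E0[of a]] E0D(2)[OF E_E0[of b]]] by (simp add: end_tens_def)
next
  case (tens_scale_right a r b)
  then show ?case
    using bilinD(4)[OF bilin_append E0D(2)[OF E_E0[of a]] E0D(2)[OF E_E0[of b]]] by (simp add: end_tens_def)
next
  case (comp_assoc a b c)
  show ?case by (intro ext) (simp add: end_comp_def tensor_lift_def)
next
  case (comp_id_left a)
  then show ?case using lift_id[OF E0D(2)[OF E_E0[of a]]] by (simp add: end_comp_def)
next
  case (comp_id_right a)
  show ?case
  proof (rule E0_ext)
    have "wf_pexp a" using comp_id_right by simp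
    note a = E_E0[OF this]
    show "E a \<in> E0 (src a) (tgt a)" by (rule a)
    show "E (Comp a (Perm (src a) id)) \<in> E0 (src a) (tgt a)" using E_E0[OF comp_id_right(1)] by simp
    show "E (Comp a (Perm (src a) id)) xs = E a xs" if "xs \<in> listset (Tp (src a))" for xs
      using tensor_lift_pure[OF E0D(1)[OF a] that] that by (simp add: end_comp_def end_perm_def)
  qed
next
  case (tens_assoc a b c)
  then show ?case
    using tensor_append_assoc[OF E0D(2)[OF E_E0[of a]] E0D(2)[OF E_E0[of b]] E0D(2)[OF E_E0[of c]]]
    by (simp add: end_tens_def drop_take add.commute)
next
  case (tens_unit_left a)
  then show ?case
    using tensor_append_unit_left[OF E0D(2)[OF E_E0[of a]]] by (simp add: end_tens_def end_perm_def)
next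
  case (tens_unit_right a)
  show ?case
  proof (rule E0_ext)
    have "wf_pexp a" using tens_unit_right by simp
    note a = E_E0[OF this]
    show "E a \<in> E0 (src a) (tgt a)" by (rule a)
    show "E (Tens a (Perm [] id)) \<in> E0 (src a) (tgt a)" using E_E0[OF tens_unit_right(1)] by simp
    show "E (Tens a (Perm [] id)) xs = E a xs" if "xs \<in> listset (Tp (src a))" for xs
      using tensor_append_unit_right[OF E0D(2)[OF a, of xs]] listset_length[OF that]
      by (simp add: end_tens_def end_perm_def)
  qed
next
  case (interchange a b a' b')
  then have wf: "wf_pexp a" "wf_pexp b" "wf_pexp a'" "wf_pexp b'" "src a = tgt a'" "src b = tgt b'"
    by simp_all
  note e = wf(1-4)[THEN E_E0]
  show ?case
  proof (cases "even (deg b * deg a')")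
    case True
    show ?thesis
      using lift_tens[OF e(1,2)[unfolded wf(5,6)] E0D(2)[OF e(3)] E0D(2)[OF e(4)]] True wf(5,6)
      by (intro ext) (simp add: sign_pow_def end_comp_def end_tens_def tensor_scale_apply)
  next
    case False
    \<comment> \<open>An odd product of degrees means that both factors have nonzero degree, so both
      sides are \<open>0\<close> and the sign is harmless; the same argument serves
      \<open>swap_natural\<close>.\<close>
    then have "deg b \<noteq> 0" "deg a' \<noteq> 0" by auto
    then have z: "E b = 0" "E a' = 0" using E_deg wf by blast+
    show ?thesis
      by (intro ext) (simp only: ev.simps z end_comp_zero_right end_tens_zero_left tensor_scale_apply, simp)
  qed
next
  case (perm_comp \<sigma> c \<tau>)
  then have \<sigma>: "\<sigma> permutes {..<length c}" and \<tau>: "\<tau> permutes {..<length (permute_list \<sigma> c)}" by simp_all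
  have d: "permute_list \<tau> (permute_list \<sigma> c) = permute_list (\<sigma> \<circ> \<tau>) c" using \<tau> by (simp add: permute_list_compose)
  show ?case
  proof (rule E0_ext)
    show "E (Comp (Perm (permute_list \<sigma> c) \<tau>) (Perm c \<sigma>)) \<in> E0 c (permute_list (\<sigma> \<circ> \<tau>) c)"
      using E_E0[OF perm_comp(1)] d by simp
    show "E (Perm c (\<sigma> \<circ> \<tau>)) \<in> E0 c (permute_list (\<sigma> \<circ> \<tau>) c)" using E_E0[OF perm_comp(2)] by simp
    fix xs assume xs: "xs \<in> listset (Tp c)"
    have l: "length xs = length c" using listset_length[OF xs] by simp
    have c: "permute_list \<tau> (permute_list \<sigma> xs) = permute_list (\<sigma> \<circ> \<tau>) xs"
      using \<tau> l by (simp add: permute_list_compose)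
    have "E (Comp (Perm (permute_list \<sigma> c) \<tau>) (Perm c \<sigma>)) xs = end_perm sU sV (permute_list \<sigma> c) \<tau> (permute_list \<sigma> xs)"
      unfolding ev.simps end_comp_def end_perm_eq[OF \<sigma> l]
      by (rule tensor_lift_pure[OF E0D(1)[OF E0_perm[OF \<tau>]] listset_Tp_permute[OF \<sigma> xs]])
    also have "\<dots> = pt (permute_list (\<sigma> \<circ> \<tau>) c) (permute_list (\<sigma> \<circ> \<tau>) xs)"
      unfolding d[symmetric] c[symmetric] using l by (intro end_perm_eq[OF \<tau>]) simp
    also have "\<dots> = E (Perm c (\<sigma> \<circ> \<tau>)) xs"
      using end_perm_eq[of "\<sigma> \<circ> \<tau>" c xs] perm_comp(2) l by simp
    finally show "E (Comp (Perm (permute_list \<sigma> c) \<tau>) (Perm c \<sigma>)) xs = E (Perm c (\<sigma> \<circ> \<tau>)) xs" .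
  qed
next
  case (perm_tens c \<sigma> d \<tau>)
  then have \<sigma>: "\<sigma> permutes {..<length c}" and \<tau>: "\<tau> permutes {..<length d}" by simp_all
  have d: "permute_list (perm_sum (length c) \<sigma> \<tau>) (c @ d) = permute_list \<sigma> c @ permute_list \<tau> d"
    by (rule permute_perm_sum[OF \<sigma> \<tau>])
  show ?case
  proof (rule E0_ext)
    show "E (Tens (Perm c \<sigma>) (Perm d \<tau>)) \<in> E0 (c @ d) (permute_list \<sigma> c @ permute_list \<tau> d)"
      using E_E0[OF perm_tens(1)] by simp
    show "E (Perm (c @ d) (perm_sum (length c) \<sigma> \<tau>)) \<in> E0 (c @ d) (permute_list \<sigma> c @ permute_list \<tau> d)"
      using E_E0[OF perm_tens(2)] d by simp
    fix xs assume xs: "xs \<in> listset (Tp (c @ d))"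
    then have h: "take (length c) xs \<in> listset (Tp c)" "drop (length c) xs \<in> listset (Tp d)"
      using listset_append_iff[of xs "Tp c" "Tp d"] by auto
    have l: "length (take (length c) xs) = length c" "length (drop (length c) xs) = length d"
      using listset_length[OF h(1)] listset_length[OF h(2)] by simp_all
    have p: "permute_list (perm_sum (length c) \<sigma> \<tau>) xs = permute_list \<sigma> (take (length c) xs) @ permute_list \<tau> (drop (length c) xs)"
      using permute_perm_sum[of \<sigma> "take (length c) xs" \<tau> "drop (length c) xs"] \<sigma> \<tau> unfolding l by simp
    show "E (Tens (Perm c \<sigma>) (Perm d \<tau>)) xs = E (Perm (c @ d) (perm_sum (length c) \<sigma> \<tau>)) xs"
      using tensor_append_pure[OF listset_Tp_permute[OF \<sigma> h(1)] listset_Tp_permute[OF \<tau> h(2)], of s] xs h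
      by (simp add: end_tens_def end_perm_def p d)
  qed
next
  case (swap_natural a b)
  then have wf: "wf_pexp a" "wf_pexp b" by simp_all
  note e = wf[THEN E_E0]
  show ?case
  proof (cases "even (deg a * deg b)")
    case True
    let ?L = "Comp (Perm (tgt a @ tgt b) (block_swap (length (tgt a)) (length (tgt b)))) (Tens a b)"
    let ?R = "Comp (Tens b a) (Perm (src a @ src b) (block_swap (length (src a)) (length (src b))))"
    have "E ?L = E ?R"
    proof (rule E0_ext)
      show "E ?L \<in> E0 (src a @ src b) (tgt b @ tgt a)"
        using E_E0[OF swap_natural(1)] by (simp add: permute_block_swap)
      show "E ?R \<in> E0 (src a @ src b) (tgt b @ tgt a)"
        using E_E0[of ?R] swap_natural(2) by simp
      fix xs assume xs: "xs \<in> listset (Tp (src a @ src b))"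
      define p q where "p = take (length (src a)) xs" and "q = drop (length (src a)) xs"
      have x: "xs = p @ q" by (simp add: p_def q_def)
      have h: "p \<in> listset (Tp (src a))" "q \<in> listset (Tp (src b))"
        using listset_append_iff[of xs "Tp (src a)" "Tp (src b)"] xs by (auto simp: p_def q_def)
      have l: "length p = length (src a)" "length q = length (src b)"
        using listset_length[OF h(1)] listset_length[OF h(2)] by simp_all
      have m: "q @ p \<in> listset (Tp (src b @ src a))"
        using listset_append[of q "Tp (src b)" p "Tp (src a)"] h l by simp
      have "E ?L xs = tensor_append s (Tp (tgt b)) (Tp (tgt a)) (E b q) (E a p)"
        using lift_swap[OF E0D(2)[OF e(1)] E0D(2)[OF e(2)]] by (simp add: end_comp_def end_tens_def p_def q_def)
      also have "\<dots> = E ?R xs"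
        using tensor_lift_pure[OF E0D(1)[OF E0_tens[OF e(2,1)]] m] xs
          permute_block_swap[of p q] permute_block_swap[of "src a" "src b"]
        by (simp add: end_comp_def end_perm_def x l end_tens_def)
      finally show "E ?L xs = E ?R xs" .
    qed
    then show ?thesis using True by (intro ext) (simp add: sign_pow_def tensor_scale_apply)
  next
    case False
    then have "deg b \<noteq> 0" "deg a \<noteq> 0" by auto
    then have z: "E b = 0" "E a = 0" using E_deg wf by blast+
    have "end_comp 0 (E (Perm (src a @ src b) (block_swap (length (src a)) (length (src b))))) = 0"
      by (rule end_comp_zero_left[OF E_E0]) (use swap_natural(2) in simp)
    then show ?thesis
      by (intro ext) (simp only: ev.simps z end_comp_zero_right end_tens_zero_left tensor_scale_apply, simp)
  qed
next
  case (gen_skew x \<sigma>)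
  \<comment> \<open>Well-formedness of the composite forces \<open>\<sigma>\<close> to preserve the
    word of colors.\<close>
  then have \<sigma>: "\<sigma> permutes {..<length (gen_src x)}" and v: "gen_valid x" and p: "gen_src x = permute_list \<sigma> (gen_src x)"
    by simp_all
  show ?case
  proof (rule E0_ext)
    show "E (Comp (Gen x) (Perm (gen_src x) \<sigma>)) \<in> E0 (gen_src x) (gen_tgt x)" using E_E0[OF gen_skew(1)] by simp
    show "E (Scale (of_int (sign \<sigma>)) (Gen x)) \<in> E0 (gen_src x) (gen_tgt x)" using E_E0[OF gen_skew(2)] by simp
    have g: "gm x \<in> E0 (gen_src x) (gen_tgt x)" using E_E0[of "Gen x"] v by simp
    fix xs assume xs: "xs \<in> listset (Tp (gen_src x))"
    have "permute_list \<sigma> xs \<in> listset (Tp (gen_src x))" using listset_Tp_permute[OF \<sigma> xs] p by simp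
    from tensor_lift_pure[OF E0D(1)[OF g] this] gm_skew[OF v \<sigma> xs] xs p
    show "E (Comp (Gen x) (Perm (gen_src x) \<sigma>)) xs = E (Scale (of_int (sign \<sigma>)) (Gen x)) xs"
      by (simp add: end_comp_def end_perm_def)
  qed
qed (intro ext; simp add: tensor_scale_apply algebra_simps)+

lemma E_prop_eq: "prop_eq a b \<Longrightarrow> E a = E b"
proof (induct rule: prop_eq.induct)
  case (axiom a b)
  then show ?case by (rule E_axiom)
next
  case (tens a a' b b')
  then show ?case using prop_eq_boundaries[of a a'] prop_eq_boundaries[of b b'] by simp
qed simp_all

end

section \<open>Boundaries of the generators\<close>

definition typed :: "'k::field pexp \<Rightarrow> color list \<Rightarrow> color list \<Rightarrow> int \<Rightarrow> bool" where
  "typed a c d n \<longleftrightarrow> wf_pexp a \<and> src a = c \<and> tgt a = d \<and> deg a = n"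

text \<open>The order of summation is an unspecified choice; only the existence of an enumeration
  without repetition is extracted.\<close>

lemma foldr_psum:
  assumes "finite I" obtains js where "psum c d n e I = foldr (\<lambda>i. Plus (e i)) js (Zero c d n)" "set js = I" "distinct js"
  using someI_ex[OF finite_distinct_list[OF assms]] unfolding psum_def by blast

lemma typed_psum:
  assumes "finite I" "\<And>i. i \<in> I \<Longrightarrow> typed (e i) c d n"
  shows "typed (psum c d n e I) c d n"
proof -
  obtain js where js: "psum c d n e I = foldr (\<lambda>i. Plus (e i)) js (Zero c d n)" "set js = I"
    using foldr_psum[OF assms(1)] by metis
  have "typed (foldr (\<lambda>i. Plus (e i)) ks (Zero c d n)) c d n" if "set ks \<subseteq> I" for ks
    using that by (induct ks) (use assms(2) in \<open>auto simp: typed_def\<close>)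
  with js show ?thesis by simp
qed

lemma typed_Scale: "typed (Scale r a) c d n \<longleftrightarrow> typed a c d n"
  by (simp add: typed_def)

lemma permute_list_replicate: "\<sigma> permutes {..<n} \<Longrightarrow> permute_list \<sigma> (replicate n x) = replicate n x"
  using permutes_in_image[of \<sigma> "{..<n}"] by (intro nth_equalityI) (simp_all add: permute_list_def)

lemma unshuffles_permutes: "\<sigma> \<in> unshuffles rs \<Longrightarrow> \<sigma> permutes {..<sum_list rs}"
  by (simp add: unshuffles_def)

lemma finite_unshuffles_list: "finite (unshuffles rs)"
  by (rule finite_subset[OF _ finite_permutations[of "{..<sum_list rs}"]]) (auto simp: unshuffles_def)

lemma finite_pairs: "finite {(i, j). i + j = n + 1 \<and> P i j}" for n :: nat
  by (rule finite_subset[of _ "{..n + 1} \<times> {..n + 1}"]) auto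

lemma typed_insertion_sum:
  assumes h: "\<And>i. lo \<le> i \<Longrightarrow> gen_valid (h i) \<and> gen_src (h i) = replicate i x \<and> gen_tgt (h i) = [y]"
    and m: "\<And>j. 2 \<le> j \<Longrightarrow> gen_valid (m j) \<and> gen_src (m j) = replicate j x \<and> gen_tgt (m j) = [x]"
    and q: "\<And>i j. i + j = n + 1 \<Longrightarrow> lo \<le> i \<Longrightarrow> 2 \<le> j \<Longrightarrow> gen_deg (h i) + gen_deg (m j) = q"
    and lo: "1 \<le> lo"
  shows "typed (insertion_sum x y q lo h m n) (replicate n x) [y] q"
  unfolding insertion_sum_def
proof (rule typed_psum[OF finite_pairs], clarify)
  fix i j assume ij: "i + j = n + 1" "lo \<le> i" "2 \<le> j"
  then have n: "n = j + (i - 1)" and i: "i = Suc (i - 1)" using lo by auto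
  have e: "x # replicate (i - 1) x = replicate i x" by (subst (2) i) simp
  have e': "replicate j x @ replicate (i - 1) x = replicate n x" unfolding replicate_add[symmetric] n by simp
  have *: "typed (Scale (of_int (sign \<sigma>)) (Comp (Comp (Gen (h i)) (Tens (Gen (m j)) (Perm (replicate (i - 1) x) id)))
      (Perm (replicate n x) \<sigma>))) (replicate n x) [y] q" if "\<sigma> \<in> unshuffles [j, i - 1]" for \<sigma>
  proof -
    have "\<sigma> permutes {..<n}" using unshuffles_permutes[OF that] n by simp
    then show ?thesis
      using h[OF ij(2)] m[OF ij(3)] q[OF ij] e e'
      by (simp add: typed_def permute_list_replicate permutes_id)
  qed
  show "typed (Scale ((- 1) ^ (j * (i - 1))) (psum (replicate n x) [y] q
      (\<lambda>\<sigma>. Scale (of_int (sign \<sigma>)) (Comp (Comp (Gen (h i)) (Tens (Gen (m j)) (Perm (replicate (i - 1) x) id)))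
        (Perm (replicate n x) \<sigma>))) (unshuffles [j, i - 1]))) (replicate n x) [y] q"
    by (subst typed_Scale) (intro typed_psum finite_unshuffles_list *)
qed

lemma typed_tens_list:
  "\<forall>r\<in>set rs. 1 \<le> r \<Longrightarrow> typed (tens_list (map (\<lambda>r. Gen (Fm r)) rs) :: 'k::field pexp) (replicate (sum_list rs) B)
    (replicate (length rs) W) (int (sum_list rs) - int (length rs))"
  by (induct rs) (simp_all add: tens_list_def typed_def replicate_add permutes_id)

lemma finite_splittings:
  "finite {rs :: nat list. 2 \<le> length rs \<and> length rs \<le> n \<and> (\<forall>r\<in>set rs. 1 \<le> r) \<and> sum_list rs = n \<and> sorted rs}"
  by (rule finite_subset[OF _ finite_lists_length_le[of "{..n}" n]]) (auto dest: member_le_sum_list)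

lemma typed_splitting_sum: "typed (splitting_sum n :: 'k::field pexp) (replicate n B) [W] (int n - 2)"
  unfolding splitting_sum_def Let_def
proof (rule typed_psum[OF finite_splittings], clarify)
  fix rs :: "nat list" assume rs: "2 \<le> length rs" "\<forall>r\<in>set rs. 1 \<le> r" and n: "n = sum_list rs"
  have *: "typed (Scale (of_int (sign \<sigma>) :: 'k) (Comp (Comp (Gen (Nu (length rs)) :: 'k pexp) (tens_list (map (\<lambda>r. Gen (Fm r)) rs)))
      (Perm (replicate (sum_list rs) B) \<sigma>))) (replicate (sum_list rs) B) [W] (int (sum_list rs) - 2)" if "\<sigma> \<in> ordered_unshuffles rs" for \<sigma>
  proof -
    have "\<sigma> permutes {..<sum_list rs}" using unshuffles_permutes that by (simp add: ordered_unshuffles_def)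
    then show ?thesis
      using typed_tens_list[OF rs(2), where ?'k = 'k] rs(1) by (simp add: typed_def permute_list_replicate)
  qed
  have **: "finite (ordered_unshuffles rs)"
    by (rule finite_subset[OF _ finite_unshuffles_list[of rs]]) (auto simp: ordered_unshuffles_def)
  show "typed (Scale ((- 1 :: 'k) ^ (length rs * (length rs - 1) div 2 + (\<Sum>i\<in>{1..length rs - 1}. rs ! (i - 1) * (length rs - i))))
      (psum (replicate (sum_list rs) B) [W] (int (sum_list rs) - 2)
        (\<lambda>\<sigma>. Scale (of_int (sign \<sigma>)) (Comp (Comp (Gen (Nu (length rs))) (tens_list (map (\<lambda>r. Gen (Fm r)) rs)))
          (Perm (replicate (sum_list rs) B) \<sigma>))) (ordered_unshuffles rs)))
      (replicate (sum_list rs) B) [W] (int (sum_list rs) - 2)"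
    by (subst typed_Scale, rule typed_psum[OF **], rule *)
qed

text \<open>Besides well-formedness this records the degree, which decides the vanishing of all
  boundaries except those of generators of degree 1.\<close>

lemma typed_gen_boundary:
  assumes "gen_valid x"
  shows "typed (gen_boundary x :: 'k::field pexp) (gen_src x) (gen_tgt x) (gen_deg x - 1)"
proof (cases x)
  case (Mu n)
  then show ?thesis using typed_insertion_sum[of 2 Mu B B Mu n "int n - 3"] by simp
next
  case (Nu n)
  then show ?thesis using typed_insertion_sum[of 2 Nu W W Nu n "int n - 3"] by simp
next
  case (Fm n)
  then show ?thesis
    using typed_insertion_sum[of 1 Fm B W Mu n "int n - 2", where ?'a = 'k] typed_splitting_sum[of n, where ?'k = 'k]
    by (simp add: typed_def)
qed

context fe_ground
begin

lemma ev_psum: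
  assumes "finite I"
  shows "ev gm (psum c d n e I) xs = (\<Sum>i\<in>I. ev gm (e i) xs)"
proof -
  obtain js where js: "psum c d n e I = foldr (\<lambda>i. Plus (e i)) js (Zero c d n)" "set js = I" "distinct js"
    using foldr_psum[OF assms] by metis
  have "ev gm (foldr (\<lambda>i. Plus (e i)) ks (Zero c d n)) xs = (\<Sum>i\<leftarrow>ks. ev gm (e i) xs)" for ks
    by (induct ks) simp_all
  then show ?thesis using js by (simp add: sum_list_distinct_conv_sum_set)
qed

text \<open>Freeness of the PROP on its generators, in the form needed for uniqueness.\<close>

lemma FE_algebra_eq_ev:
  assumes \<alpha>: "\<alpha> \<in> FE_algebras sU sV" and gm: "\<And>x. gen_valid x \<Longrightarrow> gm x = \<alpha> (Gen x)"
  shows "wf_pexp a \<Longrightarrow> \<alpha> a = ev gm a"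
proof (induct a)
  case (Zero c d n)
  then show ?case using \<alpha> unfolding FE_algebras_def by (simp del: zero_fun_apply)
next
  case (Plus a b)
  then have "\<alpha> (Plus a b) = \<alpha> a + \<alpha> b" using \<alpha> unfolding FE_algebras_def by blast
  with Plus show ?case by (simp del: plus_fun_apply)
next
  case (Scale r a)
  then have "\<alpha> (Scale r a) = (\<lambda>xs. tensor_scale r (\<alpha> a xs))" using \<alpha> unfolding FE_algebras_def by simp
  with Scale show ?case by simp
next
  case (Comp a b)
  then have "\<alpha> (Comp a b) = end_comp (\<alpha> a) (\<alpha> b)" using \<alpha> unfolding FE_algebras_def by blast
  with Comp show ?case by simp
next
  case (Tens a b)
  then have "\<alpha> (Tens a b) = end_tens sU sV (src a) (tgt a) (tgt b) (\<alpha> a) (\<alpha> b)" using \<alpha> unfolding FE_algebras_def by blast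
  with Tens show ?case by simp
next
  case (Perm c \<sigma>)
  then show ?case using \<alpha> unfolding FE_algebras_def by simp
qed (simp add: gm)

end

context fe_gens
begin

lemma E_gen_boundary_zero: "gen_valid x \<Longrightarrow> gen_deg x \<noteq> 1 \<Longrightarrow> E (gen_boundary x) = 0"
  using typed_gen_boundary[of x, where ?'k = 'k] E_deg[of "gen_boundary x"] unfolding typed_def by auto

lemma E_gen_boundary_E0: "gen_valid x \<Longrightarrow> E (gen_boundary x) \<in> E0 (gen_src x) (gen_tgt x)"
  using typed_gen_boundary[of x, where ?'k = 'k] E_E0[of "gen_boundary x"] unfolding typed_def by simp

text \<open>\<open>boundary\<close> is a derivation, so its vanishing after evaluation spreads from
  generators to all expressions.\<close>

lemma E_boundary:
  assumes "\<And>x. gen_valid x \<Longrightarrow> E (gen_boundary x) = 0"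
  shows "wf_pexp a \<Longrightarrow> E (boundary a) = 0"
proof (induct a)
  case (Comp a b)
  then have z: "E (boundary a) = 0" "E (boundary b) = 0" and b: "wf_pexp b" by (simp_all del: zero_fun_apply)
  show ?case
    unfolding boundary.simps ev.simps z end_comp_zero_left[OF E_E0[OF b]] end_comp_zero_right
    by (intro ext) (simp add: tensor_scale_apply)
next
  case (Tens a b)
  then have z: "E (boundary a) = 0" "E (boundary b) = 0" and a: "wf_pexp a" by (simp_all del: zero_fun_apply)
  show ?case
    unfolding boundary.simps ev.simps z end_tens_zero_right[OF E_E0[OF a]] end_tens_zero_left
    by (intro ext) (simp add: tensor_scale_apply)
next
  case (Plus a b)
  then have "E (boundary a) = 0" "E (boundary b) = 0" by (simp_all del: zero_fun_apply)
  then show ?case by (simp only: boundary.simps ev.simps add_0_left)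
next
  case (Scale r a)
  then have "E (boundary a) = 0" by (simp del: zero_fun_apply)
  then show ?case by (intro ext) (simp add: tensor_scale_apply)
qed (simp_all only: boundary.simps ev.simps wf_pexp.simps assms)

definition FE_structure :: "'k pexp \<Rightarrow> ('k, 'u, 'v) end_map" where
  "FE_structure a = (if wf_pexp a then E a else 0)"

lemma FE_structure_in:
  assumes "\<And>x. gen_valid x \<Longrightarrow> E (gen_boundary x) = 0"
  shows "FE_structure \<in> FE_algebras sU sV"
proof -
  have "FE_structure a = FE_structure b" if "prop_eq a b" for a b
    using E_prop_eq[OF that] prop_eq_boundaries[OF that] by (simp only: FE_structure_def)
  moreover have "FE_structure a \<in> End_T sU sV (src a) (tgt a) (deg a)" if "wf_pexp a" for a
    using E_End[OF that] that by (simp only: FE_structure_def if_True)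
  moreover have "FE_structure (boundary a) = 0" if "wf_pexp a" for a
    using E_boundary[OF assms that] by (simp only: FE_structure_def split: if_split) blast
  moreover have "FE_structure (Plus a b) = FE_structure a + FE_structure b" if "wf_pexp (Plus a b)" for a b
    using that by (simp add: FE_structure_def del: plus_fun_apply)
  moreover have "FE_structure (Zero c d n) = 0" for c d n
    by (simp only: FE_structure_def ev.simps wf_pexp.simps if_True)
  moreover have "FE_structure (Scale r a) = (\<lambda>xs. tensor_scale r (FE_structure a xs))" if "wf_pexp a" for r a
    using that by (simp add: FE_structure_def del: plus_fun_apply)
  moreover have "FE_structure (Comp a b) = end_comp (FE_structure a) (FE_structure b)" if "wf_pexp (Comp a b)" for a b
    using that by (simp add: FE_structure_def del: plus_fun_apply)
  moreover have "FE_structure (Tens a b) = end_tens sU sV (src a) (tgt a) (tgt b) (FE_structure a) (FE_structure b)" if "wf_pexp (Tens a b)" for a b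
    using that by (simp add: FE_structure_def del: plus_fun_apply)
  moreover have "FE_structure (Perm c \<sigma>) = end_perm sU sV c \<sigma>" if "wf_pexp (Perm c \<sigma> :: 'k pexp)" for c \<sigma>
    using that by (simp only: FE_structure_def ev.simps if_True)
  moreover have "FE_structure a = 0" if "\<not> wf_pexp a" for a
    using that by (simp only: FE_structure_def if_False)
  ultimately show ?thesis unfolding FE_algebras_def by blast
qed

end

text \<open>Tensors are functionals on forms, so a nonzero vector must be detected by some linear
  form before it can be recovered from its tensor.\<close>

lemma (in vector_space) separating_functional:
  assumes "x \<noteq> 0"
  obtains \<phi> where "Vector_Spaces.linear scale (*) \<phi>" "\<phi> x = 1"
proof -
  interpret P: vector_space_pair scale "(*)"
    by unfold_locales (simp_all add: algebra_simps)
  have "independent {x}" using assms by (simp add: dependent_single)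
  from P.linear_independent_extend[OF this, of "\<lambda>_. 1"] show thesis using that by auto
qed

lemma two_perms:
  assumes "\<sigma> permutes {..<2::nat}"
  shows "\<sigma> = id \<or> \<sigma> = transpose 0 1"
proof -
  have "\<sigma> permutes {0, 1}" using assms by (simp add: lessThan_nat_numeral lessThan_Suc insert_commute numeral_2_eq_2)
  then show ?thesis by (simp only: permutes_doubleton_iff)
qed

lemma permute_list_swap: "permute_list (transpose 0 1) [x, y] = [y, x]"
  by (simp add: permute_list_def upt_rec)

section \<open>Maps with a single output, and their recovery from elements of the endomorphism
  PROP\<close>

locale fe_space = fe_ground sU sV + U: vector_space sU + V: vector_space sV
  for sU :: "'k::field \<Rightarrow> 'u::ab_group_add \<Rightarrow> 'u" and sV :: "'k \<Rightarrow> 'v::ab_group_add \<Rightarrow> 'v"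
begin

lemma T_piece_add: "(x :: 'u \<times> 'v) \<in> T_piece c \<Longrightarrow> y \<in> T_piece c \<Longrightarrow> x + y \<in> T_piece c"
  by (cases c) (auto simp: image_iff)

lemma T_piece_scale: "x \<in> T_piece c \<Longrightarrow> s k x \<in> T_piece c"
  by (cases c) (auto simp: T_scale_def image_iff)

lemma listset_single: "xs \<in> listset [A] \<longleftrightarrow> (\<exists>x\<in>A. xs = [x])"
  by (auto simp: set_Cons_def)

lemma T_piece_0: "0 \<in> T_piece c"
  by (cases c) (auto simp: image_iff zero_prod_def)

lemma pt_add: "x \<in> T_piece c \<Longrightarrow> y \<in> T_piece c \<Longrightarrow> pt [c] [x + y] = pt [c] [x] + pt [c] [y]"
  using multilinearD(2)[OF pure_tensor_multilinear, of "[0]" "Tp [c]" 0 x y s] T_piece_0[of c]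
  by (simp del: plus_fun_apply listset.simps add: listset_single)

lemma pt_scale: "x \<in> T_piece c \<Longrightarrow> pt [c] [s k x] = tensor_scale k (pt [c] [x])"
  using multilinearD(3)[OF pure_tensor_multilinear, of "[0]" "Tp [c]" 0 x s k] T_piece_0[of c]
  by (simp del: listset.simps add: listset_single)

lemma listset_update:
  "xs \<in> listset (Tp c) \<Longrightarrow> i < length c \<Longrightarrow> z \<in> Tp c ! i \<Longrightarrow> xs[i := z] \<in> listset (Tp c)"
  by (simp add: mem_listset nth_list_update)

definition single_map :: "color list \<Rightarrow> color \<Rightarrow> (('u \<times> 'v) list \<Rightarrow> 'u \<times> 'v) \<Rightarrow> ('k, 'u, 'v) end_map" where
  "single_map c d m = (\<lambda>xs. if xs \<in> listset (Tp c) then pt [d] [m xs] else 0)"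

lemma single_map_E0:
  assumes m: "\<And>xs. xs \<in> listset (Tp c) \<Longrightarrow> m xs \<in> T_piece d"
    and add: "\<And>xs i x y. xs \<in> listset (Tp c) \<Longrightarrow> i < length c \<Longrightarrow> m (xs[i := x + y]) = m (xs[i := x]) + m (xs[i := y])"
    and scale: "\<And>xs i k x. xs \<in> listset (Tp c) \<Longrightarrow> i < length c \<Longrightarrow> m (xs[i := s k x]) = s k (m (xs[i := x]))"
  shows "single_map c d m \<in> E0 c [d]"
proof (rule E0I)
  fix xs i x assume xs: "xs \<in> listset (Tp c)" and i: "i < length c" and x: "x \<in> Tp c ! i"
  note u = listset_update[OF xs i]
  show "single_map c d m (xs[i := s k x]) = tensor_scale k (single_map c d m (xs[i := x]))" for k
    using u[OF x] u[of "s k x"] x i T_piece_scale[of x "c ! i"] pt_scale[OF m]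
    by (simp add: single_map_def scale[OF xs i])
  fix y assume y: "y \<in> Tp c ! i"
  show "single_map c d m (xs[i := x + y]) = single_map c d m (xs[i := x]) + single_map c d m (xs[i := y])"
    using u[OF x] u[OF y] u[of "x + y"] x y i T_piece_add[of x "c ! i" y] pt_add[OF m m]
    by (simp del: plus_fun_apply add: single_map_def add[OF xs i])
next
  fix xs assume "xs \<in> listset (Tp c)"
  with pure_in_tensor_space[of "[m xs]" "Tp [d]" s] m show "single_map c d m xs \<in> tensor_space s (Tp [d])"
    by (simp add: single_map_def set_Cons_iff)
qed (simp only: single_map_def if_False)

text \<open>With a single factor, sums and multiples of decomposable tensors are again
  decomposable.\<close>

lemma tensor_space_single: "t \<in> tensor_space s (Tp [c]) \<Longrightarrow> \<exists>x\<in>T_piece c. t = pt [c] [x]"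
proof (induct rule: tensor_space_induct)
  case (pure xs)
  then show ?case by (auto simp: set_Cons_def)
next
  case zero
  have "pt [c] [0] = 0" using pt_scale[OF T_piece_0, of c 0] by (simp only: TS.scale_zero_left) (simp add: T_scale_def zero_prod_def case_prod_beta)
  then show ?case using T_piece_0 by metis
next
  case (add t u)
  then show ?case using pt_add T_piece_add by metis
next
  case (scale k t)
  then show ?case using pt_scale T_piece_scale by metis
qed

lemma pt_eq_zero:
  assumes x: "x \<in> T_piece c" and z: "pt [c] [x] = 0"
  shows "x = 0"
proof (rule ccontr)
  assume "x \<noteq> 0"
  obtain \<phi> where \<phi>: "\<And>v w. v \<in> T_piece c \<Longrightarrow> w \<in> T_piece c \<Longrightarrow> \<phi> (v + w) = \<phi> v + \<phi> w"
    "\<And>k v. \<phi> (s k v) = k * \<phi> v" and 1: "\<phi> x = 1"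
  proof (cases c)
    case B
    then have "fst x \<noteq> 0" using x \<open>x \<noteq> 0\<close> by (auto simp: zero_prod_def)
    then obtain \<psi> where \<psi>: "Vector_Spaces.linear sU (*) \<psi>" "\<psi> (fst x) = 1" by (rule U.separating_functional)
    interpret Vector_Spaces.linear sU "(*)" \<psi> by (rule \<psi>(1))
    show thesis by (rule that[of "\<lambda>v. \<psi> (fst v)"]) (auto simp: \<psi>(2) add scale T_scale_def case_prod_beta)
  next
    case W
    then have "snd x \<noteq> 0" using x \<open>x \<noteq> 0\<close> by (auto simp: zero_prod_def)
    then obtain \<psi> where \<psi>: "Vector_Spaces.linear sV (*) \<psi>" "\<psi> (snd x) = 1" by (rule V.separating_functional)
    interpret Vector_Spaces.linear sV "(*)" \<psi> by (rule \<psi>(1))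
    show thesis by (rule that[of "\<lambda>v. \<psi> (snd v)"]) (auto simp: \<psi>(2) add scale T_scale_def case_prod_beta)
  qed
  \<comment> \<open>The linear form turned into a form on singleton lists, with the value
    \<open>0\<close> elsewhere that \<open>multilinear_maps\<close> demands.\<close>
  let ?\<omega> = "\<lambda>xs. if xs \<in> listset (Tp [c]) then \<phi> (hd xs) else 0"
  have "?\<omega> \<in> multilinear_forms s (Tp [c])"
    unfolding multilinear_maps_def mem_Collect_eq
  proof (intro conjI allI ballI impI)
    fix xs i v w k assume "xs \<in> listset (Tp [c])" "i < length (Tp [c])" and v: "v \<in> Tp [c] ! i"
    then obtain z where xs: "xs = [z]" and i: "i = 0" unfolding list.map listset_single by auto
    have m: "xs[i := z'] \<in> listset (Tp [c]) \<longleftrightarrow> z' \<in> T_piece c" for z'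
      by (simp del: listset.simps add: xs i listset_single)
    show "?\<omega> (xs[i := s k v]) = k * ?\<omega> (xs[i := v])"
      unfolding m using v by (simp add: i xs \<phi> T_piece_scale)
    assume w: "w \<in> Tp [c] ! i"
    show "?\<omega> (xs[i := v + w]) = ?\<omega> (xs[i := v]) + ?\<omega> (xs[i := w])"
      unfolding m using v w by (simp add: i xs \<phi> T_piece_add)
  qed simp
  then have "pt [c] [x] ?\<omega> = 1" using x 1 by (simp add: pure_tensor_def set_Cons_iff)
  then show False using z by simp
qed

lemma pt_inject:
  assumes "x \<in> T_piece c" "y \<in> T_piece c" "pt [c] [x] = pt [c] [y]"
  shows "x = y"
proof -
  have "pt [c] [x + s (- 1) y] = 0"
    unfolding pt_add[OF assms(1) T_piece_scale[OF assms(2)]] pt_scale[OF assms(2)] assms(3)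
    by (intro ext) (simp add: tensor_scale_apply)
  from pt_eq_zero[OF T_piece_add[OF assms(1) T_piece_scale[OF assms(2)]] this]
  have "x + s (- 1) y = 0" .
  moreover have "s (- 1) y = - y" by (cases y) (simp add: T_scale_def)
  ultimately show ?thesis by simp
qed

lemma end_comp_perm:
  assumes "F \<in> E0 (permute_list \<sigma> c) d" "\<sigma> permutes {..<length c}" "xs \<in> listset (Tp c)"
  shows "end_comp F (end_perm sU sV c \<sigma>) xs = F (permute_list \<sigma> xs)"
  using tensor_lift_pure[OF E0D(1)[OF assms(1)] listset_Tp_permute[OF assms(2,3)]] assms(3)
  by (simp add: end_comp_def end_perm_def)

lemma insertion_value:
  assumes P: "single_map (b # cs) e p \<in> E0 (b # cs) [e]" and q: "q (take (length bs) ys) \<in> T_piece b"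
    and ys: "ys \<in> listset (Tp (bs @ cs))"
  shows "end_comp (single_map (b # cs) e p) (end_tens sU sV bs [b] cs (single_map bs b q) (end_perm sU sV cs id)) ys =
    pt [e] [p (q (take (length bs) ys) # drop (length bs) ys)]"
proof -
  let ?l = "take (length bs) ys" and ?r = "drop (length bs) ys"
  have h: "?l \<in> listset (Tp bs)" "?r \<in> listset (Tp cs)"
    using listset_append_iff[of ys "Tp bs" "Tp cs"] ys by auto
  have v: "[q ?l] \<in> listset (Tp [b])" using q by (simp add: set_Cons_iff)
  have m: "q ?l # ?r \<in> listset (Tp (b # cs))" using q h by (simp add: set_Cons_iff)
  have "end_tens sU sV bs [b] cs (single_map bs b q) (end_perm sU sV cs id) ys = tensor_append s (Tp [b]) (Tp cs) (pt [b] [q ?l]) (pt cs ?r)"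
    using h by (simp add: end_tens_def single_map_def end_perm_def del: id_apply)
  also have "\<dots> = pt (b # cs) (q ?l # ?r)" using tensor_append_pure[OF v h(2), of s] by simp
  finally have 1: "end_tens sU sV bs [b] cs (single_map bs b q) (end_perm sU sV cs id) ys = pt (b # cs) (q ?l # ?r)" .
  show ?thesis
    unfolding end_comp_def 1 tensor_lift_pure[OF E0D(1)[OF P] m] using m by (simp only: single_map_def if_True)
qed

end

text \<open>Serves both colors at once: \<open>\<iota>\<close> embeds \<open>U\<close> or
  \<open>V\<close> as the piece of color \<open>c\<close>, and \<open>\<pi>\<close> projects back
  onto it.\<close>

locale fe_color = fe_space sU sV
  for sU :: "'k::field \<Rightarrow> 'u::ab_group_add \<Rightarrow> 'u" and sV :: "'k \<Rightarrow> 'v::ab_group_add \<Rightarrow> 'v" +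
  fixes c :: color and \<iota> :: "'w::ab_group_add \<Rightarrow> 'u \<times> 'v" and \<pi> :: "'u \<times> 'v \<Rightarrow> 'w" and sW :: "'k \<Rightarrow> 'w \<Rightarrow> 'w"
  assumes \<iota>_add: "\<iota> (v + w) = \<iota> v + \<iota> w" and \<iota>_scale: "\<iota> (sW k w) = s k (\<iota> w)"
    and \<pi>_add: "\<pi> (x + y) = \<pi> x + \<pi> y" and \<pi>_scale: "\<pi> (s k x) = sW k (\<pi> x)"
    and \<pi>_\<iota>: "\<pi> (\<iota> w) = w" and piece: "T_piece c = range \<iota>" and W: "vector_space sW"
begin

sublocale W: vector_space sW by (rule W)

definition bin :: "('w list \<Rightarrow> 'w) \<Rightarrow> ('k, 'u, 'v) end_map" where
  "bin \<mu> = single_map [c, c] c (\<lambda>xs. \<iota> (\<mu> (map \<pi> xs)))"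

lemma \<iota>_piece: "\<iota> w \<in> T_piece c"
  by (simp add: piece)

lemma pt_\<iota>_inject: "pt [c] [\<iota> v] = pt [c] [\<iota> w] \<longleftrightarrow> v = w"
  using pt_inject[OF \<iota>_piece \<iota>_piece] \<pi>_\<iota> by metis

lemma pt_\<iota>_zero: "pt [c] [\<iota> 0] = 0"
  using pt_scale[OF \<iota>_piece, of 0 0] unfolding \<iota>_scale[symmetric] W.scale_zero_left TS.scale_zero_left .

lemma pt_\<iota>_sum: "finite A \<Longrightarrow> (\<Sum>a\<in>A. tensor_scale (k a) (pt [c] [\<iota> (w a)])) = pt [c] [\<iota> (\<Sum>a\<in>A. sW (k a) (w a))]"
proof (induct A rule: finite_induct)
  case (insert a A)
  then show ?case
    by (simp only: not_False_eq_True sum.insert \<iota>_add \<iota>_scale pt_add \<iota>_piece T_piece_scale pt_scale)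
qed (simp only: sum.empty pt_\<iota>_zero)

lemma bin_E0:
  assumes \<mu>: "coch sW sW 2 \<mu>"
  shows "bin \<mu> \<in> E0 [c, c] [c]"
  unfolding bin_def
proof (rule single_map_E0)
  fix xs :: "('u \<times> 'v) list" and i x y k assume "xs \<in> listset (Tp [c, c])" and i: "i < length [c, c]"
  then obtain a b where xs: "xs = [a, b]" by (auto simp: set_Cons_def)
  have i: "i = 0 \<or> i = 1" using i by auto
  show "\<iota> (\<mu> (map \<pi> (xs[i := x + y]))) = \<iota> (\<mu> (map \<pi> (xs[i := x]))) + \<iota> (\<mu> (map \<pi> (xs[i := y])))"
    using i coch_add1[OF \<mu>, of "\<pi> x" "\<pi> y" "[\<pi> b]"] coch_add[OF \<mu>, of "[\<pi> a]" "\<pi> x" "\<pi> y" "[]"]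
    by (auto simp: xs \<pi>_add \<iota>_add)
  show "\<iota> (\<mu> (map \<pi> (xs[i := s k x]))) = s k (\<iota> (\<mu> (map \<pi> (xs[i := x]))))"
    using i coch_scale1[OF \<mu>, of k "\<pi> x" "[\<pi> b]"] coch_scale[OF \<mu>, of "[\<pi> a]" k "\<pi> x" "[]"]
    by (auto simp: xs \<pi>_scale \<iota>_scale)
qed (rule \<iota>_piece)

lemma bin_skew:
  assumes \<mu>: "coch sW sW 2 \<mu>" and \<sigma>: "\<sigma> permutes {..<2}" and xs: "xs \<in> listset (Tp [c, c])"
  shows "bin \<mu> (permute_list \<sigma> xs) = tensor_scale (of_int (sign \<sigma>)) (bin \<mu> xs)"
proof -
  obtain a b where ab: "xs = [a, b]" "a \<in> T_piece c" "b \<in> T_piece c" using xs by (auto simp: set_Cons_def)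
  from two_perms[OF \<sigma>] show ?thesis
  proof
    assume "\<sigma> = id"
    then show ?thesis by (simp add: sign_id)
  next
    assume t: "\<sigma> = transpose 0 1"
    have "\<mu> [\<pi> b, \<pi> a] = sW (- 1) (\<mu> [\<pi> a, \<pi> b])" using coch_swap1[OF \<mu>, of "\<pi> b" "\<pi> a" "[]"] by simp
    then show ?thesis
      using ab pt_scale[OF \<iota>_piece, of "- 1" "\<mu> [\<pi> a, \<pi> b]", folded \<iota>_scale]
      unfolding t ab(1) permute_list_swap
      by (simp add: sign_swap_id bin_def single_map_def set_Cons_iff)
  qed
qed

lemma bin_inject:
  assumes "coch sW sW 2 \<mu>" "coch sW sW 2 \<mu>'" "bin \<mu> = bin \<mu>'"
  shows "\<mu> = \<mu>'"
proof
  fix us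
  show "\<mu> us = \<mu>' us"
  proof (cases "length us = 2")
    case True
    then obtain v w where us: "us = [v, w]" by (rule list_length_2_cases)
    have "bin \<mu> [\<iota> v, \<iota> w] = bin \<mu>' [\<iota> v, \<iota> w]" by (simp only: assms(3))
    then show ?thesis by (simp add: bin_def single_map_def set_Cons_iff \<iota>_piece \<pi>_\<iota> pt_\<iota>_inject[simplified] us)
  qed (use coch_len[OF assms(1), of us] coch_len[OF assms(2), of us] in simp)
qed

lemma bin_surj:
  assumes F: "F \<in> E0 [c, c] [c]"
    and skew: "\<And>\<sigma> xs. \<sigma> permutes {..<2} \<Longrightarrow> xs \<in> listset (Tp [c, c]) \<Longrightarrow>
      F (permute_list \<sigma> xs) = tensor_scale (of_int (sign \<sigma>)) (F xs)"
  obtains \<mu> where "coch sW sW 2 \<mu>" "F = bin \<mu>"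
proof -
  have ex: "\<exists>w. F xs = pt [c] [\<iota> w]" for xs
    using tensor_space_single[OF E0D(2)[OF F]] by (force simp: piece)
  \<comment> \<open>Every value of \<open>F\<close> is the tensor of a single vector, which
    \<open>pt_\<iota>_inject\<close> makes unique; the value \<open>0\<close> on other lengths makes
    \<open>\<mu>\<close> a cochain of arity 2.\<close>
  define \<mu> where "\<mu> us = (if length us = 2 then SOME w. F (map \<iota> us) = pt [c] [\<iota> w] else 0)" for us
  have \<mu>: "F (map \<iota> us) = pt [c] [\<iota> (\<mu> us)]" if "length us = 2" for us
    using someI_ex[OF ex[of "map \<iota> us"]] that by (simp add: \<mu>_def)
  have mem: "map \<iota> us \<in> listset (Tp [c, c])" if "length us = 2" for us
    using that by (elim list_length_2_cases) (simp add: set_Cons_iff \<iota>_piece)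
  have slot: "map \<iota> (p @ z # q) = (map \<iota> (p @ v # q))[length p := \<iota> z]" for p v z q
    by (simp add: list_update_append)
  have "coch sW sW 2 \<mu>"
    unfolding coch_def
  proof (intro conjI allI impI)
    fix p v w q and k :: 'k
    show "\<mu> (p @ (v + w) # q) = \<mu> (p @ v # q) + \<mu> (p @ w # q)"
    proof (cases "length (p @ v # q) = 2")
      case True
      then have l: "length (p @ z # q) = 2" for z by simp
      have i: "length p < length [c, c]" "[c, c] ! length p = c" using True by (auto simp: less_2_cases_iff nth_Cons')
      have "F (map \<iota> (p @ (v + w) # q)) = F (map \<iota> (p @ v # q)) + F (map \<iota> (p @ w # q))"
        using E0_slot(1)[OF F mem[OF l[of v]] i(1), of "\<iota> v" "\<iota> w"] i
        unfolding slot[of p _ q v, symmetric] \<iota>_add[symmetric] by (simp del: plus_fun_apply map_append list.map add: \<iota>_piece)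
      then have "pt [c] [\<iota> (\<mu> (p @ (v + w) # q))] = pt [c] [\<iota> (\<mu> (p @ v # q) + \<mu> (p @ w # q))]"
        unfolding \<mu>[OF l] by (simp only: \<iota>_add pt_add \<iota>_piece)
      then show ?thesis by (simp only: pt_\<iota>_inject)
    qed (auto simp: \<mu>_def)
    show "\<mu> (p @ sW k v # q) = sW k (\<mu> (p @ v # q))"
    proof (cases "length (p @ v # q) = 2")
      case True
      then have l: "length (p @ z # q) = 2" for z by simp
      have i: "length p < length [c, c]" "[c, c] ! length p = c" using True by (auto simp: less_2_cases_iff nth_Cons')
      have "F (map \<iota> (p @ sW k v # q)) = tensor_scale k (F (map \<iota> (p @ v # q)))"
        using E0_slot(2)[OF F mem[OF l[of v]] i(1), of "\<iota> v" k] i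
        unfolding slot[of p _ q v, symmetric] \<iota>_scale[symmetric] by (simp del: map_append list.map add: \<iota>_piece)
      then have "pt [c] [\<iota> (\<mu> (p @ sW k v # q))] = pt [c] [\<iota> (sW k (\<mu> (p @ v # q)))]"
        unfolding \<mu>[OF l] by (simp only: \<iota>_scale pt_scale \<iota>_piece)
      then show ?thesis by (simp only: pt_\<iota>_inject)
    qed (auto simp: \<mu>_def)
    show "\<mu> (p @ v # w # q) = - \<mu> (p @ w # v # q)"
    proof (cases "length (p @ v # w # q) = 2")
      case True
      then have pq: "p = []" "q = []" by simp_all
      have "transpose 0 (1::nat) permutes {..<2}" by (rule permutes_swap_id) auto
      from skew[OF this mem[of "[w, v]"]]
      have "F (map \<iota> [v, w]) = tensor_scale (- 1) (F (map \<iota> [w, v]))"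
        by (simp add: permute_list_swap[unfolded One_nat_def] sign_swap_id)
      then have "pt [c] [\<iota> (\<mu> [v, w])] = pt [c] [\<iota> (sW (- 1) (\<mu> [w, v]))]"
        using \<mu>[of "[v, w]"] \<mu>[of "[w, v]"] by (simp only: \<iota>_scale pt_scale \<iota>_piece) simp
      then show ?thesis unfolding pt_\<iota>_inject pq by simp
    qed (auto simp: \<mu>_def)
  next
    fix us assume "\<mu> us \<noteq> 0"
    then show "int (length us) = 2" by (auto simp: \<mu>_def split: if_splits)
  qed
  moreover have "F = bin \<mu>"
  proof (rule E0_ext[OF F bin_E0[OF calculation]])
    fix xs assume xs: "xs \<in> listset (Tp [c, c])"
    then obtain v w where "xs = map \<iota> [v, w]" by (auto simp: set_Cons_def piece)
    with \<mu>[of "[v, w]"] mem[of "[v, w]"] show "F xs = bin \<mu> xs"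
      by (simp add: bin_def single_map_def \<pi>_\<iota>)
  qed
  ultimately show thesis by (rule that)
qed

end

section \<open>The boundaries of \<open>Mu 3\<close>, \<open>Nu 3\<close> and
  \<open>Fm 2\<close>\<close>

lemma transpose_not_increasing: "\<not> (transpose 0 1 :: nat \<Rightarrow> nat) 0 < transpose 0 1 1"
  by simp

lemma unshuffles_2_0: "unshuffles [2, 0] = {id}"
proof
  show "unshuffles [2, 0] \<subseteq> {id}"
  proof
    fix \<sigma> assume "\<sigma> \<in> unshuffles [2, 0]"
    then have p: "\<sigma> permutes {..<2}" and "\<forall>b<2. strict_mono_on {sum_list (take b [2, 0])..<sum_list (take (Suc b) [2, 0])} \<sigma>"
      by (simp_all add: unshuffles_def)
    from this(2)[rule_format, of 0] have "strict_mono_on {0..<2} \<sigma>" by simp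
    then have "\<sigma> 0 < \<sigma> 1" by (rule strict_mono_onD) simp_all
    then show "\<sigma> \<in> {id}" using two_perms[OF p] transpose_not_increasing by auto
  qed
  show "{id} \<subseteq> unshuffles [2, 0]"
    by (simp add: unshuffles_def permutes_id strict_mono_on_def)
qed

text \<open>The order condition on blocks of equal size excludes the transposition, so that the term
  \<open>\<nu> (f, f)\<close> occurs once.\<close>

lemma ordered_unshuffles_1_1: "ordered_unshuffles [1, 1] = {id}"
proof
  show "ordered_unshuffles [1, 1] \<subseteq> {id}"
  proof
    fix \<sigma> assume s: "\<sigma> \<in> ordered_unshuffles [1, 1]"
    then have p: "\<sigma> permutes {..<2}" using unshuffles_permutes[of \<sigma> "[1, 1]"] by (simp add: ordered_unshuffles_def numeral_2_eq_2)
    from s have "\<forall>b. Suc b < length [1, 1 :: nat] \<and> [1, 1 :: nat] ! b = [1, 1] ! Suc b \<longrightarrow>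
         \<sigma> (sum_list (take b [1, 1])) < \<sigma> (sum_list (take (Suc b) [1, 1]))"
      unfolding ordered_unshuffles_def by blast
    from this[rule_format, of 0] have "\<sigma> 0 < \<sigma> 1" by simp
    then show "\<sigma> \<in> {id}" using two_perms[OF p] transpose_not_increasing by auto
  qed
  show "{id} \<subseteq> ordered_unshuffles [1, 1]"
    by (auto simp: ordered_unshuffles_def unshuffles_def permutes_id strict_mono_on_def)
qed

lemma splittings_2: "{rs :: nat list. 2 \<le> length rs \<and> length rs \<le> 2 \<and> (\<forall>r\<in>set rs. 1 \<le> r) \<and> sum_list rs = 2 \<and> sorted rs} = {[1, 1]}"
proof -
  have "rs = [1, 1]" if r: "2 \<le> length rs" "length rs \<le> 2" "\<forall>r\<in>set rs. 1 \<le> r" "sum_list rs = 2" for rs :: "nat list"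
  proof -
    from r(1,2) have "length rs = 2" by simp
    then obtain a b where "rs = [a, b]" by (rule list_length_2_cases)
    with r(3,4) show ?thesis by auto
  qed
  then show ?thesis by auto
qed

context fe_color
begin

text \<open>For arguments of degree 1 the Koszul sign is the sign of the permutation, so
  \<open>sum_unshuffles\<close> recognizes the boundary as a composition.\<close>

lemma bin_jacobi:
  assumes \<mu>: "coch sW sW 2 \<mu>" and G: "gm (G 2) = bin \<mu>" "gen_src (G 2) = [c, c]" "gen_tgt (G 2) = [c]"
    and xs: "xs \<in> listset (Tp [c, c, c])"
  shows "ev gm (insertion_sum c c 0 2 G G 3) xs = pt [c] [\<iota> (comp \<mu> \<mu> (map \<pi> xs))]"
proof -
  let ?m = "\<lambda>xs. \<iota> (\<mu> (map \<pi> xs))" and ?us = "map \<pi> xs"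
  let ?X = "end_comp (bin \<mu>) (end_tens sU sV [c, c] [c] [c] (bin \<mu>) (end_perm sU sV [c] id))"
  note b = bin_E0[OF \<mu>]
  have id1: "end_perm sU sV [c] id \<in> E0 [c] [c]" using E0_perm[of id "[c]"] permutes_id by simp
  have X: "?X \<in> E0 [c, c, c] [c]" by (rule E0_comp[OF b]) (use E0_tens[OF b id1] in simp)
  have l: "length ?us = 3" using listset_length[OF xs] by simp
  \<comment> \<open>Only \<open>i = j = 2\<close> is possible, and its prefactor
    \<open>(- 1) ^ (j * (i - 1))\<close> is 1.\<close>
  have I: "{(i, j). i + j = 3 + 1 \<and> 2 \<le> i \<and> 2 \<le> j} = {(2, 2 :: nat)}" by auto
  have r: "replicate 3 c = [c, c, c]" "replicate (2 - 1) c = [c]" by (simp_all add: numeral_3_eq_3)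
  have p: "end_comp ?X (end_perm sU sV [c, c, c] \<sigma>) xs =
      pt [c] [\<iota> (\<mu> (\<mu> (take 2 (permute_list \<sigma> ?us)) # drop 2 (permute_list \<sigma> ?us)))]" if "\<sigma> \<in> unshuffles [2, 1]" for \<sigma>
  proof -
    have \<sigma>: "\<sigma> permutes {..<length [c, c, c]}" using unshuffles_permutes[OF that] by (simp add: numeral_3_eq_3)
    have pc: "permute_list \<sigma> [c, c, c] = [c, c, c]"
      using permute_list_replicate[of \<sigma> 3 c] \<sigma> by (simp add: numeral_3_eq_3)
    have X': "?X \<in> E0 (permute_list \<sigma> [c, c, c]) [c]" unfolding pc by (rule X)
    let ?ys = "permute_list \<sigma> xs"
    have ys: "?ys \<in> listset (Tp ([c, c] @ [c]))"
      using listset_Tp_permute[OF \<sigma> xs] unfolding pc by simp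
    have "end_comp ?X (end_perm sU sV [c, c, c] \<sigma>) xs = ?X ?ys"
      by (rule end_comp_perm[OF X' \<sigma> xs])
    also have "\<dots> = pt [c] [?m (?m (take (length [c, c]) ?ys) # drop (length [c, c]) ?ys)]"
      unfolding bin_def by (rule insertion_value[OF b[unfolded bin_def] \<iota>_piece ys])
    also have "\<dots> = pt [c] [\<iota> (\<mu> (\<mu> (take 2 (permute_list \<sigma> ?us)) # drop 2 (permute_list \<sigma> ?us)))]"
    proof -
      have "map \<pi> ?ys = permute_list \<sigma> ?us" using permute_list_map[of \<sigma> xs \<pi>] \<sigma> l by (simp add: numeral_3_eq_3)
      then show ?thesis by (simp add: \<pi>_\<iota> take_map[symmetric] drop_map[symmetric] numeral_2_eq_2)
    qed
    finally show ?thesis .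
  qed
  have "ev gm (insertion_sum c c 0 2 G G 3) xs =
      (\<Sum>\<sigma>\<in>unshuffles [2, 1]. tensor_scale (of_int (sign \<sigma>)) (end_comp ?X (end_perm sU sV [c, c, c] \<sigma>) xs))"
    unfolding insertion_sum_def I by (simp add: ev_psum finite_unshuffles_list r G numeral_3_eq_3)
  also have "\<dots> = (\<Sum>\<sigma>\<in>unshuffles [2, 1]. tensor_scale (of_int (sign \<sigma>))
      (pt [c] [\<iota> (\<mu> (\<mu> (take 2 (permute_list \<sigma> ?us)) # drop 2 (permute_list \<sigma> ?us)))]))"
    by (rule sum.cong[OF HOL.refl]) (simp only: p)
  also have "\<dots> = pt [c] [\<iota> (\<Sum>\<sigma>\<in>unshuffles [2, 1]. sW (of_int (sign \<sigma>)) (\<mu> (\<mu> (take 2 (permute_list \<sigma> ?us)) # drop 2 (permute_list \<sigma> ?us))))]"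
    by (rule pt_\<iota>_sum[OF finite_unshuffles_list])
  also have "(\<Sum>\<sigma>\<in>unshuffles [2, 1]. sW (of_int (sign \<sigma>)) (\<mu> (\<mu> (take 2 (permute_list \<sigma> ?us)) # drop 2 (permute_list \<sigma> ?us)))) =
      (\<Sum>\<sigma>\<in>unshuffles [2, length ?us - 2]. sg (isum (length ?us) (\<lambda>a b. 1 * 1) \<sigma>)
        (\<mu> (\<mu> (take 2 (permute_list \<sigma> ?us)) # drop 2 (permute_list \<sigma> ?us))))"
  proof (rule sum.cong)
    fix \<sigma> assume "\<sigma> \<in> unshuffles [2, length ?us - 2]"
    then have "\<sigma> permutes {..<length ?us}" using unshuffles_permutes l by fastforce
    from sign_isum[OF this]
    show "sW (of_int (sign \<sigma>)) (\<mu> (\<mu> (take 2 (permute_list \<sigma> ?us)) # drop 2 (permute_list \<sigma> ?us))) =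
       sg (isum (length ?us) (\<lambda>a b. 1 * 1) \<sigma>) (\<mu> (\<mu> (take 2 (permute_list \<sigma> ?us)) # drop 2 (permute_list \<sigma> ?us)))"
      by (simp add: sg_def sign_pow_def)
  qed (simp only: l, simp)
  also have "\<dots> = sps (\<lambda>_. 1) ?us (\<lambda>p q. if length p = 2 then \<mu> (\<mu> p # q) else 0)"
    by (rule sum_unshuffles[where f = "\<lambda>p q. \<mu> (\<mu> p # q)"]) (use l in simp)
  also have "\<dots> = comp \<mu> \<mu> ?us"
    unfolding comp_def using coch_len[OF \<mu>] coch_zero1[OF \<mu>] by (intro sps_cong) auto
  finally show ?thesis .
qed

end

context fe_space
begin

sublocale black: fe_color sU sV B "\<lambda>u. (u, 0)" fst sU
  by unfold_locales (auto simp: T_scale_def case_prod_beta)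

sublocale white: fe_color sU sV W "\<lambda>v. (0, v)" snd sV
  by unfold_locales (auto simp: T_scale_def case_prod_beta)

definition lin_map :: "('u \<Rightarrow> 'v) \<Rightarrow> ('k, 'u, 'v) end_map" where
  "lin_map f = single_map [B] W (\<lambda>xs. (0, f (fst (hd xs))))"

lemma lin_map_E0:
  assumes "Vector_Spaces.linear sU sV f"
  shows "lin_map f \<in> E0 [B] [W]"
proof -
  interpret Vector_Spaces.linear sU sV f by (rule assms)
  show ?thesis
    unfolding lin_map_def
    by (rule single_map_E0) (auto simp del: listset.simps simp: listset_single add scale T_scale_def)
qed

lemma lin_map_apply: "lin_map f [(u, 0)] = pt [W] [(0, f u)]"
  by (simp add: lin_map_def single_map_def del: listset.simps add: listset_single)

lemma lin_map_inject: "lin_map f = lin_map f' \<Longrightarrow> f = f'"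
proof
  fix u assume "lin_map f = lin_map f'"
  then have "lin_map f [(u, 0)] = lin_map f' [(u, 0)]" by (simp only:)
  then show "f u = f' u" unfolding lin_map_apply white.pt_\<iota>_inject .
qed

lemma lin_map_surj:
  assumes F: "F \<in> E0 [B] [W]"
  obtains f where "Vector_Spaces.linear sU sV f" "F = lin_map f"
proof -
  have "\<exists>v. F [(u, 0)] = pt [W] [(0, v)]" for u
    using tensor_space_single[OF E0D(2)[OF F]] by (force simp: white.piece)
  then obtain f where f: "\<And>u. F [(u, 0)] = pt [W] [(0, f u)]" by metis
  have m: "[(u, 0)] \<in> listset (Tp [B])" for u by (simp del: listset.simps add: listset_single)
  have "f (u + v) = f u + f v" for u v
  proof -
    have "F [(u + v, 0)] = F [(u, 0)] + F [(v, 0)]"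
      using E0_slot(1)[OF F m[of u], of 0 "(u, 0)" "(v, 0)"] by (simp del: plus_fun_apply)
    then have "pt [W] [(0, f (u + v))] = pt [W] [(0, f u + f v)]"
      unfolding f white.\<iota>_add by (simp only: pt_add white.\<iota>_piece)
    then show ?thesis unfolding white.pt_\<iota>_inject .
  qed
  moreover have "f (sU k u) = sV k (f u)" for k u
  proof -
    have "F [(sU k u, 0)] = tensor_scale k (F [(u, 0)])"
      using E0_slot(2)[OF F m[of u], of 0 "(u, 0)" k] by (simp add: T_scale_def)
    then have "pt [W] [(0, f (sU k u))] = pt [W] [(0, sV k (f u))]"
      unfolding f white.\<iota>_scale by (simp only: pt_scale white.\<iota>_piece)
    then show ?thesis unfolding white.pt_\<iota>_inject .
  qed
  ultimately have lin: "Vector_Spaces.linear sU sV f" by unfold_locales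
  moreover have "F = lin_map f"
  proof (rule E0_ext[OF F lin_map_E0[OF lin]])
    fix xs assume "xs \<in> listset (Tp [B])"
    then obtain u where "xs = [(u, 0)]" by (auto simp del: listset.simps simp: listset_single)
    then show "F xs = lin_map f xs" by (simp only: f lin_map_apply)
  qed
  ultimately show thesis by (rule that)
qed

lemma splitting_value:
  assumes gm: "gm (Fm 1) = lin_map f" "gm (Nu 2) = white.bin \<nu>"
    and f: "Vector_Spaces.linear sU sV f" and \<nu>: "coch sV sV 2 \<nu>"
  shows "ev gm (splitting_sum 2) [(x, 0), (y, 0)] = pt [W] [(0, \<nu> [f x, f y])]"
proof -
  let ?xs = "[(x, 0), (y, 0)]"
  let ?T = "tens_list [Gen (Fm 1), Gen (Fm 1)] :: 'k pexp"
  have xs: "?xs \<in> listset (Tp [B, B])" by (simp add: set_Cons_iff)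
  have e: "[] \<in> listset (Tp [])" by simp
  have v: "[(0, w)] \<in> listset (Tp [W])" for w by (simp del: listset.simps add: listset_single)
  have vv: "[(0, w), (0, w')] \<in> listset (Tp [W, W])" for w w' by (simp add: set_Cons_iff)
  have 1: "tensor_append s (Tp [W]) (Tp []) (pt [W] [(0, w)]) (pt [] []) = pt [W] [(0, w)]" for w
    using tensor_append_pure[OF v e, where s = s] by simp
  have 2: "tensor_append s (Tp [W]) (Tp [W]) (pt [W] [(0, w)]) (pt [W] [(0, w')]) = pt [W, W] [(0, w), (0, w')]" for w w'
    using tensor_append_pure[OF v v, where s = s] by simp
  have id0: "end_perm sU sV [] id \<in> E0 [] []" using E0_perm[of id "[]"] permutes_id by simp
  have T: "ev gm ?T = end_tens sU sV [B] [W] [W] (lin_map f) (end_tens sU sV [B] [W] [] (lin_map f) (end_perm sU sV [] id))"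
    by (simp add: tens_list_def gm[unfolded One_nat_def])
  have TE: "ev gm ?T \<in> E0 [B, B] [W, W]"
    unfolding T using E0_tens[OF lin_map_E0[OF f] E0_tens[OF lin_map_E0[OF f] id0]] by simp
  have "ev gm ?T ?xs = pt [W, W] [(0, f x), (0, f y)]"
    unfolding T end_tens_def
    using 1 2 by (simp add: lin_map_apply end_perm_def)
  then have X: "end_comp (white.bin \<nu>) (ev gm ?T) ?xs = pt [W] [(0, \<nu> [f x, f y])]"
    unfolding end_comp_def using tensor_lift_pure[OF E0D(1)[OF white.bin_E0[OF \<nu>]] vv] vv
    by (simp add: white.bin_def single_map_def)
  have XE: "end_comp (white.bin \<nu>) (ev gm ?T) \<in> E0 (permute_list id [B, B]) [W]"
    using E0_comp[OF white.bin_E0[OF \<nu>] TE] by simp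
  have P: "end_comp (end_comp (white.bin \<nu>) (ev gm ?T)) (end_perm sU sV [B, B] id) ?xs = pt [W] [(0, \<nu> [f x, f y])]"
    using end_comp_perm[OF XE permutes_id xs] X by simp
  have r: "replicate 2 B = [B, B]" by (simp add: numeral_2_eq_2)
  have l: "length [1, 1 :: nat] = 2" by simp
  \<comment> \<open>For two blocks of size 1 the exponent is \<open>1 + 1\<close>, so
    \<open>\<nu> (f, f)\<close> comes with a plus sign.\<close>
  have one: "(- 1 :: 'k) ^ (2 * (2 - 1) div 2 + (\<Sum>i\<in>{1..2 - 1}. [1, 1] ! (i - 1) * (2 - i))) = 1"
    by simp
  show ?thesis
    unfolding splitting_sum_def splittings_2 Let_def
    by (simp only: ev_psum finite.intros sum.insert empty_iff not_False_eq_True sum.empty ev.simps l one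
        ordered_unshuffles_1_1 sign_id of_int_1 TS.scale_one add_0_right r list.map P gm)
qed

end

section \<open>Algebras over the resolution\<close>

lemma replicate_2: "replicate 2 x = [x, x]"
  by (simp add: numeral_2_eq_2)

lemma single_append: "single (p @ z # q) h = (if p = [] \<and> q = [] then h z else 0)"
  by (cases p; cases q; cases "tl p") (auto simp: single_def split: list.splits)

lemma coch_single_map:
  assumes "\<And>v w. h (v + w) = h v + h w" "\<And>c v. h (s c v) = t c (h v)" "\<And>c. t c 0 = 0"
  shows "coch s t 1 (\<lambda>us. single us h)"
proof -
  have "int (length us) = 1" if "single us h \<noteq> 0" for us
    using that by (cases us rule: remdups_adj.cases) simp_all
  then show ?thesis
    using assms unfolding coch_def by (simp add: single_append)
qed

context fe_space
begin

lemma insertion_value_hom: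
  assumes gm: "gm (Fm 1) = lin_map f" "gm (Mu 2) = black.bin \<mu>"
    and f: "Vector_Spaces.linear sU sV f" and \<mu>: "coch sU sU 2 \<mu>"
  shows "ev gm (insertion_sum B W 0 1 Fm Mu 2) [(x, 0), (y, 0)] = pt [W] [(0, f (\<mu> [x, y]))]"
proof -
  let ?xs = "[(x, 0), (y, 0)]"
  let ?X = "end_comp (lin_map f) (end_tens sU sV [B, B] [B] [] (black.bin \<mu>) (end_perm sU sV [] id))"
  have xs: "?xs \<in> listset (Tp [B, B])" by (simp add: set_Cons_iff)
  have id0: "end_perm sU sV [] id \<in> E0 [] []" using E0_perm[of id "[]"] permutes_id by simp
  have X: "?X \<in> E0 (permute_list id [B, B]) [W]"
    using E0_comp[OF lin_map_E0[OF f], of _ "[B, B]"] E0_tens[OF black.bin_E0[OF \<mu>] id0] by simp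
  have "?X ?xs = pt [W] [(0, f (\<mu> [x, y]))]"
    using insertion_value[of B "[]" W "\<lambda>xs. (0, f (fst (hd xs)))" "\<lambda>xs. (\<mu> (map fst xs), 0)" "[B, B]" ?xs]
      lin_map_E0[OF f] xs
    by (simp add: lin_map_def black.bin_def del: listset.simps)
  then have P: "end_comp ?X (end_perm sU sV [B, B] id) ?xs = pt [W] [(0, f (\<mu> [x, y]))]"
    using end_comp_perm[OF X permutes_id xs] by simp
  \<comment> \<open>Only \<open>f_1\<close> after \<open>\<mu>_2\<close> remains:
    \<open>i - 1 = 0\<close>, so the identity factor is empty and the prefactor is 1.\<close>
  have I: "{(i, j). i + j = 2 + 1 \<and> 1 \<le> i \<and> 2 \<le> j} = {(1, 2 :: nat)}" by auto
  have r: "replicate 2 B = [B, B]" "replicate (1 - 1) B = []" by (simp_all add: numeral_2_eq_2)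
  have q: "(- 1 :: 'k) ^ (2 * (1 - 1)) = 1" "unshuffles [2, 1 - 1] = {id}" by (simp_all add: unshuffles_2_0)
  have t: "permute_list id [] = []" for xs by simp
  show ?thesis
    unfolding insertion_sum_def I
    by (simp only: case_prod_conv ev_psum finite.intros sum.insert empty_iff not_False_eq_True sum.empty ev.simps q r t src.simps
        tgt.simps gen_src.simps gen_tgt.simps sign_id of_int_1 TS.scale_one add_0_right P gm)
qed

text \<open>The value \<open>0\<close> is forced on all remaining generators, because their degrees
  are nonzero.\<close>

primrec gen_maps :: "('u list \<Rightarrow> 'u) \<times> ('v list \<Rightarrow> 'v) \<times> ('u \<Rightarrow> 'v) \<Rightarrow> gen \<Rightarrow> ('k, 'u, 'v) end_map" where
  "gen_maps d (Mu n) = (if n = 2 then black.bin (fst d) else 0)"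
| "gen_maps d (Nu n) = (if n = 2 then white.bin (fst (snd d)) else 0)"
| "gen_maps d (Fm n) = (if n = 1 then lin_map (snd (snd d)) else 0)"

definition operations :: "(('u list \<Rightarrow> 'u) \<times> ('v list \<Rightarrow> 'v) \<times> ('u \<Rightarrow> 'v)) set" where
  "operations = {\<mu>. coch sU sU 2 \<mu>} \<times> {\<nu>. coch sV sV 2 \<nu>} \<times> {f. Vector_Spaces.linear sU sV f}"

lemma fe_gens_gen_maps:
  assumes "d \<in> operations"
  shows "fe_gens sU sV (gen_maps d)"
proof
  obtain \<mu> \<nu> f where d: "d = (\<mu>, \<nu>, f)" by (cases d)
  have c: "coch sU sU 2 \<mu>" "coch sV sV 2 \<nu>" "Vector_Spaces.linear sU sV f"
    using assms by (simp_all add: d operations_def)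
  fix x
  show "gen_maps d x \<in> End_T sU sV (gen_src x) (gen_tgt x) (gen_deg x)" if "gen_valid x"
    using black.bin_E0[OF c(1)] white.bin_E0[OF c(2)] lin_map_E0[OF c(3)] E0_zero that
    by (cases x) (auto simp: d End_T_eq numeral_2_eq_2 simp del: zero_fun_apply)
  fix \<sigma> xs
  assume \<sigma>: "\<sigma> permutes {..<length (gen_src x)}" and xs: "xs \<in> listset (Tp (gen_src x))"
  have z: "(0 :: ('k, 'u, 'v) end_map) (permute_list \<sigma> xs) = tensor_scale k ((0 :: ('k, 'u, 'v) end_map) xs)" for k
    by (simp only: zero_fun_apply TS.scale_zero_right)
  show "gen_maps d x (permute_list \<sigma> xs) = tensor_scale (of_int (sign \<sigma>)) (gen_maps d x xs)"
  proof (cases x)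
    case (Mu n)
    show ?thesis
    proof (cases "n = 2")
      case True
      have "\<sigma> permutes {..<2}" using \<sigma> Mu True by simp
      moreover have "xs \<in> listset (Tp [B, B])" using xs by (simp only: Mu True gen_src.simps replicate_2)
      ultimately show ?thesis
        using black.bin_skew[OF c(1)] by (simp only: Mu True gen_maps.simps d fst_conv if_True simp_thms)
    next
      case False
      then show ?thesis by (simp only: Mu gen_maps.simps if_False z)
    qed
  next
    case (Nu n)
    show ?thesis
    proof (cases "n = 2")
      case True
      have "\<sigma> permutes {..<2}" using \<sigma> Nu True by simp
      moreover have "xs \<in> listset (Tp [W, W])" using xs by (simp only: Nu True gen_src.simps replicate_2)
      ultimately show ?thesis
        using white.bin_skew[OF c(2)] by (simp only: Nu True gen_maps.simps d fst_conv snd_conv if_True simp_thms)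
    next
      case False
      then show ?thesis by (simp only: Nu gen_maps.simps if_False z)
    qed
  next
    case (Fm n)
    have "\<sigma> = id" if "n = 1" using \<sigma> that Fm by (simp add: lessThan_Suc)
    with Fm z show ?thesis by (simp only: gen_maps.simps split: if_split) (simp add: sign_id)
  qed
qed

definition FE_of :: "('u list \<Rightarrow> 'u) \<times> ('v list \<Rightarrow> 'v) \<times> ('u \<Rightarrow> 'v) \<Rightarrow> 'k pexp \<Rightarrow> ('k, 'u, 'v) end_map" where
  "FE_of d a = (if wf_pexp a then ev (gen_maps d) a else 0)"

lemma FE_of_gens:
  "FE_of d (Gen (Mu 2)) = black.bin (fst d)" "FE_of d (Gen (Nu 2)) = white.bin (fst (snd d))"
  "FE_of d (Gen (Fm 1)) = lin_map (snd (snd d))"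
  by (simp_all add: FE_of_def)

lemma inj_on_FE_of: "inj_on FE_of operations"
proof (rule inj_onI)
  fix d d' assume d: "d \<in> operations" "d' \<in> operations" and eq: "FE_of d = FE_of d'"
  have "black.bin (fst d) = black.bin (fst d')" "white.bin (fst (snd d)) = white.bin (fst (snd d'))"
    "lin_map (snd (snd d)) = lin_map (snd (snd d'))"
    unfolding FE_of_gens[symmetric] by (simp_all only: eq)
  then show "d = d'"
    using d black.bin_inject[of "fst d" "fst d'"] white.bin_inject[of "fst (snd d)" "fst (snd d')"] lin_map_inject
    by (auto simp: operations_def prod_eq_iff)
qed

lemma gen_boundary_zero_iff:
  assumes "d \<in> operations"
  shows "(\<forall>x. gen_valid x \<longrightarrow> ev (gen_maps d) (gen_boundary x) = 0) \<longleftrightarrow> lie_hom_data d"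
proof -
  interpret fe_gens sU sV "gen_maps d" by (rule fe_gens_gen_maps[OF assms])
  obtain \<mu> \<nu> f where d: "d = (\<mu>, \<nu>, f)" by (cases d)
  have c: "coch sU sU 2 \<mu>" "coch sV sV 2 \<nu>" "Vector_Spaces.linear sU sV f"
    using assms by (simp_all add: d operations_def)
  have M: "E (gen_boundary (Mu 3)) xs = pt [B] [(comp \<mu> \<mu> (map fst xs), 0)]" if "xs \<in> listset (Tp [B, B, B])" for xs
    using black.bin_jacobi[OF c(1), of "gen_maps d" Mu, OF _ _ _ that] by (simp add: d numeral_2_eq_2)
  have N: "E (gen_boundary (Nu 3)) xs = pt [W] [(0, comp \<nu> \<nu> (map snd xs))]" if "xs \<in> listset (Tp [W, W, W])" for xs
    using white.bin_jacobi[OF c(2), of "gen_maps d" Nu, OF _ _ _ that] by (simp add: d numeral_2_eq_2)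
  have F: "E (gen_boundary (Fm 2)) [(x, 0), (y, 0)] = pt [W] [(0, \<nu> [f x, f y])] - pt [W] [(0, f (\<mu> [x, y]))]" for x y
  proof -
    have "E (gen_boundary (Fm 2)) [(x, 0), (y, 0)] =
        E (splitting_sum 2) [(x, 0), (y, 0)] + tensor_scale (- 1) (E (insertion_sum B W 0 1 Fm Mu 2) [(x, 0), (y, 0)])"
      by simp
    also have "\<dots> = pt [W] [(0, \<nu> [f x, f y])] + tensor_scale (- 1) (pt [W] [(0, f (\<mu> [x, y]))])"
      using splitting_value[OF _ _ c(3,2), of "gen_maps d" x y] insertion_value_hom[OF _ _ c(3,1), of "gen_maps d" x y]
      by (simp only: d gen_maps.simps fst_conv snd_conv if_True simp_thms)
    finally show ?thesis by simp
  qed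
  show ?thesis
  proof
    assume z: "\<forall>x. gen_valid x \<longrightarrow> E (gen_boundary x) = 0"
    \<comment> \<open>The boundary of \<open>Mu 3\<close> speaks only of triples; on other lengths
      \<open>comp \<mu> \<mu>\<close> vanishes by arity.\<close>
    have "comp \<mu> \<mu> us = 0" for us
    proof (cases "length us = 3")
      case True
      let ?xs = "map (\<lambda>u. (u, 0)) us"
      have m: "?xs \<in> listset (Tp [B, B, B])"
        using True by (auto simp: numeral_3_eq_3 length_Suc_conv set_Cons_iff)
      have "E (gen_boundary (Mu 3)) = 0" by (rule z[rule_format]) simp
      then have "pt [B] [(comp \<mu> \<mu> us, 0)] = pt [B] [(0, 0)]"
        using M[OF m] black.pt_\<iota>_zero by (simp add: comp_def[of _ _ us] o_def)
      then show ?thesis unfolding black.pt_\<iota>_inject .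
    next
      case False
      have "coch sU sU (2 + 2 - 1) (comp \<mu> \<mu>)" by (rule coch_comp[OF c(1) c(1)]) (simp add: additive_def U.scale_right_distrib)
      from coch_len[OF this, of us] False show ?thesis by simp
    qed
    moreover have "comp \<nu> \<nu> us = 0" for us
    proof (cases "length us = 3")
      case True
      let ?xs = "map (\<lambda>v. (0, v)) us"
      have m: "?xs \<in> listset (Tp [W, W, W])"
        using True by (auto simp: numeral_3_eq_3 length_Suc_conv set_Cons_iff)
      have "E (gen_boundary (Nu 3)) = 0" by (rule z[rule_format]) simp
      then have "pt [W] [(0, comp \<nu> \<nu> us)] = pt [W] [(0, 0)]"
        using N[OF m] white.pt_\<iota>_zero by (simp add: comp_def[of _ _ us] o_def)
      then show ?thesis unfolding white.pt_\<iota>_inject .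
    next
      case False
      have "coch sV sV (2 + 2 - 1) (comp \<nu> \<nu>)" by (rule coch_comp[OF c(2) c(2)]) (simp add: additive_def V.scale_right_distrib)
      from coch_len[OF this, of us] False show ?thesis by simp
    qed
    moreover have "f (\<mu> [x, y]) = \<nu> [f x, f y]" for x y
    proof -
      have "E (gen_boundary (Fm 2)) = 0" by (rule z[rule_format]) simp
      then have "pt [W] [(0, \<nu> [f x, f y])] = pt [W] [(0, f (\<mu> [x, y]))]" using F[of x y] by simp
      then show ?thesis unfolding white.pt_\<iota>_inject by simp
    qed
    ultimately show "lie_hom_data d" by (simp add: d lie_hom_data_def)
  next
    assume "lie_hom_data d"
    then have z: "comp \<mu> \<mu> us = 0" "comp \<nu> \<nu> vs = 0" "f (\<mu> [x, y]) = \<nu> [f x, f y]" for us vs x y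
      by (simp_all add: d lie_hom_data_def)
    have three: "replicate 3 col = [col, col, col]" for col :: color by (simp add: numeral_3_eq_3)
    show "\<forall>x. gen_valid x \<longrightarrow> E (gen_boundary x) = 0"
    proof (intro allI impI)
      fix x assume v: "gen_valid x"
      show "E (gen_boundary x) = 0"
      proof (cases "gen_deg x = 1")
        case True
        note e = E_gen_boundary_E0[OF v]
        show ?thesis
        proof (rule E0_ext[OF e E0_zero])
          fix xs assume xs: "xs \<in> listset (Tp (gen_src x))"
          show "E (gen_boundary x) xs = 0 xs"
          proof (cases x)
            case (Mu n)
            then have "n = 3" using True by simp
            then show ?thesis using M[of xs] xs Mu black.pt_\<iota>_zero by (simp only: three z gen_src.simps zero_fun_apply)
          next
            case (Nu n)
            then have "n = 3" using True by simp
            then show ?thesis using N[of xs] xs Nu white.pt_\<iota>_zero by (simp only: three z gen_src.simps zero_fun_apply)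
          next
            case (Fm n)
            then have n: "n = 2" using True by simp
            then have "xs \<in> listset (Tp [B, B])" using xs Fm by (simp only: gen_src.simps replicate_2)
            then obtain x1 y1 where "xs = [(x1, 0), (y1, 0)]" by (auto simp: set_Cons_def)
            then show ?thesis using F Fm n by (simp only: z diff_self zero_fun_apply)
          qed
        qed
      qed (rule E_gen_boundary_zero[OF v])
    qed
  qed
qed

lemma FE_of_in:
  assumes "d \<in> operations" "lie_hom_data d"
  shows "FE_of d \<in> FE_algebras sU sV"
proof -
  interpret fe_gens sU sV "gen_maps d" by (rule fe_gens_gen_maps[OF assms(1)])
  have "FE_of d = FE_structure" by (rule ext) (simp only: FE_of_def FE_structure_def)
  then show ?thesis
    using FE_structure_in gen_boundary_zero_iff[OF assms(1)] assms(2) by metis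
qed

lemma FE_algebra_E0:
  assumes "\<alpha> \<in> FE_algebras sU sV" "wf_pexp a"
  shows "\<alpha> a \<in> (if deg a = 0 then E0 (src a) (tgt a) else {0})"
  using assms unfolding FE_algebras_def End_T_eq by blast

text \<open>An algebra structure respects \<open>prop_eq\<close>, and \<open>gen_skew\<close> is one
  of its axioms; evaluating both sides turns the formal relation into skew symmetry of the
  map.\<close>

lemma FE_algebra_skew:
  assumes \<alpha>: "\<alpha> \<in> FE_algebras sU sV" and v: "gen_valid x" "gen_deg x = 0" and \<sigma>: "\<sigma> permutes {..<length (gen_src x)}"
    and p: "permute_list \<sigma> (gen_src x) = gen_src x" and xs: "xs \<in> listset (Tp (gen_src x))"
  shows "\<alpha> (Gen x) (permute_list \<sigma> xs) = tensor_scale (of_int (sign \<sigma>)) (\<alpha> (Gen x) xs)"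
proof -
  have wf: "wf_pexp (Gen x :: 'k pexp)" "wf_pexp (Comp (Gen x) (Perm (gen_src x) \<sigma>) :: 'k pexp)"
    "wf_pexp (Perm (gen_src x) \<sigma> :: 'k pexp)" "wf_pexp (Scale (of_int (sign \<sigma>)) (Gen x) :: 'k pexp)"
    using v \<sigma> p by simp_all
  have e: "\<alpha> (Gen x) \<in> E0 (permute_list \<sigma> (gen_src x)) (gen_tgt x)"
    using FE_algebra_E0[OF \<alpha> wf(1)] v p by simp
  have "\<alpha> (Gen x) (permute_list \<sigma> xs) = end_comp (\<alpha> (Gen x)) (end_perm sU sV (gen_src x) \<sigma>) xs"
    by (rule end_comp_perm[OF e \<sigma> xs, symmetric])
  also have "end_comp (\<alpha> (Gen x)) (end_perm sU sV (gen_src x) \<sigma>) = \<alpha> (Comp (Gen x) (Perm (gen_src x) \<sigma>))"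
  proof -
    have "\<alpha> (Comp (Gen x) (Perm (gen_src x) \<sigma>)) = end_comp (\<alpha> (Gen x)) (\<alpha> (Perm (gen_src x) \<sigma>))"
      using \<alpha> wf(2) unfolding FE_algebras_def by blast
    moreover have "\<alpha> (Perm (gen_src x) \<sigma>) = end_perm sU sV (gen_src x) \<sigma>"
      using \<alpha> wf(3) unfolding FE_algebras_def by blast
    ultimately show ?thesis by simp
  qed
  also have "\<dots> = \<alpha> (Scale (of_int (sign \<sigma>)) (Gen x))"
    using \<alpha> prop_eq.axiom[OF prop_axiom.gen_skew wf(2,4)] unfolding FE_algebras_def by blast
  also have "\<dots> = (\<lambda>xs. tensor_scale (of_int (sign \<sigma>)) (\<alpha> (Gen x) xs))"
    using \<alpha> wf(1) unfolding FE_algebras_def by blast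
  finally show ?thesis .
qed

lemma FE_algebra_eq_FE_of:
  assumes \<alpha>: "\<alpha> \<in> FE_algebras sU sV"
  obtains d where "d \<in> operations" "lie_hom_data d" "\<alpha> = FE_of d"
proof -
  have skew: "\<alpha> (Gen x) (permute_list \<sigma> xs) = tensor_scale (of_int (sign \<sigma>)) (\<alpha> (Gen x) xs)"
    if x: "gen_valid x" "gen_deg x = 0" "gen_src x = [col, col]" and \<sigma>: "\<sigma> permutes {..<2}" and xs: "xs \<in> listset (Tp [col, col])"
    for x col \<sigma> xs
  proof (rule FE_algebra_skew[OF \<alpha> x(1,2)])
    show "\<sigma> permutes {..<length (gen_src x)}" using \<sigma> x(3) by (simp add: numeral_2_eq_2)
    show "permute_list \<sigma> (gen_src x) = gen_src x"
      unfolding x(3) replicate_2[symmetric] by (rule permute_list_replicate[OF \<sigma>])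
    show "xs \<in> listset (Tp (gen_src x))" unfolding x(3) by (rule xs)
  qed
  have "\<alpha> (Gen (Mu 2)) \<in> E0 [B, B] [B]" using FE_algebra_E0[OF \<alpha>, of "Gen (Mu 2)"] by (simp add: replicate_2)
  then obtain \<mu> where \<mu>: "coch sU sU 2 \<mu>" "\<alpha> (Gen (Mu 2)) = black.bin \<mu>"
    by (rule black.bin_surj) (rule skew[of "Mu 2", OF _ _ replicate_2[of B, folded gen_src.simps]], simp_all)
  have "\<alpha> (Gen (Nu 2)) \<in> E0 [W, W] [W]" using FE_algebra_E0[OF \<alpha>, of "Gen (Nu 2)"] by (simp add: replicate_2)
  then obtain \<nu> where \<nu>: "coch sV sV 2 \<nu>" "\<alpha> (Gen (Nu 2)) = white.bin \<nu>"
    by (rule white.bin_surj) (rule skew[of "Nu 2", OF _ _ replicate_2[of W, folded gen_src.simps]], simp_all)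
  have "\<alpha> (Gen (Fm 1)) \<in> E0 [B] [W]" using FE_algebra_E0[OF \<alpha>, of "Gen (Fm 1)"] by simp
  then obtain f where f: "Vector_Spaces.linear sU sV f" "\<alpha> (Gen (Fm 1)) = lin_map f" by (rule lin_map_surj)
  define d where "d = (\<mu>, \<nu>, f)"
  have d: "d \<in> operations" using \<mu> \<nu> f by (simp add: d_def operations_def)
  have gens: "gen_maps d x = \<alpha> (Gen x)" if "gen_valid x" for x
  proof (cases x)
    case (Mu n)
    then show ?thesis
      using FE_algebra_E0[OF \<alpha>, of "Gen x"] \<mu>(2) that by (cases "n = 2") (simp_all del: zero_fun_apply add: d_def)
  next
    case (Nu n)
    then show ?thesis
      using FE_algebra_E0[OF \<alpha>, of "Gen x"] \<nu>(2) that by (cases "n = 2") (simp_all del: zero_fun_apply add: d_def)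
  next
    case (Fm n)
    then show ?thesis
      using FE_algebra_E0[OF \<alpha>, of "Gen x"] f(2) that by (cases "n = 1") (simp_all del: zero_fun_apply add: d_def)
  qed
  note agree = FE_algebra_eq_ev[OF \<alpha> gens]
  have "\<alpha> a = FE_of d a" for a
    using agree[of a] \<alpha> unfolding FE_of_def FE_algebras_def by (cases "wf_pexp a") (simp_all del: zero_fun_apply)
  moreover have "lie_hom_data d"
  proof -
    have "ev (gen_maps d) (gen_boundary x) = 0" if x: "gen_valid x" for x
    proof -
      have "\<alpha> (boundary (Gen x)) = 0" using \<alpha> x wf_pexp.simps(1)[of x, where ?'k = 'k] unfolding FE_algebras_def by blast
      then show ?thesis
        using agree[of "gen_boundary x"] typed_gen_boundary[OF x, where ?'k = 'k] unfolding typed_def by simp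
    qed
    then show ?thesis using gen_boundary_zero_iff[OF d] by blast
  qed
  ultimately show thesis using that d by blast
qed

lemma bij_betw_FE_of: "bij_betw FE_of {d \<in> operations. lie_hom_data d} (FE_algebras sU sV)"
  unfolding bij_betw_def
  using inj_on_FE_of FE_of_in FE_algebra_eq_FE_of by (auto intro: inj_on_subset) blast

end

sublocale lie_hom_background \<subseteq> fe_space sU sV
  by unfold_locales

context lie_hom_background
begin

lemma S_cochains_2_iff:
  "\<kappa> \<in> S_cochains sU sV 2 \<longleftrightarrow> coch sU sU 2 (fst \<kappa>) \<and> coch sV sV 2 (fst (snd \<kappa>)) \<and> coch sU sV 1 (snd (snd \<kappa>))"
  unfolding S_cochains_def alternating_maps_eq_coch[OF dom.vector_space_axioms]
    alternating_maps_eq_coch[OF cod.vector_space_axioms]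
  by (simp add: mem_Times_iff)

text \<open>\<open>deform\<close> is an affine translation by the given structure, with a sign in
  the third component; subtracting the structure inverts it.\<close>

lemma bij_betw_deform: "bij_betw deform (S_cochains sU sV 2) operations"
  unfolding bij_betw_def
proof
  show "inj_on deform (S_cochains sU sV 2)"
  proof (rule inj_onI)
    fix x y assume x: "x \<in> S_cochains sU sV 2" and y: "y \<in> S_cochains sU sV 2" and eq: "deform x = deform y"
    have "fst x = fst y" "fst (snd x) = fst (snd y)" and 1: "snd (snd x) [u] = snd (snd y) [u]" for u
      using eq by (auto simp: deform_def fun_eq_iff)
    moreover have "snd (snd x) us = snd (snd y) us" for us
    proof (cases us rule: remdups_adj.cases)
      case (2 u)
      then show ?thesis using 1 by simp
    qed (use x y coch_len[of sU sV 1 "snd (snd x)" us] coch_len[of sU sV 1 "snd (snd y)" us] in \<open>simp_all add: S_cochains_2_iff\<close>)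
    ultimately show "x = y" by (simp add: prod_eq_iff fun_eq_iff)
  qed
  have lin: "Vector_Spaces.linear sU sV (\<lambda>u. g u - \<phi> [u])" if "coch sU sV 1 \<phi>" for \<phi>
    using coch_add1[OF that] coch_scale1[OF that]
    by unfold_locales (simp_all add: add scale algebra_simps cod.scale_right_diff_distrib)
  show "deform ` S_cochains sU sV 2 = operations"
  proof
    show "deform ` S_cochains sU sV 2 \<subseteq> operations"
      by (auto simp: S_cochains_2_iff deform_def operations_def intro!: coch_plus mU mV sU sV lin)
    show "operations \<subseteq> deform ` S_cochains sU sV 2"
    proof
      fix d assume d: "d \<in> operations"
      obtain \<mu> \<nu> f where d': "d = (\<mu>, \<nu>, f)" by (cases d)
      have c: "coch sU sU 2 \<mu>" "coch sV sV 2 \<nu>" and f: "Vector_Spaces.linear sU sV f"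
        using d by (simp_all add: d' operations_def)
      interpret f: Vector_Spaces.linear sU sV f by (rule f)
      \<comment> \<open>The third component is \<open>g - f\<close> rather than
        \<open>f - g\<close>, because \<open>deform\<close> subtracts it; \<open>single\<close>
        makes it vanish on lists of length other than 1.\<close>
      define \<kappa> where "\<kappa> = (\<lambda>us. \<mu> us + - binary brU us, \<lambda>vs. \<nu> vs + - binary brV vs, \<lambda>us. single us (\<lambda>u. g u - f u))"
      have "coch sU sV 1 (\<lambda>us. single us (\<lambda>u. g u - f u))"
        by (rule coch_single_map) (simp_all add: add scale f.add f.scale cod.scale_right_diff_distrib)
      then have "\<kappa> \<in> S_cochains sU sV 2"
        unfolding S_cochains_2_iff \<kappa>_def fst_conv snd_conv
        by (intro conjI coch_plus coch_uminus c mU mV sU sV)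
      moreover have "deform \<kappa> = d" by (simp add: deform_def \<kappa>_def d')
      ultimately show "d \<in> deform ` S_cochains sU sV 2" by blast
    qed
  qed
qed

text \<open>\<open>master_terms\<close> identifies the solutions with the preimage of
  \<open>lie_hom_data\<close> under \<open>deform\<close>, so the two bijections can be
  composed.\<close>

lemma master_bij:
  "bij_betw (FE_of \<circ> deform) {\<kappa> \<in> S_cochains sU sV 2. quantum_master_equation cscale lop \<kappa>} (FE_algebras sU sV)"
proof (rule bij_betw_trans[OF _ bij_betw_FE_of])
  have "{\<kappa> \<in> S_cochains sU sV 2. quantum_master_equation cscale lop \<kappa>} = {\<kappa> \<in> S_cochains sU sV 2. lie_hom_data (deform \<kappa>)}"
    using master_terms(2) by blast
  moreover have "bij_betw deform {\<kappa> \<in> S_cochains sU sV 2. lie_hom_data (deform \<kappa>)} {d \<in> operations. lie_hom_data d}"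
  proof (rule bij_betw_subset[OF bij_betw_deform])
    show "deform ` {\<kappa> \<in> S_cochains sU sV 2. lie_hom_data (deform \<kappa>)} = {d \<in> operations. lie_hom_data d}"
      unfolding bij_betw_imp_surj_on[OF bij_betw_deform, symmetric] by blast
  qed blast
  ultimately show "bij_betw deform {\<kappa> \<in> S_cochains sU sV 2. quantum_master_equation cscale lop \<kappa>} {d \<in> operations. lie_hom_data d}"
    by simp
qed

lemma deformed_by_FE_of: "deformed_by sU brU sV brV g \<kappa> (FE_of (deform \<kappa>))"
  unfolding deformed_by_def case_prod_beta FE_of_gens[unfolded One_nat_def[symmetric]]
  by (simp add: deform_def lin_map_apply black.bin_def white.bin_def single_map_def set_Cons_iff)

end

theorem corollary7p7:
  fixes sU :: "'k::field_char_0 \<Rightarrow> 'u::ab_group_add \<Rightarrow> 'u" and brU :: "'u \<Rightarrow> 'u \<Rightarrow> 'u"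
    and sV :: "'k \<Rightarrow> 'v::ab_group_add \<Rightarrow> 'v" and brV :: "'v \<Rightarrow> 'v \<Rightarrow> 'v"
    and g :: "'u \<Rightarrow> 'v"
  assumes "lie_algebra_hom sU brU sV brV g"
  shows "\<exists>l. L_infinity_structure (cochain_scale sU sV) (S_graded sU sV) l \<and>
    (\<forall>n\<ge>2. \<forall>x\<in>S_cochains sU sV n. l [int n - 1] [x] = S_differential sU brU sV brV g n x) \<and>
    (\<forall>\<kappa>\<in>S_cochains sU sV 2. finite {k. 1 \<le> k \<and> master_term (cochain_scale sU sV) l \<kappa> k \<noteq> 0}) \<and>
    (\<exists>\<Phi>. bij_betw \<Phi>
            {\<kappa>\<in>S_cochains sU sV 2. quantum_master_equation (cochain_scale sU sV) l \<kappa>}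
            (FE_algebras sU sV) \<and>
          (\<forall>\<kappa>\<in>S_cochains sU sV 2. quantum_master_equation (cochain_scale sU sV) l \<kappa> \<longrightarrow>
             deformed_by sU brU sV brV g \<kappa> (\<Phi> \<kappa>)))"
proof -
  interpret lie_hom_background sU brU sV brV g
    by (rule lie_hom_background.intro) (rule assms)
  let ?mc = "{\<kappa> \<in> S_cochains sU sV 2. quantum_master_equation cscale lop \<kappa>}"
  have "\<exists>\<Phi>. bij_betw \<Phi> ?mc (FE_algebras sU sV) \<and>
      (\<forall>\<kappa>\<in>S_cochains sU sV 2. quantum_master_equation cscale lop \<kappa> \<longrightarrow> deformed_by sU brU sV brV g \<kappa> (\<Phi> \<kappa>))"
    using master_bij deformed_by_FE_of by (intro exI[of _ "FE_of \<circ> deform"]) simp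
  then show ?thesis
    using L_infinity_lop lop_differential master_terms(1) by blast
qed

end
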